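(* Let $p$ be a prime, $k$ an algebraically closed field of characteristic $p$, and $0\le l\le m$ integers with $m-l=p$. Let $B$ be a belt block of $\mathcal C_{l,m}^k$, that is, a combinatorial block of $\mathcal C_{l,m}^k$ for which the common $p$-content of the skew-partitions in $B$ is $\mathbb Z/p\mathbb Z$ (each residue occurring exactly once). Then, for every $\mu_1\setminus\lambda_1\in B$ and every $\mu_2\setminus\lambda_2\in\mathcal P_{l,m}$, the Specht modules $S_k^{\mu_1\setminus\lambda_1}$ and $S_k^{\mu_2\setminus\lambda_2}$ belong to the same $p$-block of $\mathcal C_{l,m}^k$ if and only if $\operatorname{core}_p(\mu_1)=\operatorname{core}_p(\mu_2)$ and $\operatorname{core}_p(\lambda_1)=\operatorname{core}_p(\lambda_2)$.
   Context: A partition is a weakly decreasing, eventually zero sequence $\nu=(\nu_1,\nu_2,\dots)$ of non-negative integers, with Young diagram $[\nu]=\{(r,c)\in\mathbb N^2: c\le\nu_r\}$. A skew-partition $\mu\setminus\lambda$ is a pair of partitions with $[\lambda]\subseteq[\mu]$; $\mathcal P_{l,m}$ denotes the set of skew-partitions $\mu\setminus\lambda$ with $|\lambda|=l$, $|\mu|=m$. The $p$-residue of a node $(r,c)$ is $c-r$ modulo $p$; the $p$-content of $\mu\setminus\lambda$ is the multiset of $p$-residues of the nodes in $[\mu]\setminus[\lambda]$. The $p$-core $\operatorname{core}_p(\nu)$ is the partition obtained from $\nu$ by repeatedly removing rim $p$-hooks until none remain. The centraliser algebra is $\mathcal C_{l,m}^k=\{a\in kS_m: ab=ba\text{ for all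 }b\in kS_l\}$. For $\mu\setminus\lambda\in\mathcal P_{l,m}$, the Specht module over $k$ is $S_k^{\mu\setminus\lambda}=k\otimes_{\mathbb Z}\operatorname{Hom}_{\mathbb ZS_l}(S^\lambda_{\mathbb Z},S^\mu_{\mathbb Z}\downarrow_{S_l})$, where $S^\nu_{\mathbb Z}$ is the integral Specht module; it is a $\mathcal C_{l,m}^k$-module via $(c\phi)(v)=c\,\phi(v)$ (it is the $p$-modular reduction of the corresponding simple module in characteristic $0$). The $p$-blocks of $\mathcal C_{l,m}^k$ are the ideals $e\,\mathcal C_{l,m}^k$ with $e$ a primitive central idempotent of $\mathcal C_{l,m}^k$; a Specht module belongs to the block $e\,\mathcal C_{l,m}^k$ if $e$ acts on it as the identity (each Specht module belongs to exactly one block). A combinatorial block is a non-empty set of the form $\{\mu\setminus\lambda\in\mathcal P_{l,m}:\operatorname{core}_p(\mu)=\gamma,\ \operatorname{core}_p(\lambda)=\delta\}$ for some $p$-cores $\gamma,\delta$. All skew-partitions in a combinatorial block have the same $p$-content. *)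

theory Defs
  imports
    "HOL-Algebra.Sym_Groups"
    "HOL-Algebra.Free_Abelian_Groups"
    "HOL-Algebra.Generated_Groups"
    "HOL-Algebra.Ring"
    "HOL-Library.Multiset"
    "HOL-Library.Poly_Mapping"
    "HOL-Computational_Algebra.Primes"
    "HOL-Computational_Algebra.Polynomial"
begin

section \<open>Partitions, contents and cores\<close>

text \<open>
  Rows and columns are numbered from 0: the value of a partition at \<open>i\<close> is its
  \<open>(i+1)\<close>-st part. This shift does not affect the difference \<open>c - r\<close>.
\<close>

definition is_partition :: "(nat \<Rightarrow> nat) \<Rightarrow> bool" where
  "is_partition \<nu> \<longleftrightarrow> antimono \<nu> \<and> (\<exists>N. \<forall>i\<ge>N. \<nu> i = 0)"

definition diagram :: "(nat \<Rightarrow> nat) \<Rightarrow> (nat \<times> nat) set" where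
  "diagram \<nu> = {(r, c). c < \<nu> r}"

definition partition_size :: "(nat \<Rightarrow> nat) \<Rightarrow> nat" where
  "partition_size \<nu> = card (diagram \<nu>)"

text \<open>The pair \<open>(\<mu>, \<lambda>)\<close> stands for the skew-partition with outer shape \<open>\<mu>\<close> and inner shape \<open>\<lambda>\<close>.\<close>

definition skew_partitions :: "nat \<Rightarrow> nat \<Rightarrow> ((nat \<Rightarrow> nat) \<times> (nat \<Rightarrow> nat)) set" where
  "skew_partitions l m =
     {(mu, lam). is_partition mu \<and> is_partition lam \<and> diagram lam \<subseteq> diagram mu \<and>
                 partition_size lam = l \<and> partition_size mu = m}"

definition residue :: "nat \<Rightarrow> nat \<times> nat \<Rightarrow> int" where
  "residue p = (\<lambda>(r, c). (int c - int r) mod int p)"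

definition content :: "nat \<Rightarrow> (nat \<Rightarrow> nat) \<times> (nat \<Rightarrow> nat) \<Rightarrow> int multiset" where
  "content p = (\<lambda>(mu, lam). image_mset (residue p) (mset_set (diagram mu - diagram lam)))"

definition rim :: "(nat \<Rightarrow> nat) \<Rightarrow> (nat \<times> nat) set" where
  "rim \<nu> = {(r, c) \<in> diagram \<nu>. (Suc r, Suc c) \<notin> diagram \<nu>}"

text \<open>Two nodes are adjacent when they share an edge.\<close>

definition adjacent_nodes :: "((nat \<times> nat) \<times> (nat \<times> nat)) set" where
  "adjacent_nodes =
     {((r, c), (r', c')). \<bar>int r - int r'\<bar> + \<bar>int c - int c'\<bar> = 1}"

definition connected_nodes :: "(nat \<times> nat) set \<Rightarrow> bool" where
  "connected_nodes R \<longleftrightarrow> (\<forall>x\<in>R. \<forall>y\<in>R. (x, y) \<in> (adjacent_nodes \<inter> R \<times> R)\<^sup>*)"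

text \<open>
  \<open>\<nu>'\<close> arises from \<open>\<nu>\<close> by removing one rim \<open>p\<close>-hook, i.e. a connected part of the rim
  with \<open>p\<close> nodes whose removal leaves the diagram of a partition.
\<close>

definition remove_rim_hook :: "nat \<Rightarrow> (nat \<Rightarrow> nat) \<Rightarrow> (nat \<Rightarrow> nat) \<Rightarrow> bool" where
  "remove_rim_hook p \<nu> \<nu>' \<longleftrightarrow>
     is_partition \<nu> \<and> is_partition \<nu>' \<and>
     (\<exists>R. R \<subseteq> rim \<nu> \<and> card R = p \<and> connected_nodes R \<and> diagram \<nu>' = diagram \<nu> - R)"

definition is_core :: "nat \<Rightarrow> (nat \<Rightarrow> nat) \<Rightarrow> bool" where
  "is_core p \<nu> \<longleftrightarrow> is_partition \<nu> \<and> \<not> (\<exists>\<nu>'. remove_rim_hook p \<nu> \<nu>')"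

definition core :: "nat \<Rightarrow> (nat \<Rightarrow> nat) \<Rightarrow> nat \<Rightarrow> nat" where
  "core p \<nu> = (THE \<gamma>. (remove_rim_hook p)\<^sup>*\<^sup>* \<nu> \<gamma> \<and> is_core p \<gamma>)"

definition combinatorial_block ::
    "nat \<Rightarrow> nat \<Rightarrow> nat \<Rightarrow> ((nat \<Rightarrow> nat) \<times> (nat \<Rightarrow> nat)) set \<Rightarrow> bool" where
  "combinatorial_block p l m B \<longleftrightarrow> B \<noteq> {} \<and>
     (\<exists>\<gamma> \<delta>. is_core p \<gamma> \<and> is_core p \<delta> \<and>
        B = {(mu, lam) \<in> skew_partitions l m. core p mu = \<gamma> \<and> core p lam = \<delta>})"

definition belt_block ::
    "nat \<Rightarrow> nat \<Rightarrow> nat \<Rightarrow> ((nat \<Rightarrow> nat) \<times> (nat \<Rightarrow> nat)) set \<Rightarrow> bool" where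
  "belt_block p l m B \<longleftrightarrow> combinatorial_block p l m B \<and>
     (\<forall>s\<in>B. content p s = mset_set {0..<int p})"


section \<open>Group algebras, centraliser algebras and blocks\<close>

definition group_algebra :: "('g, 'z) monoid_scheme \<Rightarrow> ('g \<Rightarrow>\<^sub>0 'r::comm_ring_1) ring" where
  "group_algebra G =
     \<lparr>carrier = {a. Poly_Mapping.keys a \<subseteq> carrier G},
      monoid.mult = (\<lambda>a b. \<Sum>g\<in>Poly_Mapping.keys a. \<Sum>h\<in>Poly_Mapping.keys b.
         Poly_Mapping.single (g \<otimes>\<^bsub>G\<^esub> h) (Poly_Mapping.lookup a g * Poly_Mapping.lookup b h)),
      one = Poly_Mapping.single \<one>\<^bsub>G\<^esub> 1,
      zero = 0,
      add = (+)\<rparr>"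

text \<open>
  \<open>sym_group l\<close> consists of the permutations of \<open>{1..l}\<close>, as functions fixing all other
  numbers, so for \<open>l \<le> m\<close> the algebra of \<open>S\<^sub>l\<close> is literally a subset of that of \<open>S\<^sub>m\<close>.
\<close>

definition centraliser_algebra :: "nat \<Rightarrow> nat \<Rightarrow> ((nat \<Rightarrow> nat) \<Rightarrow>\<^sub>0 'r::comm_ring_1) ring" where
  "centraliser_algebra l m =
     (group_algebra (sym_group m))
       \<lparr>carrier := {a \<in> carrier (group_algebra (sym_group m)).
                     \<forall>b\<in>carrier (group_algebra (sym_group l)).
                       a \<otimes>\<^bsub>group_algebra (sym_group m)\<^esub> b = b \<otimes>\<^bsub>group_algebra (sym_group m)\<^esub> a}\<rparr>"

definition central_idempotent :: "('a, 'z) ring_scheme \<Rightarrow> 'a \<Rightarrow> bool" where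
  "central_idempotent R e \<longleftrightarrow> e \<in> carrier R \<and> e \<otimes>\<^bsub>R\<^esub> e = e \<and>
     (\<forall>a\<in>carrier R. e \<otimes>\<^bsub>R\<^esub> a = a \<otimes>\<^bsub>R\<^esub> e)"

definition primitive_central_idempotent :: "('a, 'z) ring_scheme \<Rightarrow> 'a \<Rightarrow> bool" where
  "primitive_central_idempotent R e \<longleftrightarrow> central_idempotent R e \<and> e \<noteq> \<zero>\<^bsub>R\<^esub> \<and>
     (\<forall>f g. central_idempotent R f \<and> central_idempotent R g \<and>
            f \<otimes>\<^bsub>R\<^esub> g = \<zero>\<^bsub>R\<^esub> \<and> e = f \<oplus>\<^bsub>R\<^esub> g \<longrightarrow> f = \<zero>\<^bsub>R\<^esub> \<or> g = \<zero>\<^bsub>R\<^esub>)"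

definition block_ideals :: "('a, 'z) ring_scheme \<Rightarrow> 'a set set" where
  "block_ideals R = {e <#\<^bsub>R\<^esub> carrier R | e. primitive_central_idempotent R e}"


section \<open>Integral Specht modules of symmetric groups\<close>

definition tableaux :: "(nat \<Rightarrow> nat) \<Rightarrow> (nat \<times> nat \<Rightarrow> nat) set" where
  "tableaux \<nu> = {t. bij_betw t (diagram \<nu>) {1..partition_size \<nu>}}"

text \<open>
  A tabloid (tableau up to rearranging entries within rows) is encoded by the sequence of
  its sets of row entries. A permutation acts by taking images of these sets.
\<close>

definition tabloid :: "(nat \<Rightarrow> nat) \<Rightarrow> (nat \<times> nat \<Rightarrow> nat) \<Rightarrow> nat \<Rightarrow> nat set" where
  "tabloid \<nu> t = (\<lambda>r. t ` {x \<in> diagram \<nu>. fst x = r})"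

definition column_stabiliser :: "(nat \<Rightarrow> nat) \<Rightarrow> (nat \<times> nat \<Rightarrow> nat) \<Rightarrow> (nat \<Rightarrow> nat) set" where
  "column_stabiliser \<nu> t =
     {\<pi> \<in> carrier (sym_group (partition_size \<nu>)).
        \<forall>c. \<pi> ` t ` {x \<in> diagram \<nu>. snd x = c} = t ` {x \<in> diagram \<nu>. snd x = c}}"

definition polytabloid ::
    "(nat \<Rightarrow> nat) \<Rightarrow> (nat \<times> nat \<Rightarrow> nat) \<Rightarrow> (nat \<Rightarrow> nat set) \<Rightarrow>\<^sub>0 int" where
  "polytabloid \<nu> t =
     (\<Sum>\<pi>\<in>column_stabiliser \<nu> t. frag_cmul (sign \<pi>) (frag_of (tabloid \<nu> (\<pi> \<circ> t))))"

text \<open>The subgroup of the integral permutation module on tabloids spanned by the polytabloids.\<close>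

definition specht_lattice :: "(nat \<Rightarrow> nat) \<Rightarrow> ((nat \<Rightarrow> nat set) \<Rightarrow>\<^sub>0 int) set" where
  "specht_lattice \<nu> =
     generate (free_Abelian_group (tabloid \<nu> ` tableaux \<nu>)) (polytabloid \<nu> ` tableaux \<nu>)"

definition perm_act ::
    "(nat \<Rightarrow> nat) \<Rightarrow> ((nat \<Rightarrow> nat set) \<Rightarrow>\<^sub>0 int) \<Rightarrow> (nat \<Rightarrow> nat set) \<Rightarrow>\<^sub>0 int" where
  "perm_act \<sigma> = frag_extend (\<lambda>T. frag_of (\<lambda>r. \<sigma> ` T r))"


section \<open>Specht modules of centraliser algebras\<close>

type_synonym specht_map =
  "((nat \<Rightarrow> nat set) \<Rightarrow>\<^sub>0 int) \<Rightarrow> ((nat \<Rightarrow> nat set) \<Rightarrow>\<^sub>0 int)"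

text \<open>
  The abelian group of \<open>\<int>S\<^sub>l\<close>-homomorphisms from the lattice of \<open>lam\<close> to the restriction
  of the lattice of \<open>mu\<close>. Its operation, pointwise addition, is the \<open>mult\<close> of the record.
\<close>

definition specht_hom :: "nat \<Rightarrow> (nat \<Rightarrow> nat) \<Rightarrow> (nat \<Rightarrow> nat) \<Rightarrow> specht_map monoid" where
  "specht_hom l mu lam =
     \<lparr>carrier = {\<phi> \<in> specht_lattice lam \<rightarrow>\<^sub>E specht_lattice mu.
        (\<forall>v\<in>specht_lattice lam. \<forall>w\<in>specht_lattice lam. \<phi> (v + w) = \<phi> v + \<phi> w) \<and>
        (\<forall>\<sigma>\<in>carrier (sym_group l). \<forall>v\<in>specht_lattice lam. \<phi> (perm_act \<sigma> v) = perm_act \<sigma> (\<phi> v))},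
      monoid.mult = (\<lambda>\<phi> \<psi>. \<lambda>v\<in>specht_lattice lam. \<phi> v + \<psi> v),
      one = (\<lambda>v\<in>specht_lattice lam. 0)\<rparr>"

text \<open>
  The tensor product over \<open>\<int>\<close> of the additive group of a field with an abelian group \<open>H\<close>,
  presented as the free abelian group on pairs modulo biadditivity.
\<close>

definition tensor_gens :: "('h, 'z) monoid_scheme \<Rightarrow> (('k::field \<times> 'h) \<Rightarrow>\<^sub>0 int) monoid" where
  "tensor_gens H = free_Abelian_group (UNIV \<times> carrier H)"

definition tensor_rels :: "('h, 'z) monoid_scheme \<Rightarrow> (('k::field \<times> 'h) \<Rightarrow>\<^sub>0 int) set" where
  "tensor_rels H = generate (tensor_gens H)
     ({frag_of (a + b, h) - frag_of (a, h) - frag_of (b, h) | a b h. h \<in> carrier H} \<union>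
      {frag_of (a, h \<otimes>\<^bsub>H\<^esub> h') - frag_of (a, h) - frag_of (a, h') | a h h'.
         h \<in> carrier H \<and> h' \<in> carrier H})"

definition field_tensor :: "('h, 'z) monoid_scheme \<Rightarrow> (('k::field \<times> 'h) \<Rightarrow>\<^sub>0 int) set monoid" where
  "field_tensor H = tensor_gens H Mod tensor_rels H"

definition specht_module ::
    "nat \<Rightarrow> (nat \<Rightarrow> nat) \<times> (nat \<Rightarrow> nat) \<Rightarrow> (('k::field \<times> specht_map) \<Rightarrow>\<^sub>0 int) set monoid" where
  "specht_module l = (\<lambda>(mu, lam). field_tensor (specht_hom l mu lam))"

text \<open>
  Over every coefficient ring, the sums over the orbits of \<open>S\<^sub>l\<close> acting on \<open>S\<^sub>m\<close> by
  conjugation form a basis of the centraliser algebra. Hence the centraliser algebra over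
  \<open>k\<close> is the scalar extension of the integral one, and an element with value \<open>a\<^sub>O\<close>
  on the orbit \<open>O\<close> sends \<open>b \<otimes> \<phi>\<close> to the sum over \<open>O\<close> of \<open>a\<^sub>O b \<otimes> (O\<^sup>+ \<phi>)\<close>, where
  the orbit sum \<open>O\<^sup>+\<close> acts on homomorphisms by \<open>(O\<^sup>+ \<phi>) v = O\<^sup>+ (\<phi> v)\<close>.
\<close>

definition conj_orbit :: "nat \<Rightarrow> (nat \<Rightarrow> nat) \<Rightarrow> (nat \<Rightarrow> nat) set" where
  "conj_orbit l \<sigma> = {\<tau> \<circ> \<sigma> \<circ> inv\<^bsub>sym_group l\<^esub> \<tau> | \<tau>. \<tau> \<in> carrier (sym_group l)}"

definition orbit_sum_act :: "(nat \<Rightarrow> nat) \<Rightarrow> (nat \<Rightarrow> nat) set \<Rightarrow> specht_map \<Rightarrow> specht_map" where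
  "orbit_sum_act lam X \<phi> = (\<lambda>v\<in>specht_lattice lam. \<Sum>\<sigma>\<in>X. perm_act \<sigma> (\<phi> v))"

definition pure_act ::
    "nat \<Rightarrow> (nat \<Rightarrow> nat) \<Rightarrow> ((nat \<Rightarrow> nat) \<Rightarrow>\<^sub>0 'k::field) \<Rightarrow> 'k \<times> specht_map \<Rightarrow>
      ('k \<times> specht_map) \<Rightarrow>\<^sub>0 int" where
  "pure_act l lam c = (\<lambda>(b, \<phi>).
     \<Sum>X\<in>conj_orbit l ` Poly_Mapping.keys c.
       frag_of (the_elem (Poly_Mapping.lookup c ` X) * b, orbit_sum_act lam X \<phi>))"

definition specht_act ::
    "nat \<Rightarrow> (nat \<Rightarrow> nat) \<times> (nat \<Rightarrow> nat) \<Rightarrow> ((nat \<Rightarrow> nat) \<Rightarrow>\<^sub>0 'k::field) \<Rightarrow>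
      (('k \<times> specht_map) \<Rightarrow>\<^sub>0 int) set \<Rightarrow> (('k \<times> specht_map) \<Rightarrow>\<^sub>0 int) set" where
  "specht_act l = (\<lambda>(mu, lam) c \<xi>.
     \<Union>x\<in>\<xi>. tensor_rels (specht_hom l mu lam)
              #>\<^bsub>tensor_gens (specht_hom l mu lam)\<^esub> frag_extend (pure_act l lam c) x)"

definition specht_in_block ::
    "nat \<Rightarrow> nat \<Rightarrow> (nat \<Rightarrow> nat) \<times> (nat \<Rightarrow> nat) \<Rightarrow> ((nat \<Rightarrow> nat) \<Rightarrow>\<^sub>0 'k::field) set \<Rightarrow> bool" where
  "specht_in_block l m s b \<longleftrightarrow>
     (\<exists>e. primitive_central_idempotent (centraliser_algebra l m) e \<and>
          b = e <#\<^bsub>centraliser_algebra l m\<^esub> carrier (centraliser_algebra l m) \<and>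
          (\<forall>\<xi>\<in>carrier (specht_module l s). specht_act l s e \<xi> = \<xi>))"

end

theory Submission
  imports Defs
begin

text \<open>
 Let the Maya diagram of a partition be the set of contents at the ends of its rows, so that adding a
 box of content \<open>c\<close> moves a bead from \<open>c - 1\<close> to \<open>c\<close>, and the core is determined by the numbers of
 beads on the runners modulo \<open>p\<close>, equivalently by the multiset of residues.

 An element commuting with \<open>S\<^sub>l\<close> acts on the lattice of equivariant maps between integral Specht
 lattices. A path of boxes from \<open>\<lambda>\<close> to \<open>\<mu>\<close> with distinct residues is a word of eigenvalues of the
 Jucys-Murphy elements that are pairwise distinct modulo \<open>p\<close>; hence a central element is modulo \<open>p\<close>
 a scalar on the corresponding weight vector, and this scalar depends only on the residue word and on
 the core of \<open>\<lambda>\<close>. So two skew-partitions sharing such a word and the core of the inner shape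
 lie in one block. Which words occur is governed by belts, periodic choices of one bead
 on each runner, and any two pairs in a belt block are linked by a chain of common words. Conversely the
 elementary symmetric polynomials in the Jucys-Murphy elements are central, and their scalars on the
 Specht modules separate the residue multisets; by Fitting's lemma, central elements have a single
 eigenvalue on a block.
\<close>

text \<open>The Specht module over the field is the reduction of the full lattice of equivariant
  maps, while a path only controls the sublattice generated by one map. Every map has a nonzero
  multiple in that sublattice, but the multiplier may be divisible by p, so a congruence modulo p
  there says nothing directly about the reduction. Idempotency repairs this: if e is congruent to a
  scalar \<beta> other than 1, then (1 - \<beta>) e = e (e - \<beta>), hence e sends the sublattice
  into p^N times itself for every N; once N exceeds the p-part of the multiplier, e kills the map in
  the reduction. Scalars come from multiplicity one: modulo p the sublattice is spanned by words in
  adjacent transpositions of {l+1..m}, the Jucys-Murphy elements act on these triangularly with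
  permuted eigenvalues, and the original weight occurs only at the identity. Different inner shapes
  with one core are compared at a word determined by the order of the runners alone. This comparison
  requires central characters to agree modulo p on a block, which is proved by induction over
  removable boxes.\<close>

abbreviation "lookup \<equiv> Poly_Mapping.lookup"
abbreviation "keys \<equiv> Poly_Mapping.keys"
abbreviation "single \<equiv> Poly_Mapping.single"
abbreviation "residues p \<equiv> map (\<lambda>c. c mod int p)"

type_synonym 'r fun_alg = "(nat \<Rightarrow> nat) \<Rightarrow>\<^sub>0 'r"

section \<open>Belts in Maya diagrams\<close>

fun maya_path :: "int set \<Rightarrow> int list \<Rightarrow> int set \<Rightarrow> bool" where
 "maya_path X [] Y \<longleftrightarrow> Y = X"
| "maya_path X (c # cs) Y \<longleftrightarrow> c - 1 \<in> X \<and> c \<notin> X \<and> maya_path (insert c (X - {c - 1})) cs Y"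

lemma maya_path_append: "maya_path X (as @ bs) Y \<longleftrightarrow> (\<exists>Z. maya_path X as Z \<and> maya_path Z bs Y)"
 by (induction as arbitrary: X) auto

text \<open>A step of content c touches only the positions c - 1 and c.\<close>

lemma maya_path_unaltered: assumes "maya_path X cs Y" "y \<notin> set cs" "y + 1 \<notin> set cs"
 shows "y \<in> Y \<longleftrightarrow> y \<in> X" using assms by (induction cs arbitrary: X) auto

text \<open>\<open>x k\<close> is the source of the move made on runner k, \<open>x k + 1\<close> is
  its target, and \<open>P k\<close> means that runner k - 1 moves before runner k. If the target of
  runner k - 1 is the source of runner k, the order decides whether this common position must be
  empty or occupied at the start; otherwise the source must be occupied and the target empty from
  the start.\<close>

definition belt_at :: "int set \<Rightarrow> (int \<Rightarrow> bool) \<Rightarrow> (int \<Rightarrow> int) \<Rightarrow> int \<Rightarrow> bool" where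
 "belt_at X P x k \<longleftrightarrow> (x k = x (k - 1) + 1 \<and> (P k \<longleftrightarrow> x k \<notin> X)) \<or> (x k \<in> X \<and> x (k - 1) + 1 \<notin> X)"

text \<open>A piece of a belt with clean ends: the first source is occupied and the last target is
  empty. Where two pieces meet, the second alternative of \<open>belt_at\<close> then holds for
  either value of P, so pieces can be glued, and the orientation can be changed, at such a
  junction.\<close>

definition segment :: "int \<Rightarrow> int set \<Rightarrow> (int \<Rightarrow> bool) \<Rightarrow> int \<Rightarrow> int \<Rightarrow> (int \<Rightarrow> int) \<Rightarrow> bool" where
 "segment p X P u v x \<longleftrightarrow> u < v \<and> (\<forall>k\<in>{u..<v}. x k mod p = k mod p) \<and> x u \<in> X \<and>
   x (v - 1) + 1 \<notin> X \<and> (\<forall>k\<in>{u<..<v}. belt_at X P x k)"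

definition belt :: "int \<Rightarrow> int set \<Rightarrow> (int \<Rightarrow> bool) \<Rightarrow> (int \<Rightarrow> int) \<Rightarrow> bool" where
 "belt p X P x \<longleftrightarrow> (\<forall>k. x k mod p = k mod p \<and> x (k mod p) = x k \<and> belt_at X P x k)"

lemma segment_glue: assumes a: "segment p X P u v x" and b: "segment p X P v w x'"
 shows "segment p X P u w (\<lambda>k. if k < v then x k else x' k)"
proof -
 have "belt_at X P (\<lambda>k. if k < v then x k else x' k) k" if "u < k" "k < w" for k
 proof (cases k v rule: linorder_cases)
  case less thus ?thesis using a that by (auto simp: segment_def belt_at_def)
 next
  case equal thus ?thesis using a b that by (auto simp: segment_def belt_at_def)
 next
  case greater thus ?thesis using b that by (auto simp: segment_def belt_at_def)
 qed
 thus ?thesis using a b by (auto simp: segment_def)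
qed

text \<open>Both alternatives of \<open>belt_at\<close> give an occupied source at an index where P
  fails, and an empty preceding target at an index where P holds.\<close>

lemma segment_cut: assumes "belt p X P x" "\<not> P t" "P r" "t < r" shows "segment p X P t r x"
 using assms unfolding segment_def belt_def belt_at_def by (metis atLeastLessThan_iff greaterThanLessThan_iff)

text \<open>Continuing the segment with period p turns its two ends into one more junction. The
  clean ends at u are recorded because P will be changed there.\<close>

lemma segment_wrap:
 assumes s: "segment p X P u (u + p) x" and P: "\<And>k. P (k mod p) = P k" and p: "p > 0"
 obtains y where "belt p X P y" "\<And>k. k \<in> {u..<u+p} ==> y k = x k" "y u \<in> X" "y (u - 1) + 1 \<notin> X"
proof -
 define f where "f = (\<lambda>k. u + (k - u) mod p)"
 define y where "y = (\<lambda>k. x (f k))"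
 have f: "f k \<in> {u..<u+p}" "f k mod p = k mod p" for k using p by (auto simp: f_def mod_simps)
 have fid: "f k = k" if "k \<in> {u..<u+p}" for k using that by (auto simp: f_def)
 have fm: "f (k mod p) = f k" for k by (auto simp: f_def mod_simps)
 have f1: "f (k - 1) = (if f k = u then u + p - 1 else f k - 1)" for k
 proof -
  have "(k - 1 - u) mod p = ((k - u) mod p - 1) mod p" by (simp add: mod_simps algebra_simps)
  also have "\<dots> = (if (k - u) mod p = 0 then p - 1 else (k - u) mod p - 1)"
  proof (cases "(k - u) mod p = 0")
   case True
   thus ?thesis using p by (simp add: zmod_minus1)
  next
   case False
   hence "0 < (k - u) mod p" "(k - u) mod p < p"
    using pos_mod_sign[OF p, of "k - u"] pos_mod_bound[OF p, of "k - u"] by linarith+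
   thus ?thesis by (auto intro: mod_pos_pos_trivial)
  qed
  finally show ?thesis by (auto simp: f_def)
 qed
 have "belt_at X P y k" for k
 proof (cases "f k = u")
  case True
  thus ?thesis using s f1[of k] by (auto simp: belt_at_def y_def segment_def)
 next
  case False
  hence "f k \<in> {u<..<u+p}" using f[of k] by auto
  hence "belt_at X P x (f k)" using s by (auto simp: segment_def)
  moreover have "P (f k) = P k" using P f by metis
  ultimately show ?thesis using False f1[of k] by (auto simp: belt_at_def y_def)
 qed
 moreover have "y k mod p = k mod p" for k using s f[of k] by (auto simp: segment_def y_def)
 moreover have "y (k mod p) = y k" for k by (simp add: y_def fm)
 ultimately have "belt p X P y" by (auto simp: belt_def)
 moreover have "y k = x k" if "k \<in> {u..<u+p}" for k using that by (simp add: y_def fid)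
 moreover have "y u \<in> X" "y (u - 1) + 1 \<notin> X"
  using s p f1[of u] fid[of u] by (auto simp: y_def segment_def)
 ultimately show ?thesis using that by blast
qed

text \<open>The diagonal \<open>b + (k - u)\<close> starting at the bead b is tried as the segment.
  Where it conflicts with P, its beginning or its end is exchanged for a segment supplied by A or B,
  and only a conflict-free middle part of the diagonal is kept.\<close>

lemma walk: assumes b: "b \<in> X" "b mod p = u mod p" "b + (v - u) \<notin> X" and uv: "u < v"
  and A: "\<And>s. u < s ==> s < v ==> P s ==> b + (s - u) \<in> X ==> \<exists>x. segment p X P u s x"
  and B: "\<And>t. u < t ==> t < v ==> \<not> P t ==> b + (t - u) \<notin> X ==> \<exists>x. segment p X P t v x"
 shows "\<exists>x. segment p X P u v x"
proof -
 \<comment> \<open>s is the last index where the diagonal is occupied although P asks for an empty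
   position, or u if there is none; t, defined below, is the first later index where it is empty
   although P asks for an occupied one, or v. Strictly between them P k holds exactly where the
   diagonal is empty.\<close>
 define s where "s = Max (insert u {s\<in>{u<..<v}. P s \<and> b + (s - u) \<in> X})"
 have s_in: "s \<in> insert u {s\<in>{u<..<v}. P s \<and> b + (s - u) \<in> X}"
  unfolding s_def by (rule Max_in) (auto intro: finite_subset[of _ "{u<..<v}"])
 have s_max: "\<not> (P k \<and> b + (k - u) \<in> X)" if "s < k" "k < v" for k
 proof
  assume "P k \<and> b + (k - u) \<in> X"
  moreover have "u \<le> s" using s_in by auto
  ultimately have "k \<in> {s\<in>{u<..<v}. P s \<and> b + (s - u) \<in> X}" using that by auto
  hence "k \<le> s" unfolding s_def by (intro Max_ge) (auto intro: finite_subset[of _ "{u<..<v}"])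
  with that show False by simp
 qed
 have sv: "u \<le> s" "s < v" using s_in uv by auto
 define t where "t = Min (insert v {t\<in>{s<..<v}. \<not> P t \<and> b + (t - u) \<notin> X})"
 have t_in: "t \<in> insert v {t\<in>{s<..<v}. \<not> P t \<and> b + (t - u) \<notin> X}"
  unfolding t_def by (rule Min_in) (auto intro: finite_subset[of _ "{s<..<v}"])
 have t_min: "\<not> (\<not> P k \<and> b + (k - u) \<notin> X)" if "s < k" "k < t" for k
 proof
  assume "\<not> P k \<and> b + (k - u) \<notin> X"
  moreover have "t \<le> v" using t_in by auto
  ultimately have "k \<in> {t\<in>{s<..<v}. \<not> P t \<and> b + (t - u) \<notin> X}" using that by auto
  hence "t \<le> k" unfolding t_def by (intro Min_le) (auto intro: finite_subset[of _ "{s<..<v}"])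
  with that show False by simp
 qed
 have st: "s < t" "t \<le> v" using t_in sv by auto
 have bs: "b + (s - u) \<in> X" using s_in b by auto
 have bt: "b + (t - u) \<notin> X" using t_in b by auto
 have "(b + (k - u)) mod p = k mod p" for k
 proof -
  have "(b + (k - u)) mod p = (b mod p + (k - u)) mod p" by (simp add: mod_simps)
  also have "\<dots> = k mod p" unfolding b(2) by (simp add: mod_simps)
  finally show ?thesis .
 qed
 moreover have "P k \<longleftrightarrow> b + (k - u) \<notin> X" if "s < k" "k < t" for k
  using s_max[of k] t_min[of k] st that by auto
 ultimately have mid: "segment p X P s t (\<lambda>k. b + (k - u))"
  unfolding segment_def belt_at_def using bs bt st by (auto simp: algebra_simps)
 have left: "\<exists>x. segment p X P u t x"
 proof (cases "s = u")
  case True thus ?thesis using mid by auto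
 next
  case False
  then obtain x where "segment p X P u s x" using A[of s] s_in by auto
  thus ?thesis using segment_glue[OF _ mid] by blast
 qed
 show ?thesis
 proof (cases "t = v")
  case True thus ?thesis using left by auto
 next
  case False
  then obtain x where x: "segment p X P t v x" using B[of t] t_in sv by auto
  from left obtain x' where "segment p X P u t x'" ..
  thus ?thesis using segment_glue[OF _ x] by blast
 qed
qed

text \<open>For a partition, q will be the lowest gap of each runner after all beads are pushed
  down. A runner that is higher in this order then has a bead whose translate to a lower runner is
  free, and every runner has a bead with a gap p places further on.\<close>

locale ordered_runners = fixes p :: int and X :: "int set" and q :: "int \<Rightarrow> int" assumes p2: "p \<ge> 2"
  and q_periodic: "q (k mod p) = q k" and q_inj: "q i = q j ==> i mod p = j mod p"
  and step: "q j < q i ==> i < j ==> j < i + p ==> \<exists>b\<in>X. b mod p = i mod p \<and> b + (j - i) \<notin> X"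
  and full: "\<exists>b\<in>X. b mod p = i mod p \<and> b + p \<notin> X"
begin

text \<open>It suffices to find a belt with a junction at r, since there \<open>belt_at\<close>
  holds for either value of P r. Starting from a bead of runner r, \<open>walk\<close> reaches every
  s with P s because r is the higher runner, and the remaining ends are cut out of the given
  belt.\<close>

lemma flip_max: assumes x: "belt p X P x" and P: "\<And>k. P (k mod p) = P k" and r: "P r"
  and mx: "\<And>s. P s ==> s mod p \<noteq> r mod p ==> q s < q r"
 shows "\<exists>y. belt p X P y \<and> belt p X (\<lambda>k. P k \<and> k mod p \<noteq> r mod p) y"
proof -
 have seg: "\<exists>x. segment p X P r s x" if "r < s" "s < r + p" "P s" for s using that
 proof (induction "nat (s - r)" arbitrary: s rule: less_induct)
  case less
  have "s mod p \<noteq> r mod p"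
  proof
   assume "s mod p = r mod p"
   hence "(s - r) mod p = 0" by (metis eq_iff_diff_eq_0 mod_0 mod_diff_cong)
   thus False using less.prems by (simp add: mod_pos_pos_trivial)
  qed
  hence "q s < q r" using mx less.prems by blast
  then obtain b where b: "b \<in> X" "b mod p = r mod p" "b + (s - r) \<notin> X"
   using step[of s r] less.prems by auto
  show ?case
  proof (rule walk[OF b less.prems(1)])
   fix s' assume "r < s'" "s' < s" "P s'"
   thus "\<exists>x. segment p X P r s' x" using less.hyps[of s'] less.prems by auto
  next
   fix t assume "r < t" "t < s" "\<not> P t"
   thus "\<exists>x. segment p X P t s x" using segment_cut[OF x] less.prems by blast
  qed
 qed
 obtain b where b: "b \<in> X" "b mod p = r mod p" "b + (r + p - r) \<notin> X" using full[of r] by auto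
 have "\<exists>x. segment p X P r (r + p) x"
 proof (rule walk[OF b])
  show "r < r + p" using p2 by simp
 next
  fix s' assume "r < s'" "s' < r + p" "P s'"
  thus "\<exists>x. segment p X P r s' x" using seg by blast
 next
  fix t assume "r < t" "t < r + p" "\<not> P t"
  moreover have "P (r + p)" using P[of "r + p"] P[of r] r by simp
  ultimately show "\<exists>x. segment p X P t (r + p) x" using segment_cut[OF x] by blast
 qed
 then obtain x' where "segment p X P r (r + p) x'" ..
 then obtain y where y: "belt p X P y" "y r \<in> X" "y (r - 1) + 1 \<notin> X"
  by (rule segment_wrap[of p X P r x']) (use P p2 in auto)
 have "belt_at X (\<lambda>k. P k \<and> k mod p \<noteq> r mod p) y k" for k
 proof (cases "k mod p = r mod p")
  case True
  hence "y k = y r" "(k - 1) mod p = (r - 1) mod p" using y(1) unfolding belt_def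
   by (metis, metis mod_diff_left_eq)
  moreover hence "y (k - 1) = y (r - 1)" using y(1) unfolding belt_def by metis
  ultimately show ?thesis using y by (auto simp: belt_at_def)
 next
  case False
  thus ?thesis using y(1) by (auto simp: belt_def belt_at_def)
 qed
 thus ?thesis using y(1) by (auto simp: belt_def)
qed

text \<open>The belt constructed has junctions at both r and s. Segments ending at s exist from
  every earlier runner because s is the lowest one; the part from s to the next copy of r is cut
  from the given belt.\<close>

lemma swap_single: assumes x: "belt p X (\<lambda>k. k mod p = r mod p) x" and sr: "r < s" "s < r + p"
  and mn: "\<And>t. t mod p \<noteq> s mod p ==> q s < q t"
 shows "\<exists>y. belt p X (\<lambda>k. k mod p = r mod p) y \<and> belt p X (\<lambda>k. k mod p = s mod p) y"
proof -
 let ?P = "\<lambda>k. k mod p = r mod p" let ?P' = "\<lambda>k. k mod p = s mod p"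
 have ne: "k mod p \<noteq> j mod p" if "j < k" "k < j + p" for j k
 proof
  assume "k mod p = j mod p"
  hence "(k - j) mod p = 0" by (metis eq_iff_diff_eq_0 mod_0 mod_diff_cong)
  thus False using that by (simp add: mod_pos_pos_trivial)
 qed
 have seg: "\<exists>x. segment p X ?P t s x" if "r \<le> t" "t < s" for t using that
 proof (induction "nat (s - t)" arbitrary: t rule: less_induct)
  case less
  have "t mod p \<noteq> s mod p" using ne[of t s] less.prems sr by auto
  hence "q s < q t" using mn by blast
  then obtain b where b: "b \<in> X" "b mod p = t mod p" "b + (s - t) \<notin> X"
   using step[of s t] less.prems sr by auto
  show ?case
  proof (rule walk[OF b less.prems(2)])
   fix s' assume "t < s'" "s' < s" "?P s'"
   thus "\<exists>x. segment p X ?P t s' x" using ne[of r s'] less.prems sr by auto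
  next
   fix t' assume "t < t'" "t' < s" "\<not> ?P t'"
   thus "\<exists>x. segment p X ?P t' s x" using less.hyps[of t'] less.prems by auto
  qed
 qed
 obtain x1 where x1: "segment p X ?P r s x1" using seg[of r] sr by auto
 have x2: "segment p X ?P s (r + p) x" by (rule segment_cut[OF x]) (use ne[of r s] sr in auto)
 have g1: "segment p X ?P r (r + p) (\<lambda>k. if k < s then x1 k else x k)"
  by (rule segment_glue[OF x1 x2])
 \<comment> \<open>Strictly inside the two pieces no index has the residue of r or of s, so both
   orientations are false there and the same pieces serve for both.\<close>
 have "segment p X ?P' r s x1"
  using x1 unfolding segment_def belt_at_def using ne[of r] ne[of _ s] sr
  by (smt (verit) greaterThanLessThan_iff)
 moreover have "segment p X ?P' s (r + p) x"
  using x2 unfolding segment_def belt_at_def using ne[of r] ne[of s] sr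
  by (smt (verit) greaterThanLessThan_iff)
 ultimately have g2: "segment p X ?P' r (r + p) (\<lambda>k. if k < s then x1 k else x k)"
  by (rule segment_glue)
 have p0: "p > 0" using p2 by simp
 obtain y where y: "belt p X ?P y" "\<And>k. k \<in> {r..<r+p} ==> y k = (if k < s then x1 k else x k)"
  by (rule segment_wrap[OF g1 _ p0]) auto
 obtain y' where y': "belt p X ?P' y'" "\<And>k. k \<in> {r..<r+p} ==> y' k = (if k < s then x1 k else x k)"
  by (rule segment_wrap[OF g2 _ p0]) auto
 have "y k = y' k" for k
 proof -
  let ?k = "r + (k - r) mod p"
  have k: "?k \<in> {r..<r+p}" "?k mod p = k mod p" using p0 by (auto simp: mod_simps)
  hence "y k = y ?k" "y' k = y' ?k" using y(1) y'(1) unfolding belt_def by metis+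
  thus ?thesis using y(2) y'(2) k by auto
 qed
 hence "y = y'" by auto
 thus ?thesis using y y' by auto
qed

end

section \<open>Belts with an order of moves, and paths with distinct residues\<close>

definition precedes :: "'a list \<Rightarrow> 'a \<Rightarrow> 'a \<Rightarrow> bool" where
 "precedes ks a b \<longleftrightarrow> (\<exists>as bs. ks = as @ a # bs \<and> b \<in> set bs)"

lemma precedes_split: assumes "distinct (as @ k # bs)"
 shows "precedes (as @ k # bs) k b \<longleftrightarrow> b \<in> set bs" and "precedes (as @ k # bs) a k \<longleftrightarrow> a \<in> set as"
proof -
 have u: "as' = as \<and> bs' = bs" if e: "as @ k # bs = as' @ k # bs'" for as' bs'
 proof -
  have "distinct (as' @ k # bs')" using assms that by simp
  moreover obtain us where "as = as' @ us \<and> us @ k # bs = k # bs' \<or> as @ us = as' \<and> k # bs = us @ k # bs'"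
   using iffD1[OF append_eq_append_conv2 e] by blast
  ultimately show ?thesis by (cases us) auto
 qed
 thus "precedes (as @ k # bs) k b \<longleftrightarrow> b \<in> set bs" unfolding precedes_def by blast
 show "precedes (as @ k # bs) a k \<longleftrightarrow> a \<in> set as"
 proof
  assume "precedes (as @ k # bs) a k"
  then obtain as' bs' where e: "as @ k # bs = as' @ a # bs'" "k \<in> set bs'"
   unfolding precedes_def by blast
  then obtain b1 b2 where "bs' = b1 @ k # b2" by (meson split_list)
  hence "as = as' @ a # b1" using u[of "as' @ a # b1" b2] e by simp
  thus "a \<in> set as" by simp
 next
  assume "a \<in> set as"
  then obtain a1 a2 where "as = a1 @ a # a2" by (meson split_list)
  thus "precedes (as @ k # bs) a k" unfolding precedes_def by fastforce
 qed
qed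

text \<open>The configuration after the runners in S have moved. A position sees at most one
  arrival, from runner y - 1, and one departure, on its own runner; if both or neither have
  happened, its occupancy is the original one.\<close>

definition moved :: "int \<Rightarrow> int set \<Rightarrow> (int \<Rightarrow> int) \<Rightarrow> int set \<Rightarrow> int set" where
 "moved p X x S = {y. if ((y - 1) mod p \<in> S \<and> x (y - 1) + 1 = y) = (y mod p \<in> S \<and> x y = y)
   then y \<in> X else (y - 1) mod p \<in> S \<and> x (y - 1) + 1 = y}"

lemma succ_mod_neq: "(k + 1) mod p \<noteq> k mod p" if "p \<ge> 2" for k p :: int
proof
 assume "(k + 1) mod p = k mod p"
 hence "1 mod p = (0::int)" by (metis add_diff_cancel_left' eq_iff_diff_eq_0 mod_0 mod_diff_cong)
 thus False using that by simp
qed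

text \<open>The two hypotheses on P say that the neighbouring runners have moved exactly if the
  orientation puts them before k. Then \<open>belt_at\<close> at k yields the occupied source and
  \<open>belt_at\<close> at k + 1 the empty target.\<close>

lemma moved_step: assumes x: "belt p X P x" and p: "p \<ge> 2" and k: "k \<in> {0..<p}" "k \<notin> S"
  and Pk: "P k \<longleftrightarrow> (k - 1) mod p \<in> S" and Pk1: "P (k + 1) \<longleftrightarrow> (k + 1) mod p \<notin> S"
 shows "x k \<in> moved p X x S" "x k + 1 \<notin> moved p X x S"
  "moved p X x (insert k S) = insert (x k + 1) (moved p X x S - {x k})"
proof -
 have per: "x j = x j'" if "j mod p = j' mod p" for j j' using x that unfolding belt_def by metis
 have res: "x j mod p = j mod p" for j using x unfolding belt_def by metis
 have km: "k mod p = k" using k by simp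
 have r1: "(x k - 1) mod p = (k - 1) mod p" using res[of k] by (metis mod_diff_left_eq)
 have r2: "(x k + 1) mod p = (k + 1) mod p" using res[of k] by (metis mod_add_left_eq)
 have x1: "x (x k - 1) = x (k - 1)" "x (x k) = x k" "x (x k + 1) = x (k + 1)"
  by (rule per[OF r1], rule per[OF res], rule per[OF r2])
 have b0: "belt_at X P x k" "belt_at X P x (k + 1)" using x unfolding belt_def by auto
 show A: "x k \<in> moved p X x S"
  using b0(1) Pk k x1 r1 res[of k] km unfolding moved_def belt_at_def by auto
 show B: "x k + 1 \<notin> moved p X x S"
  using b0(2) Pk1 k x1 r2 res[of k] km unfolding moved_def belt_at_def by auto
 show "moved p X x (insert k S) = insert (x k + 1) (moved p X x S - {x k})"
 proof (rule Set.set_eqI)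
  fix y
  have ne1: "(k - 1) mod p \<noteq> k" "(k + 1) mod p \<noteq> k"
   using succ_mod_neq[OF p, of "k - 1"] succ_mod_neq[OF p, of k] km by auto
  consider "y = x k" | "y = x k + 1" | "y \<noteq> x k" "y \<noteq> x k + 1" by blast
  thus "y \<in> moved p X x (insert k S) \<longleftrightarrow> y \<in> insert (x k + 1) (moved p X x S - {x k})"
  proof cases
   case 1
   have "x k \<notin> moved p X x (insert k S)"
    using b0(1) Pk k x1 r1 res[of k] km ne1 unfolding moved_def belt_at_def by auto
   thus ?thesis using 1 by auto
  next
   case 2
   have "x k + 1 \<in> moved p X x (insert k S)"
    using b0(2) Pk1 k x1 r2 res[of k] km ne1 unfolding moved_def belt_at_def by auto
   thus ?thesis using 2 by auto
  next
   case 3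
   have "\<not> (y mod p = k \<and> x y = y)" using 3 per[of y k] km by auto
   moreover have "\<not> ((y - 1) mod p = k \<and> x (y - 1) + 1 = y)" using 3 per[of "y - 1" k] km by auto
   ultimately have "y \<in> moved p X x (insert k S) \<longleftrightarrow> y \<in> moved p X x S"
    unfolding moved_def mem_Collect_eq insert_iff by argo
   thus ?thesis using 3 by auto
  qed
 qed
qed

lemma belt_realize: assumes x: "belt p X P x" and p: "p \<ge> 2" and Pp: "\<And>k. P (k mod p) = P k"
  and ks: "distinct ks" "set ks = {0..<p}"
  and c: "\<And>k. k \<in> {0..<p} ==> P k \<longleftrightarrow> precedes ks ((k - 1) mod p) k"
 shows "maya_path X (map (\<lambda>k. x k + 1) ks) (moved p X x {0..<p})"
proof -
 have "maya_path (moved p X x (set as)) (map (\<lambda>k. x k + 1) bs) (moved p X x {0..<p})"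
  if "ks = as @ bs" for as bs using that
 proof (induction bs arbitrary: as)
  case Nil
  thus ?case using ks by simp
 next
  case (Cons k bs)
  have d: "distinct (as @ k # bs)" using ks Cons.prems by simp
  have k: "k \<in> {0..<p}" "k \<notin> set as" using ks d Cons.prems by auto
  have 1: "P k \<longleftrightarrow> (k - 1) mod p \<in> set as" using c[OF k(1)] precedes_split(2)[OF d] Cons.prems by simp
  let ?j = "(k + 1) mod p"
  have j: "?j \<in> {0..<p}" "?j \<noteq> k" using p succ_mod_neq[OF p, of k] k by auto
  have "P (k + 1) \<longleftrightarrow> precedes ks ((?j - 1) mod p) ?j" using c[OF j(1)] Pp by metis
  also have "(?j - 1) mod p = k" using k by (simp add: mod_simps)
  also have "precedes ks k ?j \<longleftrightarrow> ?j \<in> set bs" using precedes_split(1)[OF d] Cons.prems by simp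
  also have "\<dots> \<longleftrightarrow> ?j \<notin> set as"
  proof -
   have "?j \<in> set as \<union> insert k (set bs)" using j(1) ks(2) Cons.prems by auto
   thus ?thesis using j(2) d by auto
  qed
  finally have 2: "P (k + 1) \<longleftrightarrow> ?j \<notin> set as" .
  note m = moved_step[OF x p k 1 2]
  have "maya_path (moved p X x (set (as @ [k]))) (map (\<lambda>k. x k + 1) bs) (moved p X x {0..<p})"
   by (rule Cons.IH) (use Cons.prems in simp)
  thus ?case using m by simp
 qed
 from this[of "[]" ks] show ?thesis by (simp add: moved_def)
qed

text \<open>Converse of \<open>belt_realize\<close>. The source on runner k is read off from the
  unique step of residue k + 1, and \<open>belt_at\<close> follows by comparing X with the
  configurations just before the steps on two neighbouring runners.\<close>

lemma path_belt: assumes path: "maya_path X cs Y" and p: "p \<ge> 2"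
  and d: "distinct (map (\<lambda>c. c mod p) cs)" "set (map (\<lambda>c. c mod p) cs) = {0..<p}"
 defines "ks \<equiv> map (\<lambda>c. (c - 1) mod p) cs"
 obtains x where "belt p X (\<lambda>k. precedes ks ((k - 1) mod p) (k mod p)) x"
  "map (\<lambda>k. x k + 1) ks = cs" "distinct ks" "set ks = {0..<p}"
proof -
 define f where "f = (\<lambda>k. THE c. c \<in> set cs \<and> c mod p = k mod p)"
 have inj: "inj_on (\<lambda>c. c mod p) (set cs)" using d(1) by (simp add: distinct_map)
 have f: "f k \<in> set cs \<and> f k mod p = k mod p" for k
 proof -
  have "k mod p \<in> (\<lambda>c. c mod p) ` set cs" using d(2) p by simp
  then obtain c where c: "c \<in> set cs" "c mod p = k mod p" by auto
  have "\<exists>!c. c \<in> set cs \<and> c mod p = k mod p" using c inj unfolding inj_on_def by metis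
  thus ?thesis unfolding f_def by (rule theI')
 qed
 have f_eq: "f k = c" if "c \<in> set cs" "c mod p = k mod p" for k c
  using f[of k] that inj_onD[OF inj] by metis
 have fp: "f k = f j" if "k mod p = j mod p" for k j using that by (simp add: f_def)
 define x where "x = (\<lambda>k. f (k + 1) - 1)"
 have x_eq: "x (c - 1) = c - 1" if "c \<in> set cs" for c using f_eq[of c c] that by (simp add: x_def)
 have xp: "x k = x j" if "k mod p = j mod p" for k j
  unfolding x_def using fp[of "k+1" "j+1"] that by (metis mod_add_cong)
 have res: "x k mod p = k mod p" for k
  unfolding x_def using f[of "k + 1"] by (metis add_diff_cancel_right' mod_diff_cong)
 have dk: "distinct ks"
 proof -
  have "inj_on (\<lambda>c. (c - 1) mod p) (set cs)"
   by (rule inj_onI) (metis diff_add_cancel inj inj_on_eq_iff mod_add_cong)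
  thus ?thesis using d(1) by (simp add: ks_def distinct_map)
 qed
 have sk: "set ks = {0..<p}"
 proof
  show "set ks \<subseteq> {0..<p}" using p by (auto simp: ks_def)
  show "{0..<p} \<subseteq> set ks"
  proof
   fix k assume k: "k \<in> {0..<p}"
   have "(f (k + 1) - 1) mod p = k" using f[of "k + 1"] k res[of k] by (simp add: x_def)
   thus "k \<in> set ks" using f[of "k + 1"] unfolding ks_def set_map by (metis imageI)
  qed
 qed
 have mp: "map (\<lambda>k. x k + 1) ks = cs"
 proof -
  have "x ((c - 1) mod p) + 1 = c" if "c \<in> set cs" for c
   using xp[of "(c - 1) mod p" "c - 1"] x_eq[OF that] by simp
  thus ?thesis unfolding ks_def by (simp add: map_idI)
 qed
 \<comment> \<open>The path is cut immediately before the step on runner k; the steps in the first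
   part are those whose runner precedes k.\<close>
 have stage: "\<exists>as bs Z. cs = as @ (x k + 1) # bs \<and> maya_path X as Z \<and> x k \<in> Z \<and> x k + 1 \<notin> Z \<and>
   (\<forall>c\<in>set cs. c \<in> set as \<longleftrightarrow> precedes ks ((c - 1) mod p) (k mod p))" for k
 proof -
  have "x k + 1 \<in> set cs" using f[of "k + 1"] by (simp add: x_def)
  then obtain as bs where e: "cs = as @ (x k + 1) # bs" by (meson split_list)
  have ks: "ks = map (\<lambda>c. (c - 1) mod p) as @ k mod p # map (\<lambda>c. (c - 1) mod p) bs"
   using res[of k] by (simp add: ks_def e)
  have "c \<in> set as \<longleftrightarrow> (c - 1) mod p \<in> set (map (\<lambda>c. (c - 1) mod p) as)" if "c \<in> set cs" for c
  proof
   assume "(c - 1) mod p \<in> set (map (\<lambda>c. (c - 1) mod p) as)"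
   then obtain c' where c': "c' \<in> set as" "(c - 1) mod p = (c' - 1) mod p" by auto
   hence "c mod p = c' mod p" by (metis diff_add_cancel mod_add_cong)
   hence "c = c'" using inj_onD[OF inj] that c' e by auto
   thus "c \<in> set as" using c' by simp
  qed auto
  hence "\<forall>c\<in>set cs. c \<in> set as \<longleftrightarrow> precedes ks ((c - 1) mod p) (k mod p)"
   using precedes_split(2) dk unfolding ks by metis
  moreover obtain Z where "maya_path X as Z" "x k \<in> Z" "x k + 1 \<notin> Z"
   using path unfolding e maya_path_append by auto
  ultimately show ?thesis using e by blast
 qed
 let ?P = "\<lambda>k. precedes ks ((k - 1) mod p) (k mod p)"
 have "belt_at X ?P x k" for k
 proof -
  obtain as bs Z where 1: "cs = as @ (x k + 1) # bs" "maya_path X as Z" "x k \<in> Z" "x k + 1 \<notin> Z"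
   "\<forall>c\<in>set cs. c \<in> set as \<longleftrightarrow> precedes ks ((c - 1) mod p) (k mod p)" using stage[of k] by blast
  obtain as' bs' Z' where 2: "cs = as' @ (x (k-1) + 1) # bs'" "maya_path X as' Z'" "x (k-1) \<in> Z'" "x (k-1) + 1 \<notin> Z'"
   "\<forall>c\<in>set cs. c \<in> set as' \<longleftrightarrow> precedes ks ((c - 1) mod p) ((k-1) mod p)" using stage[of "k-1"] by blast
  have dc: "distinct cs" using d(1) by (simp add: distinct_map)
  have in1: "x (k-1) + 1 \<in> set cs" "x k + 1 \<in> set cs" using 1(1) 2(1) by (metis in_set_conv_decomp)+
  have P: "x (k-1) + 1 \<in> set as \<longleftrightarrow> ?P k" using 1(5) in1 res[of "k-1"] by simp
  have uniq: "c = f k" if "c \<in> set cs" "c mod p = k mod p" for c using f_eq[OF that] by simp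
  have xk1: "x (k - 1) + 1 = f k" by (simp add: x_def)
  show ?thesis
  proof (cases "x k = x (k - 1) + 1")
   case True
   have n1: "x k + 1 \<notin> set as" using dc 1(1) by auto
   show ?thesis
   proof (cases "?P k")
    case T: True
    have "x (k-1) + 1 \<notin> set as'" using dc 2(1) by auto
    moreover have "x k + 1 \<notin> set as'"
    proof
     assume "x k + 1 \<in> set as'"
     hence "precedes cs (x k + 1) (x (k-1) + 1)" using precedes_split(2)[of as' "x (k-1) + 1" bs'] dc 2(1) by simp
     hence "x (k-1) + 1 \<in> set bs" using precedes_split(1)[of as "x k + 1" bs] dc 1(1) by simp
     thus False using P T dc 1(1) by auto
    qed
    ultimately have "x k \<notin> X" using maya_path_unaltered[OF 2(2), of "x k"] 2(4) True by simp
    thus ?thesis using True T by (simp add: belt_at_def)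
   next
    case F: False
    hence "x k \<in> X" using maya_path_unaltered[OF 1(2), of "x k"] 1(3) True P n1 by simp
    thus ?thesis using True F by (simp add: belt_at_def)
   qed
  next
   case False
   \<comment> \<open>No step enters \<open>x k\<close>, since the only step of the right residue
     ends elsewhere, and no step leaves \<open>x (k - 1) + 1\<close>. Hence the occupancies seen
     just before the two moves are those of X.\<close>
   have a: "x k \<notin> set cs" using uniq[of "x k"] res[of k] xk1 False by metis
   have b: "x (k-1) + 1 + 1 \<notin> set cs"
   proof
    assume "x (k-1) + 1 + 1 \<in> set cs"
    moreover have "(x (k-1) + 1 + 1) mod p = (k + 1) mod p"
     using res[of "k-1"] by (metis diff_add_cancel mod_add_cong)
    ultimately have "f (k + 1) = x (k-1) + 1 + 1" using f_eq by blast
    thus False using False by (simp add: x_def)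
   qed
   have "x k \<in> X" using maya_path_unaltered[OF 1(2), of "x k"] 1 a dc by auto
   moreover have "x (k-1) + 1 \<notin> X"
    using maya_path_unaltered[OF 2(2), of "x (k-1) + 1"] 2 b dc by auto
   ultimately show ?thesis by (simp add: belt_at_def)
  qed
 qed
 moreover have "x (k mod p) = x k" for k by (rule xp) simp
 ultimately have "belt p X ?P x" unfolding belt_def using res by blast
 thus ?thesis using that mp dk sk by blast
qed

lemma precedes_append: "precedes (xs @ ys) a b \<longleftrightarrow> precedes xs a b \<or> precedes ys a b \<or> (a \<in> set xs \<and> b \<in> set ys)"
proof
 assume "precedes (xs @ ys) a b"
 then obtain as bs where e: "xs @ ys = as @ a # bs" "b \<in> set bs" unfolding precedes_def by blast
 from iffD1[OF append_eq_append_conv2 e(1)] obtain us where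
  "xs = as @ us \<and> us @ ys = a # bs \<or> xs @ us = as \<and> ys = us @ a # bs" by blast
 thus "precedes xs a b \<or> precedes ys a b \<or> (a \<in> set xs \<and> b \<in> set ys)"
 proof
  assume "xs = as @ us \<and> us @ ys = a # bs"
  thus ?thesis using e(2) by (cases us) (auto simp: precedes_def)
 next
  assume "xs @ us = as \<and> ys = us @ a # bs"
  thus ?thesis using e(2) by (auto simp: precedes_def)
 qed
next
 assume "precedes xs a b \<or> precedes ys a b \<or> (a \<in> set xs \<and> b \<in> set ys)"
 then consider "precedes xs a b" | "precedes ys a b" | "a \<in> set xs" "b \<in> set ys" by blast
 thus "precedes (xs @ ys) a b"
 proof cases
  case 1
  then obtain as bs where "xs = as @ a # bs" "b \<in> set bs" unfolding precedes_def by blast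
  hence "xs @ ys = as @ a # (bs @ ys)" "b \<in> set (bs @ ys)" by auto
  thus ?thesis unfolding precedes_def by blast
 next
  case 2
  then obtain as bs where "ys = as @ a # bs" "b \<in> set bs" unfolding precedes_def by blast
  hence "xs @ ys = (xs @ as) @ a # bs" "b \<in> set bs" by auto
  thus ?thesis unfolding precedes_def by blast
 next
  case 3
  then obtain as bs where "xs = as @ a # bs" by (meson split_list)
  hence "xs @ ys = as @ a # (bs @ ys)" "b \<in> set (bs @ ys)" using 3 by auto
  thus ?thesis unfolding precedes_def by blast
 qed
qed

lemma precedes_single: "\<not> precedes [x] a b"
proof
 assume "precedes [x] a b"
 then obtain as bs where "[x] = as @ a # bs" "b \<in> set bs" unfolding precedes_def by blast
 thus False by (cases as) auto
qed

lemma precedes_Cons: "precedes (x # ys) a b \<longleftrightarrow> precedes ys a b \<or> a = x \<and> b \<in> set ys"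
proof -
 have "precedes ([x] @ ys) a b \<longleftrightarrow> precedes [x] a b \<or> precedes ys a b \<or> (a \<in> set [x] \<and> b \<in> set ys)"
  by (rule precedes_append)
 thus ?thesis by (simp add: precedes_single)
qed

lemma precedes_Nil [simp]: "\<not> precedes [] a b" by (simp add: precedes_def)

lemma precedes_in: "precedes xs a b ==> a \<in> set xs \<and> b \<in> set xs" by (auto simp: precedes_def)

lemma precedes_asym: "distinct xs ==> precedes xs a b ==> \<not> precedes xs b a"
proof (induction xs)
 case (Cons x xs)
 thus ?case using precedes_in[of xs a b] precedes_in[of xs b a] by (auto simp: precedes_Cons)
qed simp

text \<open>A non-constant orientation of a cycle is acyclic, so it has a linear extension.\<close>

lemma linear_extension: fixes p :: int
 assumes p: "p \<ge> 2" and Pp: "\<And>k. P (k mod p) = P k" and a: "\<not> P a" "P b"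
 obtains ks where "distinct ks" "set ks = {0..<p}" "\<And>k. P k \<longleftrightarrow> precedes ks ((k - 1) mod p) (k mod p)"
proof -
 \<comment> \<open>The cycle is cut open at a place where P holds at a - 1 and fails at a. The
   runners are then inserted in the order a, a + 1, and so on; the last one, a - 1, goes to the end
   of the list, which gives the edge closing the cycle its prescribed direction.\<close>
 have "\<exists>a. \<not> P a \<and> P (a - 1)"
 proof (rule ccontr)
  assume "\<not> ?thesis"
  hence backw: "P (k - 1) ==> P k" for k by blast
  have up: "P (b + int n)" for n
  proof (induction n)
   case (Suc n) thus ?case using backw[of "b + int (Suc n)"] by simp
  qed (use a in simp)
  have "P (b + int (nat ((a - b) mod p)))" by (rule up)
  also have "b + int (nat ((a - b) mod p)) = b + (a - b) mod p" using p by simp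
  finally have "P ((b + (a - b) mod p) mod p)" using Pp by simp
  hence "P (a mod p)" by (simp add: mod_simps)
  thus False using Pp a by simp
 qed
 then obtain a where a: "\<not> P a" "P (a - 1)" by blast
 have "\<exists>ks. distinct ks \<and> set ks = (\<lambda>j. (a + int j) mod p) ` {..<n} \<and>
   (\<forall>j. 0 < j \<and> j < n \<longrightarrow> P (a + int j) = precedes ks ((a + int j - 1) mod p) ((a + int j) mod p) \<and>
    P (a + int j) = (\<not> precedes ks ((a + int j) mod p) ((a + int j - 1) mod p))) \<and>
   (\<forall>j. 0 < j \<and> Suc j = n \<longrightarrow> P (a + int j) \<longrightarrow> precedes ks (a mod p) ((a + int j) mod p))"
  if "1 \<le> n" "n \<le> nat p" for n using that
 proof (induction n rule: nat_induct_at_least)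
  case base
  show ?case by (rule exI[of _ "[a mod p]"]) (auto simp: lessThan_Suc)
 next
  case (Suc n)
  then obtain ks where ks: "distinct ks" "set ks = (\<lambda>j. (a + int j) mod p) ` {..<n}"
   "\<And>j. 0 < j ==> j < n ==> P (a + int j) = precedes ks ((a + int j - 1) mod p) ((a + int j) mod p)"
   "\<And>j. 0 < j ==> j < n ==> P (a + int j) = (\<not> precedes ks ((a + int j) mod p) ((a + int j - 1) mod p))" by auto
  have inj: "i = j" if "(a + int i) mod p = (a + int j) mod p" "i \<le> n" "j \<le> n" for i j
  proof -
   have "int i mod p = int j mod p" using mod_diff_cong[OF that(1) refl, of a] by simp
   thus ?thesis using that Suc.prems by simp
  qed
  let ?z = "(a + int n) mod p"
  have z: "?z \<notin> set ks" unfolding ks(2) using inj[of n] by force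
  have mem: "(a + int j) mod p \<in> set ks" if "j < n" for j using that ks(2) by auto
  have memz: "(a + int n - 1) mod p \<in> set ks" using mem[of "n - 1"] Suc.hyps by (simp add: algebra_simps)
  have zj: "?z \<noteq> (a + int j) mod p" if "j < n" for j using inj[of n j] that by auto
  have zj': "?z \<noteq> (a + int j - 1) mod p" if "0 < j" "j < n" for j
   using zj[of "j - 1"] that by (simp add: algebra_simps)
  \<comment> \<open>Placing the new runner after or before all earlier ones settles its relation to
    its predecessor and leaves all earlier relations unchanged.\<close>
  define ks' where "ks' = (if P (a + int n) then ks @ [?z] else [?z] @ ks)"
  have "distinct ks'" using ks z by (auto simp: ks'_def)
  moreover have "set ks' = (\<lambda>j. (a + int j) mod p) ` {..<Suc n}"
   using ks(2) by (auto simp: ks'_def lessThan_Suc)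
  moreover have "P (a + int j) = precedes ks' ((a + int j - 1) mod p) ((a + int j) mod p) \<and>
    P (a + int j) = (\<not> precedes ks' ((a + int j) mod p) ((a + int j - 1) mod p))" if "0 < j" "j < Suc n" for j
  proof (cases "j = n")
   case True
   thus ?thesis using z memz precedes_in[of ks] by (auto simp: ks'_def precedes_append precedes_single precedes_Cons)
  next
   case False
   hence "j < n" using that by simp
   hence "?z \<noteq> (a + int j) mod p" "?z \<noteq> (a + int j - 1) mod p"
    "P (a + int j) = precedes ks ((a + int j - 1) mod p) ((a + int j) mod p)"
    "P (a + int j) = (\<not> precedes ks ((a + int j) mod p) ((a + int j - 1) mod p))"
    using ks(3,4)[of j] that zj[of j] zj'[of j] by blast+
   thus ?thesis unfolding ks'_def by (simp add: precedes_append precedes_Cons)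
  qed
  moreover have "precedes ks' (a mod p) ?z" if "P (a + int n)"
   using that mem[of 0] Suc.hyps by (auto simp: ks'_def precedes_append)
  ultimately show ?case by blast
 qed
 from this[of "nat p"] p obtain ks where ks: "distinct ks" "set ks = (\<lambda>j. (a + int j) mod p) ` {..<nat p}"
   "\<And>j. 0 < j ==> j < nat p ==> P (a + int j) = precedes ks ((a + int j - 1) mod p) ((a + int j) mod p)"
   "\<And>j. 0 < j ==> Suc j = nat p ==> P (a + int j) ==> precedes ks (a mod p) ((a + int j) mod p)" by force
 have s: "set ks = {0..<p}"
 proof
  show "set ks \<subseteq> {0..<p}" using ks(2) p by auto
  show "{0..<p} \<subseteq> set ks"
  proof
   fix k assume k: "k \<in> {0..<p}"
   have "(a + int (nat ((k - a) mod p))) mod p = k" using k p by (simp add: mod_simps)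
   moreover have "nat ((k - a) mod p) < nat p" using p by auto
   ultimately show "k \<in> set ks" unfolding ks(2) by (metis imageI lessThan_iff)
  qed
 qed
 have "P k \<longleftrightarrow> precedes ks ((k - 1) mod p) (k mod p)" for k
 proof -
  define j where "j = nat ((k - a) mod p)"
  have j: "int j = (k - a) mod p" "j < nat p" using p by (auto simp: j_def)
  have k1: "(a + int j) mod p = k mod p" unfolding j(1) by (simp add: mod_simps)
  hence k: "(a + int j) mod p = k mod p" "(a + int j - 1) mod p = (k - 1) mod p"
   by (auto intro: mod_diff_cong)
  have Pk: "P k = P (a + int j)" using Pp k by metis
  show ?thesis
  proof (cases "j = 0")
   case False
   thus ?thesis using ks(3)[of j] j Pk k by simp
  next
   case True
   let ?l = "nat p - 1"
   have l: "int ?l = p - 1" using p by simp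
   have e: "(a + int ?l) mod p = (a - 1) mod p" unfolding l
    by (metis add.commute add_diff_eq diff_add_eq mod_add_self2)
   have "P (a + int ?l)" using a(2) e Pp by metis
   hence "precedes ks (a mod p) ((a + int ?l) mod p)" using ks(4)[of ?l] p by simp
   hence "\<not> precedes ks ((a + int ?l) mod p) (a mod p)" using precedes_asym ks(1) by metis
   thus ?thesis using True k Pk a e by simp
  qed
 qed
 thus ?thesis using that ks(1) s by blast
qed

context ordered_runners begin

definition full_word :: "int list \<Rightarrow> bool" where
 "full_word w \<longleftrightarrow> distinct w \<and> set w = {0..<p}"

lemma belt_path: assumes "belt p X P x" "\<And>k. P (k mod p) = P k" "distinct ks" "set ks = {0..<p}"
  "\<And>k. P k \<longleftrightarrow> precedes ks ((k - 1) mod p) (k mod p)"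
 shows "maya_path X (map (\<lambda>k. x k + 1) ks) (moved p X x {0..<p})"
  and "map (\<lambda>c. c mod p) (map (\<lambda>k. x k + 1) ks) = map (\<lambda>k. (k + 1) mod p) ks"
  and "full_word (map (\<lambda>k. (k + 1) mod p) ks)"
proof -
 show "maya_path X (map (\<lambda>k. x k + 1) ks) (moved p X x {0..<p})"
  by (rule belt_realize[OF assms(1) p2 assms(2-4)]) (use assms(5) in auto)
 have "(x k + 1) mod p = (k + 1) mod p" for k
  using assms(1) unfolding belt_def by (metis mod_add_cong)
 thus "map (\<lambda>c. c mod p) (map (\<lambda>k. x k + 1) ks) = map (\<lambda>k. (k + 1) mod p) ks" by simp
 have inj: "inj_on (\<lambda>k. (k + 1) mod p) {0..<p}"
 proof (rule inj_onI)
  fix a b assume h: "a \<in> {0..<p}" "b \<in> {0..<p}" "(a + 1) mod p = (b + 1) mod p"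
  hence "a mod p = b mod p" using mod_diff_cong[OF h(3) refl, of 1] by simp
  thus "a = b" using h by simp
 qed
 moreover have "(\<lambda>k. (k + 1) mod p) ` {0..<p} = {0..<p}"
  by (rule endo_inj_surj[OF _ _ inj]) (use p2 in auto)
 ultimately show "full_word (map (\<lambda>k. (k + 1) mod p) ks)"
  unfolding full_word_def using assms(3,4) by (simp add: distinct_map)
qed

text \<open>The end configuration of a belt is independent of the order of moves. So a belt fitting
  two orientations links their residue words: \<open>flip_max\<close> removes runners from the
  orientation, highest first, until one is left, and \<open>swap_single\<close> replaces that one by
  the lowest runner s. The target word depends only on s, and this is what makes it available for
  other configurations with the same order of runners.\<close>

theorem connect: assumes A: "\<And>cs1 cs2 Y1 Y2. maya_path X cs1 Y1 ==> maya_path X cs2 Y2 ==>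
   map (\<lambda>c. c mod p) cs1 = map (\<lambda>c. c mod p) cs2 ==> full_word (map (\<lambda>c. c mod p) cs1) ==> A Y1 ==> A Y2"
  and start: "maya_path X cs Y" "full_word (map (\<lambda>c. c mod p) cs)" "A Y"
  and s: "\<And>t. t mod p \<noteq> s mod p ==> q s < q t" and ks0: "distinct ks0" "set ks0 = {0..<p}"
   "\<And>k. k mod p = s mod p \<longleftrightarrow> precedes ks0 ((k - 1) mod p) (k mod p)"
 shows "\<exists>cs' Y'. maya_path X cs' Y' \<and> map (\<lambda>c. c mod p) cs' = map (\<lambda>k. (k + 1) mod p) ks0 \<and> A Y'"
proof -
 define good where "good = (\<lambda>P. (\<forall>k. P (k mod p) = P k) \<and> (\<exists>a. P a) \<and> (\<exists>a. \<not> P a) \<and>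
   (\<exists>x. belt p X P x \<and> A (moved p X x {0..<p})))"
 \<comment> \<open>Two belts of one orientation can be traversed in the same order of runners, hence
   by paths with equal residue words.\<close>
 have transfer: "A (moved p X y {0..<p})" if g: "good P" and y: "belt p X P y" for P y
 proof -
  obtain x a b where x: "belt p X P x" "A (moved p X x {0..<p})" "\<And>k. P (k mod p) = P k" "P b" "\<not> P a"
   using g unfolding good_def by blast
  obtain ks where ks: "distinct ks" "set ks = {0..<p}"
   "\<And>k. P k \<longleftrightarrow> precedes ks ((k - 1) mod p) (k mod p)"
   using linear_extension[of p P a b] p2 x by metis
  note X = belt_path[OF x(1,3) ks] and Y = belt_path[OF y x(3) ks]
  show ?thesis by (rule A[OF X(1) Y(1) _ _ x(2)]) (simp_all only: X(2) Y(2) X(3))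
 qed
 have single: "\<exists>r. good (\<lambda>k. k mod p = r mod p)" if "good P" for P using that
 proof (induction "card {k\<in>{0..<p}. P k}" arbitrary: P rule: less_induct)
  case less
  hence Pp: "\<And>k. P (k mod p) = P k" unfolding good_def by blast
  let ?S = "{k\<in>{0..<p}. P k}"
  obtain b where b: "P b" using less.prems unfolding good_def by blast
  have "b mod p \<in> ?S" using b Pp p2 by simp
  hence ne: "?S \<noteq> {}" by blast
  have fin: "finite ?S" by (rule finite_subset[of _ "{0..<p}"]) auto
  obtain r where r: "r \<in> ?S" "\<And>k. k \<in> ?S ==> q k \<le> q r"
  proof -
   have "Max (q ` ?S) \<in> q ` ?S" using fin ne by (intro Max_in) auto
   then obtain r where "r \<in> ?S" "q r = Max (q ` ?S)" by auto
   thus ?thesis using that[of r] fin by simp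
  qed
  have mx: "q k < q r" if "P k" "k mod p \<noteq> r mod p" for k
  proof -
   have "k mod p \<in> ?S" using that Pp p2 by simp
   hence "q k \<le> q r" using r(2)[of "k mod p"] q_periodic by simp
   moreover have "q k \<noteq> q r" using q_inj that by blast
   ultimately show ?thesis by simp
  qed
  let ?P' = "\<lambda>k. P k \<and> k mod p \<noteq> r mod p"
  obtain x where x: "belt p X P x" using less.prems unfolding good_def by blast
  \<comment> \<open>This belt fits both orientations, so the property established for its end
    configuration carries over from one to the other.\<close>
  obtain y where y: "belt p X P y" "belt p X ?P' y" using flip_max[OF x Pp _ mx] r(1) by blast
  show ?case
  proof (cases "\<exists>k. ?P' k")
   case True
   have "\<not> ?P' r" by simp
   moreover have "\<forall>k. ?P' (k mod p) = ?P' k" using Pp by simp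
   moreover have "A (moved p X y {0..<p})" using transfer[OF less.prems y(1)] .
   ultimately have g: "good ?P'" unfolding good_def using True y(2) by blast
   have c: "card {k\<in>{0..<p}. ?P' k} < card ?S"
   proof (rule psubset_card_mono[OF fin])
    have "r \<notin> {k\<in>{0..<p}. ?P' k}" by simp
    thus "{k\<in>{0..<p}. ?P' k} \<subset> ?S" using r(1) by blast
   qed
   show ?thesis by (rule less.hyps[OF c g])
  next
   case False
   hence "P = (\<lambda>k. k mod p = r mod p)" using Pp r(1) by (metis (mono_tags, lifting) mem_Collect_eq)
   thus ?thesis using less.prems by blast
  qed
 qed
 obtain x where x: "belt p X (\<lambda>k. precedes (map (\<lambda>c. (c - 1) mod p) cs) ((k - 1) mod p) (k mod p)) x"
  "map (\<lambda>k. x k + 1) (map (\<lambda>c. (c - 1) mod p) cs) = cs"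
  "distinct (map (\<lambda>c. (c - 1) mod p) cs)" "set (map (\<lambda>c. (c - 1) mod p) cs) = {0..<p}"
  by (rule path_belt[OF start(1) p2]) (use start(2) in \<open>auto simp: full_word_def\<close>)
 let ?ks = "map (\<lambda>c. (c - 1) mod p) cs"
 let ?P = "\<lambda>k. precedes ?ks ((k - 1) mod p) (k mod p)"
 have "good ?P"
 proof -
  have per: "\<forall>k. ?P (k mod p) = ?P k" by (simp add: mod_simps)
  \<comment> \<open>The orientation of a path is not constant: its first runner has no runner before
    it, while the cyclic successor of that runner comes later.\<close>
  have "?ks \<noteq> []" using x(4) p2 by force
  then obtain k0 kr where k0: "?ks = k0 # kr" by (cases ?ks) auto
  hence k0p: "k0 \<in> {0..<p}" using x(4) by auto
  have "\<not> ?P k0"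
   using precedes_split(2)[of "[]" k0 kr "(k0 - 1) mod p"] x(3) k0p unfolding k0 by simp
  moreover have "?P (k0 + 1)"
  proof -
   have "(k0 + 1) mod p \<noteq> k0" using succ_mod_neq[OF p2, of k0] k0p by simp
   moreover have "(k0 + 1) mod p \<in> set ?ks" using x(4) p2 by simp
   ultimately have "(k0 + 1) mod p \<in> set kr" unfolding k0 by simp
   thus ?thesis
    using precedes_split(1)[of "[]" k0 kr "(k0 + 1) mod p"] x(3) k0p unfolding k0 by simp
  qed
  moreover have "A (moved p X x {0..<p})"
  proof (rule A[OF start(1) _ refl start(2,3)])
   have "maya_path X (map (\<lambda>k. x k + 1) ?ks) (moved p X x {0..<p})"
    by (rule belt_path(1)[OF x(1) _ x(3,4)]) (use per in auto)
   thus "maya_path X cs (moved p X x {0..<p})" unfolding x(2) .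
  qed
  ultimately show ?thesis unfolding good_def using per x(1) by blast
 qed
 then obtain r where r: "good (\<lambda>k. k mod p = r mod p)" using single by blast
 have gs: "good (\<lambda>k. k mod p = s mod p)"
 proof (cases "r mod p = s mod p")
  case True
  thus ?thesis using r by simp
 next
  case False
  define s' where "s' = r + (s - r) mod p"
  have s': "s' mod p = s mod p" by (simp add: s'_def mod_simps)
  have "(s - r) mod p \<noteq> 0" using False by (metis mod_0_imp_dvd mod_eq_dvd_iff)
  moreover have "0 \<le> (s - r) mod p" "(s - r) mod p < p" using p2 by auto
  ultimately have rs: "r < s'" "s' < r + p" by (auto simp: s'_def)
  have mn: "q s' < q t" if "t mod p \<noteq> s' mod p" for t using s[of t] that s' q_periodic by metis
  obtain x where "belt p X (\<lambda>k. k mod p = r mod p) x" using r unfolding good_def by blast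
  from swap_single[OF this rs mn] obtain y where
   y: "belt p X (\<lambda>k. k mod p = r mod p) y" "belt p X (\<lambda>k. k mod p = s mod p) y" unfolding s' by blast
  have "A (moved p X y {0..<p})" by (rule transfer[OF r y(1)])
  moreover have "(r mod p) \<noteq> s mod p" using False .
  ultimately show ?thesis unfolding good_def using y(2) by auto
 qed
 then obtain x where x: "belt p X (\<lambda>k. k mod p = s mod p) x" "A (moved p X x {0..<p})"
  unfolding good_def by blast
 have "maya_path X (map (\<lambda>k. x k + 1) ks0) (moved p X x {0..<p})"
  "map (\<lambda>c. c mod p) (map (\<lambda>k. x k + 1) ks0) = map (\<lambda>k. (k + 1) mod p) ks0"
  using belt_path[OF x(1) _ ks0] by simp_all
 thus ?thesis using x(2) by blast
qed

end

section \<open>Maya diagrams, residues and cores of partitions\<close>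

text \<open>The empty rows contribute the beads -i - 1, so all sufficiently negative positions are
  occupied.\<close>

definition maya :: "(nat \<Rightarrow> nat) \<Rightarrow> int set" where
 "maya \<nu> = range (\<lambda>i. int (\<nu> i) - int i - 1)"

definition add_box :: "(nat \<Rightarrow> nat) \<Rightarrow> int \<Rightarrow> (nat \<Rightarrow> nat) \<Rightarrow> bool" where
 "add_box \<nu> c \<nu>' \<longleftrightarrow> is_partition \<nu> \<and> is_partition \<nu>' \<and>
   (\<exists>i. \<nu>' = \<nu>(i := Suc (\<nu> i)) \<and> c = int (\<nu> i) - int i)"

fun box_path :: "(nat \<Rightarrow> nat) \<Rightarrow> int list \<Rightarrow> (nat \<Rightarrow> nat) \<Rightarrow> bool" where
 "box_path \<nu> [] \<mu> \<longleftrightarrow> is_partition \<nu> \<and> \<nu> = \<mu>"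
| "box_path \<nu> (c # cs) \<mu> \<longleftrightarrow> (\<exists>\<nu>'. add_box \<nu> c \<nu>' \<and> box_path \<nu>' cs \<mu>)"

lemma partition_antimono: "is_partition \<nu> ==> i \<le> j ==> \<nu> j \<le> \<nu> i"
 by (simp add: is_partition_def antimonoD)

lemma beta_less: "is_partition \<nu> ==> i < j ==> int (\<nu> j) - int j - 1 < int (\<nu> i) - int i - 1"
 using partition_antimono[of \<nu> i j] by simp

lemma beta_eq_iff: "is_partition \<nu> ==> int (\<nu> j) - int j - 1 = int (\<nu> i) - int i - 1 \<longleftrightarrow> i = j"
 using beta_less[of \<nu> i j] beta_less[of \<nu> j i] by (cases i j rule: linorder_cases) auto

text \<open>Beads strictly decrease with the row, so rows are recovered one after the other as the
  largest remaining bead.\<close>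

lemma maya_inj: assumes "is_partition \<nu>" "is_partition \<nu>'" "maya \<nu> = maya \<nu>'" shows "\<nu> = \<nu>'"
proof -
 have le: "\<mu> i \<le> \<mu>' i"
  if h: "is_partition \<mu>" "is_partition \<mu>'" "maya \<mu> = maya \<mu>'" "\<forall>j<i. \<mu> j = \<mu>' j" for \<mu> \<mu>' i
 proof -
  have "int (\<mu> i) - int i - 1 \<in> maya \<mu>'" using h(3) unfolding maya_def by blast
  then obtain j where j: "int (\<mu> i) - int i - 1 = int (\<mu>' j) - int j - 1" unfolding maya_def by blast
  have "i \<le> j"
  proof (rule ccontr)
   assume "\<not> i \<le> j"
   hence "j < i" by simp
   hence "int (\<mu> i) - int i - 1 = int (\<mu> j) - int j - 1" using j h(4) by simp
   thus False using beta_eq_iff[OF h(1)] \<open>j < i\<close> by simp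
  qed
  thus ?thesis using j partition_antimono[OF h(2)] by (metis beta_less[OF h(2)] diff_right_mono h(2) le_less linorder_not_less nat_int_comparison(3) diff_le_eq add.commute diff_add_cancel)
 qed
 have "\<nu> i = \<nu>' i" for i
 proof (induction i rule: less_induct)
  case (less i)
  thus ?case using le[OF assms(1,2,3), of i] le[OF assms(2,1) assms(3)[symmetric], of i] by fastforce
 qed
 thus ?thesis by auto
qed

lemma add_box_maya: assumes "add_box \<nu> c \<nu>'"
 shows "c - 1 \<in> maya \<nu>" "c \<notin> maya \<nu>" "maya \<nu>' = insert c (maya \<nu> - {c - 1})"
proof -
 obtain i where i: "is_partition \<nu>" "is_partition \<nu>'" "\<nu>' = \<nu>(i := Suc (\<nu> i))" "c = int (\<nu> i) - int i"
  using assms unfolding add_box_def by blast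
 show "c - 1 \<in> maya \<nu>" using i(4) unfolding maya_def by auto
 show nc: "c \<notin> maya \<nu>"
 proof
  assume "c \<in> maya \<nu>"
  then obtain j where j: "c = int (\<nu> j) - int j - 1" unfolding maya_def by auto
  have "j < i"
  proof (rule ccontr)
   assume "\<not> j < i"
   hence "\<nu> j \<le> \<nu> i" using partition_antimono[OF i(1)] by simp
   thus False using j i(4) \<open>\<not> j < i\<close> by simp
  qed
  hence "\<nu>' i \<le> \<nu>' j" using partition_antimono[OF i(2)] by simp
  thus False using j i \<open>j < i\<close> by simp
 qed
 show "maya \<nu>' = insert c (maya \<nu> - {c - 1})"
 proof
  show "maya \<nu>' \<subseteq> insert c (maya \<nu> - {c - 1})"
  proof
   fix y assume "y \<in> maya \<nu>'"
   then obtain j where j: "y = int (\<nu>' j) - int j - 1" unfolding maya_def by auto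
   show "y \<in> insert c (maya \<nu> - {c - 1})"
   proof (cases "j = i")
    case True thus ?thesis using j i by simp
   next
    case False
    hence "y = int (\<nu> j) - int j - 1" using j i by simp
    moreover have "y \<noteq> c - 1" using beta_eq_iff[OF i(1), of j i] False calculation i(4) by auto
    ultimately show ?thesis unfolding maya_def by blast
   qed
  qed
  show "insert c (maya \<nu> - {c - 1}) \<subseteq> maya \<nu>'"
  proof
   fix y assume "y \<in> insert c (maya \<nu> - {c - 1})"
   then consider "y = c" | j where "y = int (\<nu> j) - int j - 1" "y \<noteq> c - 1" unfolding maya_def by blast
   thus "y \<in> maya \<nu>'"
   proof cases
    case 1
    hence "y = int (\<nu>' i) - int i - 1" using i by simp
    thus ?thesis unfolding maya_def by blast
   next
    case 2
    hence "j \<noteq> i" using i by auto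
    hence "y = int (\<nu>' j) - int j - 1" using 2 i by simp
    thus ?thesis unfolding maya_def by blast
   qed
  qed
 qed
qed

lemma maya_add_box: assumes p: "is_partition \<nu>" and c: "c - 1 \<in> maya \<nu>" "c \<notin> maya \<nu>"
 obtains \<nu>' where "add_box \<nu> c \<nu>'"
proof -
 obtain i where i: "c - 1 = int (\<nu> i) - int i - 1" using c(1) unfolding maya_def by blast
 let ?n = "\<nu>(i := Suc (\<nu> i))"
 have gt: "\<nu> i < \<nu> j" if "j < i" for j
 proof (rule ccontr)
  assume "\<not> \<nu> i < \<nu> j"
  moreover have "j \<le> i - 1" using that by simp
  ultimately have "\<nu> (i - 1) = \<nu> i"
   using partition_antimono[OF p, of "i - 1" i] partition_antimono[OF p, of j "i - 1"] by simp
  hence "c = int (\<nu> (i - 1)) - int (i - 1) - 1" using i that by auto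
  thus False using c(2) unfolding maya_def by blast
 qed
 have "antimono ?n"
 proof (rule antimonoI)
  fix x y :: nat assume xy: "x \<le> y"
  show "?n y \<le> ?n x" using partition_antimono[OF p xy] gt[of x] xy by auto
 qed
 moreover have "\<exists>N. \<forall>j\<ge>N. ?n j = 0"
 proof -
  obtain N where "\<forall>j\<ge>N. \<nu> j = 0" using p unfolding is_partition_def by blast
  hence "\<forall>j\<ge>max N (Suc i). ?n j = 0" by auto
  thus ?thesis by blast
 qed
 ultimately have "is_partition ?n" unfolding is_partition_def by blast
 hence "add_box \<nu> c ?n" unfolding add_box_def using p i by auto
 thus ?thesis using that by blast
qed

lemma finite_diagram: assumes "is_partition \<nu>" shows "finite (diagram \<nu>)"
proof -
 obtain N where N: "\<forall>i\<ge>N. \<nu> i = 0" using assms unfolding is_partition_def by blast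
 have "diagram \<nu> \<subseteq> {..<N} \<times> {..<\<nu> 0}"
 proof
  fix z assume z: "z \<in> diagram \<nu>"
  obtain r c where rc: "z = (r, c)" by (cases z)
  hence c: "c < \<nu> r" using z by (simp add: diagram_def)
  have "r < N" using c N by (metis not_less less_nat_zero_code)
  moreover have "c < \<nu> 0" using c partition_antimono[OF assms, of 0 r] by simp
  ultimately show "z \<in> {..<N} \<times> {..<\<nu> 0}" using rc by simp
 qed
 thus ?thesis by (rule finite_subset) simp
qed

lemma diagram_subset_iff: "diagram \<nu> \<subseteq> diagram \<nu>' \<longleftrightarrow> (\<forall>i. \<nu> i \<le> \<nu>' i)"
proof
 assume s: "diagram \<nu> \<subseteq> diagram \<nu>'"
 show "\<forall>i. \<nu> i \<le> \<nu>' i"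
 proof
  fix i show "\<nu> i \<le> \<nu>' i"
  proof (rule ccontr)
   assume "\<not> \<nu> i \<le> \<nu>' i"
   hence "(i, \<nu>' i) \<in> diagram \<nu>" by (simp add: diagram_def)
   thus False using s by (auto simp: diagram_def)
  qed
 qed
qed (auto simp: diagram_def intro: order_less_le_trans)

lemma diagram_add_box: assumes "add_box \<nu> c \<nu>'"
 obtains z where "z \<notin> diagram \<nu>" "diagram \<nu>' = insert z (diagram \<nu>)" "c = int (snd z) - int (fst z)"
proof -
 obtain i where i: "\<nu>' = \<nu>(i := Suc (\<nu> i))" "c = int (\<nu> i) - int i"
  using assms unfolding add_box_def by blast
 have "diagram \<nu>' = insert (i, \<nu> i) (diagram \<nu>)"
  unfolding diagram_def i(1) by (auto split: if_splits)
 thus ?thesis using that[of "(i, \<nu> i)"] i by (simp add: diagram_def)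
qed

lemma box_path_partition: "box_path \<nu> cs \<mu> ==> is_partition \<nu> \<and> is_partition \<mu>"
 by (induction cs arbitrary: \<nu>) (auto simp: add_box_def)

lemma box_path_append: "box_path \<nu> (as @ bs) \<mu> \<longleftrightarrow> (\<exists>\<kappa>. box_path \<nu> as \<kappa> \<and> box_path \<kappa> bs \<mu>)"
 by (induction as arbitrary: \<nu>) (auto dest: box_path_partition)

lemma box_path_maya: "box_path \<nu> cs \<mu> ==> maya_path (maya \<nu>) cs (maya \<mu>)"
proof (induction cs arbitrary: \<nu>)
 case (Cons c cs)
 then obtain \<nu>' where n: "add_box \<nu> c \<nu>'" "box_path \<nu>' cs \<mu>" by auto
 thus ?case using Cons.IH[OF n(2)] add_box_maya[OF n(1)] by simp
qed simp

lemma maya_box_path: "is_partition \<nu> ==> maya_path (maya \<nu>) cs Y ==> \<exists>\<mu>. box_path \<nu> cs \<mu> \<and> Y = maya \<mu>"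
proof (induction cs arbitrary: \<nu>)
 case (Cons c cs)
 obtain \<nu>' where n: "add_box \<nu> c \<nu>'"
  by (rule maya_add_box[OF Cons.prems(1), of c]) (use Cons.prems(2) in auto)
 hence "maya_path (maya \<nu>') cs Y" using Cons.prems(2) add_box_maya(3)[OF n] by simp
 moreover have "is_partition \<nu>'" using n unfolding add_box_def by blast
 ultimately obtain \<mu> where "box_path \<nu>' cs \<mu>" "Y = maya \<mu>" using Cons.IH by blast
 thus ?case using n by auto
qed auto

lemma box_path_exists: assumes "is_partition \<nu>" "is_partition \<mu>" "diagram \<nu> \<subseteq> diagram \<mu>"
 shows "\<exists>cs. box_path \<nu> cs \<mu>" using assms
proof (induction "card (diagram \<mu> - diagram \<nu>)" arbitrary: \<nu> rule: less_induct)
 case less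
 show ?case
 proof (cases "\<nu> = \<mu>")
  case True
  hence "box_path \<nu> [] \<mu>" using less.prems by simp
  thus ?thesis by blast
 next
  case False
  have le: "\<nu> i \<le> \<mu> i" for i using less.prems(3) diagram_subset_iff by blast
  have ex: "\<exists>i. \<nu> i < \<mu> i" using False le by (metis ext le_neq_implies_less)
  \<comment> \<open>In the topmost row that is too short a box can be added: the rows above already
    agree with \<mu> and are therefore long enough.\<close>
  define i where "i = (LEAST i. \<nu> i < \<mu> i)"
  have i: "\<nu> i < \<mu> i" unfolding i_def using ex by (metis LeastI_ex)
  have eq: "\<nu> j = \<mu> j" if "j < i" for j
   using not_less_Least[OF that[unfolded i_def]] le[of j] by simp
  let ?c = "int (\<nu> i) - int i"
  have 1: "?c - 1 \<in> maya \<nu>" unfolding maya_def by blast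
  have 2: "?c \<notin> maya \<nu>"
  proof
   assume "?c \<in> maya \<nu>"
   then obtain j where j: "?c = int (\<nu> j) - int j - 1" unfolding maya_def by blast
   show False
   proof (cases "j < i")
    case True
    hence "\<nu> i < \<nu> j" using eq[OF True] i partition_antimono[OF less.prems(2), of j i] by simp
    thus ?thesis using j True by simp
   next
    case False
    thus ?thesis using j partition_antimono[OF less.prems(1), of i j] by simp
   qed
  qed
  obtain \<nu>' where n: "add_box \<nu> ?c \<nu>'" using maya_add_box[OF less.prems(1) 1 2] .
  then obtain k where k: "\<nu>' = \<nu>(k := Suc (\<nu> k))" "?c = int (\<nu> k) - int k" "is_partition \<nu>'"
   unfolding add_box_def by blast
  have "k = i" using beta_eq_iff[OF less.prems(1), of i k] k(2) by simp
  hence n': "\<nu>' = \<nu>(i := Suc (\<nu> i))" using k by simp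
  have sub: "diagram \<nu>' \<subseteq> diagram \<mu>" unfolding diagram_subset_iff n' using le i by auto
  have "(i, \<nu> i) \<in> diagram \<mu> - diagram \<nu>" "(i, \<nu> i) \<notin> diagram \<mu> - diagram \<nu>'"
   using i by (auto simp: diagram_def n')
  moreover have "diagram \<nu> \<subseteq> diagram \<nu>'" unfolding diagram_subset_iff n' by simp
  ultimately have "diagram \<mu> - diagram \<nu>' \<subset> diagram \<mu> - diagram \<nu>" by blast
  hence "card (diagram \<mu> - diagram \<nu>') < card (diagram \<mu> - diagram \<nu>)"
   using finite_diagram[OF less.prems(2)] by (intro psubset_card_mono) auto
  then obtain cs where "box_path \<nu>' cs \<mu>" using less.hyps k(3) less.prems(2) sub by blast
  hence "box_path \<nu> (?c # cs) \<mu>" using n by auto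
  thus ?thesis by blast
 qed
qed

section \<open>Residue counts, charges and the abacus\<close>

definition res_count :: "nat \<Rightarrow> (nat \<Rightarrow> nat) \<Rightarrow> int multiset" where
 "res_count p \<nu> = image_mset (residue p) (mset_set (diagram \<nu>))"

lemma add_box_res: assumes "add_box \<nu> c \<nu>'"
 shows "res_count p \<nu>' = add_mset (c mod int p) (res_count p \<nu>)"
  "partition_size \<nu>' = Suc (partition_size \<nu>)" "diagram \<nu> \<subseteq> diagram \<nu>'"
proof -
 obtain z where z: "z \<notin> diagram \<nu>" "diagram \<nu>' = insert z (diagram \<nu>)" "c = int (snd z) - int (fst z)"
  using diagram_add_box[OF assms] .
 have f: "finite (diagram \<nu>)" using finite_diagram assms unfolding add_box_def by blast
 show "res_count p \<nu>' = add_mset (c mod int p) (res_count p \<nu>)"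
  using z f by (cases z) (simp add: res_count_def residue_def)
 show "partition_size \<nu>' = Suc (partition_size \<nu>)" using z f by (simp add: partition_size_def)
 show "diagram \<nu> \<subseteq> diagram \<nu>'" using z by blast
qed

lemma box_path_res: assumes "box_path \<nu> cs \<mu>"
 shows "res_count p \<mu> = res_count p \<nu> + mset (residues p cs)"
  "partition_size \<mu> = partition_size \<nu> + length cs" "diagram \<nu> \<subseteq> diagram \<mu>"
proof -
 have "res_count p \<mu> = res_count p \<nu> + mset (residues p cs) \<and>
  partition_size \<mu> = partition_size \<nu> + length cs \<and> diagram \<nu> \<subseteq> diagram \<mu>" using assms
 proof (induction cs arbitrary: \<nu>)
  case (Cons c cs)
  then obtain \<nu>' where n: "add_box \<nu> c \<nu>'" "box_path \<nu>' cs \<mu>" by auto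
  thus ?case using Cons.IH[OF n(2)] add_box_res(1)[OF n(1), of p] add_box_res(2,3)[OF n(1)] by auto
 qed simp
 thus "res_count p \<mu> = res_count p \<nu> + mset (residues p cs)"
  "partition_size \<mu> = partition_size \<nu> + length cs" "diagram \<nu> \<subseteq> diagram \<mu>" by auto
qed

lemma box_path_content: assumes "box_path \<nu> cs \<mu>" shows "content p (\<mu>, \<nu>) = mset (residues p cs)"
proof -
 have f: "finite (diagram \<mu>)" using box_path_partition[OF assms] finite_diagram by blast
 have "mset_set (diagram \<mu>) = mset_set (diagram \<mu> - diagram \<nu>) + mset_set (diagram \<nu>)"
  using box_path_res(3)[OF assms] f by (subst mset_set_Union[symmetric])
   (auto intro: finite_subset simp: Un_absorb2)
 hence "res_count p \<mu> = content p (\<mu>, \<nu>) + res_count p \<nu>" by (simp add: res_count_def content_def)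
 thus ?thesis using box_path_res(1)[OF assms, of p] by (simp add: add.commute)
qed

lemma empty_partition: "is_partition (\<lambda>_. 0)" "diagram (\<lambda>_. 0) = {}" "partition_size (\<lambda>_. 0) = 0"
 by (auto simp: is_partition_def diagram_def partition_size_def antimono_def)

lemma box_path_from_empty: assumes "is_partition \<nu>" obtains cs where "box_path (\<lambda>_. 0) cs \<nu>"
 using box_path_exists[OF empty_partition(1) assms] by (auto simp: empty_partition)

text \<open>The surplus of beads on runner k compared with the empty partition: a box of residue k
  brings a bead to this runner and a box of residue k + 1 takes one away.\<close>

definition charge :: "nat \<Rightarrow> (nat \<Rightarrow> nat) \<Rightarrow> int \<Rightarrow> int" where
 "charge p \<nu> k = int (count (res_count p \<nu>) (k mod int p)) - int (count (res_count p \<nu>) ((k + 1) mod int p))"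

text \<open>The lowest free position on runner k once its beads have been pushed down, that is, on
  the abacus of the core.\<close>

definition runner_pos :: "nat \<Rightarrow> (nat \<Rightarrow> nat) \<Rightarrow> int \<Rightarrow> int" where
 "runner_pos p \<nu> k = k mod int p + int p * charge p \<nu> k"

text \<open>The cut-off makes bead counts finite. It is a multiple of p so that every runner has
  exactly K positions between it and 0.\<close>

definition beads :: "nat \<Rightarrow> nat \<Rightarrow> int set \<Rightarrow> int \<Rightarrow> int set" where
 "beads p K X k = {d \<in> X. d mod int p = k mod int p \<and> - int (p * K) \<le> d}"

lemma maya_tail: assumes "is_partition \<nu>" "d < - int (partition_size \<nu>)" shows "d \<in> maya \<nu>"
proof -
 define i where "i = nat (- d - 1)"
 have i: "int i = - d - 1" using assms(2) by (simp add: i_def)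
 have "\<nu> i = 0"
 proof (rule ccontr)
  assume nz: "\<nu> i \<noteq> 0"
  have "(\<lambda>r. (r, 0)) ` {..i} \<subseteq> diagram \<nu>"
  proof
   fix z assume "z \<in> (\<lambda>r. (r, 0::nat)) ` {..i}"
   then obtain r where "z = (r, 0)" "r \<le> i" by auto
   moreover have "\<nu> i \<le> \<nu> r" using partition_antimono[OF assms(1)] calculation by simp
   ultimately show "z \<in> diagram \<nu>" using nz by (simp add: diagram_def)
  qed
  hence "card ((\<lambda>r. (r, 0::nat)) ` {..i}) \<le> partition_size \<nu>"
   unfolding partition_size_def using finite_diagram[OF assms(1)] by (rule card_mono[rotated])
  moreover have "card ((\<lambda>r. (r, 0::nat)) ` {..i}) = Suc i" by (subst card_image) (auto simp: inj_on_def)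
  ultimately show False using i assms(2) by simp
 qed
 hence "d = int (\<nu> i) - int i - 1" using i by simp
 thus ?thesis unfolding maya_def by blast
qed

lemma maya_bounded: "is_partition \<nu> ==> d \<in> maya \<nu> ==> d < int (\<nu> 0)"
proof -
 assume \<nu>: "is_partition \<nu>" and "d \<in> maya \<nu>"
 then obtain i where "d = int (\<nu> i) - int i - 1" unfolding maya_def by blast
 thus ?thesis using partition_antimono[OF \<nu>, of 0 i] by simp
qed

lemma finite_beads: assumes "is_partition \<nu>" shows "finite (beads p K (maya \<nu>) k)"
proof (rule finite_subset)
 show "beads p K (maya \<nu>) k \<subseteq> {- int (p * K)..<int (\<nu> 0)}"
  using maya_bounded[OF assms] by (simp add: beads_def subset_eq)
qed simp

lemma maya_empty: "maya (\<lambda>_. 0) = {d. d < 0}"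
proof
 show "maya (\<lambda>_. 0) \<subseteq> {d. d < 0}" by (auto simp: maya_def)
 show "{d. d < 0} \<subseteq> maya (\<lambda>_. 0)" using maya_tail[OF empty_partition(1)] by (auto simp: empty_partition)
qed

lemma charge_add_box: assumes "add_box \<nu> c \<nu>'"
 shows "charge p \<nu>' k = charge p \<nu> k + (if c mod int p = k mod int p then 1 else 0)
   - (if c mod int p = (k + 1) mod int p then 1 else 0)"
proof -
 have "int (count (add_mset x M) a) - int (count (add_mset x M) b) =
   int (count M a) - int (count M b) + (if x = a then 1 else 0) - (if x = b then 1 else 0)"
  for x a b :: int and M by simp
 thus ?thesis unfolding charge_def add_box_res(1)[OF assms] .
qed

lemma card_beads: assumes p: "p \<ge> 2" and \<nu>: "is_partition \<nu>" and K: "partition_size \<nu> \<le> p * K"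
 shows "int (card (beads p K (maya \<nu>) k)) = int K + charge p \<nu> k"
proof -
 obtain cs where "box_path (\<lambda>_. 0) cs \<nu>" using box_path_from_empty[OF \<nu>] .
 thus ?thesis using K
 proof (induction cs arbitrary: \<nu> rule: rev_induct)
  case Nil
  hence \<nu>: "\<nu> = (\<lambda>_. 0)" by simp
  let ?k = "k mod int p"
  have "beads p K (maya \<nu>) k = (\<lambda>t. ?k - int p * (int t + 1)) ` {..<K}"
  proof
   show "beads p K (maya \<nu>) k \<subseteq> (\<lambda>t. ?k - int p * (int t + 1)) ` {..<K}"
   proof
    fix d assume "d \<in> beads p K (maya \<nu>) k"
    hence d: "d < 0" "d mod int p = ?k" "- int (p * K) \<le> d" by (auto simp: beads_def \<nu> maya_empty)
    define u where "u = d div int p"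
    have "d = int p * u + d mod int p" by (simp add: u_def)
    hence du: "d = int p * u + ?k" unfolding d(2) .
    have "u < 0" using d(1) p by (simp add: u_def div_neg_pos_less0)
    moreover have "- int K \<le> u"
    proof -
     have "int p * (- int K) \<le> d" using d(3) by simp
     hence "(int p * (- int K)) div int p \<le> u" unfolding u_def using p by (intro zdiv_mono1) auto
     moreover have "(int p * (- int K)) div int p = - int K"
      using p by (intro nonzero_mult_div_cancel_left) auto
     ultimately show ?thesis by simp
    qed
    ultimately have "d = ?k - int p * (int (nat (- u - 1)) + 1)" "nat (- u - 1) \<in> {..<K}"
     using du by (auto simp: algebra_simps)
    thus "d \<in> (\<lambda>t. ?k - int p * (int t + 1)) ` {..<K}" by blast
   qed
   show "(\<lambda>t. ?k - int p * (int t + 1)) ` {..<K} \<subseteq> beads p K (maya \<nu>) k"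
   proof
    fix d assume "d \<in> (\<lambda>t. ?k - int p * (int t + 1)) ` {..<K}"
    then obtain t where t: "t < K" "d = ?k - int p * (int t + 1)" by auto
    have "?k < int p" "0 \<le> ?k" using p by auto
    moreover have "int p * (int t + 1) \<le> int p * int K" using t by (intro mult_left_mono) auto
    moreover have "int p * 1 \<le> int p * (int t + 1)" by (intro mult_left_mono) auto
    ultimately have "d < 0" "- int (p * K) \<le> d" using t(2) by (simp_all, linarith+)
    moreover have "d mod int p = ?k"
    proof -
     have "d = ?k + int p * (- (int t + 1))" using t(2) by (simp add: algebra_simps)
     thus ?thesis by (simp only: mod_mult_self2 mod_mod_trivial)
    qed
    ultimately show "d \<in> beads p K (maya \<nu>) k" by (simp add: beads_def \<nu> maya_empty)
   qed
  qed
  moreover have "inj_on (\<lambda>t. ?k - int p * (int t + 1)) {..<K}" using p by (auto simp: inj_on_def)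
  ultimately have "card (beads p K (maya \<nu>) k) = K" by (simp add: card_image)
  moreover have "charge p \<nu> k = 0" by (simp add: charge_def \<nu> res_count_def empty_partition)
  ultimately show ?case by simp
 next
  case (snoc c cs \<nu>')
  then obtain \<nu> where \<nu>: "box_path (\<lambda>_. 0) cs \<nu>" "add_box \<nu> c \<nu>'" by (auto simp: box_path_append)
  note m = add_box_maya[OF \<nu>(2)]
  have s: "partition_size \<nu>' = Suc (partition_size \<nu>)" using add_box_res(2)[OF \<nu>(2)] .
  have pt: "is_partition \<nu>" using \<nu>(2) by (simp add: add_box_def)
  \<comment> \<open>Everything below minus the size is occupied, so the move takes place above the
    cut-off and is seen by the bead counts.\<close>
  have "- int (partition_size \<nu>) \<le> c" using maya_tail[OF pt, of c] m(2) by force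
  hence lo: "- int (p * K) \<le> c - 1" "- int (p * K) \<le> c" using snoc.prems(2) s by linarith+
  have IH: "int (card (beads p K (maya \<nu>) k)) = int K + charge p \<nu> k"
   using snoc.IH[OF \<nu>(1)] snoc.prems(2) s by simp
  have fin: "finite (beads p K (maya \<nu>) k)" by (rule finite_beads[OF pt])
  have ne: "\<not> (c mod int p = k mod int p \<and> (c - 1) mod int p = k mod int p)"
   using succ_mod_neq[of "int p" "c - 1"] p by auto
  have c1: "(c - 1) mod int p = k mod int p \<longleftrightarrow> c mod int p = (k + 1) mod int p"
   using mod_add_cong[of "c - 1" "int p" k 1 1] mod_diff_cong[of c "int p" "k + 1" 1 1] by auto
  consider "c mod int p = k mod int p" | "(c - 1) mod int p = k mod int p"
   | "c mod int p \<noteq> k mod int p" "(c - 1) mod int p \<noteq> k mod int p" by blast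
  hence "int (card (beads p K (maya \<nu>') k)) = int (card (beads p K (maya \<nu>) k))
   + (if c mod int p = k mod int p then 1 else 0) - (if (c - 1) mod int p = k mod int p then 1 else 0)"
  proof cases
   case 1
   hence "beads p K (maya \<nu>') k = insert c (beads p K (maya \<nu>) k)"
    using ne lo unfolding beads_def m(3) by auto
   moreover have "c \<notin> beads p K (maya \<nu>) k" using m(2) by (simp add: beads_def)
   ultimately show ?thesis using fin 1 ne by simp
  next
   case 2
   hence "beads p K (maya \<nu>') k = beads p K (maya \<nu>) k - {c - 1}"
    using ne lo unfolding beads_def m(3) by auto
   moreover have "c - 1 \<in> beads p K (maya \<nu>) k" using m(1) 2 lo by (simp add: beads_def)
   ultimately have "card (beads p K (maya \<nu>) k) = Suc (card (beads p K (maya \<nu>') k))"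
    using card.remove[OF fin] by metis
   moreover have "c mod int p \<noteq> k mod int p" using ne 2 by blast
   ultimately show ?thesis using 2 by simp
  next
   case 3
   have "d \<in> beads p K (maya \<nu>') k \<longleftrightarrow> d \<in> beads p K (maya \<nu>) k" for d
   proof (cases "d mod int p = k mod int p")
    case True
    have "d \<noteq> c" by (rule notI) (use True 3(1) in simp)
    moreover have "d \<noteq> c - 1" by (rule notI) (use True 3(2) in simp)
    ultimately
    show ?thesis by (simp add: beads_def m(3))
   qed (simp add: beads_def)
   hence "beads p K (maya \<nu>') k = beads p K (maya \<nu>) k" by blast
   thus ?thesis using 3 by simp
  qed
  thus ?case using IH charge_add_box[OF \<nu>(2), of p k] c1 by simp
 qed
qed

lemma charge_periodic: "charge p \<nu> (k mod int p) = charge p \<nu> k" by (simp add: charge_def mod_simps)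

lemma le_of_mod: fixes d :: int assumes "d mod int p = k mod int p" "- int (p * K) \<le> d"
 shows "- int (p * K) + k mod int p \<le> d"
proof -
 have "(d + int (p * K)) mod int p = k mod int p" using assms(1) by simp
 moreover have "(d + int (p * K)) mod int p \<le> d + int (p * K)"
  using assms(2) by (intro zmod_le_nonneg_dividend) simp
 ultimately show ?thesis by simp
qed

text \<open>If translation by j - i mapped all beads of runner i to beads of runner j, then runner j
  would carry at least as many beads. When the translation crosses a multiple of p, the lowest bead
  of runner j is not a translate, which supplies one more. In both cases the gap of runner j could
  not lie below that of runner i.\<close>

theorem maya_ordered_runners: assumes p: "p \<ge> 2" and \<nu>: "is_partition \<nu>"
 shows "ordered_runners (int p) (maya \<nu>) (runner_pos p \<nu>)"
proof
 let ?X = "maya \<nu>" and ?q = "runner_pos p \<nu>"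
 show "2 \<le> int p" using p by simp
 show "?q (k mod int p) = ?q k" for k by (simp add: runner_pos_def charge_periodic)
 have qm: "?q i mod int p = i mod int p" for i by (simp add: runner_pos_def)
 show "i mod int p = j mod int p" if "?q i = ?q j" for i j using qm[of i] qm[of j] that by simp
 define K where "K = Suc (partition_size \<nu>)"
 have big: "partition_size \<nu> + p \<le> p * K" using p by (simp add: K_def)
 hence K: "partition_size \<nu> \<le> p * K" by simp
 note cb = card_beads[OF p \<nu> K]
 show "\<exists>b\<in>?X. b mod int p = i mod int p \<and> b + (j - i) \<notin> ?X"
  if q: "?q j < ?q i" and ij: "i < j" "j < i + int p" for i j
 proof (rule ccontr)
  assume "\<not> ?thesis"
  hence all: "b + (j - i) \<in> ?X" if "b \<in> ?X" "b mod int p = i mod int p" for b using that by blast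
  let ?i = "i mod int p" and ?j = "j mod int p"
  let ?f = "\<lambda>b. b + (j - i)"
  have im: "?f ` beads p K ?X i \<subseteq> beads p K ?X j"
  proof
   fix y assume "y \<in> ?f ` beads p K ?X i"
   then obtain b where b: "y = b + (j - i)" "b \<in> ?X" "b mod int p = i mod int p" "- int (p * K) \<le> b"
    by (auto simp: beads_def)
   have "y mod int p = (b mod int p + (j - i)) mod int p" unfolding b(1) by (simp add: mod_simps)
   also have "\<dots> = j mod int p" unfolding b(3) by (simp add: mod_simps)
   finally show "y \<in> beads p K ?X j" using all[OF b(2,3)] b(1,4) ij by (simp add: beads_def)
  qed
  have ci: "card (?f ` beads p K ?X i) = card (beads p K ?X i)" by (rule card_image) (simp add: inj_on_def)
  have fin: "finite (beads p K ?X j)" by (rule finite_beads[OF \<nu>])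
  have jm: "?j = (?i + (j - i)) mod int p" by (simp add: mod_simps)
  have bnd: "0 \<le> ?i" "?i < int p" "0 \<le> ?j" "?j < int p" using p by auto
  show False
  proof (cases "?i + (j - i) < int p")
   case True
   hence "?j = ?i + (j - i)" using jm ij bnd by simp
   hence lt: "?i < ?j" using ij by simp
   have "card (beads p K ?X i) \<le> card (beads p K ?X j)" using card_mono[OF fin im] ci by simp
   hence "charge p \<nu> i \<le> charge p \<nu> j" using cb[of i] cb[of j] by simp
   hence "int p * charge p \<nu> i \<le> int p * charge p \<nu> j" by (intro mult_left_mono) auto
   thus False using q lt by (simp add: runner_pos_def)
  next
   case False
   have "?j = (?i + (j - i) - int p) mod int p" unfolding jm by simp
   also have "\<dots> = ?i + (j - i) - int p" using False ij bnd by (intro mod_pos_pos_trivial) linarith+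
   finally have jl: "?j < ?i" using ij by simp
   \<comment> \<open>The lowest position of runner j above the cut-off. It is occupied, while all
     translates of beads of runner i lie strictly above it.\<close>
   let ?e = "- int (p * K) + ?j"
   have "?e < - int (partition_size \<nu>)" using big bnd by linarith
   hence "?e \<in> ?X" by (rule maya_tail[OF \<nu>])
   moreover have "?e mod int p = ?j"
   proof -
    have "?e mod int p = (int p * (- int K) + j mod int p) mod int p" by simp
    thus ?thesis by (simp only: mod_mult_self4 mod_mod_trivial)
   qed
   ultimately have e: "?e \<in> beads p K ?X j" using bnd by (simp add: beads_def)
   have "?e \<notin> ?f ` beads p K ?X i"
   proof
    assume "?e \<in> ?f ` beads p K ?X i"
    then obtain b where b: "?e = b + (j - i)" "b mod int p = ?i" "- int (p * K) \<le> b"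
     by (auto simp: beads_def)
    have "- int (p * K) + ?i \<le> b" by (rule le_of_mod[OF b(2,3)])
    thus False using b(1) jl ij by linarith
   qed
   hence "Suc (card (?f ` beads p K ?X i)) = card (insert ?e (?f ` beads p K ?X i))"
    using finite_beads[OF \<nu>, of p K i] by simp
   also have "\<dots> \<le> card (beads p K ?X j)" using im e by (intro card_mono[OF fin]) auto
   finally have "charge p \<nu> i + 1 \<le> charge p \<nu> j" using cb[of i] cb[of j] ci by linarith
   hence "int p * (charge p \<nu> i + 1) \<le> int p * charge p \<nu> j" by (intro mult_left_mono) auto
   thus False using q bnd by (simp add: runner_pos_def algebra_simps)
  qed
 qed
 show "\<exists>b\<in>?X. b mod int p = i mod int p \<and> b + int p \<notin> ?X" for i
 proof -
  let ?S = "beads p K ?X i"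
  let ?e = "- int (p * K) + i mod int p"
  have "i mod int p < int p" "0 \<le> i mod int p" using p by auto
  hence "?e < - int (partition_size \<nu>)" "- int (p * K) \<le> ?e" using big by linarith+
  moreover have "?e mod int p = i mod int p"
  proof -
   have "?e mod int p = (int p * (- int K) + i mod int p) mod int p" by simp
   thus ?thesis by (simp only: mod_mult_self4 mod_mod_trivial)
  qed
  ultimately have "?e \<in> ?S" using maya_tail[OF \<nu>] by (simp add: beads_def)
  hence ne: "?S \<noteq> {}" by blast
  have fin: "finite ?S" by (rule finite_beads[OF \<nu>])
  define b where "b = Max ?S"
  have b: "b \<in> ?S" unfolding b_def by (rule Max_in[OF fin ne])
  have "b + int p \<notin> ?X"
  proof
   assume "b + int p \<in> ?X"
   hence "b + int p \<in> ?S" using b p by (auto simp: beads_def)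
   hence "b + int p \<le> b" unfolding b_def using fin by (rule Max_ge[rotated])
   thus False using p by simp
  qed
  thus ?thesis using b by (auto simp: beads_def)
 qed
qed

text \<open>Such a bead is a removable box of residue c. Without one, moving left by one position
  would embed the beads of runner c into runner c - 1, contradicting the bead counts.\<close>

lemma runner_left: assumes p: "p \<ge> 2" and \<nu>: "is_partition \<nu>"
  and q: "runner_pos p \<nu> (c - 1) + 1 < runner_pos p \<nu> c"
 shows "\<exists>b\<in>maya \<nu>. b mod int p = c mod int p \<and> b - 1 \<notin> maya \<nu>"
proof (rule ccontr)
 assume "\<not> ?thesis"
 hence all: "b - 1 \<in> maya \<nu>" if "b \<in> maya \<nu>" "b mod int p = c mod int p" for b using that by blast
 define K where "K = Suc (partition_size \<nu>)"
 have K: "partition_size \<nu> \<le> p * K" using p by (simp add: K_def trans_le_add2)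
 note cb = card_beads[OF p \<nu> K]
 let ?X = "maya \<nu>"
 \<comment> \<open>A bead exactly at the cut-off would be sent below it. It can only occur on runner
   0, where it accounts for the extra unit in the second case.\<close>
 let ?B = "beads p K ?X c - {- int (p * K)}"
 have im: "(\<lambda>b. b - 1) ` ?B \<subseteq> beads p K ?X (c - 1)"
 proof
  fix y assume "y \<in> (\<lambda>b. b - 1) ` ?B"
  then obtain b where b: "y = b - 1" "b \<in> ?X" "b mod int p = c mod int p" "- int (p * K) \<le> b" "b \<noteq> - int (p * K)"
   by (auto simp: beads_def)
  have "(b - 1) mod int p = (c - 1) mod int p" using b(3) by (rule mod_diff_cong) simp
  thus "y \<in> beads p K ?X (c - 1)" using all[OF b(2,3)] b by (simp add: beads_def)
 qed
 have "card ((\<lambda>b. b - 1) ` ?B) = card ?B" by (rule card_image) (simp add: inj_on_def)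
 hence cB: "card ?B \<le> card (beads p K ?X (c - 1))" using card_mono[OF finite_beads[OF \<nu>] im] by simp
 have fin: "finite (beads p K ?X c)" by (rule finite_beads[OF \<nu>])
 have bnd: "0 \<le> c mod int p" "c mod int p < int p" using p by auto
 show False
 proof (cases "c mod int p = 0")
  case False
  hence "?B = beads p K ?X c" by (auto simp: beads_def)
  hence "charge p \<nu> c \<le> charge p \<nu> (c - 1)" using cb[of c] cb[of "c - 1"] cB by simp
  hence 1: "int p * charge p \<nu> c \<le> int p * charge p \<nu> (c - 1)" by (intro mult_left_mono) auto
  have "(c - 1) mod int p = (c mod int p - 1) mod int p" by (simp add: mod_simps)
  also have "\<dots> = c mod int p - 1" using False bnd by (intro mod_pos_pos_trivial) auto
  finally show False using q 1 by (simp add: runner_pos_def)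
 next
  case True
  have "card (beads p K ?X c) \<le> Suc (card ?B)"
   using fin by (cases "- int (p * K) \<in> beads p K ?X c") (auto simp: card_Diff_singleton)
  hence "charge p \<nu> c \<le> charge p \<nu> (c - 1) + 1" using cb[of c] cb[of "c - 1"] cB by linarith
  hence 1: "int p * charge p \<nu> c \<le> int p * (charge p \<nu> (c - 1) + 1)" by (intro mult_left_mono) auto
  have "(c - 1) mod int p = (c mod int p - 1) mod int p" by (simp add: mod_simps)
  also have "\<dots> = int p - 1" using True p by (simp add: zmod_minus1)
  finally show False using q 1 True by (simp add: runner_pos_def algebra_simps)
 qed
qed

text \<open>Equal charges make the difference of the two residue counts the same for every residue,
  and equal sizes make this common value zero.\<close>

lemma charge_size_eq: assumes p: "p \<ge> 1" and c: "\<And>k. charge p \<nu> k = charge p \<nu>' k"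
  and s: "partition_size \<nu> = partition_size \<nu>'" and f: "is_partition \<nu>" "is_partition \<nu>'"
 shows "res_count p \<nu> = res_count p \<nu>'"
proof -
 let ?c = "\<lambda>\<nu> k. int (count (res_count p \<nu>) (k mod int p))"
 let ?d = "\<lambda>k. ?c \<nu> k - ?c \<nu>' k"
 have step: "?d k = ?d (k + 1)" for k
 proof -
  have gen: "a - b = a' - b' ==> a - a' = b - b'" for a b a' b' :: int by simp
  show ?thesis by (rule gen) (rule c[of k, unfolded charge_def])
 qed
 have const: "?d (int n) = ?d 0" for n
 proof (induction n)
  case (Suc n)
  have "?d (int (Suc n)) = ?d (int n + 1)" by (simp add: add.commute)
  also have "\<dots> = ?d (int n)" by (rule step[symmetric])
  finally show ?case using Suc.IH by (rule trans)
 qed simp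
 have cnt: "int (partition_size \<kappa>) = (\<Sum>k\<in>{0..<int p}. int (count (res_count p \<kappa>) k))" if "is_partition \<kappa>" for \<kappa>
 proof -
  have sub: "set_mset (res_count p \<kappa>) \<subseteq> {0..<int p}" using p by (auto simp: res_count_def residue_def)
  have "size (res_count p \<kappa>) = (\<Sum>k\<in>set_mset (res_count p \<kappa>). count (res_count p \<kappa>) k)"
   by (rule size_multiset_overloaded_eq)
  also have "\<dots> = (\<Sum>k\<in>{0..<int p}. count (res_count p \<kappa>) k)"
   by (rule sum.mono_neutral_left) (use sub in \<open>auto simp: not_in_iff\<close>)
  finally show ?thesis by (simp add: res_count_def partition_size_def)
 qed
 have cd: "int (count (res_count p \<nu>) k) - int (count (res_count p \<nu>') k) = ?d 0" if "k \<in> {0..<int p}" for k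
  using const[of "nat k"] that by simp
 have "0 = (\<Sum>k\<in>{0..<int p}. int (count (res_count p \<nu>) k) - int (count (res_count p \<nu>') k))"
  using cnt[OF f(1)] cnt[OF f(2)] s by (simp add: sum_subtractf)
 also have "\<dots> = (\<Sum>k\<in>{0..<int p}. ?d 0)" by (rule sum.cong[OF refl], rule cd)
 finally have "?d 0 = 0" using p by simp
 hence e: "count (res_count p \<nu>) k = count (res_count p \<nu>') k" if "k \<in> {0..<int p}" for k
  using cd[OF that] by simp
 show ?thesis
 proof (rule multiset_eqI)
  fix k
  have "k \<notin> {0..<int p} ==> k \<notin># res_count p \<kappa>" for \<kappa> using p by (auto simp: res_count_def residue_def)
  thus "count (res_count p \<nu>) k = count (res_count p \<nu>') k" using e[of k]
   by (cases "k \<in> {0..<int p}") (metis, metis not_in_iff)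
 qed
qed

section \<open>Rim hooks and cores on the abacus\<close>

definition node_content :: "nat \<times> nat \<Rightarrow> int" where
 "node_content z = int (snd z) - int (fst z)"

lemma residue_node_content: "residue p z = node_content z mod int p"
 by (cases z) (simp add: residue_def node_content_def)

lemma inj_on_rim_content: assumes \<nu>: "is_partition \<nu>" shows "inj_on node_content (rim \<nu>)"
proof (rule inj_onI)
 fix x y assume xy: "x \<in> rim \<nu>" "y \<in> rim \<nu>" "node_content x = node_content y"
 have no: False if a: "(r, c) \<in> rim \<nu>" "(r', c') \<in> rim \<nu>" "int c - int r = int c' - int r'" "r < r'" for r c r' c'
 proof -
  have "c' < \<nu> r'" using a(2) by (simp add: rim_def diagram_def)
  moreover have "\<nu> r' \<le> \<nu> (Suc r)" using partition_antimono[OF \<nu>] a(4) by simp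
  moreover have "Suc c \<le> c'" using a(3,4) by linarith
  ultimately have "(Suc r, Suc c) \<in> diagram \<nu>" by (simp add: diagram_def)
  thus False using a(1) by (simp add: rim_def)
 qed
 obtain r c r' c' where e: "x = (r, c)" "y = (r', c')" by (cases x, cases y)
 have eq: "int c - int r = int c' - int r'" using xy(3) by (simp add: e node_content_def)
 have "r = r'" using no[of r c r' c'] no[of r' c' r c] xy eq by (cases r r' rule: linorder_cases) (auto simp: e)
 thus "x = y" using eq by (simp add: e)
qed

text \<open>Contents are distinct on the rim and change by one between adjacent nodes. By a discrete
  intermediate value argument a connected set of p rim nodes has p consecutive contents, hence every
  residue once.\<close>

lemma rim_hook_res: assumes "remove_rim_hook p \<nu> \<nu>'" and p: "p \<ge> 1"
 shows "res_count p \<nu> = res_count p \<nu>' + mset_set {0..<int p}"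
proof -
 obtain R where \<nu>: "is_partition \<nu>" "is_partition \<nu>'" and R: "R \<subseteq> rim \<nu>" "card R = p" "connected_nodes R"
  "diagram \<nu>' = diagram \<nu> - R" using assms(1) unfolding remove_rim_hook_def by blast
 have fin: "finite R" using R(2) p by (metis card.infinite not_one_le_zero)
 have ne: "R \<noteq> {}" using R(2) p by auto
 have inj: "inj_on node_content R" using inj_on_rim_content[OF \<nu>(1)] R(1) by (rule inj_on_subset)
 let ?C = "node_content ` R"
 have finC: "finite ?C" and neC: "?C \<noteq> {}" using fin ne by auto
 have cC: "card ?C = p" using card_image[OF inj] R(2) by simp
 have conv: "v \<in> ?C" if v: "Min ?C < v" "v < Max ?C" for v
 proof (rule ccontr)
  assume nv: "v \<notin> ?C"
  obtain x y where xy: "x \<in> R" "node_content x = Min ?C" "y \<in> R" "node_content y = Max ?C"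
   using Min_in[OF finC neC] Max_in[OF finC neC] by (metis imageE)
  have "(x, y) \<in> (adjacent_nodes \<inter> R \<times> R)\<^sup>*" using R(3) xy unfolding connected_nodes_def by blast
  hence "node_content y < v"
  proof (induction rule: rtrancl_induct)
   case base show ?case using v xy by simp
  next
   case (step z w)
   have "\<bar>node_content w - node_content z\<bar> \<le> 1"
    using step.hyps(2) by (cases z, cases w) (auto simp: adjacent_nodes_def node_content_def)
   moreover have "node_content w \<noteq> v" using step.hyps(2) nv by auto
   ultimately show ?case using step.IH by linarith
  qed
  thus False using v xy by simp
 qed
 have C: "?C = {Min ?C..Max ?C}"
 proof
  show "?C \<subseteq> {Min ?C..Max ?C}" using finC by auto
  show "{Min ?C..Max ?C} \<subseteq> ?C"
  proof
   fix v assume "v \<in> {Min ?C..Max ?C}"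
   hence "Min ?C \<le> v" "v \<le> Max ?C" by simp_all
   then consider "v = Min ?C" | "v = Max ?C" | "Min ?C < v" "v < Max ?C" by linarith
   thus "v \<in> ?C" using conv Min_in[OF finC neC] Max_in[OF finC neC] by cases auto
  qed
 qed
 define a where "a = Min ?C"
 have "card {a..Max ?C} = p" using C cC by (simp add: a_def)
 hence "Max ?C = a + int p - 1" using p by simp
 hence Ca: "?C = {a..<a + int p}" using C by (auto simp: a_def)
 have injm: "inj_on (\<lambda>c. c mod int p) {a..<a + int p}"
 proof (rule inj_onI)
  fix x y assume h: "x \<in> {a..<a + int p}" "y \<in> {a..<a + int p}" "x mod int p = y mod int p"
  hence "int p dvd x - y" by (simp add: mod_eq_dvd_iff)
  moreover have "\<bar>x - y\<bar> < int p" using h by auto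
  ultimately show "x = y" using zdvd_not_zless[of "\<bar>x - y\<bar>" "int p"] by (cases "x = y") auto
 qed
 have imm: "(\<lambda>c. c mod int p) ` {a..<a + int p} = {0..<int p}"
 proof (rule card_subset_eq)
  show "(\<lambda>c. c mod int p) ` {a..<a + int p} \<subseteq> {0..<int p}" using p by auto
  show "card ((\<lambda>c. c mod int p) ` {a..<a + int p}) = card {0..<int p}" using card_image[OF injm] by simp
 qed simp
 have "image_mset (residue p) (mset_set R) = image_mset (\<lambda>c. c mod int p) (image_mset node_content (mset_set R))"
 proof -
  have "residue p = (\<lambda>z. node_content z mod int p)" by (rule ext) (rule residue_node_content)
  thus ?thesis by (simp add: multiset.map_comp comp_def)
 qed
 also have "image_mset node_content (mset_set R) = mset_set ?C" by (rule image_mset_mset_set[OF inj])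
 also have "image_mset (\<lambda>c. c mod int p) (mset_set ?C) = mset_set {0..<int p}"
  unfolding Ca using image_mset_mset_set[OF injm] imm by simp
 finally have r: "image_mset (residue p) (mset_set R) = mset_set {0..<int p}" .
 have "R \<subseteq> diagram \<nu>" using R(1) by (auto simp: rim_def)
 hence "mset_set (diagram \<nu>) = mset_set (diagram \<nu>') + mset_set R"
  unfolding R(4) using finite_diagram[OF \<nu>(1)] fin
  by (subst mset_set_Union[symmetric]) (auto simp: Un_absorb2)
 thus ?thesis using r by (simp add: res_count_def)
qed

lemma connected_nodesI: assumes "\<And>x. x \<in> R ==> (x, z) \<in> (adjacent_nodes \<inter> R \<times> R)\<^sup>*"
 shows "connected_nodes R"
proof -
 have "sym (adjacent_nodes \<inter> R \<times> R)" by (auto simp: sym_def adjacent_nodes_def abs_minus_commute)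
 hence "sym ((adjacent_nodes \<inter> R \<times> R)\<^sup>*)" by (rule sym_rtrancl)
 thus ?thesis unfolding connected_nodes_def using assms by (meson rtrancl_trans symE)
qed

text \<open>A free position p below a bead would allow the bead to be moved there, and this is the
  removal of a rim hook with p nodes. The proof constructs that hook.\<close>

lemma core_maya: assumes core: "is_core p \<nu>" and p: "p \<ge> 1" and d: "d \<in> maya \<nu>"
 shows "d - int p \<in> maya \<nu>"
proof (rule ccontr)
 assume e: "d - int p \<notin> maya \<nu>"
 have \<nu>: "is_partition \<nu>" using core by (simp add: is_core_def)
 note anti = partition_antimono[OF \<nu>]
 let ?e = "d - int p"
 obtain i where i: "d = int (\<nu> i) - int i - 1" using d unfolding maya_def by blast
 \<comment> \<open>The last row whose bead lies beyond the free position \<open>d - int p\<close>;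
   the moved bead will belong to this row.\<close>
 define j where "j = Max {k. ?e < int (\<nu> k) - int k - 1}"
 have fin: "finite {k. ?e < int (\<nu> k) - int k - 1}"
 proof (rule finite_subset)
  show "{k. ?e < int (\<nu> k) - int k - 1} \<subseteq> {..nat (int (\<nu> 0) - ?e)}"
  proof
   fix k assume "k \<in> {k. ?e < int (\<nu> k) - int k - 1}"
   thus "k \<in> {..nat (int (\<nu> 0) - ?e)}" using anti[of 0 k] by simp
  qed
 qed simp
 have ii: "i \<in> {k. ?e < int (\<nu> k) - int k - 1}" using i p by simp
 hence jin: "j \<in> {k. ?e < int (\<nu> k) - int k - 1}" unfolding j_def using Max_in[OF fin] by blast
 have ij: "i \<le> j" unfolding j_def using fin ii by (rule Max_ge)
 have below: "int (\<nu> k) - int k - 1 < ?e" if "j < k" for k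
 proof -
  have "k \<notin> {k. ?e < int (\<nu> k) - int k - 1}"
  proof
   assume "k \<in> {k. ?e < int (\<nu> k) - int k - 1}"
   hence "k \<le> j" unfolding j_def using fin by (rule Max_ge[rotated])
   thus False using that by simp
  qed
  moreover have "int (\<nu> k) - int k - 1 \<noteq> ?e"
  proof
   have "int (\<nu> k) - int k - 1 \<in> maya \<nu>" unfolding maya_def by blast
   moreover assume "int (\<nu> k) - int k - 1 = ?e"
   ultimately show False using e by simp
  qed
  ultimately show ?thesis by simp
 qed
 have bj: "int (\<nu> (Suc j)) \<le> ?e + int j + 1" using below[of "Suc j"] by simp
 have aj: "?e + int j + 1 < int (\<nu> j)" using jin by simp
 define f where "f = nat (?e + int j + 1)"
 have f: "int f = ?e + int j + 1" using bj by (simp add: f_def)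
 \<comment> \<open>Without its bead d, row i takes over the bead of row i + 1, and so on; a bead
   moved up by one row corresponds to a part shorter by one. Row j receives the bead at
   \<open>d - int p\<close>, which is the part f.\<close>
 define n where "n = (\<lambda>k. if k < i \<or> j < k then \<nu> k else if k < j then \<nu> (Suc k) - 1 else f)"
 have pos: "f < \<nu> k" if "k \<le> j" for k using anti[of k j] that aj f by linarith
 have nle: "n k \<le> \<nu> k" for k using anti[of k "Suc k"] pos[of k] by (auto simp: n_def)
 have nlt: "n k < \<nu> k" if "i \<le> k" "k \<le> j" for k
  using anti[of k "Suc k"] pos[of k] that pos[of "Suc k"] by (auto simp: n_def)
 have nge: "\<nu> (Suc k) - 1 \<le> n k" for k
  using anti[of k "Suc k"] bj f by (auto simp: n_def dest: less_antisym)
 have nS: "n (Suc k) \<le> n k" for k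
 proof -
  consider "Suc k < i" | "Suc k = i" | "i \<le> k" "Suc k < j" | "i \<le> k" "Suc k = j" | "i \<le> k" "k = j" | "j < k" "i \<le> k"
   using ij by linarith
  thus ?thesis
  proof cases
   case 1 thus ?thesis using anti[of k "Suc k"] by (simp add: n_def)
  next
   case 2 thus ?thesis using anti[of k "Suc k"] nle[of "Suc k"] by (simp add: n_def)
  next
   case 3 thus ?thesis using anti[of "Suc k" "Suc (Suc k)"] by (simp add: n_def diff_le_mono)
  next
   case 4 thus ?thesis using pos[of j] by (auto simp: n_def)
  next
   case 5 thus ?thesis using bj f by (simp add: n_def)
  next
   case 6 thus ?thesis using anti[of k "Suc k"] by (simp add: n_def)
  qed
 qed
 have np: "is_partition n"
 proof -
  have "antimono n" using nS by (simp add: decseq_Suc_iff)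
  moreover obtain N where "\<forall>i\<ge>N. \<nu> i = 0" using \<nu> unfolding is_partition_def by blast
  ultimately show ?thesis unfolding is_partition_def using nle by (metis le_zero_eq)
 qed
 define R where "R = diagram \<nu> - diagram n"
 have dn: "diagram n = diagram \<nu> - R" using nle diagram_subset_iff[of n \<nu>] by (auto simp: R_def)
 have Rin: "(k, c) \<in> R \<longleftrightarrow> i \<le> k \<and> k \<le> j \<and> n k \<le> c \<and> c < \<nu> k" for k c
  by (auto simp: R_def diagram_def n_def)
 have Rrim: "R \<subseteq> rim \<nu>"
 proof
  fix z assume z: "z \<in> R"
  obtain k c where kc: "z = (k, c)" by (cases z)
  have "n k \<le> c" "c < \<nu> k" using z Rin kc by auto
  hence "\<nu> (Suc k) \<le> Suc c" using nge[of k] by simp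
  thus "z \<in> rim \<nu>" using \<open>c < \<nu> k\<close> by (simp add: kc rim_def diagram_def)
 qed
 have Rsig: "R = Sigma {i..j} (\<lambda>k. {n k..<\<nu> k})" using Rin by auto
 \<comment> \<open>Row k with k < j loses the difference to the next part plus one, so the number of
   removed nodes telescopes.\<close>
 have tel: "(\<Sum>k\<in>{i..<j'}. int (\<nu> k) - int (n k)) = int (\<nu> i) - int (\<nu> j') + int j' - int i" if "i \<le> j'" "j' \<le> j" for j'
  using that
 proof (induction j' rule: dec_induct)
  case (step k)
  have "int (n k) = int (\<nu> (Suc k)) - 1" using step.prems step.hyps pos[of "Suc k"] by (simp add: n_def of_nat_diff)
  thus ?case using step by simp
 qed simp
 have "int (card R) = (\<Sum>k\<in>{i..j}. int (\<nu> k - n k))" unfolding Rsig by (subst card_SigmaI) auto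
 also have "\<dots> = (\<Sum>k\<in>{i..j}. int (\<nu> k) - int (n k))" using nle by (simp add: of_nat_diff)
 also have "\<dots> = (\<Sum>k\<in>{i..<j}. int (\<nu> k) - int (n k)) + (int (\<nu> j) - int (n j))"
  using ij by (simp add: atLeastLessThanSuc_atLeastAtMost[symmetric])
 also have "\<dots> = int (\<nu> i) - int i + int j - int (n j)" using tel[OF ij] by simp
 also have "n j = f" using ij by (simp add: n_def)
 also have "int (\<nu> i) - int i + int j - int f = int p" using i f by simp
 finally have cR: "card R = p" by simp
 let ?Q = "adjacent_nodes \<inter> R \<times> R"
 have row: "((k, c), (k, \<nu> k - 1)) \<in> ?Q\<^sup>*" if "(k, c) \<in> R" for k c
 proof -
  have "c \<le> \<nu> k - 1" using that Rin by auto
  thus ?thesis using that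
  proof (induction c rule: inc_induct)
   case (step c)
   have s: "(k, Suc c) \<in> R" using step.prems step.hyps Rin by auto
   have "((k, c), (k, Suc c)) \<in> ?Q" using step.prems s by (simp add: adjacent_nodes_def)
   thus ?case using step.IH[OF s] by (rule converse_rtrancl_into_rtrancl)
  qed simp
 qed
 have last_in: "(k, \<nu> k - 1) \<in> R" if "i \<le> k" "k \<le> j" for k using nlt[OF that] that Rin by auto
 \<comment> \<open>The last node of row k + 1 lies directly below the first removed node of row k,
   so removed rows hang together.\<close>
 have up: "((k, \<nu> k - 1), (i, \<nu> i - 1)) \<in> ?Q\<^sup>*" if "i \<le> k" "k \<le> j" for k using that
 proof (induction k rule: dec_induct)
  case (step k)
  have nk: "n k = \<nu> (Suc k) - 1" using step by (simp add: n_def)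
  have a: "(k, n k) \<in> R" using nlt[of k] step Rin by auto
  have "((Suc k, \<nu> (Suc k) - 1), (k, n k)) \<in> ?Q"
   using a last_in[of "Suc k"] step nk by (simp add: adjacent_nodes_def)
  thus ?case using row[OF a] step by (meson Suc_leD converse_rtrancl_into_rtrancl rtrancl_trans)
 qed simp
 have "connected_nodes R"
 proof (rule connected_nodesI)
  fix x assume x: "x \<in> R"
  obtain k c where kc: "x = (k, c)" by (cases x)
  have "i \<le> k" "k \<le> j" using x Rin kc by auto
  thus "(x, (i, \<nu> i - 1)) \<in> ?Q\<^sup>*" using row[of k c] up[of k] x unfolding kc by (meson rtrancl_trans)
 qed
 hence "remove_rim_hook p \<nu> n" unfolding remove_rim_hook_def using \<nu> np Rrim cR dn by blast
 thus False using core unfolding is_core_def by blast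
qed

lemma core_maya_closed:
 assumes "is_core p \<nu>" "p \<ge> 1" "d \<in> maya \<nu>" "d' \<le> d" "d' mod int p = d mod int p"
 shows "d' \<in> maya \<nu>"
proof -
 have "d - int n * int p \<in> maya \<nu>" for n
 proof (induction n)
  case (Suc n)
  have "d - int n * int p - int p \<in> maya \<nu>" by (rule core_maya[OF assms(1,2) Suc])
  thus ?case by (simp add: algebra_simps)
 qed (use assms in simp)
 moreover obtain n where "d - d' = int p * n" using assms(5) by (metis dvdE mod_eq_dvd_iff)
 moreover have "n \<ge> 0" using calculation(2) assms(2,4) by (metis diff_ge_0_iff_ge mult_le_0_iff not_le of_nat_0_le_iff order.strict_iff_order of_nat_0_less_iff less_le_trans zero_less_one mult_pos_neg)
 ultimately show ?thesis using assms by (metis add_diff_cancel_left' diff_add_cancel mult.commute nonneg_int_cases diff_diff_eq2)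
qed

text \<open>On each runner the beads of a core form a down-closed set, which is determined by the
  number of beads above a common cut-off.\<close>

lemma core_charge_unique:
 assumes p: "p \<ge> 2" and c: "is_core p \<nu>" "is_core p \<nu>'" and ch: "\<And>k. charge p \<nu> k = charge p \<nu>' k"
 shows "\<nu> = \<nu>'"
proof -
 have sub: "maya \<mu> \<subseteq> maya \<mu>'" if h: "is_core p \<mu>" "is_core p \<mu>'" "\<And>k. charge p \<mu> k = charge p \<mu>' k" for \<mu> \<mu>'
 proof (rule subsetI, rule ccontr)
  fix d assume d: "d \<in> maya \<mu>" "d \<notin> maya \<mu>'"
  have pt: "is_partition \<mu>" "is_partition \<mu>'" using h unfolding is_core_def by auto
  define K where "K = partition_size \<mu> + partition_size \<mu>' + nat (- d)"
  have K: "partition_size \<mu> \<le> p * K" "partition_size \<mu>' \<le> p * K" "- int (p * K) \<le> d"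
  proof -
   have "K \<le> p * K" using p by simp
   thus "partition_size \<mu> \<le> p * K" "partition_size \<mu>' \<le> p * K" "- int (p * K) \<le> d"
    unfolding K_def by linarith+
  qed
  have "beads p K (maya \<mu>') d \<subset> beads p K (maya \<mu>) d"
  proof
   show "beads p K (maya \<mu>') d \<subseteq> beads p K (maya \<mu>) d"
   proof
    fix b assume b: "b \<in> beads p K (maya \<mu>') d"
    have "b < d"
    proof (rule ccontr)
     assume "\<not> b < d"
     hence "d \<in> maya \<mu>'" using core_maya_closed[OF h(2), of b d] b p by (simp add: beads_def)
     thus False using d(2) by simp
    qed
    hence "b \<in> maya \<mu>" using core_maya_closed[OF h(1), of d b] b p d(1) by (simp add: beads_def)
    thus "b \<in> beads p K (maya \<mu>) d" using b by (simp add: beads_def)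
   qed
   show "beads p K (maya \<mu>') d \<noteq> beads p K (maya \<mu>) d"
   proof
    assume e: "beads p K (maya \<mu>') d = beads p K (maya \<mu>) d"
    have "d \<in> beads p K (maya \<mu>) d" using d(1) K(3) by (simp add: beads_def)
    hence "d \<in> beads p K (maya \<mu>') d" unfolding e .
    thus False using d(2) by (simp add: beads_def)
   qed
  qed
  hence "card (beads p K (maya \<mu>') d) < card (beads p K (maya \<mu>) d)"
   by (rule psubset_card_mono[OF finite_beads[OF pt(1)]])
  thus False
   using card_beads[OF p pt(1) K(1), of d] card_beads[OF p pt(2) K(2), of d] h(3)[of d] by linarith
 qed
 have "maya \<nu> = maya \<nu>'" using sub[OF c(1,2) ch] sub[OF c(2,1) ch[symmetric]] by blast
 thus ?thesis using maya_inj c unfolding is_core_def by blast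
qed

lemma charge_of_res_shift: assumes "res_count p \<nu> = res_count p \<nu>' + mset_set {0..<int p}" "p \<ge> 1"
 shows "charge p \<nu> k = charge p \<nu>' k" using assms(2) unfolding charge_def assms(1) by simp

text \<open>This justifies the description operator in \<open>core\<close>: hook removal terminates
  because the size drops, and it preserves charges, so all cores reachable from one partition
  coincide.\<close>

lemma core_properties: assumes p: "p \<ge> 2" and \<nu>: "is_partition \<nu>"
 shows "is_core p (core p \<nu>)" "charge p (core p \<nu>) k = charge p \<nu> k"
proof -
 let ?R = "remove_rim_hook p"
 have ex: "\<exists>\<gamma>. ?R\<^sup>*\<^sup>* \<nu> \<gamma> \<and> is_core p \<gamma>" using \<nu>
 proof (induction "partition_size \<nu>" arbitrary: \<nu> rule: less_induct)
  case less
  show ?case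
  proof (cases "is_core p \<nu>")
   case True thus ?thesis by blast
  next
   case False
   then obtain \<nu>' where n: "?R \<nu> \<nu>'" using less.prems unfolding is_core_def by blast
   hence pt: "is_partition \<nu>'" unfolding remove_rim_hook_def by blast
   have "size (res_count p \<nu>) = size (res_count p \<nu>') + p" using rim_hook_res[OF n] p by simp
   hence "partition_size \<nu>' < partition_size \<nu>" using p by (simp add: res_count_def partition_size_def)
   from less.hyps[OF this pt] obtain \<gamma> where "?R\<^sup>*\<^sup>* \<nu>' \<gamma>" "is_core p \<gamma>" by blast
   thus ?thesis using n by (meson converse_rtranclp_into_rtranclp)
  qed
 qed
 have ch: "charge p \<gamma> k = charge p \<nu> k" if "?R\<^sup>*\<^sup>* \<nu> \<gamma>" for \<gamma> k using that
 proof (induction rule: rtranclp_induct)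
  case (step \<kappa> \<gamma>)
  thus ?case using charge_of_res_shift[OF rim_hook_res[OF step.hyps(2)]] p by simp
 qed simp
 have "\<exists>!\<gamma>. ?R\<^sup>*\<^sup>* \<nu> \<gamma> \<and> is_core p \<gamma>" using ex core_charge_unique[OF p] ch by metis
 hence "?R\<^sup>*\<^sup>* \<nu> (core p \<nu>) \<and> is_core p (core p \<nu>)" unfolding core_def by (rule theI')
 thus "is_core p (core p \<nu>)" "charge p (core p \<nu>) k = charge p \<nu> k" using ch by blast+
qed

theorem core_eq_iff: assumes p: "p \<ge> 2" and \<nu>: "is_partition \<nu>" "is_partition \<nu>'"
 shows "core p \<nu> = core p \<nu>' \<longleftrightarrow> (\<forall>k. charge p \<nu> k = charge p \<nu>' k)"
 using core_properties[OF p \<nu>(1)] core_properties[OF p \<nu>(2)] core_charge_unique[OF p] by metis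

corollary core_eq_iff_res:
 assumes p: "p \<ge> 2" and \<nu>: "is_partition \<nu>" "is_partition \<nu>'" "partition_size \<nu> = partition_size \<nu>'"
 shows "core p \<nu> = core p \<nu>' \<longleftrightarrow> res_count p \<nu> = res_count p \<nu>'"
proof
 assume "core p \<nu> = core p \<nu>'"
 thus "res_count p \<nu> = res_count p \<nu>'"
  using core_eq_iff[OF p \<nu>(1,2)] charge_size_eq[of p \<nu> \<nu>'] \<nu> p by auto
next
 assume "res_count p \<nu> = res_count p \<nu>'"
 thus "core p \<nu> = core p \<nu>'" using core_eq_iff[OF p \<nu>(1,2)] by (simp add: charge_def)
qed

lemma full_word_iff: "distinct w \<and> set w = {0..<int p} \<longleftrightarrow> mset w = mset_set {0..<int p}"
proof
 assume "distinct w \<and> set w = {0..<int p}"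
 thus "mset w = mset_set {0..<int p}" by (metis mset_set_set)
next
 assume m: "mset w = mset_set {0..<int p}"
 hence "set_mset (mset w) = set_mset (mset_set {0..<int p})" by (rule arg_cong)
 hence s: "set w = {0..<int p}" by simp
 have "size (mset w) = size (mset_set {0..<int p})" using m by (rule arg_cong)
 hence "length w = card (set w)" by (simp add: s)
 thus "distinct w \<and> set w = {0..<int p}" using s card_distinct by metis
qed

text \<open>The order of the runners is determined by the residue count of the inner shape. So the
  word in which only the lowest runner follows its cyclic predecessor is the same for both inner
  shapes, and it is reached by \<open>connect\<close> from either side; the passage between the
  inner shapes happens at this common word.\<close>

theorem belt_link: fixes A :: "(nat \<Rightarrow> nat) \<Rightarrow> (nat \<Rightarrow> nat) \<Rightarrow> bool" assumes p: "p \<ge> 2"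
  and A: "\<And>lam cs mu lam' cs' mu'. box_path lam cs mu ==> box_path lam' cs' mu' ==>
   residues p cs = residues p cs' ==> mset (residues p cs) = mset_set {0..<int p} ==>
   res_count p lam = res_count p lam' ==> A lam mu ==> A lam' mu'"
  and 1: "box_path lam1 cs1 mu1" "mset (residues p cs1) = mset_set {0..<int p}"
  and 2: "box_path lam2 cs2 mu2" "mset (residues p cs2) = mset_set {0..<int p}"
  and r: "res_count p lam1 = res_count p lam2" and A1: "A lam1 mu1" shows "A lam2 mu2"
proof -
 have pt: "is_partition lam1" "is_partition lam2" using 1(1) 2(1) box_path_partition by blast+
 interpret o1: ordered_runners "int p" "maya lam1" "runner_pos p lam1"
  by (rule maya_ordered_runners[OF p pt(1)])
 interpret o2: ordered_runners "int p" "maya lam2" "runner_pos p lam2"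
  by (rule maya_ordered_runners[OF p pt(2)])
 let ?q = "runner_pos p lam1"
 have q: "runner_pos p lam2 = ?q" by (rule ext) (simp add: runner_pos_def charge_def r)
 have "Min (?q ` {0..<int p}) \<in> ?q ` {0..<int p}" using p by (intro Min_in) auto
 then obtain s where s: "s \<in> {0..<int p}" "?q s = Min (?q ` {0..<int p})" by auto
 have mn: "?q s < ?q t" if "t mod int p \<noteq> s mod int p" for t
 proof -
  have "t mod int p \<in> {0..<int p}" using p by simp
  hence "?q s \<le> ?q (t mod int p)" unfolding s(2) by (intro Min_le) auto
  hence "?q s \<le> ?q t" using o1.q_periodic[of t] by simp
  moreover have "?q s \<noteq> ?q t" using o1.q_inj[of s t] that by metis
  ultimately show ?thesis by simp
 qed
 have mn2: "runner_pos p lam2 s < runner_pos p lam2 t" if "t mod int p \<noteq> s mod int p" for t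
  unfolding q by (rule mn[OF that])
 let ?P = "\<lambda>k. k mod int p = s mod int p"
 have p': "int p \<ge> 2" using p by simp
 obtain ks where ks: "distinct ks" "set ks = {0..<int p}"
  "\<And>k. k mod int p = s mod int p \<longleftrightarrow> precedes ks ((k - 1) mod int p) (k mod int p)"
 proof (rule linear_extension[OF p', of ?P "s + 1" s])
  show "(k mod int p mod int p = s mod int p) = (k mod int p = s mod int p)" for k by simp
  show "(s + 1) mod int p \<noteq> s mod int p" by (rule succ_mod_neq[OF p'])
 qed (use that in auto)
 have fw: "o1.full_word w \<longleftrightarrow> mset w = mset_set {0..<int p}" "o2.full_word w \<longleftrightarrow> mset w = mset_set {0..<int p}" for w
  unfolding o1.full_word_def o2.full_word_def using full_word_iff by simp_all
 let ?A1 = "\<lambda>Y. \<forall>\<mu>. maya \<mu> = Y \<and> is_partition \<mu> \<longrightarrow> A lam1 \<mu>"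
 have "\<exists>cs' Y'. maya_path (maya lam1) cs' Y' \<and>
   residues p cs' = map (\<lambda>k. (k + 1) mod int p) ks \<and> ?A1 Y'"
 proof (rule o1.connect[OF _ box_path_maya[OF 1(1)] _ _ mn ks])
  show "o1.full_word (residues p cs1)" using 1(2) fw by simp
  show "?A1 (maya mu1)" using A1 maya_inj box_path_partition[OF 1(1)] by metis
  fix cs cs' Y Y' assume h: "maya_path (maya lam1) cs Y" "maya_path (maya lam1) cs' Y'"
   "residues p cs = residues p cs'" "o1.full_word (residues p cs)" "?A1 Y"
  obtain \<mu> where m: "box_path lam1 cs \<mu>" "Y = maya \<mu>" using maya_box_path[OF pt(1) h(1)] by blast
  obtain \<mu>' where m': "box_path lam1 cs' \<mu>'" "Y' = maya \<mu>'" using maya_box_path[OF pt(1) h(2)] by blast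
  have "A lam1 \<mu>" using h(5) m box_path_partition by blast
  hence "A lam1 \<mu>'" using A[OF m(1) m'(1) h(3)] h(4) fw by blast
  thus "?A1 Y'" using m' maya_inj box_path_partition by metis
 qed
 then obtain c1 Y1 where c1: "maya_path (maya lam1) c1 Y1"
  "residues p c1 = map (\<lambda>k. (k + 1) mod int p) ks" "?A1 Y1" by blast
 obtain \<mu>1 where m1: "box_path lam1 c1 \<mu>1" "Y1 = maya \<mu>1" using maya_box_path[OF pt(1) c1(1)] by blast
 have a1: "A lam1 \<mu>1" using c1(3) m1 box_path_partition by blast
 \<comment> \<open>On the second side the chain has to be traversed backwards. Applying
   \<open>connect\<close> to this implication, which is trivial at mu2, has that effect.\<close>
 let ?A2 = "\<lambda>Y. \<forall>\<mu>. maya \<mu> = Y \<and> is_partition \<mu> \<longrightarrow> A lam2 \<mu> \<longrightarrow> A lam2 mu2"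
 have "\<exists>cs' Y'. maya_path (maya lam2) cs' Y' \<and>
   residues p cs' = map (\<lambda>k. (k + 1) mod int p) ks \<and> ?A2 Y'"
 proof (rule o2.connect[OF _ box_path_maya[OF 2(1)] _ _ mn2 ks])
  show "o2.full_word (residues p cs2)" using 2(2) fw by simp
  show "?A2 (maya mu2)" using maya_inj box_path_partition[OF 2(1)] by metis
  fix cs cs' Y Y' assume h: "maya_path (maya lam2) cs Y" "maya_path (maya lam2) cs' Y'"
   "residues p cs = residues p cs'" "o2.full_word (residues p cs)" "?A2 Y"
  obtain \<mu> where m: "box_path lam2 cs \<mu>" "Y = maya \<mu>" using maya_box_path[OF pt(2) h(1)] by blast
  obtain \<mu>' where m': "box_path lam2 cs' \<mu>'" "Y' = maya \<mu>'" using maya_box_path[OF pt(2) h(2)] by blast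
  have 3: "A lam2 \<mu> \<longrightarrow> A lam2 mu2" using h(5) m box_path_partition by blast
  have "mset (residues p cs') = mset_set {0..<int p}" using h(3,4) fw by simp
  hence "A lam2 \<mu>' \<longrightarrow> A lam2 \<mu>" using A[OF m'(1) m(1) h(3)[symmetric]] by blast
  thus "?A2 Y'" using 3 m' maya_inj box_path_partition by metis
 qed
 then obtain c2 Y2 where c2: "maya_path (maya lam2) c2 Y2"
  "residues p c2 = map (\<lambda>k. (k + 1) mod int p) ks" "?A2 Y2" by blast
 obtain \<mu>2 where m2: "box_path lam2 c2 \<mu>2" "Y2 = maya \<mu>2" using maya_box_path[OF pt(2) c2(1)] by blast
 have "mset (residues p c1) = mset_set {0..<int p}"
 proof -
  have "mset (residues p c1) + res_count p lam1 = mset_set {0..<int p} + res_count p lam1"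
  proof -
   have "inj_on (\<lambda>k. (k + 1) mod int p) {0..<int p}"
   proof (rule inj_onI)
    fix a b assume h: "a \<in> {0..<int p}" "b \<in> {0..<int p}" "(a + 1) mod int p = (b + 1) mod int p"
    hence "a mod int p = b mod int p" using mod_diff_cong[OF h(3) refl, of 1] by simp
    thus "a = b" using h by simp
   qed
   moreover hence "(\<lambda>k. (k + 1) mod int p) ` {0..<int p} = {0..<int p}"
    by (intro endo_inj_surj) (use p in auto)
   ultimately have "distinct (map (\<lambda>k. (k + 1) mod int p) ks) \<and> set (map (\<lambda>k. (k + 1) mod int p) ks) = {0..<int p}"
    using ks(1,2) by (simp add: distinct_map)
   thus ?thesis unfolding c1(2) full_word_iff by simp
  qed
  thus ?thesis by simp
 qed
 hence "A lam2 \<mu>2" using A[OF m1(1) m2(1) _ _ r a1] c1(2) c2(2) by simp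
 thus ?thesis using c2(3) m2 box_path_partition by blast
qed

section \<open>Linking partitions with equal residue counts through removable boxes\<close>

definition hook :: "nat \<Rightarrow> nat \<Rightarrow> nat \<Rightarrow> nat" where
 "hook x y = (\<lambda>i. if i = 0 then Suc x else if i \<le> y then 1 else 0)"

lemma hook_partition: "is_partition (hook x y)" unfolding is_partition_def
proof
 show "antimono (hook x y)" by (intro antimonoI) (auto simp: hook_def)
 show "\<exists>N. \<forall>i\<ge>N. hook x y i = 0" by (rule exI[of _ "Suc y"]) (auto simp: hook_def)
qed

lemma add_boxI:
 assumes "is_partition \<nu>" "is_partition \<nu>'" "\<nu>' = \<nu>(i := Suc (\<nu> i))" "c = int (\<nu> i) - int i"
 shows "add_box \<nu> c \<nu>'" using assms unfolding add_box_def by blast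

lemma add_box_hook: "add_box (hook x y) (int x + 1) (hook (Suc x) y)" "add_box (hook x y) (- int y - 1) (hook x (Suc y))"
proof -
 show "add_box (hook x y) (int x + 1) (hook (Suc x) y)"
  by (rule add_boxI[OF hook_partition hook_partition, of _ _ _ _ 0]) (auto simp: hook_def)
 show "add_box (hook x y) (- int y - 1) (hook x (Suc y))"
  by (rule add_boxI[OF hook_partition hook_partition, of _ _ _ _ "Suc y"]) (auto simp: hook_def)
qed

lemma hook_00: "add_box (\<lambda>_. 0) 0 (hook 0 0)"
 by (rule add_boxI[OF empty_partition(1) hook_partition, of _ _ 0]) (auto simp: hook_def)

lemma hook_res: "res_count p (hook x y) = image_mset (\<lambda>c. c mod int p) (mset_set {- int y..int x})"
 "partition_size (hook x y) = x + y + 1"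
proof -
 have "res_count p (hook x y) = image_mset (\<lambda>c. c mod int p) (mset_set {- int y..int x}) \<and>
  partition_size (hook x y) = x + y + 1"
 proof (induction x)
  case 0
  show ?case
  proof (induction y)
   case 0
   show ?case using add_box_res(1)[OF hook_00, of p] add_box_res(2)[OF hook_00]
    by (simp add: res_count_def empty_partition)
  next
   case (Suc y)
   have "{- int (Suc y)..int 0} = insert (- int y - 1) {- int y..int 0}" by auto
   thus ?case using add_box_res(1)[OF add_box_hook(2)[of 0 y], of p] add_box_res(2)[OF add_box_hook(2)[of 0 y]] Suc
    by simp
  qed
 next
  case (Suc x)
  have "{- int y..int (Suc x)} = insert (int x + 1) {- int y..int x}" by auto
  thus ?case using add_box_res(1)[OF add_box_hook(1)[of x y], of p] add_box_res(2)[OF add_box_hook(1)[of x y]] Suc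
   by simp
 qed
 thus "res_count p (hook x y) = image_mset (\<lambda>c. c mod int p) (mset_set {- int y..int x})"
  "partition_size (hook x y) = x + y + 1" by auto
qed

lemma charge_interval:
 assumes p: "p \<ge> 1" and M: "M = image_mset (\<lambda>c. c mod int p) (mset_set {a..<a + int (w * p)})"
 shows "count M (k mod int p) = w"
proof -
 have "count (image_mset (\<lambda>c. c mod int p) (mset_set {a..<a + int (w * p)})) (k mod int p) = w" for w
 proof (induction w)
  case (Suc w)
  let ?b = "a + int (w * p)"
  have "a + int (Suc w * p) = ?b + int p" by simp
  hence e: "{a..<a + int (Suc w * p)} = {a..<?b} \<union> {?b..<?b + int p}"
   by (simp only:) (rule ivl_disj_un_two(3)[symmetric], simp_all)
  have "mset_set {a..<a + int (Suc w * p)} = mset_set {a..<?b} + mset_set {?b..<?b + int p}"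
   unfolding e by (rule mset_set_Union) auto
  moreover have "count (image_mset (\<lambda>c. c mod int p) (mset_set {?b..<?b + int p})) (k mod int p) = 1"
  proof -
   let ?c = "?b + (k - ?b) mod int p"
   have "{x \<in> {?b..<?b + int p}. x mod int p = k mod int p} = {?c}"
   proof
    show "{?c} \<subseteq> {x \<in> {?b..<?b + int p}. x mod int p = k mod int p}"
    proof -
     have "?c mod int p = k mod int p" by (simp only: mod_add_right_eq) simp
     moreover have "0 \<le> (k - ?b) mod int p" "(k - ?b) mod int p < int p" using p by auto
     ultimately show ?thesis by simp
    qed
    show "{x \<in> {?b..<?b + int p}. x mod int p = k mod int p} \<subseteq> {?c}"
    proof
     fix x assume "x \<in> {x \<in> {?b..<?b + int p}. x mod int p = k mod int p}"
     hence x: "?b \<le> x" "x < ?b + int p" "x mod int p = k mod int p" by auto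
     have "(x - ?b) mod int p = (k - ?b) mod int p" by (rule mod_diff_cong[OF x(3) refl])
     moreover have "(x - ?b) mod int p = x - ?b" using x(1,2) by (intro mod_pos_pos_trivial) auto
     ultimately show "x \<in> {?c}" by simp
    qed
   qed
   hence e2: "(\<lambda>c. c mod int p) -` {k mod int p} \<inter> {?b..<?b + int p} = {?c}" by blast
   hence "?c \<in> {?b..<?b + int p}" by blast
   thus ?thesis unfolding count_image_mset using e2 by simp
  qed
  ultimately show ?case using Suc by simp
 qed simp
 thus ?thesis using M by simp
qed

lemma maya_remove_box: assumes \<nu>: "is_partition \<nu>" and c: "c \<in> maya \<nu>" "c - 1 \<notin> maya \<nu>"
 obtains \<kappa> where "add_box \<kappa> c \<nu>"
proof -
 obtain i where i: "c = int (\<nu> i) - int i - 1" using c(1) unfolding maya_def by blast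
 have lt: "\<nu> (Suc i) < \<nu> i"
 proof (rule ccontr)
  assume "\<not> \<nu> (Suc i) < \<nu> i"
  hence "\<nu> (Suc i) = \<nu> i" using partition_antimono[OF \<nu>, of i "Suc i"] by simp
  hence "c - 1 = int (\<nu> (Suc i)) - int (Suc i) - 1" using i by simp
  thus False using c(2) unfolding maya_def by blast
 qed
 let ?k = "\<nu>(i := \<nu> i - 1)"
 have "antimono ?k"
 proof (rule antimonoI)
  fix x y :: nat assume xy: "x \<le> y"
  show "?k y \<le> ?k x"
  proof (cases "x = i \<and> y \<noteq> i")
   case True
   thus ?thesis using partition_antimono[OF \<nu>, of "Suc i" y] xy lt by auto
  next
   case False
   thus ?thesis using partition_antimono[OF \<nu> xy] by auto
  qed
 qed
 moreover have "\<exists>N. \<forall>j\<ge>N. ?k j = 0" using \<nu> unfolding is_partition_def by (metis diff_0_eq_0 fun_upd_apply)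
 ultimately have "is_partition ?k" unfolding is_partition_def by blast
 hence "add_box ?k c \<nu>" by (rule add_boxI[OF _ \<nu>, of _ i]) (use lt i in auto)
 thus ?thesis using that by blast
qed

lemma box_path_last: assumes "is_partition \<nu>" "partition_size \<nu> \<ge> 1"
 obtains \<kappa> c where "add_box \<kappa> c \<nu>"
proof -
 obtain cs where cs: "box_path (\<lambda>_. 0) cs \<nu>" using box_path_from_empty[OF assms(1)] .
 have "cs \<noteq> []" using cs assms(2) empty_partition(3) by auto
 then obtain as c where "cs = as @ [c]" by (metis rev_exhaust)
 thus ?thesis using cs that by (auto simp: box_path_append)
qed

lemma charge_sum_zero: "p \<ge> 1 ==> (\<Sum>k\<in>{0..<int p}. charge p \<nu> k) = 0"
proof -
 assume p: "p \<ge> 1"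
 let ?f = "\<lambda>k. int (count (res_count p \<nu>) (k mod int p))"
 have inj: "inj_on (\<lambda>k. (k + 1) mod int p) {0..<int p}"
 proof (rule inj_onI)
  fix a b assume h: "a \<in> {0..<int p}" "b \<in> {0..<int p}" "(a + 1) mod int p = (b + 1) mod int p"
  hence "a mod int p = b mod int p" using mod_diff_cong[OF h(3) refl, of 1] by simp
  thus "a = b" using h by simp
 qed
 have im: "(\<lambda>k. (k + 1) mod int p) ` {0..<int p} = {0..<int p}"
  by (rule endo_inj_surj[OF _ _ inj]) (use p in auto)
 have "(\<Sum>k\<in>{0..<int p}. ?f (k + 1)) = (\<Sum>k\<in>{0..<int p}. ?f ((k + 1) mod int p))" by simp
 also have "\<dots> = (\<Sum>k\<in>(\<lambda>k. (k + 1) mod int p) ` {0..<int p}. ?f k)" by (simp add: sum.reindex[OF inj])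
 finally have "(\<Sum>k\<in>{0..<int p}. ?f (k + 1)) = (\<Sum>k\<in>{0..<int p}. ?f k)" unfolding im .
 thus ?thesis by (simp add: charge_def sum_subtractf)
qed

text \<open>If no gap jumps in this way, the charges weakly decrease along 0, ..., p - 1 and their
  total drop is at most one. As they sum to zero, they all vanish.\<close>

lemma removable_or_neutral: assumes p: "p \<ge> 2"
 shows "(\<exists>c. runner_pos p \<nu> (c - 1) + 1 < runner_pos p \<nu> c) \<or> (\<forall>k. charge p \<nu> k = 0)"
proof (rule disjCI)
 assume no: "\<not> (\<forall>k. charge p \<nu> k = 0)"
 show "\<exists>c. runner_pos p \<nu> (c - 1) + 1 < runner_pos p \<nu> c"
 proof (rule ccontr)
  assume "\<not> ?thesis"
  hence le: "runner_pos p \<nu> c \<le> runner_pos p \<nu> (c - 1) + 1" for c by (metis not_less)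
  let ?h = "charge p \<nu>" let ?l = "int p - 1"
  have st: "?h (int k) \<le> ?h (int k - 1)" if "1 \<le> k" "k < p" for k
  proof -
   have "int k mod int p = int k" "(int k - 1) mod int p = int k - 1" using that by auto
   hence "int p * ?h (int k) \<le> int p * ?h (int k - 1)" using le[of "int k"] by (simp add: runner_pos_def)
   thus ?thesis using p by simp
  qed
  have z: "?h 0 \<le> ?h ?l + 1"
  proof -
   have "(0 - 1) mod int p = ?l" using p by (simp add: zmod_minus1)
   moreover have "?h (0 - 1) = ?h ?l" using charge_periodic[of p \<nu> "0 - 1"] calculation by simp
   ultimately have "int p * ?h 0 \<le> int p * (?h ?l + 1)" using le[of 0] by (simp add: runner_pos_def algebra_simps)
   thus ?thesis using p by (simp add: mult_le_cancel_left)
  qed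
  have anti: "?h (int j) \<le> ?h (int i)" if "i \<le> j" "j < p" for i j using that
  proof (induction j rule: dec_induct)
   case (step j)
   have "?h (int (Suc j)) \<le> ?h (int (Suc j) - 1)" by (rule st) (use step in auto)
   also have "int (Suc j) - 1 = int j" by simp
   finally show ?case using step by simp
  qed simp
  have bd: "?h ?l \<le> ?h k \<and> ?h k \<le> ?h ?l + 1" if "k \<in> {0..<int p}" for k
  proof -
   have "?h (int (p - 1)) \<le> ?h (int (nat k))" "?h (int (nat k)) \<le> ?h (int 0)"
    by (rule anti; use that p in auto)+
   thus ?thesis using z that p by (simp add: of_nat_diff)
  qed
  let ?d = "\<lambda>k. ?h k - ?h ?l"
  have "(\<Sum>k\<in>{0..<int p}. ?d k) = - (int p * ?h ?l)"
   using charge_sum_zero[of p \<nu>] p by (simp add: sum_subtractf)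
  moreover have "0 \<le> (\<Sum>k\<in>{0..<int p}. ?d k)" by (rule sum_nonneg) (use bd in fastforce)
  moreover have "(\<Sum>k\<in>{0..<int p}. ?d k) < int p"
  proof -
   have "(\<Sum>k\<in>{0..<int p}. ?d k) = ?d ?l + (\<Sum>k\<in>{0..<int p} - {?l}. ?d k)"
    using p by (intro sum.remove) auto
   also have "\<dots> = (\<Sum>k\<in>{0..<int p} - {?l}. ?d k)" by simp
   also have "\<dots> \<le> (\<Sum>k\<in>{0..<int p} - {?l}. 1)"
   proof (rule sum_mono)
    fix k assume "k \<in> {0..<int p} - {?l}"
    hence "k \<in> {0..<int p}" by blast
    thus "?d k \<le> 1" using bd[of k] by linarith
   qed
   also have "\<dots> < int p" using p by (simp add: card_Diff_singleton_if)
   finally show ?thesis .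
  qed
  ultimately have h: "0 \<le> int p * (- ?h ?l)" "int p * (- ?h ?l) < int p * 1" by simp_all
  have "- ?h ?l < 1" using h(2) p by (simp only: mult_less_cancel_left)
  moreover have "0 \<le> - ?h ?l" using h(1) p by (simp add: zero_le_mult_iff mult_le_0_iff)
  ultimately have l0: "?h ?l = 0" by linarith
  hence "(\<Sum>k\<in>{0..<int p}. ?h k) = 0 \<longleftrightarrow> (\<forall>k\<in>{0..<int p}. ?h k = 0)"
   using bd by (intro sum_nonneg_eq_0_iff) auto
  hence "\<forall>k\<in>{0..<int p}. ?h k = 0" using charge_sum_zero[of p \<nu>] p by simp
  hence "?h k = 0" for k using charge_periodic[of p \<nu> k] p by (metis atLeastLessThan_iff of_nat_0_less_iff order_less_le_trans pos2 pos_mod_bound pos_mod_sign)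
  thus False using no by blast
 qed
qed

text \<open>A jump between neighbouring gaps depends only on the residue count and gives both
  partitions a removable box of the same residue. Otherwise all charges vanish; then the hooks of
  the given size have the same residue count, they are linked to each other, and every partition is
  linked to a hook.\<close>

theorem nakayama_link: fixes A :: "(nat \<Rightarrow> nat) \<Rightarrow> bool" assumes p: "p \<ge> 2"
  and A: "\<And>\<nu> c lam \<nu>' c' lam'. add_box \<nu> c lam ==> add_box \<nu>' c' lam' ==> c mod int p = c' mod int p ==>
   res_count p lam = res_count p lam' ==> A lam ==> A lam'"
  and pt: "is_partition lam1" "is_partition lam2" and r: "res_count p lam1 = res_count p lam2"
  and sz: "partition_size lam1 \<ge> 1" and A1: "A lam1" shows "A lam2"
proof -
 have ch: "charge p lam2 = charge p lam1" by (rule ext) (simp add: charge_def r)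
 hence q: "runner_pos p lam2 = runner_pos p lam1" by (intro ext) (simp add: runner_pos_def)
 have "size (res_count p lam1) = size (res_count p lam2)" by (simp add: r)
 hence sz2: "partition_size lam2 = partition_size lam1" by (simp add: res_count_def partition_size_def)
 consider c where "runner_pos p lam1 (c - 1) + 1 < runner_pos p lam1 c" | "\<forall>k. charge p lam1 k = 0"
  using removable_or_neutral[OF p] by blast
 thus ?thesis
 proof cases
  case 1
  obtain b where b: "b \<in> maya lam1" "b mod int p = c mod int p" "b - 1 \<notin> maya lam1"
   using runner_left[OF p pt(1) 1] by blast
  have "runner_pos p lam2 (c - 1) + 1 < runner_pos p lam2 c" using 1 by (simp only: q)
  from runner_left[OF p pt(2) this]
  obtain b' where b': "b' \<in> maya lam2" "b' mod int p = c mod int p" "b' - 1 \<notin> maya lam2" by blast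
  obtain \<kappa> where k: "add_box \<kappa> b lam1" using maya_remove_box[OF pt(1) b(1,3)] .
  obtain \<kappa>' where k': "add_box \<kappa>' b' lam2" using maya_remove_box[OF pt(2) b'(1,3)] .
  show ?thesis by (rule A[OF k k' _ r A1]) (simp only: b(2) b'(2))
 next
  case 2
  define n where "n = partition_size lam1"
  define w where "w = count (res_count p lam1) 0"
  have step: "count (res_count p lam1) (k mod int p) = count (res_count p lam1) ((k + 1) mod int p)" for k
   using 2[rule_format, of k] unfolding charge_def by (metis eq_iff_diff_eq_0 of_nat_eq_iff)
  have cw: "count (res_count p lam1) (int k mod int p) = w" for k
  proof (induction k)
   case (Suc k)
   have "int (Suc k) = int k + 1" by simp
   thus ?case using step[of "int k"] Suc by metis
  qed (simp add: w_def)
  have sub: "set_mset (res_count p lam1) \<subseteq> {0..<int p}" using p by (auto simp: res_count_def residue_def)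
  have "n = size (res_count p lam1)" by (simp add: n_def res_count_def partition_size_def)
  also have "\<dots> = (\<Sum>k\<in>set_mset (res_count p lam1). count (res_count p lam1) k)"
   by (rule size_multiset_overloaded_eq)
  also have "\<dots> = (\<Sum>k\<in>{0..<int p}. count (res_count p lam1) k)"
   by (rule sum.mono_neutral_left) (use sub in \<open>auto simp: not_in_iff\<close>)
  also have "\<dots> = (\<Sum>k\<in>{0..<int p}. w)"
  proof (rule sum.cong[OF refl])
   fix k assume "k \<in> {0..<int p}"
   thus "count (res_count p lam1) k = w" using cw[of "nat k"] by simp
  qed
  finally have n: "n = w * p" by simp
  have w1: "w \<ge> 1" using sz n by (cases w) (auto simp: n_def)
  have np: "n \<ge> p" using n w1 by simp
  \<comment> \<open>All hooks of size n, indexed by the arm length. Their contents form an interval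
    of length w p, so every residue occurs w times.\<close>
  define H where "H = (\<lambda>x. hook x (n - 1 - x))"
  have Hres: "res_count p (H x) = res_count p lam1" if "x < n" for x
  proof (rule charge_size_eq)
   show "p \<ge> 1" using p by simp
   have e: "{- int (n - 1 - x)..int x} = {- int (n - 1 - x)..<- int (n - 1 - x) + int (w * p)}"
    using that unfolding n[symmetric] by auto
   have "res_count p (H x) = image_mset (\<lambda>c. c mod int p)
     (mset_set {- int (n - 1 - x)..<- int (n - 1 - x) + int (w * p)})"
    unfolding H_def hook_res(1) e ..
   hence "count (res_count p (H x)) (k mod int p) = w" for k
    by (rule charge_interval[rotated]) (use p in simp)
   hence "charge p (H x) k = 0" for k by (simp add: charge_def)
   thus "charge p (H x) k = charge p lam1 k" for k using 2 by simp
   show "partition_size (H x) = partition_size lam1"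
    using that by (simp add: H_def hook_res(2) n_def)
   show "is_partition (H x)" by (simp add: H_def hook_partition)
   show "is_partition lam1" by (rule pt)
  qed
  have Hstep: "\<exists>\<nu> c c'. add_box \<nu> c (H x) \<and> add_box \<nu> c' (H (Suc x)) \<and> c mod int p = c' mod int p"
   if "Suc x < n" for x
  proof -
   let ?y = "n - 1 - Suc x"
   have y: "n - 1 - x = Suc ?y" using that by simp
   \<comment> \<open>Two consecutive hooks arise from one smaller hook by lengthening the arm or the
     leg. The contents of these two boxes differ by n = w p, so their residues agree.\<close>
   have "int x + 1 = (- int ?y - 1) + int p * int w" using that n by (simp add: of_nat_diff algebra_simps)
   hence "(int x + 1) mod int p = (- int ?y - 1) mod int p" by (simp only: mod_mult_self2)
   thus ?thesis using add_box_hook[of x ?y] unfolding H_def y by metis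
  qed
  have Hall: "A (H x) \<longleftrightarrow> A (H 0)" if "x < n" for x using that
  proof (induction x)
   case (Suc x)
   obtain \<nu> c c' where h: "add_box \<nu> c (H x)" "add_box \<nu> c' (H (Suc x))" "c mod int p = c' mod int p"
    using Hstep[OF Suc.prems] by blast
   have e: "res_count p (H x) = res_count p (H (Suc x))" using Hres Suc.prems by simp
   have "A (H x) \<longleftrightarrow> A (H (Suc x))" using A[OF h e] A[OF h(2,1) h(3)[symmetric] e[symmetric]] by blast
   thus ?case using Suc by simp
  qed simp
  have link: "A lam \<longleftrightarrow> A (H 0)" if lam: "is_partition lam" "res_count p lam = res_count p lam1" for lam
  proof -
   have szl: "partition_size lam = n"
    using arg_cong[OF lam(2), of size] by (simp add: n_def res_count_def partition_size_def)
   have "partition_size lam \<ge> 1" using szl np p by simp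
   then obtain \<kappa> c where k: "add_box \<kappa> c lam" using box_path_last[OF lam(1)] by blast
   \<comment> \<open>An arm length between 1 and p with the residue of the removable box of
     \<open>lam\<close>. For residue 0 it is p instead of 0, since the last box of the arm can be
     removed only from a nonempty arm.\<close>
   define i where "i = (if c mod int p = 0 then p else nat (c mod int p))"
   have cb: "0 \<le> c mod int p" "c mod int p < int p" using p by auto
   have "c mod int p = 0 \<or> 0 < c mod int p" using cb by linarith
   hence i: "1 \<le> i" "int i mod int p = c mod int p" using p by (auto simp: i_def)
   have "i < n"
   proof (cases "c mod int p = 0")
    case False
    thus ?thesis using cb np by (simp add: i_def nat_less_iff)
   next
    case True
    \<comment> \<open>For w = 1 the corner node would be the only node of residue 0; it remains
      after the removal, so the removed box cannot have that residue.\<close>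
    have "w \<noteq> 1"
    proof
     assume w: "w = 1"
     have "count (res_count p lam) 0 = 1" using lam(2) w by (simp add: w_def)
     hence c0: "count (res_count p \<kappa>) 0 = 0" using add_box_res(1)[OF k, of p] True by simp
     have sk: "partition_size \<kappa> \<ge> 1" using add_box_res(2)[OF k] szl np p by simp
     have pk: "is_partition \<kappa>" using k by (simp add: add_box_def)
     have "\<kappa> \<noteq> (\<lambda>_. 0)" using sk empty_partition(3) by auto
     then obtain j where "\<kappa> j \<noteq> 0" by auto
     hence "\<kappa> 0 > 0" using partition_antimono[OF pk, of 0 j] by simp
     hence "(0, 0) \<in> diagram \<kappa>" by (simp add: diagram_def)
     hence "residue p (0, 0) \<in># res_count p \<kappa>"
      unfolding res_count_def using finite_diagram[OF pk] by simp
     thus False using c0 by (simp add: residue_def count_eq_zero_iff)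
    qed
    hence "w \<ge> 2" using w1 by simp
    hence "2 * p \<le> n" unfolding n by (rule mult_le_mono1)
    thus ?thesis using True p by (simp add: i_def)
   qed
   then obtain x where x: "i = Suc x" using i(1) by (cases i) auto
   have a: "add_box (hook x (n - 1 - i)) (int x + 1) (H i)" unfolding H_def x by (rule add_box_hook(1))
   have cc: "c mod int p = (int x + 1) mod int p" using i(2) x by (simp add: add.commute)
   have e: "res_count p lam = res_count p (H i)" using lam(2) Hres[OF \<open>i < n\<close>] by simp
   have "A lam \<longleftrightarrow> A (H i)" using A[OF k a cc e] A[OF a k cc[symmetric] e[symmetric]] by blast
   thus ?thesis using Hall[OF \<open>i < n\<close>] by simp
  qed
  show ?thesis using link[OF pt(1) refl] link[OF pt(2) r[symmetric]] A1 by blast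
 qed
qed

section \<open>Centralisers in group algebras of symmetric groups\<close>

text \<open>Permutations are written additively because multiplication of finitely supported
  functions is convolution over an additive monoid: \<open>nperm \<Rightarrow>\<^sub>0 'r\<close> is
  then the group ring as an instance of the ring classes. Bijections of all natural numbers put
  every symmetric group into one type.\<close>

typedef nperm = "{f :: nat \<Rightarrow> nat. bij f}" morphisms nfun Nperm by (rule exI[of _ id]) simp

setup_lifting type_definition_nperm

instantiation nperm :: group_add begin
lift_definition zero_nperm :: nperm is id by simp
lift_definition plus_nperm :: "nperm \<Rightarrow> nperm \<Rightarrow> nperm" is "(\<circ>)" by (simp add: bij_comp)
lift_definition uminus_nperm :: "nperm \<Rightarrow> nperm" is "inv_into UNIV" by (simp add: bij_imp_bij_inv)
definition minus_nperm :: "nperm \<Rightarrow> nperm \<Rightarrow> nperm" where "minus_nperm a b = a + - b"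
instance
proof
 fix a b c :: nperm
 show "a + b + c = a + (b + c)" by transfer (simp add: comp_assoc)
 show "0 + a = a" "a + 0 = a" by (transfer; simp)+
 show "- a + a = 0" by transfer (simp add: bij_is_inj)
 show "a + - b = a - b" by (simp add: minus_nperm_def)
qed
end

lemma nfun_add [simp]: "nfun (g + h) = nfun g \<circ> nfun h" by transfer simp
lemma nfun_0 [simp]: "nfun 0 = id" by transfer simp
lemma nfun_bij [simp]: "bij (nfun g)" using nfun by simp
lemma nfun_inj [simp]: "nfun g i = nfun g j \<longleftrightarrow> i = j" using nfun_bij by (metis bij_pointE)
lemma nfun_minus_left [simp]: "nfun (- g) (nfun g i) = i" by transfer (simp add: bij_is_inj)
lemma nfun_minus_right [simp]: "nfun g (nfun (- g) i) = i"
 by transfer (simp add: bij_is_surj surj_f_inv_f)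
lemma nperm_eqI: "(\<And>i. nfun g i = nfun h i) ==> g = h" by transfer auto
lemma nfun_Nperm [simp]: "bij f ==> nfun (Nperm f) = f" by (simp add: Nperm_inverse)

definition tr :: "nat \<Rightarrow> nat \<Rightarrow> nperm" where "tr i j = Nperm (transpose i j)"

lemma nfun_tr [simp]: "nfun (tr i j) = transpose i j" by (simp add: tr_def)

lemma tr_self [simp]: "tr i i = 0" by (rule nperm_eqI) simp
lemma tr_tr [simp]: "tr i j + tr i j = 0" by (rule nperm_eqI) simp
lemma minus_tr [simp]: "- tr i j = tr i j" by (metis eq_neg_iff_add_eq_0 tr_tr)
lemma tr_commute: "tr i j = tr j i" by (rule nperm_eqI) (simp add: transpose_commute)

lemma conj_tr: "g + tr i j = tr (nfun g i) (nfun g j) + g"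
 by (rule nperm_eqI) (auto simp: transpose_def)

definition syms :: "nat \<Rightarrow> nperm set" where
 "syms n = {g. nfun g permutes {1..n}}"

lemma syms_0 [simp]: "0 \<in> syms n" by (simp add: syms_def permutes_id)
lemma syms_add [simp]: "g \<in> syms n ==> h \<in> syms n ==> g + h \<in> syms n"
 by (simp add: syms_def permutes_compose)
lemma nfun_minus: "nfun (- g) = inv_into UNIV (nfun g)" by transfer simp
lemma syms_minus [simp]: "g \<in> syms n ==> - g \<in> syms n" by (simp add: syms_def nfun_minus permutes_inv)
lemma syms_mono: "m \<le> n ==> syms m \<subseteq> syms n" unfolding syms_def by (auto intro: permutes_subset)
lemma tr_syms [simp]: "i \<in> {1..n} ==> j \<in> {1..n} ==> tr i j \<in> syms n"
 by (simp add: syms_def permutes_swap_id)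
lemma syms_in: "g \<in> syms n ==> nfun g i \<in> {1..n} \<longleftrightarrow> i \<in> {1..n}"
 unfolding syms_def mem_Collect_eq by (rule permutes_in_image)
lemma syms_out: "g \<in> syms n ==> i \<notin> {1..n} ==> nfun g i = i"
 unfolding syms_def by (simp add: permutes_not_in)

lemma finite_syms [simp]: "finite (syms n)"
proof -
 have "nfun ` syms n \<subseteq> {f. f permutes {1..n}}" by (auto simp: syms_def)
 hence "finite (nfun ` syms n)" by (rule finite_subset) (simp add: finite_permutations)
 moreover have "inj_on nfun (syms n)" by (simp add: inj_on_def nfun_inject)
 ultimately show ?thesis using finite_imageD by blast
qed

text \<open>Conjugation by adjacent transpositions yields all transpositions of the interval, and
  these yield all its permutations.\<close>

lemma adjacent_generate: assumes g: "nfun g permutes {a..b}"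
  and P0: "P 0" and Ps: "\<And>i. a \<le> i ==> i < b ==> P (tr i (Suc i))" and Pa: "\<And>g h. P g ==> P h ==> P (g + h)"
 shows "P g"
proof -
 have Pt: "P (tr i (i + d))" if "a \<le> i" "i + d \<le> b" for i d using that
 proof (induction d)
  case 0 thus ?case using P0 by simp
 next
  case (Suc d)
  show ?case
  proof (cases "d = 0")
   case True thus ?thesis using Ps[of i] Suc.prems by simp
  next
   case False
   let ?s = "tr (i + d) (Suc (i + d))"
   have "?s + tr i (i + d) = tr i (i + Suc d) + ?s"
    using conj_tr[of ?s i "i + d"] False by (simp add: transpose_def)
   hence "tr i (i + Suc d) = ?s + tr i (i + d) + ?s" by (metis add.assoc add.right_neutral tr_tr)
   moreover have "P (?s + tr i (i + d) + ?s)" using Suc Ps[of "i + d"] Pa by auto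
   ultimately show ?thesis by metis
  qed
 qed
 have Pt': "P (tr i j)" if "i \<in> {a..b}" "j \<in> {a..b}" for i j
 proof (cases "i \<le> j")
  case True thus ?thesis using Pt[of i "j - i"] that by simp
 next
  case False thus ?thesis using Pt[of j "i - j"] that by (simp add: tr_commute)
 qed
 have "P (Nperm f)" if "f permutes {a..b}" for f
 proof (rule permutes_induct[OF that])
  have "Nperm id = 0" by (rule nperm_eqI) simp
  thus "P (Nperm id)" using P0 by simp
 next
  fix x y f assume h: "x \<in> {a..b}" "y \<in> {a..b}" "P (Nperm f)" "f permutes {a..b}"
  have "Nperm (transpose x y \<circ> f) = tr x y + Nperm f"
   using permutes_bij[OF h(4)] by (intro nperm_eqI) (simp add: bij_comp)
  thus "P (Nperm (transpose x y \<circ> f))" using Pa[OF Pt'[OF h(1,2)] h(3)] by simp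
 qed simp
 from this[OF g] show ?thesis by (simp add: nfun_inverse)
qed

type_synonym 'r gring = "nperm \<Rightarrow>\<^sub>0 'r"

abbreviation gs :: "nperm \<Rightarrow> 'r::comm_ring_1 gring" where "gs g \<equiv> single g 1"

lemma gs_mult: "gs g * gs h = gs (g + h)" by (simp add: mult_single)

lemma single_times: "single (g::nperm) (c::'r::comm_ring_1) = single 0 c * gs g"
 by (simp add: mult_single)

lemma poly_mapping_sum: "a = (\<Sum>k\<in>keys a. single k (lookup a k))"
proof (rule poly_mapping_eqI)
 fix k
 have "(\<Sum>x\<in>keys a. lookup (single x (lookup a x)) k) = (\<Sum>x\<in>keys a. if x = k then lookup a k else 0)"
  by (rule sum.cong) (auto simp: lookup_single)
 also have "\<dots> = lookup a k" by (auto simp: in_keys_iff)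
 finally show "lookup a k = lookup (\<Sum>k\<in>keys a. single k (lookup a k)) k" by (simp add: lookup_sum)
qed

lemma lookup_gs_left: "lookup (gs t * a) h = lookup a (- t + h)"
proof -
 have "gs t * a = (\<Sum>k\<in>keys a. single (t + k) (lookup a k))"
  by (subst poly_mapping_sum[of a]) (simp add: sum_distrib_left mult_single)
 moreover have "t + k = h \<longleftrightarrow> k = - t + h" for k by (metis minus_add_cancel add_minus_cancel)
 ultimately have "lookup (gs t * a) h = (\<Sum>k\<in>keys a. if k = - t + h then lookup a k else 0)"
  by (simp add: lookup_sum lookup_single when_def)
 also have "\<dots> = lookup a (- t + h)" by (auto simp: in_keys_iff)
 finally show ?thesis .
qed

lemma lookup_gs_right: "lookup (a * gs t) h = lookup a (h - t)"
proof -
 have "a * gs t = (\<Sum>k\<in>keys a. single (k + t) (lookup a k))"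
  by (subst poly_mapping_sum[of a]) (simp add: sum_distrib_right mult_single)
 moreover have "k + t = h \<longleftrightarrow> k = h - t" for k by (metis add_diff_cancel diff_add_cancel)
 ultimately have "lookup (a * gs t) h = (\<Sum>k\<in>keys a. if k = h - t then lookup a k else 0)"
  by (simp add: lookup_sum lookup_single when_def)
 also have "\<dots> = lookup a (h - t)" by (auto simp: in_keys_iff)
 finally show ?thesis .
qed

definition galg :: "nat \<Rightarrow> 'r::comm_ring_1 gring set" where
 "galg n = {a. keys a \<subseteq> syms n}"

lemma galg_0 [simp]: "0 \<in> galg n" by (simp add: galg_def)
lemma galg_gs [simp]: "g \<in> syms n ==> single g c \<in> galg n" by (simp add: galg_def)
lemma galg_1 [simp]: "1 \<in> galg n" by (simp add: galg_def)
lemma galg_add [simp]: "a \<in> galg n ==> b \<in> galg n ==> a + b \<in> galg n"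
 using keys_add[of a b] by (auto simp: galg_def)
lemma keys_uminus_poly: "keys (- a) = keys (a :: 'a \<Rightarrow>\<^sub>0 'r::comm_ring_1)"
 by (auto simp: in_keys_iff)
lemma galg_uminus [simp]: "a \<in> galg n ==> - a \<in> galg n" by (simp add: galg_def keys_uminus_poly)
lemma galg_diff [simp]: "a \<in> galg n ==> b \<in> galg n ==> a - b \<in> galg n"
 using galg_add[of a n "- b"] by simp
lemma galg_mult [simp]: "a \<in> galg n ==> b \<in> galg n ==> a * b \<in> galg n"
 using keys_mult[of a b] by (fastforce simp: galg_def)
lemma galg_sum: "(\<And>i. i \<in> I ==> f i \<in> galg n) ==> sum f I \<in> galg n"
 by (induction I rule: infinite_finite_induct) auto
lemma galg_mono: "m \<le> n ==> galg m \<subseteq> galg n" using syms_mono by (fastforce simp: galg_def)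

lemma galg_induct: assumes "a \<in> galg n"
  and "\<And>g c. g \<in> syms n ==> P (single g c)" "P 0" "\<And>a b. P a ==> P b ==> P (a + b)" shows "P a"
proof -
 have "P (\<Sum>k\<in>K. single k (lookup a k))" if "K \<subseteq> syms n" for K
  using finite_subset[OF that finite_syms] that by induction (auto intro: assms)
 from this[of "keys a"] assms(1) show ?thesis using poly_mapping_sum[of a] by (simp add: galg_def)
qed

definition cent :: "nat \<Rightarrow> nat \<Rightarrow> 'r::comm_ring_1 gring set" where
 "cent l m = {a \<in> galg m. \<forall>g\<in>syms l. gs g * a = a * gs g}"

lemma cent_galg: "a \<in> cent l m ==> a \<in> galg m" by (simp add: cent_def)
lemma cent_0 [simp]: "0 \<in> cent l m" by (simp add: cent_def)
lemma cent_1 [simp]: "1 \<in> cent l m" by (simp add: cent_def)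
lemma cent_add [simp]: "a \<in> cent l m ==> b \<in> cent l m ==> a + b \<in> cent l m"
 by (simp add: cent_def distrib_left distrib_right)
lemma cent_uminus [simp]: "a \<in> cent l m ==> - a \<in> cent l m" by (simp add: cent_def)
lemma cent_diff [simp]: "a \<in> cent l m ==> b \<in> cent l m ==> a - b \<in> cent l m"
 by (simp add: cent_def left_diff_distrib right_diff_distrib)
lemma cent_mult [simp]: "a \<in> cent l m ==> b \<in> cent l m ==> a * b \<in> cent l m"
 unfolding cent_def by (auto simp: mult.assoc) (metis mult.assoc)
lemma cent_sum: "(\<And>i. i \<in> I ==> f i \<in> cent l m) ==> sum f I \<in> cent l m"
 by (induction I rule: infinite_finite_induct) auto
lemma cent_power [simp]: "a \<in> cent l m ==> a ^ n \<in> cent l m" by (induction n) auto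
lemma cent_mono: "l \<le> l' ==> cent l' m \<subseteq> cent l m" using syms_mono by (auto simp: cent_def)
lemma cent_mono2: "m \<le> m' ==> cent l m \<subseteq> cent l m'" using galg_mono by (auto simp: cent_def)

lemma scalar_commute: "single 0 c * a = a * single (0::nperm) (c::'r::comm_ring_1)"
proof -
 have "single 0 c * single k d = single k d * single 0 c" for k :: nperm and d
  by (simp add: mult_single mult.commute)
 thus ?thesis by (subst (1 2) poly_mapping_sum[of a]) (simp add: sum_distrib_left sum_distrib_right)
qed

lemma cent_scalar [simp]: "single 0 c \<in> cent l m" by (simp add: cent_def scalar_commute)

lemma cent_commute: assumes "a \<in> cent l m" "b \<in> galg l" shows "b * a = a * b" using assms(2)
proof (rule galg_induct)
 fix g c assume "g \<in> syms l"
 hence "gs g * a = a * gs g" using assms(1) by (simp add: cent_def)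
 thus "single g c * a = a * single g c"
  unfolding single_times[of g c] by (metis mult.assoc scalar_commute)
qed (simp_all add: distrib_left distrib_right)

lemma cent_lookup: assumes "a \<in> cent l m" "t \<in> syms l" shows "lookup a (t + g - t) = lookup a g"
proof -
 have "lookup (gs t * a) (t + g) = lookup (a * gs t) (t + g)" using assms by (simp add: cent_def)
 thus ?thesis by (simp add: lookup_gs_left lookup_gs_right)
qed

text \<open>Comparing the coefficients of both sides of the commutation relation at t + g shows that
  the centraliser consists of the functions that are constant on conjugation orbits.\<close>

lemma cent_iff_lookup:
 "a \<in> cent l m \<longleftrightarrow> a \<in> galg m \<and> (\<forall>t\<in>syms l. \<forall>g. lookup a (t + g - t) = lookup a g)"
proof
 assume "a \<in> galg m \<and> (\<forall>t\<in>syms l. \<forall>g. lookup a (t + g - t) = lookup a g)"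
 hence a: "a \<in> galg m" "\<And>t g. t \<in> syms l ==> lookup a (t + g - t) = lookup a g" by blast+
 have "gs t * a = a * gs t" if "t \<in> syms l" for t
 proof (rule poly_mapping_eqI)
  fix h show "lookup (gs t * a) h = lookup (a * gs t) h"
   using a(2)[OF that, of "- t + h"] by (simp add: lookup_gs_left lookup_gs_right add.assoc[symmetric])
 qed
 thus "a \<in> cent l m" using a by (simp add: cent_def)
qed (auto simp: cent_lookup cent_galg)

definition orb :: "nat \<Rightarrow> nperm \<Rightarrow> nperm set" where
 "orb l g = (\<lambda>t. t + g - t) ` syms l"

definition osum :: "nat \<Rightarrow> nperm \<Rightarrow> 'r::comm_ring_1 gring" where
 "osum l g = (\<Sum>h\<in>orb l g. gs h)"

lemma finite_orb [simp]: "finite (orb l g)" by (simp add: orb_def)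
lemma orb_self [simp]: "g \<in> orb l g" unfolding orb_def by (rule image_eqI[of _ _ 0]) auto
lemma orb_conj: "t \<in> syms l ==> t + h - t \<in> orb l g \<longleftrightarrow> h \<in> orb l g"
proof -
 have a: "t + h - t \<in> orb l g" if t: "t \<in> syms l" and h: "h \<in> orb l g" for t h
 proof -
  obtain s where "s \<in> syms l" "h = s + g - s" using h by (auto simp: orb_def)
  hence "t + h - t = (t + s) + g - (t + s)" "t + s \<in> syms l"
   using t by (auto simp: minus_add add.assoc diff_conv_add_uminus simp del: add_uminus_conv_diff)
  thus ?thesis unfolding orb_def by blast
 qed
 assume t: "t \<in> syms l"
 show ?thesis
 proof
  assume "t + h - t \<in> orb l g"
  hence "- t + (t + h - t) - (- t) \<in> orb l g" using a[of "- t"] t by simp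
  thus "h \<in> orb l g" by (simp add: diff_conv_add_uminus add.assoc del: add_uminus_conv_diff)
 qed (use a t in blast)
qed

lemma orb_eq: assumes "h \<in> orb l g" shows "orb l h = orb l g"
proof -
 obtain s where s: "s \<in> syms l" "h = s + g - s" using assms by (auto simp: orb_def)
 have "x \<in> orb l h ==> x \<in> orb l g" for x using assms orb_conj by (auto simp: orb_def[of l h])
 moreover have "g \<in> orb l h" using orb_conj[OF s(1), of g h] orb_self[of h l] s(2) by simp
 hence "x \<in> orb l g ==> x \<in> orb l h" for x using orb_conj by (auto simp: orb_def[of l g])
 ultimately show ?thesis by blast
qed

lemma orb_syms: "g \<in> syms m ==> l \<le> m ==> orb l g \<subseteq> syms m"
 using syms_mono[of l m] by (auto simp: orb_def diff_conv_add_uminus simp del: add_uminus_conv_diff)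

lemma lookup_osum: "lookup (osum l g) h = (if h \<in> orb l g then 1 else 0)"
 by (simp add: osum_def lookup_sum lookup_single when_def)

lemma osum_cent: "g \<in> syms m ==> l \<le> m ==> (osum l g :: 'r::comm_ring_1 gring) \<in> cent l m"
 unfolding cent_iff_lookup
proof
 show "g \<in> syms m ==> l \<le> m ==> (osum l g :: 'r gring) \<in> galg m"
  unfolding osum_def using orb_syms[of g m l] by (intro galg_sum) auto
 show "\<forall>t\<in>syms l. \<forall>h. lookup (osum l g :: 'r gring) (t + h - t) = lookup (osum l g) h"
  by (simp add: lookup_osum orb_conj)
qed

section \<open>Jucys-Murphy elements and their symmetric polynomials\<close>

definition jm :: "nat \<Rightarrow> 'r::comm_ring_1 gring" where
 "jm k = (\<Sum>i\<in>{1..<k}. gs (tr i k))"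

lemma jm_galg [simp]: "k \<le> n ==> jm k \<in> galg n" unfolding jm_def by (rule galg_sum) simp

lemma jm_commute:
 assumes g: "g \<in> syms (k - 1)" shows "gs g * jm k = jm k * (gs g :: 'r::comm_ring_1 gring)"
proof (cases "k = 0")
 case True thus ?thesis by (simp add: jm_def)
next
 case False
 have k: "nfun g k = k" using g False by (intro syms_out[of _ "k - 1"]) auto
 have "gs g * jm k = (\<Sum>i\<in>{1..<k}. gs (tr (nfun g i) k) * (gs g :: 'r gring))"
  unfolding jm_def sum_distrib_left by (rule sum.cong) (simp_all add: gs_mult conj_tr k)
 also have "\<dots> = (\<Sum>i\<in>{1..<k}. gs (tr i k) * (gs g :: 'r gring))"
 proof (rule sum.reindex_bij_betw)
  have "{1..<k} = {1..k - 1}" by auto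
  thus "bij_betw (nfun g) {1..<k} {1..<k}" using g permutes_imp_bij unfolding syms_def by auto
 qed
 finally show ?thesis by (simp add: jm_def sum_distrib_right)
qed

lemma jm_cent: "jm k \<in> cent (k - 1) k" by (simp add: cent_def jm_commute)

lemma jm_comm: "jm i * jm j = jm j * (jm i :: 'r::comm_ring_1 gring)"
proof -
 have "jm i * jm j = jm j * (jm i :: 'r gring)" if "i < j" for i j
  by (rule cent_commute[OF jm_cent]) (use that in simp)
 thus ?thesis by (metis linorder_neqE_nat)
qed

abbreviation sw :: "nat \<Rightarrow> 'r::comm_ring_1 gring" where "sw i \<equiv> gs (tr i (Suc i))"

lemma sw_sw: "sw i * sw i = 1" by (simp add: gs_mult)

lemma sw_jm_other:
 assumes "j \<noteq> i" "j \<noteq> Suc i" "1 \<le> i" shows "sw i * jm j = jm j * (sw i :: 'r::comm_ring_1 gring)"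
proof (cases "j < i")
 case True
 have "gs (tr a j) * sw i = sw i * (gs (tr a j) :: 'r gring)" if "a \<in> {1..<j}" for a
  using that True conj_tr[of "tr i (Suc i)" a j] by (simp add: gs_mult transpose_def)
 thus ?thesis unfolding jm_def sum_distrib_left sum_distrib_right by (metis (no_types, lifting) sum.cong)
next
 case False
 hence "tr i (Suc i) \<in> syms (j - 1)" using assms by (intro tr_syms) auto
 thus ?thesis by (rule jm_commute)
qed

text \<open>Conjugation by \<open>sw i\<close> turns the summands of \<open>jm i\<close> into those
  of \<open>jm (Suc i)\<close> other than \<open>sw i\<close> itself, and that summand contributes
  the constant. These are the relations of the degenerate affine Hecke algebra.\<close>

lemma sw_jm: assumes "1 \<le> i" shows "sw i * jm i = jm (Suc i) * (sw i :: 'r::comm_ring_1 gring) - 1"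
proof -
 have "jm (Suc i) * sw i = (\<Sum>a\<in>{1..<i}. gs (tr a (Suc i)) * sw i) + (1 :: 'r gring)"
  using assms by (simp add: jm_def sum_distrib_right distrib_right gs_mult)
 moreover have "(\<Sum>a\<in>{1..<i}. gs (tr a (Suc i)) * sw i) = sw i * (jm i :: 'r gring)"
  unfolding jm_def sum_distrib_left
 proof (rule sum.cong[OF refl])
  fix a assume "a \<in> {1..<i}"
  thus "gs (tr a (Suc i)) * sw i = sw i * (gs (tr a i) :: 'r gring)"
   using conj_tr[of "tr i (Suc i)" a i] by (simp add: gs_mult transpose_def)
 qed
 ultimately show ?thesis by simp
qed

lemma sw_jm_Suc: assumes "1 \<le> i" shows "sw i * jm (Suc i) = jm i * (sw i :: 'r::comm_ring_1 gring) + 1"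
proof -
 have "jm i * sw i = (sw i * sw i) * jm i * (sw i :: 'r gring)" by (simp only: sw_sw mult_1_left)
 also have "\<dots> = sw i * (sw i * jm i) * sw i" by (simp only: mult.assoc)
 also have "\<dots> = sw i * (jm (Suc i) * sw i - 1) * sw i" by (simp only: sw_jm[OF assms])
 also have "\<dots> = sw i * jm (Suc i) * (sw i * sw i) - sw i * sw i"
  by (simp only: right_diff_distrib left_diff_distrib mult.assoc mult_1_right mult_1_left)
 also have "\<dots> = sw i * jm (Suc i) - 1" by (simp only: sw_sw mult_1_right)
 finally show ?thesis by (simp only: eq_diff_eq)
qed

lemma commute_mult: "s * a = a * s ==> s * b = b * s ==> s * (a * b) = a * b * (s :: 'a::semigroup_mult)"
 by (metis mult.assoc)

text \<open>The elementary symmetric polynomial of degree j in x 1, ..., x n. The recursion on the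
  last variable fixes the order of the factors, so it is meaningful in a noncommutative
  ring.\<close>

fun esym :: "(nat \<Rightarrow> 'a::ring_1) \<Rightarrow> nat \<Rightarrow> nat \<Rightarrow> 'a" where
 "esym x 0 0 = 1"
| "esym x 0 (Suc j) = 0"
| "esym x (Suc n) 0 = esym x n 0"
| "esym x (Suc n) (Suc j) = esym x n (Suc j) + esym x n j * x (Suc n)"

lemma esym_0 [simp]: "esym x n 0 = 1" by (induction n) auto

lemma esym_galg: "esym jm n j \<in> (galg n :: 'r::comm_ring_1 gring set)"
proof (induction n arbitrary: j)
 case 0 thus ?case by (cases j) auto
next
 case (Suc n)
 have "esym jm n i \<in> (galg (Suc n) :: 'r gring set)" for i
  using Suc.IH galg_mono[of n "Suc n", where 'a = 'r] by auto
 thus ?case by (cases j) auto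
qed

text \<open>The two variables exchanged by the transposition enter only through their sum and their
  product, and the Hecke relations make both commute with it. All other variables commute with it
  individually.\<close>

lemma esym_sw:
 assumes "1 \<le> i" "i < n" shows "sw i * esym jm n j = esym jm n j * (sw i :: 'r::comm_ring_1 gring)"
 using assms
proof (induction n arbitrary: j)
 case (Suc n)
 show ?case
 proof (cases "i < n")
  case True
  have L: "sw i * jm (Suc n) = jm (Suc n) * (sw i :: 'r gring)" using sw_jm_other[of "Suc n" i] True Suc.prems by simp
  have IH: "sw i * esym jm n j = esym jm n j * (sw i :: 'r gring)" for j using Suc True by simp
  show ?thesis
  proof (cases j)
   case (Suc j')
   have "sw i * (esym jm n j' * jm (Suc n)) = esym jm n j' * jm (Suc n) * (sw i :: 'r gring)"
    by (rule commute_mult[OF IH L])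
   thus ?thesis using IH[of "Suc j'"] by (simp add: Suc distrib_left distrib_right)
  qed simp
 next
  case False
  hence ni: "n = i" using Suc.prems by simp
  obtain k where k: "n = Suc k" using Suc.prems ni by (cases n) auto
  let ?S = "sw n :: 'r gring"
  have C: "?S * esym jm k j = esym jm k j * ?S" for j
  proof -
   have "?S \<in> cent k (Suc n)" unfolding cent_def
   proof (intro CollectI conjI ballI)
    show "?S \<in> galg (Suc n)" using k by simp
    fix g assume g: "g \<in> syms k"
    hence "nfun g n = n" "nfun g (Suc n) = Suc n" using k by (auto intro: syms_out[of _ k])
    thus "gs g * ?S = ?S * gs g" by (simp add: gs_mult conj_tr)
   qed
   thus ?thesis using cent_commute[OF _ esym_galg, of ?S k "Suc n" j] by simp
  qed
  have n1: "1 \<le> n" using k by simp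
  have s1: "?S * (jm n + jm (Suc n)) = (jm n + jm (Suc n)) * ?S"
   using sw_jm[OF n1, where 'r = 'r] sw_jm_Suc[OF n1, where 'r = 'r] by (simp add: distrib_left distrib_right)
  have s2: "?S * (jm n * jm (Suc n)) = (jm n * jm (Suc n)) * ?S"
  proof -
   have "?S * (jm n * jm (Suc n)) = (jm (Suc n) * ?S - 1) * jm (Suc n)"
    using sw_jm[OF n1, where 'r = 'r] by (simp add: mult.assoc[symmetric])
   also have "\<dots> = jm (Suc n) * (?S * jm (Suc n)) - jm (Suc n)" by (simp add: left_diff_distrib mult.assoc)
   also have "\<dots> = jm (Suc n) * (jm n * ?S + 1) - jm (Suc n)" using sw_jm_Suc[OF n1, where 'r = 'r] by simp
   also have "\<dots> = jm (Suc n) * jm n * ?S" by (simp add: distrib_left mult.assoc)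
   finally show ?thesis by (simp add: jm_comm[of "Suc n" n])
  qed
  show ?thesis
  proof (cases j)
   case (Suc j1)
   show ?thesis
   proof (cases j1)
    case 0
    have "esym jm (Suc n) j = esym jm k 1 + (jm n + (jm (Suc n) :: 'r gring))" by (simp add: Suc 0 k add.assoc)
    thus ?thesis using C[of 1] s1 by (simp add: ni distrib_left distrib_right)
   next
    case (Suc j2)
    have e: "esym jm (Suc n) j = (esym jm k (Suc (Suc j2)) :: 'r gring) + esym jm k (Suc j2) * (jm n + jm (Suc n))
      + esym jm k j2 * (jm n * jm (Suc n))"
     by (simp add: \<open>j = Suc j1\<close> Suc k distrib_left distrib_right mult.assoc add.assoc)
    have a: "?S * (esym jm k i * b) = esym jm k i * b * ?S" if "?S * b = b * ?S" for i b
     by (rule commute_mult[OF C that])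
    have "?S * esym jm (Suc n) j = esym jm (Suc n) j * ?S"
     unfolding e distrib_left[of ?S] distrib_right[of _ _ ?S] a[OF s1] a[OF s2] C ..
    thus ?thesis by (simp only: ni)
   qed
  qed simp
 qed
qed simp

lemma esym_cent: "esym jm n j \<in> (cent n n :: 'r::comm_ring_1 gring set)" unfolding cent_def
proof (intro CollectI conjI ballI)
 show "esym jm n j \<in> (galg n :: 'r gring set)" by (rule esym_galg)
 fix g assume "g \<in> syms n"
 hence "nfun g permutes {1..n}" by (simp add: syms_def)
 thus "gs g * esym jm n j = esym jm n j * (gs g :: 'r::comm_ring_1 gring)"
 proof (rule adjacent_generate)
  fix g h :: nperm
  assume "gs g * esym jm n j = esym jm n j * (gs g :: 'r gring)"
   "gs h * esym jm n j = esym jm n j * (gs h :: 'r gring)"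
  thus "gs (g + h) * esym jm n j = esym jm n j * (gs (g + h) :: 'r gring)"
   unfolding gs_mult[symmetric] by (metis commute_mult)
 qed (use esym_sw in auto)
qed

section \<open>Generators of the integral centraliser algebra, after Olshanskii\<close>

inductive_set cgen :: "nat \<Rightarrow> nat \<Rightarrow> int gring set" for l m where
 centre: "z \<in> cent l l ==> z \<in> cgen l m"
| adjacent: "l < i ==> i < m ==> sw i \<in> cgen l m"
| murphy: "l < j ==> j \<le> m ==> jm j \<in> cgen l m"
| add: "a \<in> cgen l m ==> b \<in> cgen l m ==> a + b \<in> cgen l m"
| uminus: "a \<in> cgen l m ==> - a \<in> cgen l m"
| mult: "a \<in> cgen l m ==> b \<in> cgen l m ==> a * b \<in> cgen l m"

lemma cgen_diff: "a \<in> cgen l m ==> b \<in> cgen l m ==> a - b \<in> cgen l m"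
 using cgen.add[OF _ cgen.uminus, of a l m b] by simp

lemma cgen_scalar: "a \<in> cgen l m ==> single 0 c * a \<in> cgen l m"
 by (rule cgen.mult[OF cgen.centre[OF cent_scalar]])

definition usup :: "nat \<Rightarrow> nperm \<Rightarrow> nat" where
 "usup l g = card {i \<in> {1..l}. nfun g i \<noteq> i}"

lemma usup_conj: assumes "t \<in> syms l" shows "usup l (t + g - t) = usup l g"
proof -
 have "{i \<in> {1..l}. nfun (t + g - t) i \<noteq> i} = nfun t ` {i \<in> {1..l}. nfun g i \<noteq> i}"
 proof
  show "nfun t ` {i \<in> {1..l}. nfun g i \<noteq> i} \<subseteq> {i \<in> {1..l}. nfun (t + g - t) i \<noteq> i}"
  proof
   fix y assume "y \<in> nfun t ` {i \<in> {1..l}. nfun g i \<noteq> i}"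
   then obtain i where i: "i \<in> {1..l}" "nfun g i \<noteq> i" "y = nfun t i" by blast
   have "nfun (t + g - t) y = nfun t (nfun g i)"
    by (simp add: i diff_conv_add_uminus del: add_uminus_conv_diff)
   moreover have "y \<in> {1..l}" using i syms_in[OF assms] by blast
   ultimately show "y \<in> {i \<in> {1..l}. nfun (t + g - t) i \<noteq> i}" using i by simp
  qed
  show "{i \<in> {1..l}. nfun (t + g - t) i \<noteq> i} \<subseteq> nfun t ` {i \<in> {1..l}. nfun g i \<noteq> i}"
  proof
   fix i assume i: "i \<in> {i \<in> {1..l}. nfun (t + g - t) i \<noteq> i}"
   let ?j = "nfun (- t) i"
   have "i = nfun t ?j" by simp
   moreover have "?j \<in> {1..l}" using i syms_in[OF syms_minus[OF assms]] by blast
   moreover have "nfun g ?j \<noteq> ?j"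
   proof
    assume "nfun g ?j = ?j"
    hence "nfun (t + g - t) i = i" by (simp add: diff_conv_add_uminus del: add_uminus_conv_diff)
    thus False using i by simp
   qed
   ultimately show "i \<in> nfun t ` {i \<in> {1..l}. nfun g i \<noteq> i}" by blast
  qed
 qed
 thus ?thesis unfolding usup_def by (simp add: card_image inj_on_def)
qed

lemma conj_add: "k + (a + b) - k = (k + a - k) + (k + b - k)" for k :: "'a::group_add"
 by (simp add: diff_conv_add_uminus add.assoc del: add_uminus_conv_diff)

lemma cgen_syms: assumes g: "nfun g permutes {Suc l..m}" shows "gs g \<in> cgen l m" using g
proof (rule adjacent_generate)
 show "gs 0 \<in> cgen l m" using cgen.centre[OF cent_1, of l m] by simp
 show "gs (g + h) \<in> cgen l m" if "gs g \<in> cgen l m" "gs h \<in> cgen l m" for g h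
  using cgen.mult[OF that] by (simp add: gs_mult)
qed (auto intro: cgen.adjacent)

lemma keys_sum_gs: "keys (\<Sum>x\<in>I. gs (f x) :: int gring) \<subseteq> f ` I"
 using keys_sum[of "\<lambda>x. gs (f x)" I] by auto

text \<open>With x the image of a, the permutation g is g' times the transposition of x and a, and
  g' fixes x. In the product, the terms that multiply a conjugate of g' by the transposition of a
  and a fixed point y of it with y at most l are precisely the conjugates of g, each once. Every
  other term moves no more points of {1..l} than g' does.\<close>

lemma osum_times_jm:
 assumes g: "g \<in> syms m" and lm: "l \<le> m" and a: "l < a" "a \<le> m" and x: "nfun g a \<in> {1..l}"
 defines "g' \<equiv> g + tr (nfun g a) a" shows "usup l g = Suc (usup l g')"
  and "\<And>h. h \<in> keys (osum l g' * jm a - osum l g :: int gring) ==> usup l h < usup l g"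
proof -
 let ?x = "nfun g a"
 have xa: "?x \<noteq> a" using x a by auto
 have g'x: "nfun g' ?x = ?x" by (simp add: g'_def)
 have g'a: "nfun g' a = nfun g ?x" by (simp add: g'_def)
 have g'o: "nfun g' i = nfun g i" if "i \<noteq> ?x" "i \<noteq> a" for i using that by (simp add: g'_def)
 have gg: "g = g' + tr ?x a" unfolding g'_def by (simp add: add.assoc)
 have "{i \<in> {1..l}. nfun g i \<noteq> i} = insert ?x {i \<in> {1..l}. nfun g' i \<noteq> i}"
 proof -
  have "nfun g i \<noteq> i \<longleftrightarrow> i = ?x \<or> nfun g' i \<noteq> i" if "i \<in> {1..l}" for i
  proof (cases "i = ?x")
   case True
   have "nfun g ?x \<noteq> ?x" using xa by simp
   thus ?thesis using True by simp
  next
   case False thus ?thesis using g'o[of i] that a by auto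
  qed
  thus ?thesis using x by auto
 qed
 moreover have "?x \<notin> {i \<in> {1..l}. nfun g' i \<noteq> i}" using g'x by simp
 ultimately show us: "usup l g = Suc (usup l g')" unfolding usup_def by simp
 let ?D = "orb l g' \<times> {1..<a}"
 let ?G = "{z \<in> ?D. snd z \<le> l \<and> nfun (fst z) (snd z) = snd z}"
 let ?f = "\<lambda>z. fst z + tr (snd z) a"
 have fin: "finite ?D" by simp
 have "osum l g' * jm a = (\<Sum>z\<in>?D. gs (?f z) :: int gring)"
  unfolding osum_def jm_def sum_product sum.cartesian_product by (simp add: gs_mult case_prod_unfold)
 also have "\<dots> = (\<Sum>z\<in>?D - ?G. gs (?f z)) + (\<Sum>z\<in>?G. gs (?f z))"
  by (rule sum.subset_diff) (use fin in auto)
 also have "(\<Sum>z\<in>?G. gs (?f z)) = (osum l g :: int gring)" unfolding osum_def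
 proof (rule sum.reindex_bij_betw)
  show "bij_betw ?f ?G (orb l g)" unfolding bij_betw_def
  proof
   show "inj_on ?f ?G"
   proof (rule inj_onI)
    fix z z' assume h: "z \<in> ?G" "z' \<in> ?G" "?f z = ?f z'"
    have "nfun (?f z) a = snd z" using h(1) by simp
    moreover have "nfun (?f z') a = snd z'" using h(2) by simp
    ultimately have s: "snd z = snd z'" using h(3) by metis
    hence "fst z = fst z'" using h(3) by simp
    thus "z = z'" using s by (simp add: prod_eq_iff)
   qed
   show "?f ` ?G = orb l g"
   proof
    show "orb l g \<subseteq> ?f ` ?G"
    proof
     fix h assume "h \<in> orb l g"
     then obtain k where k: "k \<in> syms l" "h = k + g - k" by (auto simp: orb_def)
     let ?t = "k + g' - k" let ?y = "nfun k ?x"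
     have ka: "nfun k a = a" using k(1) a by (intro syms_out[of _ l]) auto
     have "h = ?t + (k + tr ?x a - k)" unfolding k(2)
      by (subst gg) (simp add: diff_conv_add_uminus add.assoc del: add_uminus_conv_diff)
     also have "k + tr ?x a - k = tr ?y a" by (simp add: conj_tr ka)
     finally have "h = ?f (?t, ?y)" by simp
     moreover have "?y \<in> {1..l}" using x syms_in[OF k(1)] by blast
     moreover have "nfun ?t ?y = ?y" using g'x by (simp add: diff_conv_add_uminus del: add_uminus_conv_diff)
     moreover have "?t \<in> orb l g'" using k(1) by (auto simp: orb_def)
     ultimately show "h \<in> ?f ` ?G" using a by (intro image_eqI[of _ _ "(?t, ?y)"]) auto
    qed
    show "?f ` ?G \<subseteq> orb l g"
    proof
     fix h assume "h \<in> ?f ` ?G"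
     then obtain t y where h: "h = t + tr y a" "t \<in> orb l g'" "1 \<le> y" "y \<le> l" "nfun t y = y" by auto
     obtain k where k: "k \<in> syms l" "t = k + g' - k" using h(2) by (auto simp: orb_def)
     let ?x' = "nfun k ?x"
     \<comment> \<open>The conjugator k carries x to x' instead of y. Both x' and y are fixed by t,
       so composing with their transposition corrects this without changing t.\<close>
     let ?k = "tr ?x' y + k"
     have x': "?x' \<in> {1..l}" using x syms_in[OF k(1)] by blast
     have tx: "nfun t ?x' = ?x'" unfolding k(2) using g'x
      by (simp add: diff_conv_add_uminus del: add_uminus_conv_diff)
     have ks: "?k \<in> syms l" using x' h k(1) by (intro syms_add tr_syms) auto
     have "nfun k a = a" using k(1) a by (intro syms_out[of _ l]) auto
     hence ka: "nfun ?k a = a" "nfun ?k ?x = y" using x' h(4) a by (auto simp: transpose_def)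
     have "t + tr ?x' y = tr ?x' y + t" using tx h(5) by (simp add: conj_tr)
     hence tt: "tr ?x' y + t - tr ?x' y = t" by (metis add_diff_cancel)
     have "?k + g - ?k = ?k + (g' + tr ?x a) - ?k" by (simp only: gg[symmetric])
     also have "\<dots> = (?k + g' - ?k) + (?k + tr ?x a - ?k)" by (rule conj_add)
     also have "?k + g' - ?k = tr ?x' y + t - tr ?x' y" unfolding k(2)
      by (simp add: diff_conv_add_uminus minus_add add.assoc del: add_uminus_conv_diff)
     also have "?k + tr ?x a - ?k = tr y a" unfolding conj_tr[of ?k] ka by simp
     finally have "h = ?k + g - ?k" using tt h(1) by simp
     thus "h \<in> orb l g" unfolding orb_def using ks by blast
    qed
   qed
  qed
 qed
 finally have e: "osum l g' * jm a - osum l g = (\<Sum>z\<in>?D - ?G. gs (?f z) :: int gring)" by simp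
 show "usup l h < usup l g" if "h \<in> keys (osum l g' * jm a - osum l g :: int gring)" for h
 proof -
  have "h \<in> ?f ` (?D - ?G)" using that keys_sum_gs[of ?f "?D - ?G"] unfolding e by blast
  then obtain z where z: "z \<in> ?D - ?G" "h = ?f z" by blast
  obtain t y where ty: "z = (t, y)" by (cases z)
  have h: "h = t + tr y a" "t \<in> orb l g'" "1 \<le> y" "y < a" "\<not> (y \<le> l \<and> nfun t y = y)"
   using z unfolding ty by simp_all
  have ut: "usup l t = usup l g'" using h(2) usup_conj unfolding orb_def by auto
  have "{i \<in> {1..l}. nfun h i \<noteq> i} \<subseteq> {i \<in> {1..l}. nfun t i \<noteq> i}"
  proof
   fix i assume i: "i \<in> {i \<in> {1..l}. nfun h i \<noteq> i}"
   show "i \<in> {i \<in> {1..l}. nfun t i \<noteq> i}"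
   proof (cases "i = y")
    case True thus ?thesis using i h(5) by auto
   next
    case False
    hence "nfun h i = nfun t i" using i a unfolding h(1) by (auto simp: transpose_def)
    thus ?thesis using i by simp
   qed
  qed
  hence "usup l h \<le> usup l t" unfolding usup_def by (intro card_mono) auto
  thus ?thesis using ut us by simp
 qed
qed

text \<open>If g preserves {l+1..m}, it is the product of a permutation of {1..l} and one of
  {l+1..m}, and conjugation by S_l leaves the second factor alone.\<close>

lemma osum_split:
 assumes g: "g \<in> syms m" and lm: "l \<le> m" and stay: "\<And>a. a \<in> {Suc l..m} ==> nfun g a \<in> {Suc l..m}"
 obtains u v where "u \<in> syms l" "nfun v permutes {Suc l..m}" "osum l g = osum l u * (gs v :: int gring)"
proof -
 have gp: "nfun g permutes {1..m}" using g by (simp add: syms_def)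
 have imv: "nfun g ` {Suc l..m} = {Suc l..m}"
  by (rule endo_inj_surj) (use stay in \<open>auto simp: inj_on_def\<close>)
 have imu: "nfun g ` {1..l} = {1..l}"
 proof -
  have "{1..l} = {1..m} - {Suc l..m}" using lm by auto
  thus ?thesis using permutes_image[OF gp] imv image_set_diff[of "nfun g" "{1..m}" "{Suc l..m}"]
   by (simp add: bij_is_inj)
 qed
 let ?fu = "\<lambda>i. if i \<in> {1..l} then nfun g i else i" and ?fv = "\<lambda>i. if i \<in> {Suc l..m} then nfun g i else i"
 have pu: "?fu permutes {1..l}"
  by (rule bij_imp_permutes) (use imu in \<open>auto simp: bij_betw_def inj_on_def\<close>)
 have pv: "?fv permutes {Suc l..m}"
  by (rule bij_imp_permutes) (use imv in \<open>auto simp: bij_betw_def inj_on_def\<close>)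
 define u where "u = Nperm ?fu" define v where "v = Nperm ?fv"
 have u: "nfun u = ?fu" "u \<in> syms l" and v: "nfun v = ?fv"
  using permutes_bij[OF pu] permutes_bij[OF pv] pu by (simp_all add: u_def v_def syms_def)
 have guv: "g = u + v"
 proof (rule nperm_eqI)
  fix i
  show "nfun g i = nfun (u + v) i"
  proof (cases "i \<in> {Suc l..m}")
   case True
   hence "nfun g i \<in> {Suc l..m}" by (rule stay)
   thus ?thesis using True u v by simp
  next
   case False
   thus ?thesis using u v permutes_not_in[OF gp, of i] by auto
  qed
 qed
 have com: "k + v = v + k" if k: "k \<in> syms l" for k
 proof (rule nperm_eqI)
  fix i
  show "nfun (k + v) i = nfun (v + k) i"
  proof (cases "i \<in> {1..l}")
   case True
   hence "nfun k i \<in> {1..l}" using syms_in[OF k] by blast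
   hence "nfun k i \<notin> {Suc l..m}" "i \<notin> {Suc l..m}" using True by auto
   thus ?thesis by (simp only: nfun_add comp_apply v if_False)
  next
   case False
   hence "nfun k i = i" "nfun v i \<notin> {1..l}" using syms_out[OF k] stay[of i] by (auto simp: v)
   thus ?thesis using syms_out[OF k] by simp
  qed
 qed
 have "osum l g = (\<Sum>h\<in>(\<lambda>h. h + v) ` orb l u. gs h :: int gring)"
 proof -
  have "k + g - k = (k + u - k) + v" if "k \<in> syms l" for k
   using com[OF syms_minus[OF that]] unfolding guv by (simp add: diff_conv_add_uminus add.assoc del: add_uminus_conv_diff)
  hence "orb l g = (\<lambda>h. h + v) ` orb l u" unfolding orb_def image_image by (intro image_cong) auto
  thus ?thesis by (simp add: osum_def)
 qed
 also have "\<dots> = osum l u * gs v"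
  by (subst sum.reindex) (auto simp: inj_on_def osum_def sum_distrib_right gs_mult)
 finally have e: "osum l g = osum l u * (gs v :: int gring)" .
 have "nfun v permutes {Suc l..m}" using pv by (simp only: v)
 from that[OF u(2) this e] show ?thesis .
qed

text \<open>Induction on the number of points of {1..l} that are moved. If g brings a point from
  above into {1..l}, its orbit sum is an orbit sum of smaller degree times a Jucys-Murphy element,
  up to terms of smaller degree; otherwise the orbit sum splits into a central element of the group
  ring of S_l and a permutation of {l+1..m}.\<close>

theorem cent_subset_cgen: assumes lm: "l \<le> m" shows "cent l m \<subseteq> cgen l m"
proof -
 have "\<forall>c\<in>cent l m. (\<forall>g\<in>keys c. usup l g < n) \<longrightarrow> c \<in> cgen l m" for n
 proof (induction n)
  case 0
  have "c \<in> cgen l m" if "\<forall>g\<in>keys c. usup l g < 0" for c :: "int gring"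
  proof -
   have "c = 0" using that by (metis keys_eq_empty all_not_in_conv not_less_zero)
   thus ?thesis using cgen.centre[OF cent_0] by simp
  qed
  thus ?case by blast
 next
  case (Suc n)
  have IH: "c \<in> cgen l m" if "c \<in> cent l m" "\<And>g. g \<in> keys c ==> usup l g < n" for c
   using Suc that by blast
  have os: "osum l g \<in> cgen l m" if g: "g \<in> syms m" and un: "usup l g = n" for g
  proof (cases "\<exists>a\<in>{Suc l..m}. nfun g a \<in> {1..l}")
   case True
   then obtain a where "a \<in> {Suc l..m}" "nfun g a \<in> {1..l}" by blast
   hence a: "l < a" "a \<le> m" "nfun g a \<in> {1..l}" by auto
   let ?g' = "g + tr (nfun g a) a"
   note o = osum_times_jm[OF g lm a]
   have g': "?g' \<in> syms m" using g a lm by (intro syms_add tr_syms) auto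
   have c1: "osum l ?g' \<in> cent l m" by (rule osum_cent[OF g' lm])
   have "usup l h < n" if "h \<in> keys (osum l ?g' :: int gring)" for h
   proof -
    have "h \<in> orb l ?g'" using that by (simp add: in_keys_iff lookup_osum split: if_splits)
    hence "usup l h = usup l ?g'" using usup_conj unfolding orb_def by auto
    thus ?thesis using o(1) un by simp
   qed
   hence 1: "osum l ?g' \<in> cgen l m" by (rule IH[OF c1])
   have "jm a \<in> (cent l m :: int gring set)"
   proof -
    have "cent (a - 1) a \<subseteq> (cent l a :: int gring set)" by (rule cent_mono) (use a in simp)
    also have "\<dots> \<subseteq> cent l m" by (rule cent_mono2) (use a in simp)
    finally show ?thesis using jm_cent by blast
   qed
   hence "osum l ?g' * jm a - osum l g \<in> (cent l m :: int gring set)"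
    using c1 osum_cent[OF g lm] by (intro cent_diff cent_mult)
   hence 2: "osum l ?g' * jm a - osum l g \<in> cgen l m" using o(2) un by (intro IH) auto
   have "osum l ?g' * jm a \<in> cgen l m" using 1 a by (intro cgen.mult cgen.murphy)
   from cgen_diff[OF this 2] show ?thesis by simp
  next
   case False
   have "nfun g a \<in> {Suc l..m}" if a: "a \<in> {Suc l..m}" for a
   proof -
    have "nfun g a \<in> {1..m}" using syms_in[OF g, of a] a by auto
    thus ?thesis using False a by (metis atLeastAtMost_iff not_less_eq_eq)
   qed
   then obtain u v where u: "u \<in> syms l" and v: "nfun v permutes {Suc l..m}"
    and e: "osum l g = osum l u * (gs v :: int gring)" using osum_split[OF g lm] by metis
   have "osum l u \<in> cent l l" by (rule osum_cent[OF u]) simp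
   thus ?thesis unfolding e by (rule cgen.mult[OF cgen.centre cgen_syms[OF v]])
  qed
  show ?case
  proof (intro ballI impI)
   fix c :: "int gring" assume "c \<in> cent l m" "\<forall>g\<in>keys c. usup l g < Suc n"
   thus "c \<in> cgen l m"
   proof (induction "card {g \<in> keys c. usup l g = n}" arbitrary: c rule: less_induct)
    case less
    show ?case
    proof (cases "\<exists>g\<in>keys c. usup l g = n")
     case False
     have "usup l h < n" if h: "h \<in> keys c" for h
     proof -
      have "usup l h < Suc n" "usup l h \<noteq> n" using h less.prems(2) False by blast+
      thus ?thesis by simp
     qed
     thus ?thesis by (rule IH[OF less.prems(1)])
    next
     case True
     then obtain g where g: "g \<in> keys c" "usup l g = n" by blast
     have gm: "g \<in> syms m" using cent_galg[OF less.prems(1)] g(1) by (auto simp: galg_def)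
     let ?k = "lookup c g"
     \<comment> \<open>The coefficients of c are constant on the orbit of g, so this subtraction
       removes the whole orbit from the support and adds nothing to it.\<close>
     let ?d = "c - single 0 ?k * osum l g"
     have lk: "lookup c h = ?k" if "h \<in> orb l g" for h
      using that cent_lookup[OF less.prems(1)] unfolding orb_def by auto
     have ls: "lookup (single 0 ?k * osum l g) h = (if h \<in> orb l g then ?k else 0)" for h
     proof -
      have "single 0 ?k * osum l g = (\<Sum>h\<in>orb l g. single h ?k)"
       by (simp add: osum_def sum_distrib_left mult_single)
      thus ?thesis by (simp add: lookup_sum lookup_single when_def)
     qed
     have ld: "lookup ?d h = (if h \<in> orb l g then 0 else lookup c h)" for h
     proof (cases "h \<in> orb l g")
      case True thus ?thesis by (simp add: lookup_minus ls lk[OF True])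
     qed (simp add: lookup_minus ls)
     hence kd: "keys ?d = keys c - orb l g" by (auto simp: in_keys_iff split: if_splits)
     have "{h \<in> keys ?d. usup l h = n} \<subset> {h \<in> keys c. usup l h = n}"
     proof
      show "{h \<in> keys ?d. usup l h = n} \<noteq> {h \<in> keys c. usup l h = n}"
       unfolding kd using g by (metis (mono_tags, lifting) Diff_iff mem_Collect_eq orb_self)
     qed (unfold kd, blast)
     hence "card {h \<in> keys ?d. usup l h = n} < card {h \<in> keys c. usup l h = n}"
      by (intro psubset_card_mono) auto
     moreover have "?d \<in> cent l m"
      by (intro cent_diff cent_mult less.prems(1) cent_scalar osum_cent[OF gm lm])
     moreover have "\<forall>h\<in>keys ?d. usup l h < Suc n" using less.prems(2) kd by blast
     ultimately have "?d \<in> cgen l m" by (rule less.hyps)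
     from cgen.add[OF this cgen_scalar[OF os[OF gm g(2)], of ?k]] show ?thesis by simp
    qed
   qed
  qed
 qed
 note all = this
 show ?thesis
 proof
  fix c :: "int gring" assume c: "c \<in> cent l m"
  have "usup l g < Suc l" for g
  proof -
   have "card {i \<in> {1..l}. nfun g i \<noteq> i} \<le> card {1..l}" by (rule card_mono) auto
   thus ?thesis by (simp add: usup_def)
  qed
  thus "c \<in> cgen l m" using all[of "Suc l"] c by blast
 qed
qed

lemma sw_cent: "l < i ==> i < m ==> sw i \<in> (cent l m :: 'r::comm_ring_1 gring set)" unfolding cent_def
proof (intro CollectI conjI ballI)
 assume i: "l < i" "i < m"
 show "sw i \<in> (galg m :: 'r gring set)" using i by (intro galg_gs tr_syms) auto
 fix g assume "g \<in> syms l"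
 hence "nfun g i = i" "nfun g (Suc i) = Suc i" using i by (auto intro: syms_out[of _ l])
 thus "gs g * sw i = (sw i * gs g :: 'r gring)" by (simp add: gs_mult conj_tr)
qed

lemma jm_cent_le: "l < j ==> j \<le> m ==> jm j \<in> (cent l m :: 'r::comm_ring_1 gring set)"
proof -
 assume j: "l < j" "j \<le> m"
 have "cent (j - 1) j \<subseteq> (cent l j :: 'r gring set)" by (rule cent_mono) (use j in simp)
 also have "\<dots> \<subseteq> cent l m" by (rule cent_mono2) (use j in simp)
 finally show ?thesis using jm_cent by blast
qed

section \<open>Words in adjacent transpositions and weights modulo p\<close>

fun word_perm :: "nat list \<Rightarrow> nperm" where
 "word_perm [] = 0"
| "word_perm (i # u) = tr i (Suc i) + word_perm u"

lemma word_perm_cent: "set u \<subseteq> {l<..<m} ==> gs (word_perm u) \<in> (cent l m :: 'r::comm_ring_1 gring set)"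
proof (induction u)
 case Nil thus ?case using cent_1[of l m] by simp
next
 case (Cons i u)
 have "sw i * gs (word_perm u) \<in> (cent l m :: 'r gring set)"
  by (rule cent_mult[OF sw_cent]) (use Cons in auto)
 thus ?case by (simp add: gs_mult)
qed

lemma word_perm_permutes: "set u \<subseteq> {l<..<m} ==> nfun (word_perm u) permutes {l<..m}"
proof (induction u)
 case (Cons i u)
 hence "transpose i (Suc i) permutes {l<..m}" by (intro permutes_swap_id) auto
 hence "transpose i (Suc i) \<circ> nfun (word_perm u) permutes {l<..m}"
  using Cons by (intro permutes_compose) auto
 thus ?case by (simp only: word_perm.simps nfun_add nfun_tr)
qed (simp add: permutes_id)

abbreviation sc :: "int \<Rightarrow> int gring" where "sc \<equiv> single 0"

lemma sc_simps: "sc (a + b) = sc a + sc b" "sc (a - b) = sc a - sc b" "sc (a * b) = sc a * sc b" "sc 1 = 1" "sc 0 = 0"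
 "sc (- a) = - sc a" by (simp_all add: single_add single_diff mult_single single_uminus)

lemma sc_comm: "x * sc c = sc c * x" by (rule scalar_commute[symmetric])

lemma sc_left: "x * (sc c * y) = sc c * (x * y)" by (metis mult.assoc sc_comm)

text \<open>I will consist of the elements that send a path map into p times the submodule it
  generates, for two paths at once. Modulo I the unit is then a joint eigenvector of the
  Jucys-Murphy elements, with eigenvalues w distinct modulo p, and the centre of the group ring of
  S_l acts on it by scalars.\<close>

locale weight_ideal = fixes l m :: nat and I :: "int gring set" and p :: int and w :: "nat \<Rightarrow> int"
 assumes lm: "l \<le> m" and I0: "0 \<in> I" and Iadd: "a \<in> I ==> b \<in> I ==> a + b \<in> I"
  and Imult: "c \<in> cent l m ==> a \<in> I ==> c * a \<in> I" and pI: "c \<in> cent l m ==> sc p * c \<in> I"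
  and jmI: "l < j ==> j \<le> m ==> jm j - sc (w j) \<in> I" and centreI: "z \<in> cent l l ==> \<exists>s. z - sc s \<in> I"
  and p: "prime p" and w: "l < i ==> i \<le> m ==> l < j ==> j \<le> m ==> i \<noteq> j ==> \<not> p dvd w i - w j"
begin

lemma Isc: "a \<in> I ==> sc k * a \<in> I" by (rule Imult[OF cent_scalar])
lemma Iuminus: "a \<in> I ==> - a \<in> I" using Isc[of a "-1"] by (simp add: sc_simps)
abbreviation valid :: "nat list \<Rightarrow> bool" where "valid u \<equiv> set u \<subseteq> {l<..<m}"

inductive_set Lo :: "nat \<Rightarrow> int gring set" for n where
 ideal: "a \<in> I ==> a \<in> Lo n"
| word: "valid u ==> length u < n ==> a \<in> Lo n ==> sc k * gs (word_perm u) + a \<in> Lo n"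

lemma Lo_add: "a \<in> Lo n ==> b \<in> Lo n ==> a + b \<in> Lo n"
proof (induction rule: Lo.induct)
 case (ideal a)
 from ideal(2,1) show ?case
 proof (induction rule: Lo.induct)
  case (ideal b) thus ?case using Iadd by (intro Lo.ideal) auto
 next
  case (word u b k)
  have "sc k * gs (word_perm u) + (a + b) \<in> Lo n" using word by (intro Lo.word) auto
  thus ?case by (simp add: ac_simps)
 qed
next
 case (word u a k)
 have "sc k * gs (word_perm u) + (a + b) \<in> Lo n" using word by (intro Lo.word) auto
 thus ?case by (simp add: add.assoc)
qed

lemma Lo_word: "valid u ==> length u < n ==> sc k * gs (word_perm u) \<in> Lo n"
 using Lo.word[OF _ _ Lo.ideal[OF I0], of u n k] by simp

lemma Lo_mono: "a \<in> Lo n ==> n \<le> n' ==> a \<in> Lo n'"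
 by (induction rule: Lo.induct) (auto intro: Lo.ideal Lo.word)

lemma Lo_sc: "a \<in> Lo n ==> sc k * a \<in> Lo n"
proof (induction rule: Lo.induct)
 case (ideal a) thus ?case by (intro Lo.ideal Isc)
next
 case (word u a k')
 have "sc k * (sc k' * gs (word_perm u) + a) = sc (k * k') * gs (word_perm u) + sc k * a"
  by (simp add: sc_simps distrib_left mult.assoc)
 thus ?case using Lo.word[OF word(1,2) word(4), of "k * k'"] by simp
qed

lemma Lo_sw: "l < i ==> i < m ==> a \<in> Lo n ==> sw i * a \<in> Lo (Suc n)"
proof -
 assume i: "l < i" "i < m"
 assume "a \<in> Lo n"
 thus ?thesis
 proof (induction rule: Lo.induct)
  case (ideal a)
  thus ?case by (intro Lo.ideal Imult sw_cent i)
 next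
  case (word u a k)
  have "sw i * (sc k * gs (word_perm u) + a) = sc k * gs (word_perm (i # u)) + sw i * a"
   by (simp add: distrib_left sc_left gs_mult)
  moreover have "sc k * gs (word_perm (i # u)) + sw i * a \<in> Lo (Suc n)"
   by (rule Lo.word) (use word i in auto)
  ultimately show ?case by simp
 qed
qed

lemma jm_sw_swap:
 assumes "1 \<le> i" obtains e where "jm j * sw i = sw i * jm (transpose i (Suc i) j) + (sc e :: int gring)"
proof -
 consider "j = i" | "j = Suc i" | "j \<noteq> i" "j \<noteq> Suc i" by blast
 thus ?thesis
 proof cases
  case 1
  hence "jm j * sw i = sw i * jm (transpose i (Suc i) j) + sc (-1)"
   using sw_jm_Suc[OF assms, where 'r = int] by (simp add: sc_simps)
  thus ?thesis using that by blast
 next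
  case 2
  hence "jm j * sw i = sw i * jm (transpose i (Suc i) j) + sc 1"
   using sw_jm[OF assms, where 'r = int] by (simp add: sc_simps)
  thus ?thesis using that by blast
 next
  case 3
  hence "jm j * sw i = sw i * jm (transpose i (Suc i) j) + sc 0"
   using sw_jm_other[OF _ _ assms, of j, where 'r = int] by (simp add: sc_simps)
  thus ?thesis using that by blast
 qed
qed

text \<open>Moving a Jucys-Murphy element past a letter permutes its index by that letter and leaves
  a scalar multiple of a shorter word. At the end it meets the unit and becomes an eigenvalue modulo
  I. So the action is triangular with permuted eigenvalues.\<close>

lemma jm_word: assumes "valid u" "l < j" "j \<le> m"
 shows "jm j * gs (word_perm u) - sc (w (nfun (- word_perm u) j)) * gs (word_perm u) \<in> Lo (length u)"
 using assms
proof (induction u arbitrary: j)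
 case Nil
 thus ?case using jmI[of j] by (simp add: Lo.ideal)
next
 case (Cons i u)
 let ?j = "transpose i (Suc i) j"
 have i: "l < i" "i < m" "1 \<le> i" using Cons.prems by auto
 have j: "l < ?j" "?j \<le> m" using i Cons.prems by (auto simp: transpose_def)
 obtain e where e: "jm j * sw i = sw i * jm ?j + sc e" using jm_sw_swap[OF i(3)] .
 let ?U = "gs (word_perm u) :: int gring" let ?w = "w (nfun (- word_perm u) ?j)"
 have IH: "jm ?j * ?U - sc ?w * ?U \<in> Lo (length u)" using Cons.IH[of ?j] Cons.prems j by simp
 have wj: "nfun (- word_perm (i # u)) j = nfun (- word_perm u) ?j" by (simp add: minus_add)
 have "jm j * gs (word_perm (i # u)) = jm j * sw i * ?U" by (simp add: gs_mult mult.assoc)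
 also have "\<dots> = sw i * (jm ?j * ?U) + sc e * ?U" by (simp add: e distrib_right mult.assoc)
 finally have "jm j * gs (word_perm (i # u)) - sc ?w * gs (word_perm (i # u))
   = sw i * (jm ?j * ?U - sc ?w * ?U) + sc e * ?U" by (simp add: right_diff_distrib sc_left gs_mult)
 moreover have "sw i * (jm ?j * ?U - sc ?w * ?U) + sc e * ?U \<in> Lo (Suc (length u))"
  using Lo_sw[OF i(1,2) IH] Cons.prems by (intro Lo_add Lo_word) auto
 ultimately show ?case unfolding wj by simp
qed

lemma Lo_jm: assumes j: "l < j" "j \<le> m" and a: "a \<in> Lo n" shows "jm j * a \<in> Lo n" using a
proof (induction rule: Lo.induct)
 case (ideal a)
 thus ?case by (intro Lo.ideal Imult jm_cent_le j)
next
 case (word u a k)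
 let ?U = "gs (word_perm u) :: int gring" let ?w = "w (nfun (- word_perm u) j)"
 have "jm j * ?U - sc ?w * ?U \<in> Lo n" using Lo_mono[OF jm_word[OF word(1) j]] word(2) by simp
 hence "(jm j * ?U - sc ?w * ?U) + sc ?w * ?U \<in> Lo n" using word by (intro Lo_add Lo_word)
 hence "sc k * (jm j * ?U) \<in> Lo n" by (intro Lo_sc) simp
 hence "sc k * (jm j * ?U) + jm j * a \<in> Lo n" using word(4) by (rule Lo_add)
 thus ?case by (simp add: distrib_left sc_left)
qed

lemma Lo_centre: assumes z: "z \<in> cent l l" and a: "a \<in> Lo n" shows "z * a \<in> Lo n" using a
proof (induction rule: Lo.induct)
 case (ideal a)
 moreover have "z \<in> cent l m" using z cent_mono2[OF lm] by blast
 ultimately show ?case by (intro Lo.ideal Imult)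
next
 case (word u a k)
 let ?U = "gs (word_perm u) :: int gring"
 have U: "?U \<in> cent l m" by (rule word_perm_cent[OF word(1)])
 obtain s where s: "z - sc s \<in> I" using centreI[OF z] by blast
 have "z * ?U = ?U * z" by (rule cent_commute[OF U cent_galg[OF z]])
 also have "\<dots> = sc s * ?U + ?U * (z - sc s)" by (simp add: right_diff_distrib sc_comm)
 finally have "z * ?U \<in> Lo n" using Lo.word[OF word(1,2) Lo.ideal[OF Imult[OF U s]], of s] by simp
 hence "sc k * (z * ?U) + z * a \<in> Lo n" using word(4) by (intro Lo_add Lo_sc)
 thus ?case by (simp add: distrib_left sc_left)
qed

lemma cgen_Lo: "c \<in> cgen l m ==> a \<in> Lo n ==> \<exists>n'. c * a \<in> Lo n'"
proof (induction arbitrary: a n rule: cgen.induct)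
 case (centre z) thus ?case using Lo_centre by blast
next
 case (adjacent i) thus ?case using Lo_sw by blast
next
 case (murphy j) thus ?case using Lo_jm by blast
next
 case (add c d)
 obtain n1 n2 where "c * a \<in> Lo n1" "d * a \<in> Lo n2" using add by blast
 hence "c * a \<in> Lo (max n1 n2)" "d * a \<in> Lo (max n1 n2)" using Lo_mono by (meson max.cobounded1 max.cobounded2)+
 hence "(c + d) * a \<in> Lo (max n1 n2)" using Lo_add by (simp add: distrib_right)
 thus ?case by blast
next
 case (uminus c)
 then obtain n1 where "c * a \<in> Lo n1" by blast
 hence "sc (-1) * (c * a) \<in> Lo n1" by (rule Lo_sc)
 thus ?case by (auto simp: sc_simps)
next
 case (mult c d)
 thus ?case by (metis mult.assoc)
qed

lemma cent_Lo: assumes "c \<in> cent l m" obtains n where "c \<in> Lo n"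
proof -
 have "1 \<in> Lo 1" using Lo_word[of "[]" 1 1] by (simp add: sc_simps)
 thus ?thesis using cgen_Lo[of c 1 1] cent_subset_cgen[OF lm] assms that by auto
qed

definition top_rep :: "nat list set \<Rightarrow> nat \<Rightarrow> int gring \<Rightarrow> bool" where
 "top_rep W n c \<longleftrightarrow> finite W \<and> (\<forall>u\<in>W. valid u \<and> length u = n) \<and>
   (\<exists>k. c - (\<Sum>u\<in>W. sc (k u) * gs (word_perm u)) \<in> Lo n)"

lemma Lo_top_rep: "c \<in> Lo (Suc n) ==> \<exists>W. top_rep W n c"
proof (induction rule: Lo.induct)
 case (ideal a)
 hence "top_rep {} n a" by (simp add: top_rep_def Lo.ideal)
 thus ?case by blast
next
 case (word u a k)
 then obtain W k' where W: "finite W" "\<forall>u\<in>W. valid u \<and> length u = n"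
  "a - (\<Sum>u\<in>W. sc (k' u) * gs (word_perm u)) \<in> Lo n" unfolding top_rep_def by blast
 show ?case
 proof (cases "length u < n")
  case True
  have "sc k * gs (word_perm u) + (a - (\<Sum>u\<in>W. sc (k' u) * gs (word_perm u))) \<in> Lo n"
   by (rule Lo.word[OF word(1) True W(3)])
  hence "top_rep W n (sc k * gs (word_perm u) + a)"
   unfolding top_rep_def using W by (auto simp: add_diff_eq)
  thus ?thesis by blast
 next
  case False
  define k0 where "k0 = (\<lambda>v. if v \<in> W then k' v else 0)"
  define k1 where "k1 = k0(u := k0 u + k)"
  have "(\<Sum>v\<in>insert u W. sc (k1 v) * gs (word_perm v)) =
    (\<Sum>v\<in>insert u W. sc (k0 v) * gs (word_perm v)) + sc k * (gs (word_perm u) :: int gring)"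
   using W(1) by (simp add: sum.insert_remove k1_def sc_simps distrib_right)
  also have "(\<Sum>v\<in>insert u W. sc (k0 v) * gs (word_perm v)) = (\<Sum>v\<in>W. sc (k' v) * (gs (word_perm v) :: int gring))"
   using W(1) by (intro sum.mono_neutral_cong_right) (auto simp: k0_def sc_simps)
  finally have "(sc k * gs (word_perm u) + a) - (\<Sum>v\<in>insert u W. sc (k1 v) * gs (word_perm v)) \<in> Lo n"
   using W(3) by (simp add: algebra_simps)
  hence "top_rep (insert u W) n (sc k * gs (word_perm u) + a)"
   unfolding top_rep_def using W False word(1,2) by auto
  thus ?thesis by blast
 qed
qed

definition weight_vec :: "int gring \<Rightarrow> bool" where
 "weight_vec c \<longleftrightarrow> c \<in> cent l m \<and> (\<forall>j. l < j \<and> j \<le> m \<longrightarrow> (jm j - sc (w j)) * c \<in> I)"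

lemma descend: assumes d: "\<not> p dvd d" and c: "c \<in> cent l m" and b: "sc d * c - sc b \<in> I"
 shows "\<exists>b. c - sc b \<in> I"
proof -
 have "coprime d p" using d p by (metis coprime_commute prime_imp_coprime)
 then obtain x y where "x * d + y * p = 1" using bezout_int[of d p] by auto
 hence xy: "x * d + p * y = 1" by (simp add: mult.commute)
 have "c = sc (x * d + p * y) * c" unfolding xy by (simp add: sc_simps)
 also have "\<dots> = sc x * (sc d * c) + sc p * (sc y * c)"
  by (simp only: sc_simps(1,3) distrib_right mult.assoc)
 finally have "c - sc (x * b) = sc x * (sc d * c - sc b) + sc p * (sc y * c)"
  by (metis (no_types, lifting) add_diff_eq diff_add_eq right_diff_distrib sc_simps(3))
 moreover have "sc x * (sc d * c - sc b) + sc p * (sc y * c) \<in> I"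
  using b c by (intro Iadd Isc pI cent_mult cent_scalar)
 ultimately show ?thesis by metis
qed

text \<open>Suppose a leading word u permutes some j nontrivially, and let r be the eigenvalue of
  \<open>jm j\<close> at u. Multiplication by \<open>jm j - sc r\<close> removes u from the leading
  part, whereas on a weight vector it is the scalar d = w j - r modulo I. As p does not divide d,
  induction on the set of leading words applies to d c, and \<open>descend\<close> returns to
  c.\<close>

lemma weight_scalar: assumes "c \<in> Lo n" "weight_vec c" shows "\<exists>b. c - sc b \<in> I" using assms
proof (induction n arbitrary: c)
 case 0
 from 0(1) have "c \<in> I" by (induction rule: Lo.induct) auto
 hence "c - sc 0 \<in> I" by (simp add: sc_simps)
 thus ?case by blast
next
 case (Suc n)
 obtain W where "top_rep W n c" using Lo_top_rep[OF Suc.prems(1)] by blast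
 thus ?case using Suc.prems(2)
 proof (induction "card W" arbitrary: W c rule: less_induct)
  case less
  from less.prems(1) obtain k where W: "finite W" "\<And>u. u \<in> W ==> valid u \<and> length u = n"
   and k: "c - (\<Sum>u\<in>W. sc (k u) * gs (word_perm u)) \<in> Lo n" unfolding top_rep_def by blast
  show ?case
  proof (cases "W = {}")
   case True
   hence "c \<in> Lo n" using k by simp
   thus ?thesis using Suc.IH less.prems(2) by blast
  next
   case False
   then obtain u where u: "u \<in> W" by blast
   have split: "(\<Sum>v\<in>W. f v) = f u + (\<Sum>v\<in>W - {u}. f v)" for f :: "nat list \<Rightarrow> int gring"
    by (rule sum.remove[OF W(1) u])
   have card: "card (W - {u}) < card W" using W(1) u by (rule card_Diff1_less)
   show ?thesis
   proof (cases "word_perm u = 0")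
    case True
    show ?thesis
    proof (cases "n = 0")
     case n0: True
     have "v = []" if "v \<in> W" for v using W(2)[OF that] n0 by simp
     hence "W = {u}" using u by auto
     hence "c - sc (k u) \<in> Lo 0" using k True n0 by simp
     hence "c - sc (k u) \<in> I" by (induction rule: Lo.induct) auto
     thus ?thesis by blast
    next
     case False
     \<comment> \<open>A word of positive length representing the identity equals the empty word, so
       it belongs to the lower part of the filtration.\<close>
     have "sc (k u) * gs (word_perm []) + (c - (\<Sum>u\<in>W. sc (k u) * gs (word_perm u))) \<in> Lo n"
      using False by (intro Lo.word k) auto
     hence "c - (\<Sum>v\<in>W - {u}. sc (k v) * gs (word_perm v)) \<in> Lo n"
      unfolding split by (simp add: True algebra_simps)
     hence "top_rep (W - {u}) n c" unfolding top_rep_def using W by blast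
     thus ?thesis using less.hyps[OF card] less.prems(2) by blast
    qed
   next
    case False
    let ?g = "- word_perm u"
    have "?g \<noteq> 0" using False by simp
    then obtain j where j: "nfun ?g j \<noteq> j" by (metis nperm_eqI nfun_0 id_apply)
    have perm: "nfun ?g permutes {l<..m}"
     using word_perm_permutes[of u l m] W(2)[OF u] by (simp add: nfun_minus permutes_inv)
    have jj: "l < j" "j \<le> m" using permutes_not_in[OF perm] j by force+
    have "nfun ?g j \<in> {l<..m}" using permutes_in_image[OF perm] jj by simp
    hence nd: "\<not> p dvd w j - w (nfun ?g j)" using w[of j "nfun ?g j"] jj j by auto
    define r where "r = w (nfun ?g j)"
    define d where "d = w j - r"
    have wv: "c \<in> cent l m" "(jm j - sc (w j)) * c \<in> I" using less.prems(2) jj unfolding weight_vec_def by auto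
    have dc: "sc d * c = (jm j - sc r) * c - (jm j - sc (w j)) * c"
     by (simp add: d_def sc_simps left_diff_distrib)
    let ?lo = "c - (\<Sum>u\<in>W. sc (k u) * gs (word_perm u))"
    define k' where "k' = (\<lambda>v. k v * (w (nfun (- word_perm v) j) - r))"
    let ?t = "\<lambda>v. jm j * gs (word_perm v) - sc (w (nfun (- word_perm v) j)) * gs (word_perm v)"
    have t: "?t v \<in> Lo n" if "v \<in> W" for v using jm_word[of v j] W(2)[OF that] jj by simp
    have "(jm j - sc r) * c = (jm j - sc r) * ?lo + (\<Sum>v\<in>W. (jm j - sc r) * (sc (k v) * gs (word_perm v)))"
     by (simp add: right_diff_distrib sum_distrib_left)
    also have "(\<Sum>v\<in>W. (jm j - sc r) * (sc (k v) * gs (word_perm v)))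
      = (\<Sum>v\<in>W. sc (k v) * ?t v + sc (k' v) * gs (word_perm v))"
    proof (rule sum.cong[OF refl])
     fix v
     have "(jm j - sc r) * (sc (k v) * gs (word_perm v)) = sc (k v) * (jm j * gs (word_perm v) - sc r * gs (word_perm v))"
      by (simp only: sc_left left_diff_distrib)
     also have "\<dots> = sc (k v) * ?t v + sc (k' v) * gs (word_perm v)"
      by (simp add: k'_def sc_simps left_diff_distrib right_diff_distrib mult.assoc)
     finally show "(jm j - sc r) * (sc (k v) * gs (word_perm v)) = sc (k v) * ?t v + sc (k' v) * gs (word_perm v)" .
    qed
    also have "\<dots> = (\<Sum>v\<in>W. sc (k v) * ?t v) + (\<Sum>v\<in>W - {u}. sc (k' v) * gs (word_perm v))"
     unfolding sum.distrib split[of "\<lambda>v. sc (k' v) * gs (word_perm v)"] by (simp add: k'_def r_def sc_simps)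
    finally have e: "sc d * c - (\<Sum>v\<in>W - {u}. sc (k' v) * gs (word_perm v))
      = (jm j - sc r) * ?lo + (\<Sum>v\<in>W. sc (k v) * ?t v) + (- ((jm j - sc (w j)) * c))"
     unfolding dc by simp
    have "(jm j - sc r) * ?lo = jm j * ?lo + sc (- r) * ?lo" by (simp add: left_diff_distrib sc_simps)
    hence l1: "(jm j - sc r) * ?lo \<in> Lo n" using Lo_add[OF Lo_jm[OF jj k] Lo_sc[OF k, of "- r"]] by simp
    have l2: "(\<Sum>v\<in>V. sc (k v) * ?t v) \<in> Lo n" if "V \<subseteq> W" for V
     using finite_subset[OF that W(1)] that
    proof (induction V rule: finite_induct)
     case empty thus ?case by (simp add: Lo.ideal I0)
    next
     case (insert v V)
     thus ?case using Lo_add[OF Lo_sc[OF t, of v "k v"]] by simp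
    qed
    have l3: "- ((jm j - sc (w j)) * c) \<in> Lo n" using Iuminus[OF wv(2)] by (rule Lo.ideal)
    have "top_rep (W - {u}) n (sc d * c)" unfolding top_rep_def
    proof (intro conjI exI)
     show "sc d * c - (\<Sum>v\<in>W - {u}. sc (k' v) * gs (word_perm v)) \<in> Lo n"
      unfolding e by (rule Lo_add[OF Lo_add[OF l1 l2[OF subset_refl]] l3])
    qed (use W in auto)
    moreover have "weight_vec (sc d * c)" unfolding weight_vec_def
    proof (intro conjI allI impI)
     show "sc d * c \<in> cent l m" using wv(1) by (intro cent_mult cent_scalar)
     fix i assume "l < i \<and> i \<le> m"
     hence "(jm i - sc (w i)) * c \<in> I" using less.prems(2) unfolding weight_vec_def by blast
     thus "(jm i - sc (w i)) * (sc d * c) \<in> I" unfolding sc_left by (rule Isc)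
    qed
    ultimately have "\<exists>b. sc d * c - sc b \<in> I" using less.hyps[OF card] by blast
    thus ?thesis using descend[of d c] nd wv(1) unfolding d_def r_def by blast
   qed
  qed
 qed
qed

text \<open>An element commuting with the Jucys-Murphy elements modulo I has the same weight as the
  unit, because \<open>jm j - sc (w j)\<close> can be moved to its right, where it lies in the left
  ideal. This weight occurs only at the identity word.\<close>

theorem commuting_scalar:
 assumes c: "c \<in> cent l m" and com: "\<And>j. l < j ==> j \<le> m ==> jm j * c - c * jm j \<in> I"
 shows "\<exists>b. c - sc b \<in> I"
proof -
 have "(jm j - sc (w j)) * c \<in> I" if "l < j" "j \<le> m" for j
 proof -
  have "(jm j - sc (w j)) * c = (jm j * c - c * jm j) + c * (jm j - sc (w j))"
   by (simp add: left_diff_distrib right_diff_distrib sc_comm)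
  thus ?thesis using Iadd[OF com[OF that] Imult[OF c jmI[OF that]]] by simp
 qed
 hence "weight_vec c" using c by (simp add: weight_vec_def)
 thus ?thesis using cent_Lo[OF c] weight_scalar by metis
qed

end

type_synonym tvec = "(nat \<Rightarrow> nat set) \<Rightarrow>\<^sub>0 int"

section \<open>Integral Specht lattices and equivariant maps\<close>

lemma perm_act_of [simp]: "perm_act \<sigma> (frag_of T) = frag_of (\<lambda>r. \<sigma> ` T r)"
 by (simp add: perm_act_def)
lemma perm_act_0 [simp]: "perm_act \<sigma> 0 = 0" by (simp add: perm_act_def)
lemma perm_act_add: "perm_act \<sigma> (x + y) = perm_act \<sigma> x + perm_act \<sigma> y"
 by (simp add: perm_act_def frag_extend_add)
lemma perm_act_diff: "perm_act \<sigma> (x - y) = perm_act \<sigma> x - perm_act \<sigma> y"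
 by (simp add: perm_act_def frag_extend_diff)
lemma perm_act_cmul: "perm_act \<sigma> (frag_cmul c x) = frag_cmul c (perm_act \<sigma> x)"
 by (simp add: perm_act_def frag_extend_cmul)
lemma perm_act_sum: "perm_act \<sigma> (sum f I) = (\<Sum>i\<in>I. perm_act \<sigma> (f i))"
 by (induction I rule: infinite_finite_induct) (simp_all add: perm_act_add)
lemma frag_all_induct [case_names zero one diff]:
 assumes "P 0" "\<And>T. P (frag_of T)" "\<And>x y. P x ==> P y ==> P (x - y)" shows "P x"
 by (rule frag_induction[of x UNIV]) (use assms in auto)

lemma perm_act_comp: "perm_act \<sigma> (perm_act \<tau> x) = perm_act (\<sigma> \<circ> \<tau>) x"
 by (induction x rule: frag_all_induct) (auto simp: perm_act_diff image_comp)

lemma perm_act_id [simp]: "perm_act id x = x"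
 by (induction x rule: frag_all_induct) (auto simp: perm_act_diff)

definition act :: "int gring \<Rightarrow> tvec \<Rightarrow> tvec" where
 "act a x = frag_extend (\<lambda>g. perm_act (nfun g) x) a"

lemma act_0 [simp]: "act 0 x = 0" "act a 0 = 0" by (simp_all add: act_def frag_extend_def)
lemma act_add_left: "act (a + b) x = act a x + act b x" by (simp add: act_def frag_extend_add)
lemma act_diff_left: "act (a - b) x = act a x - act b x" by (simp add: act_def frag_extend_diff)
lemma act_uminus_left: "act (- a) x = - act a x" by (simp add: act_def frag_extend_minus)
lemma act_add_right: "act a (x + y) = act a x + act a y"
 by (simp add: act_def frag_extend_def perm_act_add frag_cmul_distrib2 sum.distrib)
lemma act_cmul: "act a (frag_cmul c x) = frag_cmul c (act a x)"
 by (simp add: act_def frag_extend_def perm_act_cmul frag_cmul_sum mult.commute)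
lemma act_uminus: "act a (- x) = - act a x" using act_cmul[of a "-1" x] by simp
lemma act_diff_right: "act a (x - y) = act a x - act a y"
 using act_add_right[of a x "- y"] act_uminus[of a y] by simp
lemma act_sum_left: "act (sum f I) x = (\<Sum>i\<in>I. act (f i) x)"
 by (induction I rule: infinite_finite_induct) (simp_all add: act_add_left)
lemma act_gs [simp]: "act (gs g) x = perm_act (nfun g) x" by (simp add: act_def)
lemma act_single: "act (single g c) x = frag_cmul c (perm_act (nfun g) x)"
proof -
 have "single g c = frag_cmul c (frag_of g)"
  by (rule poly_mapping_eqI) (simp add: lookup_single when_def)
 thus ?thesis by (simp add: act_def frag_extend_cmul)
qed
lemma act_1 [simp]: "act 1 x = x" using act_gs[of 0 x] by simp

lemma act_mult: "act (a * b) x = act a (act b x)"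
proof (induction a rule: frag_all_induct)
 case (one g)
 show ?case
 proof (induction b rule: frag_all_induct)
  case (one h)
  thus ?case by (simp add: gs_mult perm_act_comp)
 qed (simp_all add: right_diff_distrib act_diff_left perm_act_diff)
qed (simp_all add: left_diff_distrib act_diff_left)

lemma act_sc: "act (sc c * a) x = frag_cmul c (act a x)" by (simp add: act_mult act_single)

text \<open>The form for which tabloids are orthonormal. Its positivity over the integers is the
  source of all nonvanishing and injectivity statements about equivariant maps.\<close>

definition ip :: "('a \<Rightarrow>\<^sub>0 int) \<Rightarrow> ('a \<Rightarrow>\<^sub>0 int) \<Rightarrow> int" where
 "ip x y = (\<Sum>T\<in>keys x. lookup x T * lookup y T)"

lemma ip_superset: assumes "finite A" "keys x \<subseteq> A" shows "ip x y = (\<Sum>T\<in>A. lookup x T * lookup y T)"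
 unfolding ip_def by (rule sum.mono_neutral_left) (use assms in \<open>auto simp: in_keys_iff\<close>)

lemma ip_commute: "ip x y = ip y x" using ip_superset[of "keys x \<union> keys y" x y]
  ip_superset[of "keys x \<union> keys y" y x] by (simp add: mult.commute)

lemma ip_add_left: "ip (x + y) z = ip x z + ip y z"
 using ip_superset[of "keys x \<union> keys y" "x + y" z]
  ip_superset[of "keys x \<union> keys y" x z]
  ip_superset[of "keys x \<union> keys y" y z] keys_add[of x y]
 by (simp add: lookup_add distrib_right sum.distrib)
lemma ip_add_right: "ip z (x + y) = ip z x + ip z y"
 using ip_add_left[of x y z] by (simp add: ip_commute)
lemma ip_0 [simp]: "ip 0 x = 0" "ip x 0 = 0" by (simp_all add: ip_def)
lemma ip_cmul_right: "ip x (frag_cmul c y) = c * ip x y"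
 by (simp add: ip_def sum_distrib_left ac_simps)
lemma ip_cmul_left: "ip (frag_cmul c y) x = c * ip y x"
 using ip_cmul_right[of x c y] by (simp add: ip_commute)
lemma ip_uminus_right: "ip x (- y) = - ip x y" using ip_cmul_right[of x "-1" y] by simp
lemma ip_uminus_left: "ip (- y) x = - ip y x" using ip_cmul_left[of "-1" y x] by simp
lemma ip_diff_left: "ip (x - y) z = ip x z - ip y z"
 using ip_add_left[of x "- y" z] by (simp add: ip_uminus_left)
lemma ip_diff_right: "ip z (x - y) = ip z x - ip z y"
 using ip_add_right[of z x "- y"] by (simp add: ip_uminus_right)
lemma ip_sum_left: "ip (sum f I) z = (\<Sum>i\<in>I. ip (f i) z)"
 by (induction I rule: infinite_finite_induct) (simp_all add: ip_add_left)
lemma ip_sum_right: "ip z (sum f I) = (\<Sum>i\<in>I. ip z (f i))"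
 by (induction I rule: infinite_finite_induct) (simp_all add: ip_add_right)
lemma ip_of: "ip (frag_of T) y = lookup y T" by (simp add: ip_def)
lemma ip_pos: assumes "x \<noteq> 0" shows "0 < ip x x"
proof -
 have "keys x \<noteq> {}" using assms by simp
 thus ?thesis unfolding ip_def
  by (intro sum_pos) (auto simp: in_keys_iff zero_less_mult_iff linorder_neq_iff)
qed

lemma ip_perm: assumes "bij \<sigma>" shows "ip (perm_act \<sigma> x) (perm_act \<sigma> y) = ip x y"
proof (induction x rule: frag_all_induct)
 case (one T)
 show ?case
 proof (induction y rule: frag_all_induct)
  case (one U)
  have "(\<lambda>r. \<sigma> ` T r) = (\<lambda>r. \<sigma> ` U r) \<longleftrightarrow> T = U"
   using inj_image_eq_iff[OF bij_is_inj[OF assms]] by (auto simp: fun_eq_iff)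
  thus ?case by (simp add: ip_of lookup_single when_def)
 qed (simp_all add: perm_act_diff ip_diff_right)
qed (simp_all add: perm_act_diff ip_diff_left)

lemma ip_move: "ip (perm_act (nfun g) x) y = ip x (perm_act (nfun (- g)) y)"
proof -
 have "perm_act (nfun g) (perm_act (nfun (- g)) y) = y"
  using perm_act_comp[of "nfun g" "nfun (- g)" y] nfun_add[of g "- g"] by simp
 thus ?thesis using ip_perm[OF nfun_bij, of g x "perm_act (nfun (- g)) y"] by simp
qed

lemma sum_ge_initial: assumes "finite A" "card A = h"
 shows "\<Sum>{..<h} \<le> \<Sum>(A :: nat set)" "\<Sum>A = \<Sum>{..<h} ==> A = {..<h}"
proof -
 have "\<Sum>{..<h} \<le> \<Sum>A \<and> (\<Sum>A = \<Sum>{..<h} \<longrightarrow> A = {..<h})" using assms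
 proof (induction h arbitrary: A)
  case (Suc h)
  define M where "M = Max A"
  have ne: "A \<noteq> {}" using Suc.prems by auto
  have M: "M \<in> A" unfolding M_def using Suc.prems(1) ne by (rule Max_in)
  have "A \<subseteq> {..M}" unfolding M_def using Suc.prems(1) by auto
  hence "card A \<le> card {..M}" by (intro card_mono) auto
  hence hM: "h \<le> M" using Suc.prems(2) by simp
  have c: "card (A - {M}) = h" using Suc.prems M by simp
  have s: "\<Sum>A = M + \<Sum>(A - {M})" using sum.remove[OF Suc.prems(1) M, of "\<lambda>x. x"] .
  have IH: "\<Sum>{..<h} \<le> \<Sum>(A - {M})" "\<Sum>(A - {M}) = \<Sum>{..<h} ==> A - {M} = {..<h}"
   using Suc.IH[of "A - {M}"] Suc.prems(1) c by auto
  show ?case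
  proof (intro conjI impI)
   show "\<Sum>{..<Suc h} \<le> \<Sum>A" using s hM IH(1) by simp
   assume "\<Sum>A = \<Sum>{..<Suc h}"
   hence "\<Sum>(A - {M}) = \<Sum>{..<h}" "M = h" using s hM IH(1) by simp_all
   hence "A = insert h {..<h}" using IH(2) M by blast
   thus "A = {..<Suc h}" by auto
  qed
 qed simp
 thus "\<Sum>{..<h} \<le> \<Sum>A" "\<Sum>A = \<Sum>{..<h} ==> A = {..<h}" by auto
qed

definition sg :: "nperm \<Rightarrow> int" where "sg g = sign (nfun g)"

lemma syms_permutation: "g \<in> syms n ==> permutation (nfun g)"
 using permutation_permutes unfolding syms_def by blast

lemma sg_add: "g \<in> syms n ==> h \<in> syms n ==> sg (g + h) = sg g * sg h"
 unfolding sg_def nfun_add by (rule sign_compose) (auto intro: syms_permutation)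

lemma sg_0 [simp]: "sg 0 = 1" by (simp add: sg_def)
lemma sg_sg [simp]: "sg g * sg g = 1" by (simp add: sg_def sign_def)
lemma sg_minus: "g \<in> syms n ==> sg (- g) = sg g"
 by (metis mult.commute mult_cancel_right1 right_minus sg_0 sg_add sg_sg syms_minus mult.left_neutral mult.assoc)
lemma sg_tr: "a \<noteq> b ==> sg (tr a b) = - 1" by (simp add: sg_def sign_swap_id)

lemma frag_eq_uminus: "(x :: 'a \<Rightarrow>\<^sub>0 int) = - x ==> x = 0"
proof (rule poly_mapping_eqI)
 fix k assume "x = - x"
 hence "lookup x k = - lookup x k" by (metis lookup_uminus)
 thus "lookup x k = lookup 0 k" by simp
qed

locale shape = fixes \<mu> :: "nat \<Rightarrow> nat" and n :: nat
 assumes part: "is_partition \<mu>" and size: "n = partition_size \<mu>"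
begin

abbreviation D where "D \<equiv> diagram \<mu>"

lemma finD [simp]: "finite D" by (rule finite_diagram[OF part])

lemma tableau_iff: "t \<in> tableaux \<mu> \<longleftrightarrow> bij_betw t D {1..n}" by (simp add: tableaux_def size)

lemma tableau_exists: "tableaux \<mu> \<noteq> {}"
proof -
 have "card D = card {1..n}" by (simp add: size partition_size_def)
 then obtain t where "bij_betw t D {1..n}" using finite_same_card_bij[OF finD, of "{1..n}"] by auto
 thus ?thesis using tableau_iff by blast
qed

lemma tableau_inj: "t \<in> tableaux \<mu> ==> x \<in> D ==> y \<in> D ==> t x = t y \<longleftrightarrow> x = y"
 unfolding tableau_iff bij_betw_def by (meson inj_on_eq_iff)
lemma tableau_range: "t \<in> tableaux \<mu> ==> x \<in> D ==> t x \<in> {1..n}"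
 unfolding tableau_iff by (rule bij_betw_apply)
lemma tableau_surj: "t \<in> tableaux \<mu> ==> a \<in> {1..n} ==> \<exists>x\<in>D. t x = a"
 unfolding tableau_iff bij_betw_def by (metis imageE)

lemma tableau_perm: "t \<in> tableaux \<mu> ==> g \<in> syms n ==> nfun g \<circ> t \<in> tableaux \<mu>"
 unfolding tableau_iff syms_def by (auto intro: bij_betw_trans permutes_imp_bij)

lemma tabloid_perm: "tabloid \<mu> (nfun g \<circ> t) = (\<lambda>r. nfun g ` tabloid \<mu> t r)"
 by (simp add: tabloid_def image_comp)

abbreviation tb :: "(nat \<times> nat \<Rightarrow> nat) \<Rightarrow> tvec" where "tb t \<equiv> frag_of (tabloid \<mu> t)"

lemma tb_perm: "perm_act (nfun g) (tb t) = tb (nfun g \<circ> t)" by (simp add: tabloid_perm)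

lemma tableau_related: assumes "t \<in> tableaux \<mu>" "s \<in> tableaux \<mu>"
 obtains g where "g \<in> syms n" "\<And>x. x \<in> D ==> s x = nfun g (t x)"
proof -
 let ?f = "\<lambda>a. if a \<in> {1..n} then s (the_inv_into D t a) else a"
 have t: "bij_betw t D {1..n}" and s: "bij_betw s D {1..n}" using assms tableau_iff by auto
 have "bij_betw (s \<circ> the_inv_into D t) {1..n} {1..n}"
  using bij_betw_trans[OF bij_betw_the_inv_into[OF t] s] .
 hence "bij_betw ?f {1..n} {1..n}" by (rule bij_betw_cong[THEN iffD1, rotated]) auto
 hence p: "?f permutes {1..n}" by (rule bij_imp_permutes) auto
 let ?g = "Nperm ?f"
 have g: "nfun ?g = ?f" using permutes_bij[OF p] by simp
 show ?thesis
 proof (rule that[of ?g])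
  show "?g \<in> syms n" unfolding syms_def g mem_Collect_eq by (rule p)
  fix x assume x: "x \<in> D"
  thus "s x = nfun ?g (t x)" unfolding g using tableau_range[OF assms(1) x]
   by (simp add: the_inv_into_f_f[OF bij_betw_imp_inj_on[OF t] x])
 qed
qed

lemma tabloid_cong: "(\<And>x. x \<in> D ==> s x = t x) ==> tabloid \<mu> s = tabloid \<mu> t"
 unfolding tabloid_def by (intro ext image_cong) auto

definition cstab :: "(nat \<times> nat \<Rightarrow> nat) \<Rightarrow> nperm set" where
 "cstab t = {g \<in> syms n. nfun g \<in> column_stabiliser \<mu> t}"

lemma finite_cstab [simp]: "finite (cstab t)" by (simp add: cstab_def)
lemma cstab_syms: "g \<in> cstab t ==> g \<in> syms n" by (simp add: cstab_def)

lemma cstab_iff: assumes t: "t \<in> tableaux \<mu>"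
 shows "g \<in> cstab t \<longleftrightarrow> g \<in> syms n \<and> (\<forall>x\<in>D. \<exists>y\<in>D. snd y = snd x \<and> nfun g (t x) = t y)"
proof
 assume g: "g \<in> cstab t"
 hence c: "nfun g ` t ` {x \<in> D. snd x = c} = t ` {x \<in> D. snd x = c}" for c
  by (simp add: cstab_def column_stabiliser_def)
 have "\<exists>y\<in>D. snd y = snd x \<and> nfun g (t x) = t y" if "x \<in> D" for x
 proof -
  have "nfun g (t x) \<in> nfun g ` t ` {y \<in> D. snd y = snd x}" using that by blast
  thus ?thesis unfolding c by auto
 qed
 thus "g \<in> syms n \<and> (\<forall>x\<in>D. \<exists>y\<in>D. snd y = snd x \<and> nfun g (t x) = t y)" using g cstab_syms by blast
next
 assume g: "g \<in> syms n \<and> (\<forall>x\<in>D. \<exists>y\<in>D. snd y = snd x \<and> nfun g (t x) = t y)"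
 have "nfun g ` t ` {x \<in> D. snd x = c} = t ` {x \<in> D. snd x = c}" for c
 proof (rule endo_inj_surj)
  show "nfun g ` t ` {x \<in> D. snd x = c} \<subseteq> t ` {x \<in> D. snd x = c}"
  proof
   fix z assume "z \<in> nfun g ` t ` {x \<in> D. snd x = c}"
   then obtain x where x: "x \<in> D" "snd x = c" "z = nfun g (t x)" by blast
   then obtain y where "y \<in> D" "snd y = c" "z = t y" using g by metis
   thus "z \<in> t ` {x \<in> D. snd x = c}" by blast
  qed
 qed (auto simp: inj_on_def)
 moreover have "nfun g \<in> carrier (sym_group (partition_size \<mu>))"
  using g by (simp add: sym_group_def syms_def size)
 ultimately show "g \<in> cstab t" using g by (simp add: cstab_def column_stabiliser_def)
qed

lemma cstab_0 [simp]: "t \<in> tableaux \<mu> ==> 0 \<in> cstab t" by (auto simp: cstab_iff)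
lemma cstab_add: assumes t: "t \<in> tableaux \<mu>" and g: "g \<in> cstab t" "h \<in> cstab t" shows "g + h \<in> cstab t"
 unfolding cstab_iff[OF t]
proof (intro conjI ballI)
 show "g + h \<in> syms n" using g cstab_syms by auto
 fix x assume "x \<in> D"
 then obtain y where y: "y \<in> D" "snd y = snd x" "nfun h (t x) = t y" using g(2) cstab_iff[OF t] by blast
 then obtain z where "z \<in> D" "snd z = snd y" "nfun g (t y) = t z" using g(1) cstab_iff[OF t] by blast
 thus "\<exists>y\<in>D. snd y = snd x \<and> nfun (g + h) (t x) = t y" using y by (intro bexI[of _ z]) simp_all
qed

lemma cstab_bij: assumes t: "t \<in> tableaux \<mu>" and g: "g \<in> cstab t"
 shows "bij_betw (\<lambda>h. g + h) (cstab t) (cstab t)" "bij_betw (\<lambda>h. h + g) (cstab t) (cstab t)"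
proof -
 have "(\<lambda>h. g + h) ` cstab t = cstab t"
  by (rule endo_inj_surj) (use cstab_add[OF t g] in \<open>auto simp: inj_on_def\<close>)
 thus "bij_betw (\<lambda>h. g + h) (cstab t) (cstab t)" by (simp add: bij_betw_def inj_on_def)
 have "(\<lambda>h. h + g) ` cstab t = cstab t"
  by (rule endo_inj_surj) (use cstab_add[OF t _ g] in \<open>auto simp: inj_on_def\<close>)
 thus "bij_betw (\<lambda>h. h + g) (cstab t) (cstab t)" by (simp add: bij_betw_def inj_on_def)
qed

definition kap :: "(nat \<times> nat \<Rightarrow> nat) \<Rightarrow> int gring" where
 "kap t = (\<Sum>g\<in>cstab t. single g (sg g))"

lemma kap_galg: "kap t \<in> galg n"
 unfolding kap_def by (intro galg_sum galg_gs) (simp add: cstab_syms)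

lemma act_kap: "act (kap t) x = (\<Sum>g\<in>cstab t. frag_cmul (sg g) (perm_act (nfun g) x))"
 by (simp add: kap_def act_sum_left act_single)

lemma polytabloid_kap: "polytabloid \<mu> t = act (kap t) (tb t)"
proof -
 have "(\<Sum>\<pi>\<in>nfun ` cstab t. frag_cmul (sign \<pi>) (frag_of (tabloid \<mu> (\<pi> \<circ> t)))) =
  (\<Sum>g\<in>cstab t. frag_cmul (sg g) (tb (nfun g \<circ> t)))"
  by (subst sum.reindex) (auto simp: inj_on_def nfun_inject sg_def)
 moreover have "nfun ` cstab t = column_stabiliser \<mu> t"
 proof
  show "column_stabiliser \<mu> t \<subseteq> nfun ` cstab t"
  proof
   fix \<pi> assume \<pi>: "\<pi> \<in> column_stabiliser \<mu> t"
   hence p: "\<pi> permutes {1..n}" by (simp add: column_stabiliser_def sym_group_def size)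
   hence "nfun (Nperm \<pi>) = \<pi>" by (intro nfun_Nperm permutes_bij)
   thus "\<pi> \<in> nfun ` cstab t" using \<pi> p by (intro image_eqI[of _ _ "Nperm \<pi>"]) (simp_all add: cstab_def syms_def)
  qed
 qed (auto simp: cstab_def)
 ultimately show ?thesis by (simp add: polytabloid_def act_kap tabloid_perm)
qed

lemma kap_absorb: assumes t: "t \<in> tableaux \<mu>" and g: "g \<in> cstab t"
 shows "gs g * kap t = sc (sg g) * kap t" "kap t * gs g = sc (sg g) * kap t"
proof -
 have e: "single h (sg h') = sc (sg g) * single h (sg h)" if "sg h = sg g * sg h'" for h h'
 proof -
  have "sg g * sg h = sg h'" unfolding that by (simp add: mult.assoc[symmetric])
  thus ?thesis by (simp add: mult_single)
 qed
 have "gs g * kap t = (\<Sum>h\<in>cstab t. single (g + h) (sg h))"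
  by (simp add: kap_def sum_distrib_left mult_single)
 also have "\<dots> = (\<Sum>h\<in>cstab t. sc (sg g) * single (g + h) (sg (g + h)))"
  by (rule sum.cong[OF refl], rule e) (rule sg_add; use g cstab_syms in blast)
 also have "\<dots> = (\<Sum>h\<in>cstab t. sc (sg g) * single h (sg h))"
  by (rule sum.reindex_bij_betw[OF cstab_bij(1)[OF t g]])
 finally show "gs g * kap t = sc (sg g) * kap t" by (simp add: kap_def sum_distrib_left)
 have "kap t * gs g = (\<Sum>h\<in>cstab t. single (h + g) (sg h))"
  by (simp add: kap_def sum_distrib_right mult_single)
 also have "\<dots> = (\<Sum>h\<in>cstab t. sc (sg g) * single (h + g) (sg (h + g)))"
 proof (rule sum.cong[OF refl], rule e)
  fix h assume "h \<in> cstab t"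
  hence "sg (h + g) = sg h * sg g" by (intro sg_add[of _ n]) (use g cstab_syms in blast)+
  thus "sg (h + g) = sg g * sg h" by (simp add: mult.commute)
 qed
 also have "\<dots> = (\<Sum>h\<in>cstab t. sc (sg g) * single h (sg h))"
  by (rule sum.reindex_bij_betw[OF cstab_bij(2)[OF t g]])
 finally show "kap t * gs g = sc (sg g) * kap t" by (simp add: kap_def sum_distrib_left)
qed

lemma act_kap_perm: assumes t: "t \<in> tableaux \<mu>" and g: "g \<in> cstab t"
 shows "act (kap t) (perm_act (nfun g) x) = frag_cmul (sg g) (act (kap t) x)"
  "perm_act (nfun g) (act (kap t) x) = frag_cmul (sg g) (act (kap t) x)"
 using kap_absorb[OF t g] by (metis act_gs act_mult act_sc)+

lemma polytabloid_perm: "t \<in> tableaux \<mu> ==> g \<in> cstab t ==>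
  perm_act (nfun g) (polytabloid \<mu> t) = frag_cmul (sg g) (polytabloid \<mu> t)"
 unfolding polytabloid_kap by (rule act_kap_perm)

text \<open>A node is determined by its row and its column, so two column permutations of t that
  agree on rows agree.\<close>

lemma cstab_tabloid_inj: assumes t: "t \<in> tableaux \<mu>" and g: "g \<in> cstab t" "h \<in> cstab t"
  and e: "tabloid \<mu> (nfun g \<circ> t) = tabloid \<mu> (nfun h \<circ> t)" shows "g = h"
proof (rule nperm_eqI)
 fix a
 show "nfun g a = nfun h a"
 proof (cases "a \<in> {1..n}")
  case True
  then obtain x where x: "x \<in> D" "t x = a" using tableau_surj[OF t] by blast
  have "nfun g a \<in> tabloid \<mu> (nfun g \<circ> t) (fst x)" using x unfolding tabloid_def by auto
  hence "nfun g a \<in> tabloid \<mu> (nfun h \<circ> t) (fst x)" unfolding e .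
  then obtain x' where x': "x' \<in> D" "fst x' = fst x" "nfun g a = nfun h (t x')" unfolding tabloid_def by auto
  obtain y where y: "y \<in> D" "snd y = snd x" "nfun g (t x) = t y" using g(1) x cstab_iff[OF t] by blast
  obtain y' where y': "y' \<in> D" "snd y' = snd x'" "nfun h (t x') = t y'" using g(2) x' cstab_iff[OF t] by blast
  have "t y = t y'" using y y' x x' by simp
  hence "y = y'" using tableau_inj[OF t] y y' by simp
  hence "x' = x" using y y' x' by (simp add: prod_eq_iff)
  thus ?thesis using x x' by simp
 next
  case False
  thus ?thesis using g cstab_syms syms_out by metis
 qed
qed

lemma lookup_polytabloid: assumes t: "t \<in> tableaux \<mu>" and g: "g \<in> cstab t"
 shows "lookup (polytabloid \<mu> t) (tabloid \<mu> (nfun g \<circ> t)) = sg g"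
proof -
 have "lookup (polytabloid \<mu> t) (tabloid \<mu> (nfun g \<circ> t)) = (\<Sum>h\<in>cstab t. if h = g then sg g else 0)"
  unfolding polytabloid_kap act_kap lookup_sum
 proof (rule sum.cong[OF refl])
  fix h assume h: "h \<in> cstab t"
  show "lookup (frag_cmul (sg h) (perm_act (nfun h) (tb t))) (tabloid \<mu> (nfun g \<circ> t)) =
    (if h = g then sg g else 0)"
  proof (cases "h = g")
   case True thus ?thesis by (simp add: tabloid_perm)
  next
   case False
   hence "tabloid \<mu> (nfun h \<circ> t) \<noteq> tabloid \<mu> (nfun g \<circ> t)" using cstab_tabloid_inj[OF t h g] by blast
   thus ?thesis using False unfolding tb_perm by (simp add: lookup_single when_def)
  qed
 qed
 thus ?thesis using g by simp
qed

lemma lookup_polytabloid_self: "t \<in> tableaux \<mu> ==> lookup (polytabloid \<mu> t) (tabloid \<mu> t) = 1"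
 using lookup_polytabloid[of t 0] by simp

lemma lookup_polytabloid_neq: assumes "\<And>g. g \<in> cstab t ==> T \<noteq> tabloid \<mu> (nfun g \<circ> t)"
 shows "lookup (polytabloid \<mu> t) T = 0"
 unfolding polytabloid_kap act_kap lookup_sum tb_perm using assms
 by (intro sum.neutral ballI) (auto simp: lookup_single when_def)

text \<open>Two tableaux of the same shape: the entries of a column of \<open>t\<close> lie in different rows of \<open>s\<close>,
 and comparing the sums of all row indices forces them into the first rows.\<close>

lemma row_column_match: assumes t: "t \<in> tableaux \<mu>" and s: "s \<in> tableaux \<mu>"
  and sep: "\<And>x y x' y'. x \<in> D ==> y \<in> D ==> x' \<in> D ==> y' \<in> D ==> t x = s x' ==> t y = s y' ==>
    snd x = snd y ==> fst x' = fst y' ==> x = y"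
 obtains g where "g \<in> cstab t" "tabloid \<mu> s = tabloid \<mu> (nfun g \<circ> t)"
proof -
 have "\<exists>x'\<in>D. s x' = t x" if "x \<in> D" for x using tableau_surj[OF s tableau_range[OF t that]] .
 then obtain m where m: "\<And>x. x \<in> D ==> m x \<in> D \<and> s (m x) = t x" by metis
 have minj: "inj_on m D" by (rule inj_onI) (metis m t tableau_inj)
 have mD: "m ` D = D" by (rule endo_inj_surj[OF finD _ minj]) (use m in blast)
 \<comment> \<open>The target node of an entry keeps its column in t and takes the row it has in s.
   Once f is known to permute the diagram, it is the inverse of the column permutation
   sought.\<close>
 define f where "f = (\<lambda>x. (fst (m x), snd x))"
 have finj: "inj_on f D"
 proof (rule inj_onI)
  fix x y assume h: "x \<in> D" "y \<in> D" "f x = f y"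
  thus "x = y" using sep[of x y "m x" "m y"] m[of x] m[of y] by (simp add: f_def)
 qed
 let ?col = "\<lambda>c. {x \<in> D. snd x = c}"
 let ?F = "\<lambda>c. (\<lambda>x. fst (m x)) ` ?col c" and ?R = "\<lambda>c. fst ` ?col c"
 have Rdown: "?R c = {..<card (?col c)}" for c
 proof -
  have inj: "inj_on fst (?col c)" by (auto simp: inj_on_def)
  have "\<exists>h. ?R c = {..<h}"
  proof -
   have down: "r' \<in> ?R c" if "r \<in> ?R c" "r' \<le> r" for r r'
   proof -
    have "(r, c) \<in> D" using that by auto
    hence "(r', c) \<in> D" using partition_antimono[OF part that(2)] by (simp add: diagram_def)
    thus ?thesis by force
   qed
   have fin: "finite (?R c)" by simp
   define h where "h = (LEAST h. h \<notin> ?R c)"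
   have "\<exists>h. h \<notin> ?R c" using ex_new_if_finite[OF infinite_UNIV_nat fin] by blast
   hence "h \<notin> ?R c" unfolding h_def by (rule LeastI_ex)
   moreover have "r \<in> ?R c" if "r < h" for r using not_less_Least[of r "\<lambda>h. h \<notin> ?R c"] that unfolding h_def by blast
   moreover have "r < h" if "r \<in> ?R c" for r using down[OF that, of h] \<open>h \<notin> ?R c\<close> not_less by blast
   ultimately have "?R c = {..<h}" by blast
   thus ?thesis by blast
  qed
  then obtain h where "?R c = {..<h}" by blast
  moreover have "card (?R c) = card (?col c)" by (rule card_image[OF inj])
  ultimately show ?thesis by simp
 qed
 have Fcard: "card (?F c) = card (?col c)" and Fsum: "\<Sum>(?F c) = (\<Sum>x\<in>?col c. fst (m x))" for c
 proof -
  have inj: "inj_on (\<lambda>x. fst (m x)) (?col c)"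
  proof (rule inj_onI)
   fix x y assume h: "x \<in> ?col c" "y \<in> ?col c" "fst (m x) = fst (m y)"
   hence "f x = f y" by (simp add: f_def)
   thus "x = y" using inj_onD[OF finj] h by blast
  qed
  show "card (?F c) = card (?col c)" by (rule card_image[OF inj])
  show "\<Sum>(?F c) = (\<Sum>x\<in>?col c. fst (m x))" by (simp add: sum.reindex[OF inj])
 qed
 have Rsum: "\<Sum>{..<card (?col c)} = (\<Sum>x\<in>?col c. fst x)" for c
  unfolding Rdown[symmetric] by (subst sum.reindex) (auto simp: inj_on_def)
 have ge: "(\<Sum>x\<in>?col c. fst x) \<le> (\<Sum>x\<in>?col c. fst (m x))" for c
  using sum_ge_initial(1)[OF _ Fcard[of c]] Rsum[of c] Fsum[of c] by simp
 have tot: "(\<Sum>c\<in>snd ` D. \<Sum>x\<in>?col c. h x) = (\<Sum>x\<in>D. h x)" for h :: "nat \<times> nat \<Rightarrow> nat"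
  by (rule sum.group) auto
 \<comment> \<open>The row index sum of each column can only grow when passing to rows of s, but the
   total is unchanged as m permutes the diagram. So equality holds in every column.\<close>
 have "(\<Sum>x\<in>D. fst (m x)) = (\<Sum>x\<in>m ` D. fst x)" by (simp add: sum.reindex[OF minj])
 hence eqt: "(\<Sum>c\<in>snd ` D. \<Sum>x\<in>?col c. fst x) = (\<Sum>c\<in>snd ` D. \<Sum>x\<in>?col c. fst (m x))"
  unfolding tot mD by simp
 have eqc: "(\<Sum>x\<in>?col c. fst x) = (\<Sum>x\<in>?col c. fst (m x))" if "c \<in> snd ` D" for c
  using sum_mono_inv[OF eqt _ that] ge by simp
 have Feq: "?F c = ?R c" for c
 proof (cases "c \<in> snd ` D")
  case True
  thus ?thesis using sum_ge_initial(2)[OF _ Fcard[of c]] Rsum[of c] Fsum[of c] eqc[OF True] Rdown[of c] by simp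
 next
  case False
  hence "?col c = {}" by force
  thus ?thesis by (simp only: image_empty)
 qed
 have fD: "f ` D = D"
 proof (rule endo_inj_surj[OF finD _ finj])
  show "f ` D \<subseteq> D"
  proof
   fix z assume "z \<in> f ` D"
   then obtain x where x: "x \<in> D" "z = f x" by blast
   hence "fst z \<in> ?F (snd x)" by (auto simp: f_def)
   hence "fst z \<in> ?R (snd x)" unfolding Feq .
   then obtain y where "y \<in> D" "snd y = snd x" "fst y = fst z" by auto
   moreover have "snd z = snd x" using x by (simp add: f_def)
   ultimately show "z \<in> D" by (metis prod_eq_iff)
  qed
 qed
 have tf: "bij_betw (t \<circ> f) D {1..n}"
  using bij_betw_trans[of f D D t "{1..n}"] finj fD t unfolding tableau_iff by (simp add: bij_betw_def)
 hence "t \<circ> f \<in> tableaux \<mu>" using tableau_iff by simp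
 then obtain g where g: "g \<in> syms n" "\<And>x. x \<in> D ==> t x = nfun g ((t \<circ> f) x)" using tableau_related[OF _ t] by metis
 have "g \<in> cstab t" unfolding cstab_iff[OF t]
 proof (intro conjI ballI)
  fix y assume "y \<in> D"
  then obtain x where x: "x \<in> D" "y = f x" using fD by blast
  hence "nfun g (t y) = t x" using g(2) by simp
  moreover have "snd x = snd y" using x by (simp add: f_def)
  ultimately show "\<exists>z\<in>D. snd z = snd y \<and> nfun g (t y) = t z" using x by auto
 qed (rule g(1))
 moreover have "tabloid \<mu> s = tabloid \<mu> (nfun g \<circ> t)"
 proof
  fix r
  have "tabloid \<mu> (nfun g \<circ> t) r = (nfun g \<circ> t) ` {y \<in> f ` D. fst y = r}" unfolding fD by (simp add: tabloid_def)
  also have "\<dots> = t ` {x \<in> D. fst (f x) = r}"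
  proof
   show "(nfun g \<circ> t) ` {y \<in> f ` D. fst y = r} \<subseteq> t ` {x \<in> D. fst (f x) = r}"
   proof
    fix z assume "z \<in> (nfun g \<circ> t) ` {y \<in> f ` D. fst y = r}"
    then obtain x where x: "x \<in> D" "fst (f x) = r" "z = nfun g (t (f x))" by auto
    hence "z = t x" using g(2)[OF x(1)] by simp
    thus "z \<in> t ` {x \<in> D. fst (f x) = r}" using x by blast
   qed
   show "t ` {x \<in> D. fst (f x) = r} \<subseteq> (nfun g \<circ> t) ` {y \<in> f ` D. fst y = r}"
   proof
    fix z assume "z \<in> t ` {x \<in> D. fst (f x) = r}"
    then obtain x where x: "x \<in> D" "fst (f x) = r" "z = t x" by auto
    hence "z = (nfun g \<circ> t) (f x)" using g(2)[OF x(1)] by simp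
    thus "z \<in> (nfun g \<circ> t) ` {y \<in> f ` D. fst y = r}" using x by blast
   qed
  qed
  also have "\<dots> = s ` {x \<in> m ` D. fst x = r}"
  proof
   show "t ` {x \<in> D. fst (f x) = r} \<subseteq> s ` {x \<in> m ` D. fst x = r}"
   proof
    fix z assume "z \<in> t ` {x \<in> D. fst (f x) = r}"
    then obtain x where x: "x \<in> D" "fst (f x) = r" "z = t x" by auto
    hence "z = s (m x)" "fst (m x) = r" using m[OF x(1)] by (simp_all add: f_def)
    thus "z \<in> s ` {x \<in> m ` D. fst x = r}" using x(1) by blast
   qed
   show "s ` {x \<in> m ` D. fst x = r} \<subseteq> t ` {x \<in> D. fst (f x) = r}"
   proof
    fix z assume "z \<in> s ` {x \<in> m ` D. fst x = r}"
    then obtain x where x: "x \<in> D" "fst (m x) = r" "z = s (m x)" by auto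
    hence "z = t x" "fst (f x) = r" using m[OF x(1)] by (simp_all add: f_def)
    thus "z \<in> t ` {x \<in> D. fst (f x) = r}" using x(1) by blast
   qed
  qed
  finally show "tabloid \<mu> s r = tabloid \<mu> (nfun g \<circ> t) r" unfolding mD by (simp add: tabloid_def)
 qed
 ultimately show ?thesis using that by blast
qed

lemma tr_cstab: assumes t: "t \<in> tableaux \<mu>" and xy: "x \<in> D" "y \<in> D" "snd x = snd y"
 shows "tr (t x) (t y) \<in> cstab t" unfolding cstab_iff[OF t]
proof (intro conjI ballI)
 show "tr (t x) (t y) \<in> syms n" using tableau_range[OF t] xy by (intro tr_syms)
 fix z assume z: "z \<in> D"
 show "\<exists>w\<in>D. snd w = snd z \<and> nfun (tr (t x) (t y)) (t z) = t w"
  using xy z tableau_inj[OF t] by (auto simp: transpose_def)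
qed

lemma tabloid_tr_row: assumes s: "s \<in> tableaux \<mu>" and xy: "x \<in> D" "y \<in> D" "fst x = fst y"
 shows "tabloid \<mu> (nfun (tr (s x) (s y)) \<circ> s) = tabloid \<mu> s"
proof
 fix r
 have sub: "tabloid \<mu> (nfun (tr (s x) (s y)) \<circ> s) r \<subseteq> tabloid \<mu> s r"
 proof
  fix a assume "a \<in> tabloid \<mu> (nfun (tr (s x) (s y)) \<circ> s) r"
  then obtain z where z: "z \<in> D" "fst z = r" "a = transpose (s x) (s y) (s z)" unfolding tabloid_def by auto
  have "a = s x \<and> z = y \<or> a = s y \<and> z = x \<or> a = s z"
   using z tableau_inj[OF s] xy by (auto simp: transpose_def)
  thus "a \<in> tabloid \<mu> s r" using z xy unfolding tabloid_def by auto
 qed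
 have fin: "finite (tabloid \<mu> s r)" by (simp add: tabloid_def)
 have "card (tabloid \<mu> (nfun (tr (s x) (s y)) \<circ> s) r) = card (tabloid \<mu> s r)"
  unfolding tabloid_perm by (rule card_image[OF inj_on_subset[OF bij_is_inj[OF nfun_bij] subset_UNIV]])
 thus "tabloid \<mu> (nfun (tr (s x) (s y)) \<circ> s) r = tabloid \<mu> s r" using card_subset_eq[OF fin sub] by blast
qed

definition perm_module :: "tvec set" where
 "perm_module = {x. keys x \<subseteq> tabloid \<mu> ` tableaux \<mu>}"

text \<open>If two entries share a column of t and a row of s, their transposition fixes the tabloid
  of s but changes the sign of both the signed column sum and the polytabloid, so both sides vanish.
  Otherwise the tabloid of s is a column permutation of that of t. This is the computation behind
  the submodule theorem of James.\<close>

lemma kap_rank_one_tabloid: assumes t: "t \<in> tableaux \<mu>" and s: "s \<in> tableaux \<mu>"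
 shows "act (kap t) (tb s) = frag_cmul (ip (tb s) (polytabloid \<mu> t)) (polytabloid \<mu> t)"
proof (cases "\<exists>x y x' y'. x \<in> D \<and> y \<in> D \<and> x' \<in> D \<and> y' \<in> D \<and> t x = s x' \<and> t y = s y' \<and>
    snd x = snd y \<and> fst x' = fst y' \<and> x \<noteq> y")
 case True
 then obtain x y x' y' where h: "x \<in> D" "y \<in> D" "x' \<in> D" "y' \<in> D" "t x = s x'" "t y = s y'"
  "snd x = snd y" "fst x' = fst y'" "x \<noteq> y" by blast
 let ?g = "tr (t x) (t y)"
 have g: "?g \<in> cstab t" by (rule tr_cstab[OF t h(1,2,7)])
 have neq: "t x \<noteq> t y" using tableau_inj[OF t h(1,2)] h(9) by (simp only: not_False_eq_True)
 have inv: "perm_act (nfun ?g) (tb s) = tb s"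
  unfolding tb_perm h(5,6) by (simp only: tabloid_tr_row[OF s h(3,4,8)])
 have "act (kap t) (tb s) = - act (kap t) (tb s)"
  using act_kap_perm(1)[OF t g, of "tb s"] unfolding inv sg_tr[OF neq] by simp
 hence 1: "act (kap t) (tb s) = 0" by (rule frag_eq_uminus)
 have "ip (tb s) (polytabloid \<mu> t) = ip (perm_act (nfun ?g) (tb s)) (perm_act (nfun ?g) (polytabloid \<mu> t))"
  by (simp only: ip_perm[OF nfun_bij])
 also have "\<dots> = - ip (tb s) (polytabloid \<mu> t)"
  unfolding inv polytabloid_perm[OF t g] sg_tr[OF neq] by (simp add: ip_uminus_right)
 finally have "ip (tb s) (polytabloid \<mu> t) = 0" by simp
 thus ?thesis using 1 by simp
next
 case False
 have sep: "\<And>x y x' y'. x \<in> D ==> y \<in> D ==> x' \<in> D ==> y' \<in> D ==> t x = s x' ==> t y = s y' ==>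
    snd x = snd y ==> fst x' = fst y' ==> x = y" using False by blast
 obtain g where g: "g \<in> cstab t" "tabloid \<mu> s = tabloid \<mu> (nfun g \<circ> t)"
  by (rule row_column_match[OF t s sep])
 have e: "tb s = perm_act (nfun g) (tb t)" unfolding tb_perm g(2) ..
 have "act (kap t) (tb s) = frag_cmul (sg g) (polytabloid \<mu> t)"
  unfolding e act_kap_perm(1)[OF t g(1)] polytabloid_kap ..
 moreover have "ip (tb s) (polytabloid \<mu> t) = sg g"
  unfolding ip_of g(2) by (rule lookup_polytabloid[OF t g(1)])
 ultimately show ?thesis by simp
qed

theorem kap_rank_one: assumes t: "t \<in> tableaux \<mu>" and x: "x \<in> perm_module"
 shows "act (kap t) x = frag_cmul (ip x (polytabloid \<mu> t)) (polytabloid \<mu> t)"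
 using x unfolding perm_module_def mem_Collect_eq
proof (induction x rule: frag_induction)
 case (one T)
 then obtain s where "s \<in> tableaux \<mu>" "T = tabloid \<mu> s" by blast
 thus ?case using kap_rank_one_tabloid[OF t] by simp
next
 case (diff a b)
 thus ?case by (simp add: act_diff_right ip_diff_left frag_cmul_diff_distrib)
qed simp

end

section \<open>Specht lattices and central characters\<close>

lemma generate_induct_free:
 assumes x: "x \<in> generate (free_Abelian_group G) H" and H: "\<And>h. h \<in> H ==> keys h \<subseteq> G"
  and P: "P 0" "\<And>h. h \<in> H ==> P h" "\<And>x y. P x ==> P y ==> P (x - y)" shows "P x"
proof -
 have m: "P (- y)" if "P y" for y using P(3)[OF P(1) that] by simp
 from x show ?thesis
 proof (induction rule: generate.induct)
  case (inv h) thus ?case using H m P(2) by simp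
 next
  case (eng a b) thus ?case using P(3)[OF _ m, of a b] by simp
 qed (use P in auto)
qed

lemma generate_diff_free: assumes H: "\<And>h. h \<in> H ==> keys h \<subseteq> G"
  and x: "x \<in> generate (free_Abelian_group G) H" "y \<in> generate (free_Abelian_group G) H"
 shows "x - y \<in> generate (free_Abelian_group G) H"
proof -
 interpret group "free_Abelian_group G" by simp
 have s: "H \<subseteq> carrier (free_Abelian_group G)" using H by auto
 have "y \<in> carrier (free_Abelian_group G)" using generate_in_carrier[OF s x(2)] by simp
 hence "- y \<in> generate (free_Abelian_group G) H" using generate_m_inv_closed[OF s x(2)] by simp
 thus ?thesis using generate.eng[OF x(1), of "- y"] by simp
qed

lemma frag_cmul_diff2: "frag_cmul c (x - y) = frag_cmul c x - frag_cmul c y"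
 by (rule poly_mapping_eqI) (simp add: lookup_minus right_diff_distrib)

lemma lookup_perm_act: "lookup (perm_act (nfun g) x) T = lookup x (\<lambda>r. nfun (- g) ` T r)"
 using ip_move[of "- g" "frag_of T" x] by (simp add: ip_of)

context shape begin

abbreviation S :: "tvec set" where "S \<equiv> specht_lattice \<mu>"
abbreviation e :: "(nat \<times> nat \<Rightarrow> nat) \<Rightarrow> tvec" where "e \<equiv> polytabloid \<mu>"

lemma polytabloid_act_perm: assumes g: "g \<in> syms n" and t: "t \<in> tableaux \<mu>"
 shows "perm_act (nfun g) (e t) = e (nfun g \<circ> t)"
proof -
 let ?t = "nfun g \<circ> t"
 have t': "?t \<in> tableaux \<mu>" by (rule tableau_perm[OF t g])
 have c: "g + h - g \<in> cstab (nfun g \<circ> s)" if s: "s \<in> tableaux \<mu>" "nfun g \<circ> s \<in> tableaux \<mu>" and g: "g \<in> syms n" and h: "h \<in> cstab s" for s h g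
  unfolding cstab_iff[OF s(2)]
 proof (intro conjI ballI)
  show "g + h - g \<in> syms n" using g cstab_syms[OF h] by (simp only: diff_conv_add_uminus syms_add syms_minus)
  fix x assume "x \<in> D"
  then obtain y where "y \<in> D" "snd y = snd x" "nfun h (s x) = s y" using h cstab_iff[OF s(1)] by blast
  thus "\<exists>y\<in>D. snd y = snd x \<and> nfun (g + h - g) ((nfun g \<circ> s) x) = (nfun g \<circ> s) y"
   by (intro bexI[of _ y]) (simp_all add: diff_conv_add_uminus del: add_uminus_conv_diff)
 qed
 have b: "bij_betw (\<lambda>h. g + h - g) (cstab t) (cstab ?t)"
 proof (rule bij_betwI[where g = "\<lambda>h. - g + h - (- g)"])
  show "(\<lambda>h. g + h - g) \<in> cstab t \<rightarrow> cstab ?t" using c[OF t t' g] by blast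
  have tt: "nfun (- g) \<circ> ?t = t" by (rule ext) simp
  show "(\<lambda>h. - g + h - (- g)) \<in> cstab ?t \<rightarrow> cstab t" using c[of ?t "- g"] t t' g unfolding tt by simp
  show "- g + (g + h - g) - (- g) = h" for h
   by (simp add: diff_conv_add_uminus add.assoc del: add_uminus_conv_diff)
  show "g + (- g + h - (- g)) - g = h" for h
   by (simp add: diff_conv_add_uminus add.assoc del: add_uminus_conv_diff)
 qed
 have "e ?t = (\<Sum>h\<in>cstab t. frag_cmul (sg (g + h - g)) (perm_act (nfun (g + h - g)) (tb ?t)))"
  unfolding polytabloid_kap act_kap by (rule sum.reindex_bij_betw[OF b, symmetric])
 also have "\<dots> = (\<Sum>h\<in>cstab t. frag_cmul (sg h) (perm_act (nfun g) (perm_act (nfun h) (tb t))))"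
 proof (rule sum.cong[OF refl])
  fix h assume "h \<in> cstab t"
  hence h: "h \<in> syms n" by (rule cstab_syms)
  have gg: "sg g * sg (- g) = 1" using sg_minus[OF g] by simp
  have "sg (g + h - g) = sg h * (sg g * sg (- g))"
   using sg_add[of "g + h" n "- g"] sg_add[OF g h] g h by (simp add: ac_simps)
  hence s: "sg (g + h - g) = sg h" by (simp only: gg mult_1_right)
  have "nfun (g + h - g) \<circ> (nfun g \<circ> t) = nfun g \<circ> (nfun h \<circ> t)"
   by (rule ext) (simp add: diff_conv_add_uminus del: add_uminus_conv_diff)
  thus "frag_cmul (sg (g + h - g)) (perm_act (nfun (g + h - g)) (tb ?t)) =
    frag_cmul (sg h) (perm_act (nfun g) (perm_act (nfun h) (tb t)))" unfolding s tb_perm by simp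
 qed
 also have "\<dots> = perm_act (nfun g) (e t)"
  unfolding polytabloid_kap act_kap by (simp only: perm_act_sum perm_act_cmul)
 finally show ?thesis ..
qed

lemma polytabloid_cong: assumes "\<And>x. x \<in> D ==> s x = t x" shows "e s = e t"
proof -
 have "s ` {x \<in> D. snd x = c} = t ` {x \<in> D. snd x = c}" for c by (rule image_cong) (use assms in auto)
 moreover have "tabloid \<mu> (\<pi> \<circ> s) = tabloid \<mu> (\<pi> \<circ> t)" for \<pi> by (rule tabloid_cong) (simp add: assms)
 ultimately show ?thesis by (simp add: polytabloid_def column_stabiliser_def)
qed

lemma polytabloid_related: assumes "t \<in> tableaux \<mu>" "s \<in> tableaux \<mu>"
 obtains g where "g \<in> syms n" "e s = perm_act (nfun g) (e t)"
proof -
 obtain g where g: "g \<in> syms n" "\<And>x. x \<in> D ==> s x = nfun g (t x)" using tableau_related[OF assms] by metis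
 have "e s = e (nfun g \<circ> t)" by (rule polytabloid_cong) (simp add: g(2))
 hence "e s = perm_act (nfun g) (e t)" using polytabloid_act_perm[OF g(1) assms(1)] by simp
 thus ?thesis by (rule that[OF g(1)])
qed

lemma keys_polytabloid: "t \<in> tableaux \<mu> ==> keys (e t) \<subseteq> tabloid \<mu> ` tableaux \<mu>"
proof
 fix T assume t: "t \<in> tableaux \<mu>" and "T \<in> keys (e t)"
 then obtain g where "g \<in> cstab t" "T = tabloid \<mu> (nfun g \<circ> t)"
  using lookup_polytabloid_neq[of t T] by (auto simp: in_keys_iff)
 thus "T \<in> tabloid \<mu> ` tableaux \<mu>" using tableau_perm[OF t cstab_syms] by blast
qed

lemma S_0 [simp]: "0 \<in> S"
 using generate.one[of "free_Abelian_group (tabloid \<mu> ` tableaux \<mu>)"] by (simp add: specht_lattice_def)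
lemma S_poly [simp]: "t \<in> tableaux \<mu> ==> e t \<in> S"
 unfolding specht_lattice_def by (intro generate.incl) simp
lemma S_diff [simp]: "x \<in> S ==> y \<in> S ==> x - y \<in> S"
 unfolding specht_lattice_def by (rule generate_diff_free) (use keys_polytabloid in auto)
lemma S_induct [consumes 1, case_names zero poly diff]:
 assumes "x \<in> S" "P 0" "\<And>t. t \<in> tableaux \<mu> ==> P (e t)" "\<And>x y. x \<in> S ==> y \<in> S ==> P x ==> P y ==> P (x - y)"
 shows "P x"
proof -
 have "x \<in> S \<and> P x" using assms(1) unfolding specht_lattice_def
  by (rule generate_induct_free) (use keys_polytabloid assms S_0 S_poly S_diff in \<open>auto simp flip: specht_lattice_def\<close>)
 thus ?thesis ..
qed

lemma S_uminus [simp]: "x \<in> S ==> - x \<in> S" using S_diff[of 0 x] by simp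
lemma S_add [simp]: "x \<in> S ==> y \<in> S ==> x + y \<in> S" using S_diff[of x "- y"] by simp
lemma S_sum: "(\<And>i. i \<in> I ==> f i \<in> S) ==> sum f I \<in> S"
 by (induction I rule: infinite_finite_induct) auto
lemma S_cmul [simp]: assumes "x \<in> S" shows "frag_cmul c x \<in> S"
proof (induction c rule: int_induct[where k = 0])
 case (step1 i) thus ?case using S_add[OF _ assms] by (simp add: frag_cmul_distrib)
next
 case (step2 i) thus ?case using S_diff[OF _ assms] by (simp add: frag_cmul_distrib left_diff_distrib frag_cmul_diff_distrib diff_conv_add_uminus del: add_uminus_conv_diff)
qed simp

lemma S_perm_module: "x \<in> S ==> x \<in> perm_module"
proof (induction rule: S_induct)
 case (diff x y) thus ?case using keys_diff[of x y] by (auto simp: perm_module_def)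
qed (use keys_polytabloid in \<open>auto simp: perm_module_def\<close>)

lemma S_perm [simp]: assumes g: "g \<in> syms n" shows "x \<in> S ==> perm_act (nfun g) x \<in> S"
 by (induction rule: S_induct) (simp_all add: polytabloid_act_perm[OF g] tableau_perm[OF _ g] perm_act_diff)

lemma S_act: assumes "a \<in> galg n" "x \<in> S" shows "act a x \<in> S"
 using assms(1) by (rule galg_induct) (simp_all add: act_single act_add_left assms(2))

lemma poly_nonzero: "t \<in> tableaux \<mu> ==> e t \<noteq> 0" using lookup_polytabloid_self[of t] by auto

lemma ip_poly_pos: "t \<in> tableaux \<mu> ==> 0 < ip (e t) (e t)" using ip_pos poly_nonzero by blast

lemma ip_poly_zero: assumes x: "x \<in> S" and z: "\<And>t. t \<in> tableaux \<mu> ==> ip x (e t) = 0" shows "x = 0"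
proof -
 have "ip x y = 0" if "y \<in> S" for y using that by (induction rule: S_induct) (use z in \<open>auto simp: ip_diff_right\<close>)
 thus ?thesis using ip_pos[of x] x by fastforce
qed

lemma frag_cmul_cancel: "frag_cmul c x = frag_cmul c (y :: 'a \<Rightarrow>\<^sub>0 int) \<longleftrightarrow> c = 0 \<or> x = y"
proof
 assume h: "frag_cmul c x = frag_cmul c y"
 show "c = 0 \<or> x = y"
 proof (cases "c = 0")
  case False
  have "lookup x k = lookup y k" for k using arg_cong[OF h, of "\<lambda>z. lookup z k"] False by simp
  thus ?thesis by (simp add: poly_mapping_eqI)
 qed simp
qed auto

definition lin_on :: "(tvec \<Rightarrow> tvec) \<Rightarrow> bool" where
 "lin_on \<Theta> \<longleftrightarrow> (\<forall>x\<in>S. \<forall>y\<in>S. \<Theta> (x + y) = \<Theta> x + \<Theta> y)"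

lemma lin_add: "lin_on \<Theta> ==> x \<in> S ==> y \<in> S ==> \<Theta> (x + y) = \<Theta> x + \<Theta> y" by (simp add: lin_on_def)
lemma lin_0: "lin_on \<Theta> ==> \<Theta> 0 = 0" using lin_add[of \<Theta> 0 0] by simp
lemma lin_diff: "lin_on \<Theta> ==> x \<in> S ==> y \<in> S ==> \<Theta> (x - y) = \<Theta> x - \<Theta> y"
 using lin_add[of \<Theta> "x - y" y] by (simp add: algebra_simps)
lemma lin_cmul: assumes "lin_on \<Theta>" "x \<in> S" shows "\<Theta> (frag_cmul c x) = frag_cmul c (\<Theta> x)"
proof (induction c rule: int_induct[where k = 0])
 case (step1 i) thus ?case using lin_add[OF assms(1) S_cmul[of x i] assms(2)] assms by (simp add: frag_cmul_distrib)
next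
 case (step2 i)
 have "frag_cmul (i - 1) y = frag_cmul i y - y" for y :: tvec
  using frag_cmul_distrib[of "i - 1" 1 y] by simp
 thus ?case using lin_diff[OF assms(1) S_cmul[of x i] assms(2)] step2 assms(2) by simp
qed (simp add: lin_0[OF assms(1)])
lemma lin_sum: "lin_on \<Theta> ==> (\<And>i. i \<in> I ==> f i \<in> S) ==> \<Theta> (sum f I) = (\<Sum>i\<in>I. \<Theta> (f i))"
 by (induction I rule: infinite_finite_induct) (simp_all add: lin_0 lin_add S_sum)

lemma lin_act: assumes lin: "lin_on \<Theta>" and ml: "m \<le> n"
  and eq: "\<And>g x. g \<in> syms m ==> x \<in> S ==> \<Theta> (perm_act (nfun g) x) = perm_act (nfun g) (\<Theta> x)"
  and a: "a \<in> galg m" and x: "x \<in> S" shows "\<Theta> (act a x) = act a (\<Theta> x)"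
proof -
 have g: "g \<in> syms n" if "g \<in> syms m" for g using that syms_mono[OF ml] by blast
 have "act a x \<in> S \<and> \<Theta> (act a x) = act a (\<Theta> x)"
  using a by (rule galg_induct) (simp_all add: g act_single act_add_left lin_cmul[OF lin] lin_0[OF lin] lin_add[OF lin] eq x)
 thus ?thesis ..
qed

text \<open>Applying the signed column sum to the image of a polytabloid shows that a nonzero
  multiple of this image is a multiple of the polytabloid. The scalar is an integer because the
  polytabloid has coefficient 1 at its own tabloid, and equivariance extends it to the whole
  lattice.\<close>

theorem schur: assumes lin: "lin_on \<Theta>" and PM: "\<And>x. x \<in> S ==> \<Theta> x \<in> perm_module"
  and eq: "\<And>g x. g \<in> syms n ==> x \<in> S ==> \<Theta> (perm_act (nfun g) x) = perm_act (nfun g) (\<Theta> x)"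
  and t: "t \<in> tableaux \<mu>" and x: "x \<in> S" shows "\<Theta> x = frag_cmul (lookup (\<Theta> (e t)) (tabloid \<mu> t)) x"
proof -
 define c where "c = lookup (\<Theta> (e t)) (tabloid \<mu> t)"
 let ?q = "ip (e t) (e t)"
 have "frag_cmul ?q (\<Theta> (e t)) = \<Theta> (act (kap t) (e t))"
  using kap_rank_one[OF t S_perm_module[OF S_poly[OF t]]] lin_cmul[OF lin S_poly[OF t]] by simp
 also have "\<dots> = act (kap t) (\<Theta> (e t))" by (rule lin_act[OF lin order_refl eq kap_galg S_poly[OF t]])
 also have "\<dots> = frag_cmul (ip (\<Theta> (e t)) (e t)) (e t)" by (rule kap_rank_one[OF t PM[OF S_poly[OF t]]])
 finally have 1: "frag_cmul ?q (\<Theta> (e t)) = frag_cmul (ip (\<Theta> (e t)) (e t)) (e t)" .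
 have "?q * c = ip (\<Theta> (e t)) (e t)"
  using arg_cong[OF 1, of "\<lambda>z. lookup z (tabloid \<mu> t)"] lookup_polytabloid_self[OF t] by (simp add: c_def)
 hence "frag_cmul ?q (\<Theta> (e t)) = frag_cmul ?q (frag_cmul c (e t))" using 1 by simp
 hence b: "\<Theta> (e t) = frag_cmul c (e t)" using frag_cmul_cancel ip_poly_pos[OF t] by (metis less_irrefl)
 have "\<Theta> x = frag_cmul c x" using x
 proof (induction rule: S_induct)
  case (poly s)
  obtain g where g: "g \<in> syms n" "e s = perm_act (nfun g) (e t)" using polytabloid_related[OF t poly] .
  show ?case unfolding g(2) eq[OF g(1) S_poly[OF t]] b perm_act_cmul ..
 next
  case (diff x y)
  thus ?case by (simp add: lin_diff[OF lin] frag_cmul_diff2)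
 qed (simp add: lin_0[OF lin])
 thus ?thesis unfolding c_def .
qed

text \<open>The central character of the Specht lattice, read off at the tabloid where the
  polytabloid has coefficient 1.\<close>

definition omega :: "int gring \<Rightarrow> int" where
 "omega z = (let t = SOME t. t \<in> tableaux \<mu> in lookup (act z (e t)) (tabloid \<mu> t))"

lemma centre_schur: assumes z: "z \<in> cent n n" and t: "t \<in> tableaux \<mu>" and x: "x \<in> S"
 shows "act z x = frag_cmul (lookup (act z (e t)) (tabloid \<mu> t)) x"
proof (rule schur[OF _ _ _ t x])
 show "lin_on (act z)" by (simp add: lin_on_def act_add_right)
 show "act z x \<in> perm_module" if "x \<in> S" for x by (rule S_perm_module[OF S_act[OF cent_galg[OF z] that]])
 fix g assume "g \<in> syms n"
 hence "gs g * z = z * gs g" using z by (simp add: cent_def)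
 thus "act z (perm_act (nfun g) x) = perm_act (nfun g) (act z x)" for x by (metis act_mult act_gs)
qed

lemma omega: "z \<in> cent n n ==> x \<in> S ==> act z x = frag_cmul (omega z) x"
 unfolding omega_def Let_def using tableau_exists by (intro centre_schur) (auto simp: some_in_eq)

lemma omega_eqI: "z \<in> cent n n ==> t \<in> tableaux \<mu> ==> omega z = lookup (act z (e t)) (tabloid \<mu> t)"
 using omega[of z "e t"] lookup_polytabloid_self[of t] by simp

end

lemma sum_ordered_pairs: fixes h :: "'a \<Rightarrow> 'a \<Rightarrow> int"
 assumes A: "finite A" and sym: "\<And>x y. h x y = h y x"
  and R: "\<And>x y. x \<in> A ==> y \<in> A ==> x \<noteq> y ==> h x y \<noteq> 0 ==> R x y \<longleftrightarrow> \<not> R y x" and irr: "\<And>x. \<not> R x x"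
 shows "(\<Sum>x\<in>A. \<Sum>y\<in>A - {x}. h x y) = 2 * (\<Sum>x\<in>A. \<Sum>y\<in>{y \<in> A. R y x}. h x y)"
proof -
 have 1: "(\<Sum>y\<in>A - {x}. h x y) = (\<Sum>y\<in>A. if R y x then h x y else 0) + (\<Sum>y\<in>A. if R x y then h x y else 0)"
  if x: "x \<in> A" for x
 proof -
  have "(\<Sum>y\<in>A - {x}. h x y) = (\<Sum>y\<in>A. if y = x then 0 else h x y)"
   using A by (intro sum.mono_neutral_cong_left) auto
  also have "\<dots> = (\<Sum>y\<in>A. (if R y x then h x y else 0) + (if R x y then h x y else 0))"
   by (rule sum.cong[OF refl]) (use R[OF x] irr in auto)
  finally show ?thesis by (simp add: sum.distrib)
 qed
 have "(\<Sum>x\<in>A. \<Sum>y\<in>A. if R x y then h x y else 0) = (\<Sum>x\<in>A. \<Sum>y\<in>A. if R y x then h x y else 0)"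
  by (subst sum.swap, intro sum.cong refl if_cong, rule sym)
 thus ?thesis by (simp add: 1 sum.distrib sum.inter_filter[OF A])
qed

context shape begin

text \<open>A transposition within a row fixes the tabloid and one within a column contributes its
  sign. In the remaining case, a column permutation yielding the same tabloid would have to send the
  entry at the crossing of the row of x and the column of y both to t y and to itself.\<close>

lemma transposition_coeff: assumes t: "t \<in> tableaux \<mu>" and xy: "x \<in> D" "y \<in> D" "x \<noteq> y"
 shows "lookup (perm_act (nfun (tr (t x) (t y))) (e t)) (tabloid \<mu> t) =
  (if fst x = fst y then 1 else 0) - (if snd x = snd y then 1 else 0)"
proof -
 let ?g = "tr (t x) (t y)"
 have neq: "t x \<noteq> t y" using tableau_inj[OF t xy(1,2)] xy(3) by (simp only: not_False_eq_True)
 have l: "lookup (perm_act (nfun ?g) (e t)) (tabloid \<mu> t) = lookup (e t) (tabloid \<mu> (nfun ?g \<circ> t))"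
  unfolding lookup_perm_act minus_tr tabloid_perm ..
 consider "fst x = fst y" "snd x \<noteq> snd y" | "snd x = snd y" "fst x \<noteq> fst y" | "fst x \<noteq> fst y" "snd x \<noteq> snd y"
  using xy(3) by (metis prod_eqI)
 thus ?thesis
 proof cases
  case 1
  thus ?thesis unfolding l tabloid_tr_row[OF t xy(1,2) 1(1)] lookup_polytabloid_self[OF t] by simp
 next
  case 2
  thus ?thesis unfolding l lookup_polytabloid[OF t tr_cstab[OF t xy(1,2) 2(1)]] sg_tr[OF neq] by simp
 next
  case 3
  have "tabloid \<mu> (nfun ?g \<circ> t) \<noteq> tabloid \<mu> (nfun g \<circ> t)" if g: "g \<in> cstab t" for g
  proof
   assume E: "tabloid \<mu> (nfun ?g \<circ> t) = tabloid \<mu> (nfun g \<circ> t)"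
   have row: "\<exists>w\<in>D. fst w = fst z \<and> snd w = snd v \<and> nfun g (t w) = t v"
    if "z \<in> D" "v \<in> D" "nfun ?g (t z) = t v" for z v
   proof -
    have "t v \<in> tabloid \<mu> (nfun ?g \<circ> t) (fst z)" unfolding tabloid_def
     by (intro image_eqI[of _ _ z]) (use that in auto)
    hence "t v \<in> tabloid \<mu> (nfun g \<circ> t) (fst z)" unfolding E .
    then obtain w where w: "w \<in> D" "fst w = fst z" "t v = nfun g (t w)" unfolding tabloid_def by auto
    then obtain u where "u \<in> D" "snd u = snd w" "nfun g (t w) = t u" using g cstab_iff[OF t] by blast
    hence "u = v" using w tableau_inj[OF t _ that(2)] by metis
    thus ?thesis using w \<open>snd u = snd w\<close> by auto
   qed
   obtain w where w: "w \<in> D" "fst w = fst x" "snd w = snd y" "nfun g (t w) = t y"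
    using row[OF xy(1,2)] by auto
   have nw: "w \<noteq> x" "w \<noteq> y" using w 3 by metis+
   have "nfun ?g (t w) = t w" using nw tableau_inj[OF t w(1)] xy by (auto simp: transpose_def)
   then obtain w' where w': "w' \<in> D" "fst w' = fst w" "snd w' = snd w" "nfun g (t w') = t w"
    using row[OF w(1,1)] by blast
   hence "w' = w" by (simp add: prod_eq_iff)
   hence "t w = t y" using w w' by simp
   thus False using tableau_inj[OF t w(1) xy(2)] nw by blast
  qed
  thus ?thesis unfolding l using lookup_polytabloid_neq[of t] 3 by simp
 qed
qed

text \<open>The Jucys-Murphy elements add up to the sum of all transpositions, so the character is
  the number of pairs of nodes in a common row minus the number in a common column. Counting each
  pair at its later node gives the column index minus the row index of every node.\<close>

lemma omega_sum_jm: "omega (esym jm n 1) = (\<Sum>x\<in>D. int (snd x) - int (fst x))"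
proof -
 obtain t where t: "t \<in> tableaux \<mu>" using tableau_exists by blast
 have E: "esym jm k 1 = (\<Sum>b\<in>{1..k}. jm b :: int gring)" for k
  by (induction k) (auto simp: atLeastAtMostSuc_conv)
 define h where "h a b = (if a = b then 0 else lookup (perm_act (nfun (tr a b)) (e t)) (tabloid \<mu> t))" for a b
 define f where "f x y = (if fst x = fst y then 1 else 0 :: int)" for x y :: "nat \<times> nat"
 define k where "k x y = (if snd x = snd y then 1 else 0 :: int)" for x y :: "nat \<times> nat"
 have "omega (esym jm n 1) = (\<Sum>b\<in>{1..n}. \<Sum>a\<in>{1..<b}. h b a)"
  unfolding omega_eqI[OF esym_cent t] unfolding E jm_def
  by (simp add: act_sum_left lookup_sum h_def tr_commute del: nfun_tr)
 also have "\<dots> = (\<Sum>b\<in>{1..n}. \<Sum>a\<in>{a \<in> {1..n}. a < b}. h b a)" by (intro sum.cong refl) auto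
 finally have "2 * omega (esym jm n 1) = (\<Sum>b\<in>{1..n}. \<Sum>a\<in>{1..n} - {b}. h b a)"
  by (subst sum_ordered_pairs[where R = "(<)"]) (auto simp: h_def tr_commute)
 also have "\<dots> = (\<Sum>x\<in>D. \<Sum>a\<in>{1..n} - {t x}. h (t x) a)"
  using t by (intro sum.reindex_bij_betw[symmetric]) (simp add: tableau_iff)
 also have "\<dots> = (\<Sum>x\<in>D. \<Sum>y\<in>D - {x}. h (t x) (t y))"
 proof (intro sum.cong refl sum.reindex_bij_betw[symmetric])
  fix x assume "x \<in> D"
  thus "bij_betw t (D - {x}) ({1..n} - {t x})"
   using t by (intro bij_betw_DiffI) (auto simp: tableau_iff bij_betw_def)
 qed
 also have "\<dots> = (\<Sum>x\<in>D. \<Sum>y\<in>D - {x}. f x y - k x y)"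
 proof (intro sum.cong refl)
  fix x y assume xy: "x \<in> D" "y \<in> D - {x}"
  hence "t x \<noteq> t y" "x \<noteq> y" using tableau_inj[OF t, of x y] by auto
  thus "h (t x) (t y) = f x y - k x y"
   using transposition_coeff[OF t, of x y] xy unfolding h_def f_def k_def by (simp del: nfun_tr)
 qed
 also have "\<dots> = (\<Sum>x\<in>D. \<Sum>y\<in>D - {x}. f x y) - (\<Sum>x\<in>D. \<Sum>y\<in>D - {x}. k x y)" by (simp add: sum_subtractf)
 also have "(\<Sum>x\<in>D. \<Sum>y\<in>D - {x}. f x y) = 2 * (\<Sum>x\<in>D. \<Sum>y\<in>{y \<in> D. snd y < snd x}. f x y)"
  by (rule sum_ordered_pairs) (auto simp: f_def prod_eq_iff split: if_splits)
 also have "(\<Sum>x\<in>D. \<Sum>y\<in>D - {x}. k x y) = 2 * (\<Sum>x\<in>D. \<Sum>y\<in>{y \<in> D. fst y < fst x}. k x y)"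
  by (rule sum_ordered_pairs) (auto simp: k_def prod_eq_iff split: if_splits)
 also have "(\<Sum>x\<in>D. \<Sum>y\<in>{y \<in> D. snd y < snd x}. f x y) = (\<Sum>x\<in>D. int (snd x))"
 proof (rule sum.cong[OF refl])
  fix x assume x: "x \<in> D"
  have "(\<Sum>y\<in>{y \<in> D. snd y < snd x}. f x y) = int (card {y \<in> D. snd y < snd x \<and> fst x = fst y})"
   unfolding f_def by (subst sum.inter_filter[symmetric]) (auto intro: arg_cong[where f = card])
  also have "{y \<in> D. snd y < snd x \<and> fst x = fst y} = (\<lambda>c. (fst x, c)) ` {..<snd x}"
   using x by (auto simp: diagram_def)
  finally show "(\<Sum>y\<in>{y \<in> D. snd y < snd x}. f x y) = int (snd x)" by (simp add: card_image inj_on_def)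
 qed
 also have "(\<Sum>x\<in>D. \<Sum>y\<in>{y \<in> D. fst y < fst x}. k x y) = (\<Sum>x\<in>D. int (fst x))"
 proof (rule sum.cong[OF refl])
  fix x assume x: "x \<in> D"
  have "(\<Sum>y\<in>{y \<in> D. fst y < fst x}. k x y) = int (card {y \<in> D. fst y < fst x \<and> snd x = snd y})"
   unfolding k_def by (subst sum.inter_filter[symmetric]) (auto intro: arg_cong[where f = card])
  also have "{y \<in> D. fst y < fst x \<and> snd x = snd y} = (\<lambda>r. (r, snd x)) ` {..<fst x}"
  proof
   show "(\<lambda>r. (r, snd x)) ` {..<fst x} \<subseteq> {y \<in> D. fst y < fst x \<and> snd x = snd y}"
   proof
    fix y assume "y \<in> (\<lambda>r. (r, snd x)) ` {..<fst x}"
    then obtain r where r: "y = (r, snd x)" "r < fst x" by blast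
    hence "\<mu> (fst x) \<le> \<mu> r" by (intro partition_antimono[OF part]) simp
    thus "y \<in> {y \<in> D. fst y < fst x \<and> snd x = snd y}" using x r by (auto simp: diagram_def)
   qed
  qed (auto simp: image_iff prod_eq_iff)
  finally show "(\<Sum>y\<in>{y \<in> D. fst y < fst x}. k x y) = int (fst x)" by (simp add: card_image inj_on_def)
 qed
 finally show ?thesis by (simp add: sum_subtractf)
qed

end

section \<open>Equivariant maps along paths of boxes\<close>

definition shom :: "nat \<Rightarrow> (nat \<Rightarrow> nat) \<Rightarrow> (nat \<Rightarrow> nat) \<Rightarrow> specht_map \<Rightarrow> bool" where
 "shom l lam mu \<phi> \<longleftrightarrow> (\<forall>x\<in>specht_lattice lam. \<phi> x \<in> specht_lattice mu) \<and>
   (\<forall>x\<in>specht_lattice lam. \<forall>y\<in>specht_lattice lam. \<phi> (x + y) = \<phi> x + \<phi> y) \<and>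
   (\<forall>g\<in>syms l. \<forall>x\<in>specht_lattice lam. \<phi> (perm_act (nfun g) x) = perm_act (nfun g) (\<phi> x))"

lemma shom_in: "shom l lam mu \<phi> ==> x \<in> specht_lattice lam ==> \<phi> x \<in> specht_lattice mu"
 and shom_add: "shom l lam mu \<phi> ==> x \<in> specht_lattice lam ==> y \<in> specht_lattice lam ==> \<phi> (x + y) = \<phi> x + \<phi> y"
 and shom_perm: "shom l lam mu \<phi> ==> g \<in> syms l ==> x \<in> specht_lattice lam ==>
  \<phi> (perm_act (nfun g) x) = perm_act (nfun g) (\<phi> x)" by (simp_all add: shom_def)

context shape begin

lemma shom_lin: "shom n \<mu> mu \<phi> ==> lin_on \<phi>" by (simp add: lin_on_def shom_def)

lemma shom_act: assumes \<phi>: "shom n \<mu> mu \<phi>" and "a \<in> galg n" "x \<in> S"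
 shows "\<phi> (act a x) = act a (\<phi> x)"
 by (rule lin_act[OF shom_lin[OF \<phi>] order_refl shom_perm[OF \<phi>]]) (use assms in auto)

lemma shom_nonzero_poly:
 assumes \<phi>: "shom n \<mu> mu \<phi>" and x: "x \<in> S" "\<phi> x \<noteq> 0" and t: "t \<in> tableaux \<mu>" shows "\<phi> (e t) \<noteq> 0"
proof
 assume z: "\<phi> (e t) = 0"
 have "\<phi> x = 0" using x(1)
 proof (induction rule: S_induct)
  case (poly s)
  obtain g where g: "g \<in> syms n" "e s = perm_act (nfun g) (e t)" using polytabloid_related[OF t poly] .
  show ?case unfolding g(2) shom_perm[OF \<phi> g(1) S_poly[OF t]] z by simp
 qed (simp_all add: lin_0[OF shom_lin[OF \<phi>]] lin_diff[OF shom_lin[OF \<phi>]])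
 thus False using x(2) by simp
qed

text \<open>The signed column sum of t sends y to its inner product with the polytabloid of t, times
  that polytabloid. If the image of y is zero but polytabloids have nonzero images, all these inner
  products vanish.\<close>

lemma shom_injective:
 assumes \<phi>: "shom n \<mu> mu \<phi>" and x: "x \<in> S" "\<phi> x \<noteq> 0" and y: "y \<in> S" "\<phi> y = 0" shows "y = 0"
proof (rule ip_poly_zero[OF y(1)])
 fix t assume t: "t \<in> tableaux \<mu>"
 have "frag_cmul (ip y (e t)) (\<phi> (e t)) = \<phi> (act (kap t) y)"
  using kap_rank_one[OF t S_perm_module[OF y(1)]] lin_cmul[OF shom_lin[OF \<phi>] S_poly[OF t]] by simp
 also have "\<dots> = frag_cmul (ip y (e t)) 0" unfolding shom_act[OF \<phi> kap_galg y(1)] y(2) by simp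
 finally show "ip y (e t) = 0" using frag_cmul_cancel shom_nonzero_poly[OF \<phi> x t] by metis
qed

end

locale box = fixes \<nu> \<mu> :: "nat \<Rightarrow> nat" and i n :: nat
 assumes pt: "is_partition \<nu>" "is_partition \<mu>" and upd: "\<mu> = \<nu>(i := Suc (\<nu> i))" and sz: "n = partition_size \<nu>"
begin

abbreviation z where "z \<equiv> (i, \<nu> i)"

lemma z: "z \<notin> diagram \<nu>" "diagram \<mu> = insert z (diagram \<nu>)"
 by (auto simp: diagram_def upd split: if_splits)

lemma sz': "Suc n = partition_size \<mu>"
 using z finite_diagram[OF pt(1)] by (simp add: partition_size_def sz)

sublocale A: shape \<nu> n by unfold_locales (rule pt(1), rule sz)
sublocale B: shape \<mu> "Suc n" by unfold_locales (rule pt(2), rule sz')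

definition up :: "(nat \<Rightarrow> nat set) \<Rightarrow> nat \<Rightarrow> nat set" where
 "up T = T(i := insert (Suc n) (T i))"
definition Up :: "tvec \<Rightarrow> tvec" where "Up = frag_extend (\<lambda>T. frag_of (up T))"

lemma Up_simps: "Up 0 = 0" "Up (frag_of T) = frag_of (up T)" "Up (x + y) = Up x + Up y" "Up (x - y) = Up x - Up y"
 "Up (frag_cmul c x) = frag_cmul c (Up x)"
 by (simp_all add: Up_def frag_extend_add frag_extend_diff frag_extend_cmul)

lemma Up_sum: "Up (sum f I) = (\<Sum>j\<in>I. Up (f j))"
 by (induction I rule: infinite_finite_induct) (simp_all add: Up_simps)

lemma syms_fix: "g \<in> syms n ==> nfun g (Suc n) = Suc n" by (rule syms_out) auto

lemma Up_perm: assumes "g \<in> syms n" shows "Up (perm_act (nfun g) x) = perm_act (nfun g) (Up x)"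
proof (induction x rule: frag_all_induct)
 case (one T)
 have "up (\<lambda>r. nfun g ` T r) = (\<lambda>r. nfun g ` up T r)" using syms_fix[OF assms] by (simp add: up_def fun_eq_iff)
 thus ?case by (simp add: Up_simps)
qed (simp_all add: Up_simps perm_act_diff)

abbreviation ext :: "(nat \<times> nat \<Rightarrow> nat) \<Rightarrow> nat \<times> nat \<Rightarrow> nat" where "ext t \<equiv> t(z := Suc n)"

lemma ext_tableau: assumes t: "t \<in> tableaux \<nu>" shows "ext t \<in> tableaux \<mu>"
proof -
 have t: "bij_betw t (diagram \<nu>) {1..n}" using t A.tableau_iff by blast
 have "bij_betw (ext t) (diagram \<nu>) {1..n}" by (rule bij_betw_cong[THEN iffD1, OF _ t]) (use z in auto)
 hence "bij_betw (ext t) (diagram \<nu> \<union> {z}) ({1..n} \<union> {ext t z})"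
  by (subst notIn_Un_bij_betw3[symmetric]) (use z(1) in auto)
 moreover have "diagram \<nu> \<union> {z} = diagram \<mu>" "{1..n} \<union> {ext t z} = {1..Suc n}" using z(2) by auto
 ultimately show ?thesis using B.tableau_iff by simp
qed

lemma tabloid_ext: "tabloid \<mu> (ext t) = up (tabloid \<nu> t)"
proof
 fix r
 have 1: "{x \<in> diagram \<mu>. fst x = r} = (if r = i then insert z else id) {x \<in> diagram \<nu>. fst x = r}"
  using z(2) by auto
 have 2: "ext t ` {x \<in> diagram \<nu>. fst x = r} = t ` {x \<in> diagram \<nu>. fst x = r}"
  by (rule image_cong) (use z(1) in auto)
 show "tabloid \<mu> (ext t) r = up (tabloid \<nu> t) r" unfolding tabloid_def up_def 1 using 2 by auto
qed

text \<open>The column stabiliser of t, fixing the new entry, is contained in that of the extended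
  tableau. Matching terms of the two polytabloids carry the same sign, so each contributes
  1.\<close>

lemma ip_Up_ext:
 assumes t: "t \<in> tableaux \<nu>" shows "0 < ip (Up (polytabloid \<nu> t)) (polytabloid \<mu> (ext t))"
proof -
 have "ip (Up (polytabloid \<nu> t)) (polytabloid \<mu> (ext t)) =
  (\<Sum>g\<in>A.cstab t. sg g * ip (frag_of (up (tabloid \<nu> (nfun g \<circ> t)))) (polytabloid \<mu> (ext t)))"
  unfolding A.polytabloid_kap A.act_kap Up_sum ip_sum_left A.tb_perm by (simp add: Up_simps ip_cmul_left)
 also have "\<dots> = (\<Sum>g\<in>A.cstab t. 1)"
 proof (rule sum.cong[OF refl])
  fix g assume g: "g \<in> A.cstab t"
  hence gs: "g \<in> syms n" by (rule A.cstab_syms)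
  have "ext (nfun g \<circ> t) = nfun g \<circ> ext t" using syms_fix[OF gs] by auto
  hence u: "up (tabloid \<nu> (nfun g \<circ> t)) = tabloid \<mu> (nfun g \<circ> ext t)" by (metis tabloid_ext)
  have "g \<in> B.cstab (ext t)" unfolding B.cstab_iff[OF ext_tableau[OF t]]
  proof (intro conjI ballI)
   show "g \<in> syms (Suc n)" using gs syms_mono[of n "Suc n"] by auto
   fix x assume x: "x \<in> diagram \<mu>"
   show "\<exists>y\<in>diagram \<mu>. snd y = snd x \<and> nfun g (ext t x) = ext t y"
   proof (cases "x = z")
    case True thus ?thesis using x syms_fix[OF gs] by (intro bexI[of _ x]) auto
   next
    case False
    then obtain y where "y \<in> diagram \<nu>" "snd y = snd x" "nfun g (t x) = t y"
     using x z(2) g A.cstab_iff[OF t] by auto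
    thus ?thesis using False z by (intro bexI[of _ y]) auto
   qed
  qed
  thus "sg g * ip (frag_of (up (tabloid \<nu> (nfun g \<circ> t)))) (polytabloid \<mu> (ext t)) = 1"
   unfolding u ip_of using B.lookup_polytabloid[OF ext_tableau[OF t]] by simp
 qed
 also have "\<dots> > 0" using A.cstab_0[OF t] by (auto simp: card_gt_0_iff)
 finally show ?thesis .
qed

text \<open>The map adds the new entry to row i and then pairs with all translates of one
  polytabloid of the larger shape. Pairing the image of a polytabloid with its extension gives a sum
  of squares, in which the term of the identity is positive by \<open>ip_Up_ext\<close>.\<close>

lemma box_hom: obtains \<phi> where "shom n \<nu> \<mu> \<phi>" "\<And>x. x \<in> A.S ==> \<phi> x = 0 ==> x = 0"
proof -
 obtain t where t: "t \<in> tableaux \<nu>" using A.tableau_exists by blast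
 define v where "v = polytabloid \<mu> (ext t)"
 define w where "w s = perm_act (nfun s) v" for s
 define \<phi> where "\<phi> x = (\<Sum>s\<in>syms (Suc n). frag_cmul (ip (Up x) (w s)) (w s))" for x
 have v: "v \<in> B.S" unfolding v_def by (rule B.S_poly[OF ext_tableau[OF t]])
 have \<phi>: "shom n \<nu> \<mu> \<phi>" unfolding shom_def
 proof (intro conjI ballI)
  show "\<phi> x \<in> B.S" for x unfolding \<phi>_def w_def by (intro B.S_sum B.S_cmul B.S_perm v)
  show "\<phi> (x + y) = \<phi> x + \<phi> y" for x y
   by (simp add: \<phi>_def Up_simps ip_add_left frag_cmul_distrib sum.distrib)
  fix g x assume g: "g \<in> syms n"
  hence g': "g \<in> syms (Suc n)" using syms_mono[of n "Suc n"] by auto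
  have b: "bij_betw (\<lambda>s. g + s) (syms (Suc n)) (syms (Suc n))"
   by (rule bij_betwI[where g = "\<lambda>s. - g + s"]) (use g' in \<open>auto simp: add.assoc[symmetric]\<close>)
  have w: "w (g + s) = perm_act (nfun g) (w s)" for s by (simp add: w_def perm_act_comp)
  have "\<phi> (perm_act (nfun g) x) = (\<Sum>s\<in>syms (Suc n). frag_cmul (ip (Up (perm_act (nfun g) x)) (w (g + s))) (w (g + s)))"
   unfolding \<phi>_def by (rule sum.reindex_bij_betw[OF b, symmetric])
  thus "\<phi> (perm_act (nfun g) x) = perm_act (nfun g) (\<phi> x)"
   by (simp add: w Up_perm[OF g] ip_perm \<phi>_def perm_act_sum perm_act_cmul)
 qed
 have "ip (Up (polytabloid \<nu> t)) (\<phi> (polytabloid \<nu> t)) = (\<Sum>s\<in>syms (Suc n). ip (Up (polytabloid \<nu> t)) (w s) * ip (Up (polytabloid \<nu> t)) (w s))"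
  by (simp add: \<phi>_def ip_sum_right ip_cmul_right)
 also have "\<dots> > 0"
 proof (rule sum_pos2[OF finite_syms syms_0])
  show "0 < ip (Up (polytabloid \<nu> t)) (w 0) * ip (Up (polytabloid \<nu> t)) (w 0)"
   using ip_Up_ext[OF t] by (simp add: w_def v_def)
 qed simp
 finally have "\<phi> (polytabloid \<nu> t) \<noteq> 0" by auto
 thus ?thesis using that[OF \<phi>] A.shom_injective[OF \<phi> A.S_poly[OF t]] by blast
qed

text \<open>The last Jucys-Murphy element is the difference of the sums of all transpositions of n +
  1 and of n points. These act by the content sums of the two shapes, which differ by the content of
  the new box.\<close>

lemma box_jm: assumes \<phi>: "shom n \<nu> \<mu> \<phi>" and x: "x \<in> A.S"
 shows "act (jm (Suc n)) (\<phi> x) = frag_cmul (int (\<nu> i) - int i) (\<phi> x)"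
proof -
 have "act (esym jm (Suc n) 1) (\<phi> x) = act (esym jm n 1) (\<phi> x) + act (jm (Suc n)) (\<phi> x)"
  by (simp add: act_add_left)
 moreover have "act (esym jm n 1) (\<phi> x) = frag_cmul (A.omega (esym jm n 1)) (\<phi> x)"
  using A.shom_act[OF \<phi> esym_galg x] A.omega[OF esym_cent x] A.lin_cmul[OF A.shom_lin[OF \<phi>] x] by metis
 moreover have "act (esym jm (Suc n) 1) (\<phi> x) = frag_cmul (B.omega (esym jm (Suc n) 1)) (\<phi> x)"
  by (rule B.omega[OF esym_cent shom_in[OF \<phi> x]])
 moreover have "B.omega (esym jm (Suc n) 1) = A.omega (esym jm n 1) + (int (\<nu> i) - int i)"
  unfolding A.omega_sum_jm B.omega_sum_jm z(2) using z(1) by simp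
 ultimately show ?thesis by (simp add: frag_cmul_distrib)
qed

end

theorem path_hom: assumes "box_path lam cs mu" "partition_size lam = l"
 obtains \<phi> where "shom l lam mu \<phi>" "\<And>x. x \<in> specht_lattice lam ==> \<phi> x = 0 ==> x = 0"
  "\<And>j x. j < length cs ==> x \<in> specht_lattice lam ==> act (jm (Suc (l + j))) (\<phi> x) = frag_cmul (cs ! j) (\<phi> x)"
proof -
 have "\<exists>\<phi>. shom l lam mu \<phi> \<and> (\<forall>x\<in>specht_lattice lam. \<phi> x = 0 \<longrightarrow> x = 0) \<and>
  (\<forall>j x. j < length cs \<longrightarrow> x \<in> specht_lattice lam \<longrightarrow> act (jm (Suc (l + j))) (\<phi> x) = frag_cmul (cs ! j) (\<phi> x))"
  using assms
 proof (induction cs arbitrary: lam l)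
  case Nil
  thus ?case by (intro exI[of _ "\<lambda>x. x"]) (simp add: shom_def)
 next
  case (Cons c cs)
  then obtain \<nu> where \<nu>: "add_box lam c \<nu>" "box_path \<nu> cs mu" by auto
  then obtain i where i: "is_partition lam" "is_partition \<nu>" "\<nu> = lam(i := Suc (lam i))" "c = int (lam i) - int i"
   unfolding add_box_def by blast
  interpret box lam \<nu> i l by unfold_locales (use i Cons.prems in auto)
  obtain \<phi> where \<phi>: "shom l lam \<nu> \<phi>" "\<And>x. x \<in> A.S ==> \<phi> x = 0 ==> x = 0" using box_hom by blast
  obtain \<psi> where \<psi>: "shom (Suc l) \<nu> mu \<psi>" "\<And>x. x \<in> B.S ==> \<psi> x = 0 ==> x = 0"
   "\<And>j x. j < length cs ==> x \<in> B.S ==> act (jm (Suc (Suc l + j))) (\<psi> x) = frag_cmul (cs ! j) (\<psi> x)"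
   using Cons.IH[OF \<nu>(2) sz'[symmetric]] by blast
  show ?case
  proof (intro exI[of _ "\<lambda>x. \<psi> (\<phi> x)"] conjI allI impI ballI)
   show "shom l lam mu (\<lambda>x. \<psi> (\<phi> x))" unfolding shom_def
   proof (intro conjI ballI)
    fix g x assume g: "g \<in> syms l" and x: "x \<in> A.S"
    have "g \<in> syms (Suc l)" using g syms_mono[of l "Suc l"] by auto
    thus "\<psi> (\<phi> (perm_act (nfun g) x)) = perm_act (nfun g) (\<psi> (\<phi> x))"
     using shom_perm[OF \<phi>(1) g x] shom_perm[OF \<psi>(1) _ shom_in[OF \<phi>(1) x]] by simp
   qed (simp_all add: shom_in[OF \<phi>(1)] shom_in[OF \<psi>(1)] shom_add[OF \<phi>(1)] shom_add[OF \<psi>(1)])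
   show "x = 0" if "x \<in> A.S" "\<psi> (\<phi> x) = 0" for x using that \<phi> \<psi>(2) shom_in[OF \<phi>(1)] by blast
   fix j x assume j: "j < length (c # cs)" and x: "x \<in> A.S"
   have fx: "\<phi> x \<in> B.S" by (rule shom_in[OF \<phi>(1) x])
   show "act (jm (Suc (l + j))) (\<psi> (\<phi> x)) = frag_cmul ((c # cs) ! j) (\<psi> (\<phi> x))"
   proof (cases j)
    case 0
    \<comment> \<open>The element involves only the first l + 1 points, so it commutes with the map
      coming from the later boxes, and the content of the first box is kept.\<close>
    have "act (jm (Suc l)) (\<psi> (\<phi> x)) = \<psi> (act (jm (Suc l)) (\<phi> x))"
     by (rule B.shom_act[OF \<psi>(1) _ fx, symmetric]) simp
    also have "\<dots> = frag_cmul c (\<psi> (\<phi> x))"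
     unfolding box_jm[OF \<phi>(1) x] i(4) by (rule B.lin_cmul[OF B.shom_lin[OF \<psi>(1)] fx])
    finally show ?thesis using 0 by simp
   next
    case (Suc j')
    thus ?thesis using \<psi>(3)[OF _ fx, of j'] j by simp
   qed
  qed
 qed
 thus ?thesis using that by blast
qed

context shape begin

text \<open>The signed column sum of t is itself the rank one operator given by the polytabloid of
  t. Multiplication by permutations and additive combinations produce every pair of vectors of the
  lattice.\<close>

lemma rank_one: assumes u: "u \<in> S" and w: "w \<in> S"
 obtains a where "a \<in> galg n" "\<And>x. x \<in> S ==> act a x = frag_cmul (ip x u) w"
proof -
 have "\<exists>a\<in>galg n. \<forall>x\<in>S. act a x = frag_cmul (ip x u) w" using u
 proof (induction rule: S_induct)
  case zero
  thus ?case by (intro bexI[of _ 0]) auto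
 next
  case (poly t)
  show ?case using w
  proof (induction rule: S_induct)
   case zero
   thus ?case by (intro bexI[of _ 0]) auto
  next
   case (poly s)
   obtain g where g: "g \<in> syms n" "e s = perm_act (nfun g) (e t)" using polytabloid_related[OF \<open>t \<in> _\<close> poly] .
   show ?case by (intro bexI[of _ "gs g * kap t"])
     (simp_all add: g kap_galg act_mult kap_rank_one[OF \<open>t \<in> _\<close> S_perm_module] perm_act_cmul)
  next
   case (diff x y)
   then obtain a b where "a \<in> galg n" "\<forall>z\<in>S. act a z = frag_cmul (ip z (e t)) x"
    "b \<in> galg n" "\<forall>z\<in>S. act b z = frag_cmul (ip z (e t)) y" by blast
   thus ?case by (intro bexI[of _ "a - b"]) (simp_all add: act_diff_left frag_cmul_diff2)
  qed
 next
  case (diff x y)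
  then obtain a b where "a \<in> galg n" "\<forall>z\<in>S. act a z = frag_cmul (ip z x) w"
   "b \<in> galg n" "\<forall>z\<in>S. act b z = frag_cmul (ip z y) w" by blast
  thus ?case by (intro bexI[of _ "a - b"]) (simp_all add: act_diff_left ip_diff_right frag_cmul_diff_distrib)
 qed
 thus ?thesis using that by blast
qed

end

lemma shom_cent:
 assumes \<phi>: "shom l lam mu \<phi>" and mu: "is_partition mu" "partition_size mu = m" and c: "c \<in> cent l m"
 shows "shom l lam mu (\<lambda>x. act c (\<phi> x))"
proof -
 interpret shape mu m by unfold_locales (use mu in auto)
 have "gs g * c = c * gs g" if "g \<in> syms l" for g using c that by (simp add: cent_def)
 hence "act c (perm_act (nfun g) x) = perm_act (nfun g) (act c x)" if "g \<in> syms l" for g x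
  by (metis act_gs act_mult that)
 thus ?thesis using \<phi> S_act[OF cent_galg[OF c]] by (simp add: shom_def act_add_right)
qed

lemma shom_omega: assumes \<phi>: "shom l lam mu \<phi>" and lam: "is_partition lam" "partition_size lam = l"
  and z: "z \<in> cent l l" and x: "x \<in> specht_lattice lam"
 shows "act z (\<phi> x) = frag_cmul (shape.omega lam z) (\<phi> x)"
proof -
 interpret shape lam l by unfold_locales (use lam in auto)
 show ?thesis using shom_act[OF \<phi> cent_galg[OF z] x] omega[OF z x] lin_cmul[OF shom_lin[OF \<phi>] x] by metis
qed

text \<open>The average over \<open>S\<^sub>l\<close> of the rank one operator \<open>x \<mapsto> \<langle>x, \<phi> v\<rangle> \<psi> v\<close> lies in the centraliser
 algebra; its composite with \<open>\<phi>\<close> is \<open>\<psi> \<circ> \<Theta>\<close> with \<open>\<Theta>\<close> equivariant and positive.\<close>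

theorem shom_irreducible:
 assumes lam: "is_partition lam" "partition_size lam = l" and mu: "is_partition mu" "partition_size mu = m"
  and lm: "l \<le> m" and \<phi>: "shom l lam mu \<phi>" and \<psi>: "shom l lam mu \<psi>"
  and v: "v \<in> specht_lattice lam" "\<phi> v \<noteq> 0"
 obtains c k where "c \<in> cent l m" "k \<noteq> 0" "\<And>x. x \<in> specht_lattice lam ==> act c (\<phi> x) = frag_cmul k (\<psi> x)"
proof -
 interpret L: shape lam l by unfold_locales (use lam in auto)
 interpret M: shape mu m by unfold_locales (use mu in auto)
 obtain a where a: "a \<in> galg m" "\<And>x. x \<in> M.S ==> act a x = frag_cmul (ip x (\<phi> v)) (\<psi> v)"
  using M.rank_one[OF shom_in[OF \<phi> v(1)] shom_in[OF \<psi> v(1)]] by metis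
 define c where "c = (\<Sum>t\<in>syms l. gs t * a * gs (- t))"
 define r where "r t = perm_act (nfun t) v" for t
 define \<Theta> where "\<Theta> x = (\<Sum>t\<in>syms l. frag_cmul (ip (\<phi> x) (\<phi> (r t))) (r t))" for x
 have up: "t \<in> syms m" if "t \<in> syms l" for t using that syms_mono[OF lm] by blast
 have bij: "bij_betw (\<lambda>s. g + s) (syms l) (syms l)" if "g \<in> syms l" for g
  by (rule bij_betwI[where g = "\<lambda>s. - g + s"]) (use that in \<open>auto simp: add.assoc[symmetric]\<close>)
 have r: "r t \<in> L.S" if "t \<in> syms l" for t unfolding r_def by (rule L.S_perm[OF that v(1)])
 have c: "c \<in> cent l m" unfolding cent_def
 proof (intro CollectI conjI ballI)
  show "c \<in> galg m" unfolding c_def by (intro galg_sum galg_mult a galg_gs) (simp_all add: up)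
  fix g assume g: "g \<in> syms l"
  have "c = (\<Sum>t\<in>syms l. gs (g + t) * a * gs (- (g + t)))"
   unfolding c_def by (rule sum.reindex_bij_betw[OF bij[OF g], symmetric])
  also have "\<dots> * gs g = gs g * c" unfolding c_def sum_distrib_left sum_distrib_right
  proof (rule sum.cong[OF refl])
   fix t
   have h: "gs (- (g + t)) * gs g = (gs (- t) :: int gring)" by (simp add: gs_mult minus_add add.assoc)
   show "gs (g + t) * a * gs (- (g + t)) * gs g = gs g * (gs t * a * gs (- t))"
    by (simp only: mult.assoc h) (simp only: gs_mult[symmetric] mult.assoc)
  qed
  finally show "gs g * c = c * gs g" ..
 qed
 have \<Theta>in: "\<Theta> x \<in> L.S" for x unfolding \<Theta>_def by (intro L.S_sum L.S_cmul r)
 have \<Theta>lin: "L.lin_on \<Theta>"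
  unfolding L.lin_on_def by (simp add: \<Theta>_def shom_add[OF \<phi>] ip_add_left frag_cmul_distrib sum.distrib)
 have \<Theta>perm: "\<Theta> (perm_act (nfun g) x) = perm_act (nfun g) (\<Theta> x)" if g: "g \<in> syms l" and x: "x \<in> L.S" for g x
 proof -
  have rg: "r (g + t) = perm_act (nfun g) (r t)" for t by (simp add: r_def perm_act_comp)
  have "\<Theta> (perm_act (nfun g) x) = (\<Sum>t\<in>syms l. frag_cmul (ip (\<phi> (perm_act (nfun g) x)) (\<phi> (r (g + t)))) (r (g + t)))"
   unfolding \<Theta>_def by (rule sum.reindex_bij_betw[OF bij[OF g], symmetric])
  also have "\<dots> = (\<Sum>t\<in>syms l. frag_cmul (ip (\<phi> x) (\<phi> (r t))) (perm_act (nfun g) (r t)))"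
   by (rule sum.cong[OF refl]) (simp add: rg shom_perm[OF \<phi> g] r x ip_perm)
  finally show ?thesis by (simp add: \<Theta>_def perm_act_sum perm_act_cmul)
 qed
 obtain t where t: "t \<in> tableaux lam" using L.tableau_exists by blast
 define k where "k = lookup (\<Theta> (L.e t)) (tabloid lam t)"
 have k: "\<Theta> x = frag_cmul k x" if "x \<in> L.S" for x
  unfolding k_def by (rule L.schur[OF \<Theta>lin L.S_perm_module[OF \<Theta>in] \<Theta>perm t that])
 have lc: "L.lin_on \<phi>" "L.lin_on \<psi>" using L.shom_lin \<phi> \<psi> by blast+
 have "act c (\<phi> x) = frag_cmul k (\<psi> x)" if x: "x \<in> L.S" for x
 proof -
  have "act c (\<phi> x) = (\<Sum>t\<in>syms l. frag_cmul (ip (\<phi> x) (\<phi> (r t))) (\<psi> (r t)))"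
   unfolding c_def act_sum_left
  proof (rule sum.cong[OF refl])
   fix t assume t: "t \<in> syms l"
   have "act (gs t * a * gs (- t)) (\<phi> x) = perm_act (nfun t) (act a (perm_act (nfun (- t)) (\<phi> x)))"
    by (simp add: act_mult)
   also have "\<dots> = frag_cmul (ip (perm_act (nfun (- t)) (\<phi> x)) (\<phi> v)) (perm_act (nfun t) (\<psi> v))"
    by (simp add: a(2) M.S_perm up t shom_in[OF \<phi> x] perm_act_cmul)
   also have "\<dots> = frag_cmul (ip (\<phi> x) (\<phi> (r t))) (\<psi> (r t))"
    by (simp add: ip_move r_def shom_perm[OF \<phi> t v(1)] shom_perm[OF \<psi> t v(1)])
   finally show "act (gs t * a * gs (- t)) (\<phi> x) = frag_cmul (ip (\<phi> x) (\<phi> (r t))) (\<psi> (r t))" .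
  qed
  also have "\<dots> = \<psi> (\<Theta> x)"
   unfolding \<Theta>_def by (subst L.lin_sum[OF lc(2)]) (auto simp: r L.lin_cmul[OF lc(2)])
  finally show ?thesis unfolding k[OF x] L.lin_cmul[OF lc(2) x] .
 qed
 \<comment> \<open>Pairing the image of \<Theta> v under \<phi> with \<phi> v gives a sum of
   squares, to which the identity contributes the square of a positive number.\<close>
 moreover have "k \<noteq> 0"
 proof
  assume "k = 0"
  hence "\<phi> (\<Theta> v) = 0" using k[OF v(1)] L.lin_0[OF lc(1)] by simp
  hence "0 = ip (\<phi> v) (\<phi> (\<Theta> v))" by simp
  also have "\<phi> (\<Theta> v) = (\<Sum>t\<in>syms l. frag_cmul (ip (\<phi> v) (\<phi> (r t))) (\<phi> (r t)))"
   unfolding \<Theta>_def by (subst L.lin_sum[OF lc(1)]) (auto simp: r L.lin_cmul[OF lc(1)])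
  also have "ip (\<phi> v) \<dots> = (\<Sum>t\<in>syms l. ip (\<phi> v) (\<phi> (r t)) * ip (\<phi> v) (\<phi> (r t)))"
   by (simp add: ip_sum_right ip_cmul_right)
  also have "\<dots> > 0"
   by (rule sum_pos2[OF finite_syms syms_0]) (use ip_pos[OF v(2)] in \<open>simp_all add: r_def\<close>)
  finally show False by simp
 qed
 ultimately show ?thesis using that c by blast
qed

lemma cmul_eq_cmul: "x \<noteq> 0 ==> frag_cmul a x = frag_cmul b (x :: 'a \<Rightarrow>\<^sub>0 int) \<longleftrightarrow> a = b"
proof
 assume x: "x \<noteq> 0" and h: "frag_cmul a x = frag_cmul b x"
 obtain k where "lookup x k \<noteq> 0" using x poly_mapping_eqI[of x 0] by auto
 thus "a = b" using arg_cong[OF h, of "\<lambda>y. lookup y k"] by simp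
qed simp

text \<open>Induction on n along \<open>nakayama_link\<close>. Two shapes obtained by adding boxes
  of the same residue contain the images of smaller shapes with equal residue counts. There a
  central element is a polynomial in the centre of the smaller group ring, handled by induction, and
  in the last Jucys-Murphy element, which acts by the content of the added box.\<close>

theorem omega_cong:
 assumes p: "p \<ge> 2" and lam: "is_partition lam1" "is_partition lam2" "partition_size lam1 = n"
  and r: "res_count p lam1 = res_count p lam2" and z: "z \<in> cent n n"
 shows "shape.omega lam1 z mod int p = shape.omega lam2 z mod int p" using lam r z
proof (induction n arbitrary: lam1 lam2 z)
 case 0
 have "diagram lam1 = {}" using 0 finite_diagram[OF 0(1)] by (simp add: partition_size_def)
 hence r0: "res_count p lam1 = {#}" by (simp add: res_count_def)
 hence "card (diagram lam2) = 0" using 0(4) by (metis res_count_def size_empty size_image_mset size_mset_set)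
 hence "diagram lam2 = {}" using finite_diagram[OF 0(2)] by simp
 hence "lam1 = lam2" using \<open>diagram lam1 = {}\<close> by (auto simp: diagram_def fun_eq_iff) (metis gr0I)
 thus ?case by simp
next
 case (Suc n)
 let ?A = "\<lambda>\<nu>. shape.omega lam1 z mod int p = shape.omega \<nu> z mod int p \<and> partition_size \<nu> = Suc n"
 have "?A lam2"
 proof (rule nakayama_link[OF p _ Suc.prems(1,2,4), where A = ?A])
  fix \<nu> c lam \<nu>' c' lam'
  assume h: "add_box \<nu> c lam" "add_box \<nu>' c' lam'" "c mod int p = c' mod int p" "res_count p lam = res_count p lam'"
   and A: "?A lam"
  have s: "partition_size lam' = Suc n" "partition_size \<nu> = n" "partition_size \<nu>' = n"
  proof -
   have "size (res_count p lam) = size (res_count p lam')" by (simp add: h(4))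
   hence "partition_size lam = partition_size lam'" by (simp add: res_count_def partition_size_def)
   thus "partition_size lam' = Suc n" "partition_size \<nu> = n" "partition_size \<nu>' = n"
    using A add_box_res(2)[OF h(1)] add_box_res(2)[OF h(2)] by simp_all
  qed
  have pt: "is_partition \<nu>" "is_partition \<nu>'" "is_partition lam" "is_partition lam'"
   using h unfolding add_box_def by blast+
  have rc: "res_count p \<nu> = res_count p \<nu>'"
   using h(3,4) add_box_res(1)[OF h(1)] add_box_res(1)[OF h(2)] by simp
  have bp: "box_path \<nu> [c] lam" "box_path \<nu>' [c'] lam'" using h pt by auto
  obtain \<phi> where \<phi>: "shom n \<nu> lam \<phi>" "\<And>x. x \<in> specht_lattice \<nu> ==> \<phi> x = 0 ==> x = 0"
   "\<And>x. x \<in> specht_lattice \<nu> ==> act (jm (Suc n)) (\<phi> x) = frag_cmul c (\<phi> x)"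
   by (rule path_hom[OF bp(1) s(2)]) auto
  obtain \<phi>' where \<phi>': "shom n \<nu>' lam' \<phi>'" "\<And>x. x \<in> specht_lattice \<nu>' ==> \<phi>' x = 0 ==> x = 0"
   "\<And>x. x \<in> specht_lattice \<nu>' ==> act (jm (Suc n)) (\<phi>' x) = frag_cmul c' (\<phi>' x)"
   by (rule path_hom[OF bp(2) s(3)]) auto
  \<comment> \<open>The elements that act on the images of both smaller lattices by scalars
    congruent modulo p. They are closed under all the operations in \<open>cgen\<close>.\<close>
  define sc2 where "sc2 a \<longleftrightarrow> (\<exists>s s'. s mod int p = s' mod int p \<and>
   (\<forall>x\<in>specht_lattice \<nu>. act a (\<phi> x) = frag_cmul s (\<phi> x)) \<and>
   (\<forall>x\<in>specht_lattice \<nu>'. act a (\<phi>' x) = frag_cmul s' (\<phi>' x)))" for a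
  have "sc2 a" if "a \<in> cgen n (Suc n)" for a using that
  proof (induction rule: cgen.induct)
   case (centre y)
   show ?case unfolding sc2_def
    using shom_omega[OF \<phi>(1) pt(1) s(2) centre] shom_omega[OF \<phi>'(1) pt(2) s(3) centre]
     Suc.IH[OF pt(1,2) s(2) rc centre] by blast
  next
   case (murphy j)
   hence "j = Suc n" by simp
   thus ?case unfolding sc2_def using \<phi>(3) \<phi>'(3) h(3) by blast
  next
   case (add a b)
   then obtain s s' t t' where "s mod int p = s' mod int p" "t mod int p = t' mod int p"
    "\<forall>x\<in>specht_lattice \<nu>. act a (\<phi> x) = frag_cmul s (\<phi> x) \<and> act b (\<phi> x) = frag_cmul t (\<phi> x)"
    "\<forall>x\<in>specht_lattice \<nu>'. act a (\<phi>' x) = frag_cmul s' (\<phi>' x) \<and> act b (\<phi>' x) = frag_cmul t' (\<phi>' x)"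
    unfolding sc2_def by blast
   thus ?case unfolding sc2_def
    by (intro exI[of _ "s + t"] exI[of _ "s' + t'"]) (auto simp: act_add_left frag_cmul_distrib intro: mod_add_cong)
  next
   case (uminus a)
   then obtain s s' where "s mod int p = s' mod int p"
    "\<forall>x\<in>specht_lattice \<nu>. act a (\<phi> x) = frag_cmul s (\<phi> x)"
    "\<forall>x\<in>specht_lattice \<nu>'. act a (\<phi>' x) = frag_cmul s' (\<phi>' x)" unfolding sc2_def by blast
   thus ?case unfolding sc2_def
    by (intro exI[of _ "- s"] exI[of _ "- s'"]) (auto simp: act_uminus_left intro: mod_minus_cong)
  next
   case (mult a b)
   then obtain s s' t t' where "s mod int p = s' mod int p" "t mod int p = t' mod int p"
    "\<forall>x\<in>specht_lattice \<nu>. act a (\<phi> x) = frag_cmul s (\<phi> x) \<and> act b (\<phi> x) = frag_cmul t (\<phi> x)"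
    "\<forall>x\<in>specht_lattice \<nu>'. act a (\<phi>' x) = frag_cmul s' (\<phi>' x) \<and> act b (\<phi>' x) = frag_cmul t' (\<phi>' x)"
    unfolding sc2_def by blast
   thus ?case unfolding sc2_def
    by (intro exI[of _ "s * t"] exI[of _ "s' * t'"]) (auto simp: act_mult act_cmul ac_simps intro: mod_mult_cong)
  qed auto
  \<comment> \<open>An element central for n + 1 points commutes with the permutations of the first
    n, so the generation theorem applies; between n and n + 1 there are no adjacent transpositions
    among the generators.\<close>
  moreover have "z \<in> cgen n (Suc n)"
   using Suc.prems(5) cent_mono[of n "Suc n" "Suc n"] cent_subset_cgen[of n "Suc n"] by auto
  ultimately obtain s1 s1' where s1: "s1 mod int p = s1' mod int p"
   "\<forall>x\<in>specht_lattice \<nu>. act z (\<phi> x) = frag_cmul s1 (\<phi> x)"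
   "\<forall>x\<in>specht_lattice \<nu>'. act z (\<phi>' x) = frag_cmul s1' (\<phi>' x)" unfolding sc2_def by blast
  have om: "shape.omega mu z = k"
   if f: "shom n la mu f" "\<And>x. x \<in> specht_lattice la ==> f x = 0 ==> x = 0"
    and la: "is_partition la" "partition_size la = n" and mu: "is_partition mu" "partition_size mu = Suc n"
    and k: "\<forall>x\<in>specht_lattice la. act z (f x) = frag_cmul k (f x)" for mu k la f
  proof -
   interpret L: shape la n by unfold_locales (use la in auto)
   interpret M: shape mu "Suc n" by unfold_locales (use mu in auto)
   obtain t where t: "t \<in> tableaux la" using L.tableau_exists by blast
   have "f (L.e t) \<noteq> 0" using f(2) L.poly_nonzero L.S_poly t by blast
   moreover have "frag_cmul (M.omega z) (f (L.e t)) = frag_cmul k (f (L.e t))"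
    using bspec[OF k L.S_poly[OF t]] M.omega[OF Suc.prems(5) shom_in[OF f(1) L.S_poly[OF t]]] by (simp only:)
   ultimately show ?thesis using cmul_eq_cmul by blast
  qed
  have "shape.omega lam z = s1" "shape.omega lam' z = s1'"
   using om[OF \<phi>(1,2) pt(1) s(2) pt(3) _ s1(2)] om[OF \<phi>'(1,2) pt(2) s(3) pt(4) s(1) s1(3)] A by simp_all
  thus "?A lam'" using A s1(1) s(1) by simp
 qed (use Suc.prems in auto)
 thus ?case by simp
qed

theorem omega_esym: assumes cs: "box_path (\<lambda>_. 0) cs mu" and m: "partition_size mu = m"
 shows "shape.omega mu (esym jm m j) = esym (\<lambda>i. cs ! (i - 1)) m j"
proof -
 have mu: "is_partition mu" using box_path_partition[OF cs] by blast
 interpret L: shape "\<lambda>_. 0" 0 by unfold_locales (use empty_partition in auto)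
 interpret M: shape mu m by unfold_locales (use mu m in auto)
 obtain \<phi> where \<phi>: "shom 0 (\<lambda>_. 0) mu \<phi>" "\<And>x. x \<in> L.S ==> \<phi> x = 0 ==> x = 0"
  "\<And>j x. j < length cs ==> x \<in> L.S ==> act (jm (Suc (0 + j))) (\<phi> x) = frag_cmul (cs ! j) (\<phi> x)"
  using path_hom[OF cs empty_partition(3)] by blast
 obtain t where t: "t \<in> tableaux (\<lambda>_. 0)" using L.tableau_exists by blast
 define x where "x = \<phi> (L.e t)"
 have x: "x \<in> M.S" "x \<noteq> 0" using \<phi>(2) L.poly_nonzero L.S_poly t shom_in[OF \<phi>(1)] unfolding x_def by blast+
 have len: "length cs = m" using box_path_res(2)[OF cs] m empty_partition(3) by simp
 have J: "act (jm (Suc i)) x = frag_cmul (cs ! i) x" if "i < m" for i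
  using \<phi>(3)[OF _ L.S_poly[OF t], of i] that len by (simp add: x_def)
 have "act (esym jm k j) x = frag_cmul (esym (\<lambda>i. cs ! (i - 1)) k j) x" if "k \<le> m" for k j
  using that
 proof (induction k arbitrary: j)
  case 0 thus ?case by (cases j) auto
 next
  case (Suc k)
  thus ?case by (cases j) (auto simp: act_add_left act_mult J act_cmul frag_cmul_distrib ac_simps)
 qed
 from this[OF order_refl, of j] show ?thesis using M.omega[OF esym_cent x(1)] cmul_eq_cmul[OF x(2)] by metis
qed

section \<open>Specht modules over a field\<close>

definition iota :: "int gring \<Rightarrow> 'k::comm_ring_1 gring" where
 "iota = Poly_Mapping.map of_int"

lemma lookup_iota [simp]: "lookup (iota c) g = of_int (lookup c g)"
 by (simp add: iota_def Poly_Mapping.map.rep_eq when_def)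

lemma iota_0 [simp]: "iota 0 = 0" and iota_add: "iota (a + b) = iota a + iota b"
 and iota_diff: "iota (a - b) = iota a - iota b"
 by (rule poly_mapping_eqI; simp add: lookup_add lookup_minus)+
lemma iota_single [simp]: "iota (single g c) = single g (of_int c)"
 by (rule poly_mapping_eqI) (simp add: lookup_single when_def)
lemma iota_1 [simp]: "iota 1 = 1" using iota_single[of 0 1] by simp
lemma iota_sum: "iota (sum f I) = (\<Sum>i\<in>I. iota (f i))"
 by (induction I rule: infinite_finite_induct) (simp_all add: iota_add)
lemma iota_mult: "iota (a * b) = iota a * iota b"
proof (induction a rule: frag_all_induct)
 case (one g)
 show ?case
 proof (induction b rule: frag_all_induct)
  case (one h) thus ?case by (simp add: mult_single)
 qed (simp_all add: right_diff_distrib iota_diff)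
qed (simp_all add: left_diff_distrib iota_diff)

lemma iota_cent: assumes "c \<in> cent l m" shows "iota c \<in> cent l m"
proof -
 have "keys (iota c) \<subseteq> keys c" by (auto simp: in_keys_iff)
 thus ?thesis using assms by (auto simp: cent_iff_lookup galg_def)
qed

lemma esym_of_int: "of_int (esym x n j) = (esym (\<lambda>i. of_int (x i)) n j :: 'k::comm_ring_1)"
 by (induction x n j rule: esym.induct) simp_all

abbreviation scal :: "'k::comm_ring_1 \<Rightarrow> 'k gring" where "scal \<equiv> single 0"

lemma scal_simps: "scal (a + b) = scal a + scal b" "scal (a - b) = scal a - scal b" "scal (a * b) = scal a * scal b"
 "scal 1 = 1" "scal 0 = 0" "scal (- a) = - scal a"
 by (simp_all add: single_add single_diff mult_single single_uminus)

lemma scal_sum: "scal (sum f I) = (\<Sum>i\<in>I. scal (f i))"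
 by (induction I rule: infinite_finite_induct) (simp_all add: single_add)

lemma scal_left: "x * (scal c * y) = scal c * (x * y)" by (metis mult.assoc scalar_commute)

lemma lookup_scal [simp]: "lookup (scal c * a) g = c * lookup a g"
proof -
 have "scal c * a = (\<Sum>k\<in>keys a. single k (c * lookup a k))"
  by (subst poly_mapping_sum[of a]) (simp add: sum_distrib_left mult_single)
 hence "lookup (scal c * a) g = (\<Sum>k\<in>keys a. if k = g then c * lookup a g else 0)"
  by (simp add: lookup_sum lookup_single when_def cong: if_cong)
 thus ?thesis by (auto simp: in_keys_iff)
qed

definition orbits :: "nat \<Rightarrow> nat \<Rightarrow> nperm set set" where "orbits l m = orb l ` syms m"

definition orbsum :: "nperm set \<Rightarrow> 'r::comm_ring_1 gring" where "orbsum X = (\<Sum>g\<in>X. gs g)"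

definition orbcoeff :: "'r::comm_ring_1 gring \<Rightarrow> nperm set \<Rightarrow> 'r" where
 "orbcoeff a X = the_elem (lookup a ` X)"

lemma finite_orbits [simp]: "finite (orbits l m)" by (simp add: orbits_def)
lemma finite_orbit: "X \<in> orbits l m ==> finite X" by (auto simp: orbits_def)

lemma orbsum_cent: "X \<in> orbits l m ==> l \<le> m ==> orbsum X \<in> cent l m"
 using osum_cent unfolding orbits_def orbsum_def osum_def by blast

lemma iota_orbsum [simp]: "iota (orbsum X) = orbsum X" by (simp add: orbsum_def iota_sum)

lemma orbcoeff_orb: assumes "a \<in> cent l m" shows "orbcoeff a (orb l g) = lookup a g"
proof -
 have "lookup a x = lookup a g" if "x \<in> orb l g" for x
  using that cent_lookup[OF assms] by (auto simp: orb_def)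
 thus ?thesis unfolding orbcoeff_def using orb_self by (intro the_elem_image_unique) blast+
qed

lemma orbcoeff_eq: "a \<in> cent l m ==> X \<in> orbits l m ==> g \<in> X ==> orbcoeff a X = lookup a g"
 unfolding orbits_def using orb_eq orbcoeff_orb by (metis imageE)

lemma cent_decomp: fixes a :: "'r::comm_ring_1 gring" assumes a: "a \<in> cent l m" and lm: "l \<le> m"
 shows "a = (\<Sum>X\<in>orbits l m. scal (orbcoeff a X) * orbsum X)"
proof (rule poly_mapping_eqI)
 fix h
 have "lookup (\<Sum>X\<in>orbits l m. scal (orbcoeff a X) * orbsum X) h =
  (\<Sum>X\<in>orbits l m. if X = orb l h then lookup a h else 0)" unfolding lookup_sum
 proof (rule sum.cong[OF refl])
  fix X assume X: "X \<in> orbits l m"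
  have "h \<in> X \<longleftrightarrow> X = orb l h" using X unfolding orbits_def using orb_eq[of h l] orb_self[of h l] by blast
  moreover have "lookup (orbsum X :: 'r gring) h = (if h \<in> X then 1 else 0)"
   using finite_orbit[OF X] by (simp add: orbsum_def lookup_sum lookup_single when_def)
  ultimately show "lookup (scal (orbcoeff a X) * orbsum X) h = (if X = orb l h then lookup a h else 0)"
   using orbcoeff_eq[OF a X, of h] by (cases "h \<in> X") simp_all
 qed
 also have "\<dots> = lookup a h"
 proof (cases "h \<in> syms m")
  case True thus ?thesis by (simp add: orbits_def)
 next
  case False
  hence "lookup a h = 0" using cent_galg[OF a] by (auto simp: galg_def in_keys_iff)
  thus ?thesis by (simp add: sum.neutral)
 qed
 finally show "lookup a h = lookup (\<Sum>X\<in>orbits l m. scal (orbcoeff a X) * orbsum X) h" ..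
qed

lemma cent_dvd: fixes x :: "int gring"
 assumes x: "x \<in> cent l m" and p: "p \<noteq> 0" and d: "\<And>g. p dvd lookup x g"
 obtains y where "y \<in> cent l m" "x = sc p * y"
proof -
 define y where "y = Poly_Mapping.map (\<lambda>c. c div p) x"
 have l: "lookup y g = lookup x g div p" for g by (simp add: y_def Poly_Mapping.map.rep_eq when_def)
 have "keys y \<subseteq> keys x" using l by (auto simp: in_keys_iff)
 hence "y \<in> cent l m" using x by (auto simp: cent_iff_lookup galg_def l)
 moreover have "x = sc p * y" by (rule poly_mapping_eqI) (simp add: l d)
 ultimately show ?thesis using that by blast
qed

text \<open>Linear independence over the prime field, whose elements are represented by
  integers.\<close>

definition fp_indep :: "'k::field set \<Rightarrow> bool" where
 "fp_indep B \<longleftrightarrow> (\<forall>n. (\<Sum>b\<in>B. of_int (n b) * b) = 0 \<longrightarrow> (\<forall>b\<in>B. of_int (n b) = (0::'k)))"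

lemma fp_basis: fixes A :: "'k::field set" assumes p: "prime p" "CHAR('k) = p" and A: "finite A"
 obtains B where "finite B" "fp_indep B" "\<And>a. a \<in> A ==> \<exists>n. a = (\<Sum>b\<in>B. of_int (n b) * b)"
proof -
 have "\<exists>B. finite B \<and> fp_indep B \<and> (\<forall>a\<in>A. \<exists>n. a = (\<Sum>b\<in>B. of_int (n b) * b))" using A
 proof (induction A rule: finite_induct)
  case empty
  show ?case by (rule exI[of _ "{}"]) (simp add: fp_indep_def)
 next
  case (insert a A)
  then obtain B where B: "finite B" "fp_indep B" "\<forall>a\<in>A. \<exists>n. a = (\<Sum>b\<in>B. of_int (n b) * b)" by blast
  show ?case
  proof (cases "\<exists>n. a = (\<Sum>b\<in>B. of_int (n b) * b)")
   case True thus ?thesis using B by blast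
  next
   case False
   have aB: "a \<notin> B"
   proof
    assume "a \<in> B"
    have "(\<Sum>b\<in>B. of_int (if b = a then 1 else 0) * b) = (\<Sum>b\<in>B. if b = a then a else 0)"
     by (rule sum.cong) auto
    also have "\<dots> = a" using \<open>a \<in> B\<close> B(1) by simp
    finally have "(\<Sum>b\<in>B. of_int (if b = a then 1 else 0) * b) = a" .
    thus False using False by metis
   qed
   have "fp_indep (insert a B)" unfolding fp_indep_def
   proof (intro allI impI)
    fix n assume s: "(\<Sum>b\<in>insert a B. of_int (n b) * b) = 0"
    hence s': "of_int (n a) * a + (\<Sum>b\<in>B. of_int (n b) * b) = 0" using B(1) aB by simp
    have na: "of_int (n a) = (0::'k)"
    proof (rule ccontr)
     assume "of_int (n a) \<noteq> (0::'k)"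
     hence "\<not> int p dvd n a" using p(2) of_int_eq_0_iff_char_dvd by metis
     hence "coprime (n a) (int p)" using p(1)
      by (metis coprime_commute prime_imp_coprime prime_nat_int_transfer)
     then obtain x y where "x * n a + y * int p = 1" using bezout_int[of "n a" "int p"] by (auto simp only: coprime_iff_gcd_eq_1)
     have pz: "of_nat p = (0::'k)" using p(2) of_nat_CHAR[where 'a = 'k] by (simp only:)
     have "of_int (x * n a + y * int p) = (1::'k)" unfolding \<open>x * n a + y * int p = 1\<close> by simp
     hence 1: "of_int x * of_int (n a) = (1::'k)" using pz by simp
     have "a = of_int x * (of_int (n a) * a)" by (simp add: mult.assoc[symmetric] 1)
     also have "of_int (n a) * a = - (\<Sum>b\<in>B. of_int (n b) * b)" using s' by (simp add: eq_neg_iff_add_eq_0)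
     also have "of_int x * \<dots> = (\<Sum>b\<in>B. of_int (- x * n b) * b)"
      unfolding sum_negf[symmetric] sum_distrib_left by (rule sum.cong) simp_all
     finally have "\<exists>n. a = (\<Sum>b\<in>B. of_int (n b) * b)" by (rule exI[where x = "\<lambda>b. - x * n b"])
     thus False using False by simp
    qed
    hence "(\<Sum>b\<in>B. of_int (n b) * b) = 0" using s' by simp
    thus "\<forall>b\<in>insert a B. of_int (n b) = (0::'k)" using na B(2) unfolding fp_indep_def by blast
   qed
   moreover have "\<exists>n. a' = (\<Sum>b\<in>insert a B. of_int (n b) * b)" if a': "a' \<in> insert a A" for a'
   proof (cases "a' = a")
    case True
    have "(\<Sum>b\<in>insert a B. of_int (if b = a then 1 else 0) * b) = a + (\<Sum>b\<in>B. of_int (if b = a then 1 else 0) * b)"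
     using B(1) aB by simp
    also have "(\<Sum>b\<in>B. of_int (if b = a then 1 else 0) * b) = 0" using aB by (intro sum.neutral) auto
    finally have "a' = (\<Sum>b\<in>insert a B. of_int (if b = a then 1 else 0) * b)" using True by simp
    thus ?thesis by (rule exI[where x = "\<lambda>b. if b = a then 1 else 0"])
   next
    case False
    then obtain n where n: "a' = (\<Sum>b\<in>B. of_int (n b) * b)" using a' B(3) by blast
    have "(\<Sum>b\<in>B. of_int (if b = a then 0 else n b) * b) = (\<Sum>b\<in>B. of_int (n b) * b)"
     using aB by (intro sum.cong) auto
    hence "a' = (\<Sum>b\<in>insert a B. of_int (if b = a then 0 else n b) * b)"
     unfolding sum.insert[OF B(1) aB] n by simp
    thus ?thesis by (rule exI[where x = "\<lambda>b. if b = a then 0 else n b"])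
   qed
   ultimately show ?thesis using B(1) by blast
  qed
 qed
 thus ?thesis using that by blast
qed

text \<open>The coefficients of e span a finite-dimensional space over the prime field. Expanding
  them in a basis reduces statements about e to statements modulo p about integral elements, to
  which the Jucys-Murphy argument applies.\<close>

lemma cent_integral_form: fixes e :: "'k::field gring"
 assumes p: "prime p" "CHAR('k) = p" and e: "e \<in> cent l m" and lm: "l \<le> m"
 obtains B c where "finite B" "fp_indep B" "\<And>b. b \<in> B ==> c b \<in> cent l m" "e = (\<Sum>b\<in>B. scal b * iota (c b))"
proof -
 obtain B where B: "finite B" "fp_indep B" "\<And>a. a \<in> orbcoeff e ` orbits l m ==> \<exists>n. a = (\<Sum>b\<in>B. of_int (n b) * b)"
  using fp_basis[OF p, of "orbcoeff e ` orbits l m"] by auto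
 then obtain n where n: "\<And>X. X \<in> orbits l m ==> orbcoeff e X = (\<Sum>b\<in>B. of_int (n X b) * b)" using bchoice[of "orbits l m" "\<lambda>X n. orbcoeff e X = (\<Sum>b\<in>B. of_int (n b) * b)"] by blast
 define c where "c b = (\<Sum>X\<in>orbits l m. sc (n X b) * orbsum X)" for b
 have "c b \<in> cent l m" for b unfolding c_def by (intro cent_sum cent_mult cent_scalar orbsum_cent lm)
 moreover have "e = (\<Sum>b\<in>B. scal b * iota (c b))"
 proof -
  have "e = (\<Sum>X\<in>orbits l m. \<Sum>b\<in>B. scal b * (scal (of_int (n X b)) * orbsum X))"
  proof (subst cent_decomp[OF e lm], rule sum.cong[OF refl])
   fix X assume X: "X \<in> orbits l m"
   have "scal (\<Sum>b\<in>B. of_int (n X b) * b) = (\<Sum>b\<in>B. scal b * scal (of_int (n X b)) :: 'k gring)"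
    unfolding scal_sum scal_simps(3)[symmetric] by (rule sum.cong) (simp_all add: mult.commute)
   thus "scal (orbcoeff e X) * orbsum X = (\<Sum>b\<in>B. scal b * (scal (of_int (n X b)) * orbsum X))"
    unfolding n[OF X] by (simp only: sum_distrib_right mult.assoc)
  qed
  also have "\<dots> = (\<Sum>b\<in>B. scal b * iota (c b))"
   by (subst sum.swap) (simp add: c_def iota_sum iota_mult sum_distrib_left)
  finally show ?thesis .
 qed
 ultimately show ?thesis by (intro that[OF B(1,2)])
qed

text \<open>The commutator of e with an integral element vanishes; by independence each of its
  integral components vanishes modulo p, coefficient by coefficient.\<close>

lemma integral_commutes: fixes e :: "'k::field gring"
 assumes p: "prime p" "CHAR('k) = p" and B: "finite B" "fp_indep B" and c: "\<And>b. b \<in> B ==> c b \<in> cent l m"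
  and e: "e = (\<Sum>b\<in>B. scal b * iota (c b))" and com: "\<And>a. a \<in> cent l m ==> e * a = a * e"
  and b: "b \<in> B" and d: "d \<in> cent l m"
 obtains y where "y \<in> cent l m" "c b * d - d * c b = sc (int p) * y"
proof -
 let ?x = "\<lambda>b. c b * d - d * c b"
 have "(\<Sum>b\<in>B. scal b * iota (?x b)) = e * iota d - iota d * e"
  unfolding e by (simp add: iota_diff iota_mult right_diff_distrib sum_subtractf sum_distrib_left sum_distrib_right mult.assoc scal_left)
 also have "\<dots> = 0" using com[OF iota_cent[OF d]] by simp
 finally have z: "(\<Sum>b\<in>B. scal b * iota (?x b)) = 0" .
 have "int p dvd lookup (?x b) g" for g
 proof -
  have "(\<Sum>b\<in>B. of_int (lookup (?x b) g) * b) = lookup (\<Sum>b\<in>B. scal b * iota (?x b)) g"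
   by (simp add: lookup_sum mult.commute del: lookup_minus)
  hence "of_int (lookup (?x b) g) = (0::'k)"
   using B(2)[unfolded fp_indep_def, rule_format, of "\<lambda>b. lookup (?x b) g" b] b unfolding z by simp
  thus ?thesis using p(2) of_int_eq_0_iff_char_dvd by metis
 qed
 moreover have "?x b \<in> cent l m" using c[OF b] d by simp
 moreover have "int p \<noteq> 0" using p(1) by auto
 ultimately obtain y where "y \<in> cent l m" "?x b = sc (int p) * y" using cent_dvd by blast
 thus ?thesis by (rule that)
qed

section \<open>The action of the centraliser algebra on the tensor product with the field\<close>

locale skew = fixes l m :: nat and lam mu :: "nat \<Rightarrow> nat"
 assumes lm: "l \<le> m" and lam: "is_partition lam" "partition_size lam = l" and mu: "is_partition mu" "partition_size mu = m"
begin

sublocale L: shape lam l by unfold_locales (use lam in auto)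
sublocale M: shape mu m by unfold_locales (use mu in auto)

abbreviation hm :: "specht_map \<Rightarrow> bool" where "hm \<phi> \<equiv> \<phi> \<in> carrier (specht_hom l mu lam)"

lemma hm_iff: "hm \<phi> \<longleftrightarrow> shom l lam mu \<phi> \<and> \<phi> \<in> extensional L.S"
proof -
 have "(\<forall>\<sigma>\<in>carrier (sym_group l). P \<sigma>) \<longleftrightarrow> (\<forall>g\<in>syms l. P (nfun g))" for P
 proof
  assume h: "\<forall>g\<in>syms l. P (nfun g)"
  show "\<forall>\<sigma>\<in>carrier (sym_group l). P \<sigma>"
  proof
   fix \<sigma> assume "\<sigma> \<in> carrier (sym_group l)"
   hence s: "\<sigma> permutes {1..l}" by (simp add: sym_group_def)
   hence n: "nfun (Nperm \<sigma>) = \<sigma>" by (intro nfun_Nperm permutes_bij)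
   hence "Nperm \<sigma> \<in> syms l" using s by (simp add: syms_def)
   thus "P \<sigma>" using h n by metis
  qed
 qed (simp add: sym_group_def syms_def)
 thus ?thesis unfolding specht_hom_def shom_def by (auto simp: PiE_def Pi_def)
qed

lemma hm_shom: "hm \<phi> ==> shom l lam mu \<phi>" by (simp add: hm_iff)

definition op :: "int gring \<Rightarrow> specht_map \<Rightarrow> specht_map" where
 "op c \<phi> = (\<lambda>v\<in>L.S. act c (\<phi> v))"

lemma hm_restrict: assumes "shom l lam mu \<phi>" shows "hm (restrict \<phi> L.S)"
proof -
 show ?thesis using assms unfolding hm_iff shom_def by simp
qed

lemma hm_op: "hm \<phi> ==> c \<in> cent l m ==> hm (op c \<phi>)"
 unfolding op_def by (rule hm_restrict[OF shom_cent[OF hm_shom mu]])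

lemma op_eqI: "(\<And>v. v \<in> L.S ==> act c (\<phi> v) = act d (\<psi> v)) ==> op c \<phi> = op d \<psi>"
 unfolding op_def by (rule restrict_ext)
lemma op_mult: "op (c * d) \<phi> = op c (op d \<phi>)" by (auto simp: op_def act_mult)
lemma op_1: "hm \<phi> ==> op 1 \<phi> = \<phi>" by (auto simp: op_def hm_iff extensional_restrict)
lemma op_add: "op (c + d) \<phi> = op c \<phi> \<otimes>\<^bsub>specht_hom l mu lam\<^esub> op d \<phi>"
 by (auto simp: op_def specht_hom_def act_add_left)
lemma hm_mult: assumes "hm \<phi>" "hm \<psi>" shows "hm (\<phi> \<otimes>\<^bsub>specht_hom l mu lam\<^esub> \<psi>)"
proof -
 have "shom l lam mu (\<lambda>v. \<phi> v + \<psi> v)"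
  using hm_shom[OF assms(1)] hm_shom[OF assms(2)] unfolding shom_def by (auto simp: perm_act_add)
 moreover have "\<phi> \<otimes>\<^bsub>specht_hom l mu lam\<^esub> \<psi> = restrict (\<lambda>v. \<phi> v + \<psi> v) L.S"
  by (simp add: specht_hom_def)
 ultimately show ?thesis using hm_restrict by (simp only:)
qed

definition eqv :: "(('k::field \<times> specht_map) \<Rightarrow>\<^sub>0 int) \<Rightarrow> (('k \<times> specht_map) \<Rightarrow>\<^sub>0 int) \<Rightarrow> bool" where
 "eqv x y \<longleftrightarrow> x - y \<in> tensor_rels (specht_hom l mu lam)"

abbreviation rels :: "(('k::field \<times> specht_map) \<Rightarrow>\<^sub>0 int) set" where
 "rels \<equiv> {frag_of (a + b, h) - frag_of (a, h) - frag_of (b, h) | a b h. hm h} \<union>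
  {frag_of (a, h \<otimes>\<^bsub>specht_hom l mu lam\<^esub> h') - frag_of (a, h) - frag_of (a, h') | a h h'. hm h \<and> hm h'}"

lemma rels_keys: "x \<in> (rels :: (('k::field \<times> specht_map) \<Rightarrow>\<^sub>0 int) set) ==> keys x \<subseteq> UNIV \<times> {\<phi>. hm \<phi>}"
proof -
 have d: "keys (x - y) \<subseteq> A" if "keys x \<subseteq> A" "keys y \<subseteq> A"
  for x y :: "('k \<times> specht_map) \<Rightarrow>\<^sub>0 int" and A using that keys_diff[of x y] by blast
 assume "x \<in> rels"
 thus ?thesis by (elim UnE CollectE exE conjE; simp only:; intro d) (simp_all add: hm_mult)
qed

lemma tensor_rels_eq: "tensor_rels (specht_hom l mu lam) =
  generate (free_Abelian_group (UNIV \<times> {\<phi>. hm \<phi>})) rels"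
 by (simp add: tensor_rels_def tensor_gens_def Collect_mem_eq)

lemma rels_0: "0 \<in> tensor_rels (specht_hom l mu lam)"
 using generate.one[of "free_Abelian_group (UNIV \<times> {\<phi>. hm \<phi>})"] by (simp add: tensor_rels_eq)
lemma eqv_refl [simp]: "eqv x x" by (simp add: eqv_def rels_0)
lemma rels_diff: "x \<in> tensor_rels (specht_hom l mu lam) ==> y \<in> tensor_rels (specht_hom l mu lam) ==>
  x - y \<in> tensor_rels (specht_hom l mu lam)"
 unfolding tensor_rels_eq by (rule generate_diff_free[OF rels_keys])
lemma eqv_sym: "eqv x y ==> eqv y x" using rels_diff[OF rels_0, of "x - y"] by (simp add: eqv_def)
lemma eqv_diff: "eqv x y ==> eqv x' y' ==> eqv (x - x') (y - y')"
 using rels_diff[of "x - y" "x' - y'"] by (simp add: eqv_def algebra_simps)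
lemma eqv_add: "eqv x y ==> eqv x' y' ==> eqv (x + x') (y + y')"
 using eqv_diff[of x y "- x'" "- y'"] eqv_diff[of 0 0 x' y'] by simp
lemma eqv_trans [trans]: "eqv x y ==> eqv y z ==> eqv x z"
 using eqv_add[of x y y z] by (simp add: eqv_def algebra_simps)
lemma eqv_sum: "(\<And>i. i \<in> I ==> eqv (f i) (g i)) ==> eqv (sum f I) (sum g I)"
 by (induction I rule: infinite_finite_induct) (auto intro: eqv_add)
lemma eqv_eq_trans [trans]: "eqv x y ==> y = z ==> eqv x z" "x = y ==> eqv y z ==> eqv x z" by simp_all

lemma eqv_add_left: "hm h ==> eqv (frag_of (a + b, h)) (frag_of (a, h) + frag_of (b, h))"
proof -
 assume "hm h"
 hence "frag_of (a + b, h) - frag_of (a, h) - frag_of (b, h) \<in> rels" by blast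
 thus ?thesis unfolding eqv_def tensor_rels_eq diff_diff_eq[symmetric] by (rule generate.incl)
qed

lemma eqv_add_right: "hm h ==> hm h' ==>
  eqv (frag_of (a, h \<otimes>\<^bsub>specht_hom l mu lam\<^esub> h')) (frag_of (a, h) + frag_of (a, h'))"
proof -
 assume "hm h" "hm h'"
 hence "frag_of (a, h \<otimes>\<^bsub>specht_hom l mu lam\<^esub> h') - frag_of (a, h) - frag_of (a, h') \<in> rels" by blast
 thus ?thesis unfolding eqv_def tensor_rels_eq diff_diff_eq[symmetric] by (rule generate.incl)
qed

lemma eqv_cancel: "eqv (x + y) (x + z) ==> eqv y z" by (simp add: eqv_def)

lemma eqv_0_left: assumes "hm h" shows "eqv (frag_of (0, h)) 0"
 using eqv_add_left[OF assms, of 0 0] eqv_cancel[of "frag_of (0, h)" "frag_of (0, h)" 0] eqv_sym by simp blast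

lemma eqv_sum_left: "hm h ==> eqv (frag_of (sum f I, h)) (\<Sum>i\<in>I. frag_of (f i, h))"
proof (induction I rule: infinite_finite_induct)
 case (insert i I)
 thus ?case using eqv_trans[OF eqv_add_left eqv_add[OF eqv_refl insert.IH]] by simp
qed (simp_all add: eqv_0_left)

lemma eqv_op_add: assumes "hm h" "c \<in> cent l m" "d \<in> cent l m"
 shows "eqv (frag_of (a, op (c + d) h)) (frag_of (a, op c h) + frag_of (a, op d h))"
 unfolding op_add by (rule eqv_add_right) (use assms hm_op in auto)

lemma eqv_op_0: assumes "hm h" shows "eqv (frag_of (a, op 0 h)) 0"
 using eqv_op_add[OF assms cent_0 cent_0, of a] eqv_cancel[of "frag_of (a, op 0 h)" "frag_of (a, op 0 h)" 0] eqv_sym by simp blast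

lemma eqv_op_sum:
 "hm h ==> (\<And>i. i \<in> I ==> c i \<in> cent l m) ==> eqv (frag_of (a, op (sum c I) h)) (\<Sum>i\<in>I. frag_of (a, op (c i) h))"
proof (induction I rule: infinite_finite_induct)
 case (insert i I)
 have "sum c I \<in> cent l m" by (rule cent_sum) (use insert in auto)
 thus ?case using eqv_trans[OF eqv_op_add eqv_add[OF eqv_refl insert.IH]] insert by simp
qed (simp_all add: eqv_op_0)

lemma eqv_op_sc: assumes h: "hm h" and c: "c \<in> cent l m"
 shows "eqv (frag_of (a, op (sc k * c) h)) (frag_of (of_int k * a, op c h))"
proof (induction k rule: int_induct[where k = 0])
 case base
 show ?case using eqv_trans[OF eqv_op_0[OF h] eqv_sym[OF eqv_0_left[OF hm_op[OF h c]]]] by (simp add: sc_simps)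
next
 case (step1 i)
 have "eqv (frag_of (a, op (sc (i + 1) * c) h)) (frag_of (a, op (sc i * c) h) + frag_of (a, op c h))"
  using eqv_op_add[OF h _ c, of "sc i * c" a] c by (simp add: sc_simps distrib_right)
 also have "eqv \<dots> (frag_of (of_int i * a, op c h) + frag_of (a, op c h))" by (rule eqv_add[OF step1.IH eqv_refl])
 also have "eqv \<dots> (frag_of (of_int i * a + a, op c h))" by (rule eqv_sym[OF eqv_add_left[OF hm_op[OF h c]]])
 finally show ?case by (simp add: distrib_right)
next
 case (step2 i)
 have "eqv (frag_of (a, op (sc (i - 1) * c) h) + frag_of (a, op c h)) (frag_of (a, op (sc i * c) h))"
  using eqv_sym[OF eqv_op_add[OF h _ c, of "sc (i - 1) * c" a]] c by (simp add: sc_simps left_diff_distrib)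
 also have "eqv \<dots> (frag_of (of_int i * a, op c h))" by (rule step2.IH)
 also have "\<dots> = frag_of (of_int (i - 1) * a + a, op c h)" by (simp add: left_diff_distrib)
 also have "eqv \<dots> (frag_of (of_int (i - 1) * a, op c h) + frag_of (a, op c h))"
  by (rule eqv_add_left[OF hm_op[OF h c]])
 finally show ?case by (simp add: eqv_def)
qed

lemma orbit_nonempty: "X \<in> orbits l m ==> \<exists>g. g \<in> X" unfolding orbits_def using orb_self by blast

definition pact :: "'k::field gring \<Rightarrow> 'k \<times> specht_map \<Rightarrow> ('k \<times> specht_map) \<Rightarrow>\<^sub>0 int" where
 "pact a = (\<lambda>(b, \<phi>). \<Sum>X\<in>orb l ` keys a. frag_of (orbcoeff a X * b, op (orbsum X) \<phi>))"

lemma pact_orbits: assumes a: "a \<in> cent l m" and h: "hm \<phi>"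
 shows "eqv (pact a (b, \<phi>)) (\<Sum>X\<in>orbits l m. frag_of (orbcoeff a X * b, op (orbsum X) \<phi>))"
proof -
 have sub: "orb l ` keys a \<subseteq> orbits l m" using cent_galg[OF a] by (auto simp: galg_def orbits_def)
 let ?f = "\<lambda>X. frag_of (orbcoeff a X * b, op (orbsum X) \<phi>)"
 have "(\<Sum>X\<in>orbits l m. ?f X) = (\<Sum>X\<in>orb l ` keys a. ?f X) + (\<Sum>X\<in>orbits l m - orb l ` keys a. ?f X)"
  using sum.subset_diff[OF sub finite_orbits, of ?f] by (simp add: add.commute)
 also have "eqv \<dots> ((\<Sum>X\<in>orb l ` keys a. ?f X) + (\<Sum>X\<in>orbits l m - orb l ` keys a. 0))"
 proof (intro eqv_add eqv_refl eqv_sum)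
  fix X assume X: "X \<in> orbits l m - orb l ` keys a"
  then obtain g where g: "g \<in> syms m" "X = orb l g" by (auto simp: orbits_def)
  hence "lookup a g = 0" using X by (auto simp: in_keys_iff)
  hence "orbcoeff a X = 0" unfolding g(2) orbcoeff_orb[OF a] .
  thus "eqv (?f X) 0" using X by (simp add: eqv_0_left hm_op h orbsum_cent lm)
 qed
 finally have "eqv (\<Sum>X\<in>orbits l m. ?f X) (pact a (b, \<phi>))" by (simp add: pact_def)
 thus ?thesis by (rule eqv_sym)
qed

lemma orbit_expand: assumes c: "c \<in> cent l m" and h: "hm \<phi>"
 shows "eqv (frag_of (b, op c \<phi>)) (\<Sum>X\<in>orbits l m. frag_of (of_int (orbcoeff c X) * b, op (orbsum X) \<phi>))"
proof -
 have "frag_of (b, op c \<phi>) = frag_of (b, op (\<Sum>X\<in>orbits l m. sc (orbcoeff c X) * orbsum X) \<phi>)"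
  by (subst cent_decomp[OF c lm]) simp
 also have "eqv \<dots> (\<Sum>X\<in>orbits l m. frag_of (b, op (sc (orbcoeff c X) * orbsum X) \<phi>))"
  by (rule eqv_op_sum[OF h]) (intro cent_mult cent_scalar orbsum_cent lm)
 also have "eqv \<dots> (\<Sum>X\<in>orbits l m. frag_of (of_int (orbcoeff c X) * b, op (orbsum X) \<phi>))"
  by (intro eqv_sum eqv_op_sc h orbsum_cent lm)
 finally show ?thesis .
qed

text \<open>The action is defined through orbit sums and coefficients. Expanding each integral
  element in orbit sums and collecting the coefficients of one orbit shows that any presentation by
  integral elements computes the same class, so linearity and products can be checked on convenient
  presentations.\<close>

theorem pact_presentation: assumes I: "finite I" and c: "\<And>i. i \<in> I ==> c i \<in> cent l m" and h: "hm \<phi>"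
 shows "eqv (pact (\<Sum>i\<in>I. scal (b i) * iota (c i)) (s, \<phi>)) (\<Sum>i\<in>I. frag_of (b i * s, op (c i) \<phi>))"
proof -
 let ?a = "\<Sum>i\<in>I. scal (b i) * iota (c i)"
 have a: "?a \<in> cent l m" by (intro cent_sum cent_mult cent_scalar iota_cent c)
 have co: "orbcoeff ?a X = (\<Sum>i\<in>I. b i * of_int (orbcoeff (c i) X))" if X: "X \<in> orbits l m" for X
 proof -
  obtain g where g: "g \<in> X" using X orbit_nonempty by blast
  show ?thesis unfolding orbcoeff_eq[OF a X g] lookup_sum
   by (rule sum.cong[OF refl]) (simp add: orbcoeff_eq[OF c X g])
 qed
 have "eqv (\<Sum>i\<in>I. frag_of (b i * s, op (c i) \<phi>))
   (\<Sum>i\<in>I. \<Sum>X\<in>orbits l m. frag_of (of_int (orbcoeff (c i) X) * (b i * s), op (orbsum X) \<phi>))"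
  by (intro eqv_sum orbit_expand c h)
 also have "\<dots> = (\<Sum>X\<in>orbits l m. \<Sum>i\<in>I. frag_of (b i * of_int (orbcoeff (c i) X) * s, op (orbsum X) \<phi>))"
  by (subst sum.swap, intro sum.cong refl) (simp add: ac_simps)
 also have "eqv \<dots> (\<Sum>X\<in>orbits l m. frag_of ((\<Sum>i\<in>I. b i * of_int (orbcoeff (c i) X) * s), op (orbsum X) \<phi>))"
  by (intro eqv_sum eqv_sym[OF eqv_sum_left] hm_op h orbsum_cent lm)
 also have "\<dots> = (\<Sum>X\<in>orbits l m. frag_of (orbcoeff ?a X * s, op (orbsum X) \<phi>))"
  by (rule sum.cong[OF refl]) (simp add: co sum_distrib_right)
 finally show ?thesis by (rule eqv_trans[OF pact_orbits[OF a h] eqv_sym])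
qed

definition acts :: "'k::field gring \<Rightarrow> 'k \<Rightarrow> bool" where
 "acts a s \<longleftrightarrow> (\<forall>b \<phi>. hm \<phi> \<longrightarrow> eqv (pact a (b, \<phi>)) (frag_of (s * b, \<phi>)))"

lemma pact_single:
 assumes "c \<in> cent l m" "hm \<phi>" shows "eqv (pact (scal s * iota c) (b, \<phi>)) (frag_of (s * b, op c \<phi>))"
proof -
 have "eqv (pact (\<Sum>i\<in>{0::nat}. scal s * iota c) (b, \<phi>)) (\<Sum>i\<in>{0::nat}. frag_of (s * b, op c \<phi>))"
  by (rule pact_presentation) (use assms in simp_all)
 thus ?thesis by simp
qed

lemma pact_iota: "c \<in> cent l m ==> hm \<phi> ==> eqv (pact (iota c) (b, \<phi>)) (frag_of (b, op c \<phi>))"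
 using pact_single[of c \<phi> 1 b] by (simp only: scal_simps(4) mult_1_left)

lemma acts_scal: "acts (scal s) s" unfolding acts_def
proof (intro allI impI)
 fix b and \<phi> assume h: "hm \<phi>"
 show "eqv (pact (scal s) (b, \<phi>)) (frag_of (s * b, \<phi>))"
  using pact_single[OF cent_1 h, of s b] by (simp only: iota_1 mult_1_right op_1[OF h])
qed

lemma pact_add: assumes a: "a \<in> cent l m" "a' \<in> cent l m" and h: "hm \<phi>"
 shows "eqv (pact (a + a') (b, \<phi>)) (pact a (b, \<phi>) + pact a' (b, \<phi>))"
proof -
 let ?f = "\<lambda>a X. frag_of (orbcoeff a X * b, op (orbsum X) \<phi>)"
 have co: "orbcoeff (a + a') X = orbcoeff a X + orbcoeff a' X" if X: "X \<in> orbits l m" for X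
 proof -
  obtain g where g: "g \<in> X" using X orbit_nonempty by blast
  show ?thesis using orbcoeff_eq[OF a(1) X g] orbcoeff_eq[OF a(2) X g] orbcoeff_eq[OF cent_add[OF a] X g] by (simp add: lookup_add)
 qed
 have "eqv (pact (a + a') (b, \<phi>)) (\<Sum>X\<in>orbits l m. ?f (a + a') X)" by (rule pact_orbits[OF cent_add[OF a] h])
 also have "eqv \<dots> (\<Sum>X\<in>orbits l m. ?f a X + ?f a' X)"
  by (intro eqv_sum) (simp add: co distrib_right eqv_add_left hm_op h orbsum_cent lm)
 also have "\<dots> = (\<Sum>X\<in>orbits l m. ?f a X) + (\<Sum>X\<in>orbits l m. ?f a' X)" by (simp add: sum.distrib)
 also have "eqv \<dots> (pact a (b, \<phi>) + pact a' (b, \<phi>))" by (intro eqv_add eqv_sym[OF pact_orbits] a h)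
 finally show ?thesis .
qed

text \<open>Products of orbit sums are integral elements, so the double sum over orbits is a
  presentation of the product.\<close>

lemma pact_mult: assumes a: "a \<in> cent l m" "a' \<in> cent l m" and h: "hm \<phi>"
 shows "eqv (pact (a * a') (b, \<phi>)) (\<Sum>Y\<in>orbits l m. pact a (orbcoeff a' Y * b, op (orbsum Y) \<phi>))"
proof -
 let ?O = "orbits l m"
 have "a * a' = (\<Sum>X\<in>?O. scal (orbcoeff a X) * orbsum X) * (\<Sum>Y\<in>?O. scal (orbcoeff a' Y) * orbsum Y)"
  using cent_decomp[OF a(1) lm] cent_decomp[OF a(2) lm] by simp
 also have "\<dots> = (\<Sum>(X, Y)\<in>?O \<times> ?O. scal (orbcoeff a X * orbcoeff a' Y) * iota (orbsum X * orbsum Y))"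
  unfolding sum_product sum.cartesian_product by (rule sum.cong[OF refl], clarify)
   (simp only: iota_mult iota_orbsum scal_simps(3) mult.assoc scal_left[of "orbsum X" for X])
 finally have e: "a * a' = (\<Sum>i\<in>?O \<times> ?O. scal (orbcoeff a (fst i) * orbcoeff a' (snd i)) * iota (orbsum (fst i) * orbsum (snd i)))"
  by (simp add: case_prod_unfold)
 have "eqv (pact (a * a') (b, \<phi>)) (\<Sum>i\<in>?O \<times> ?O. frag_of (orbcoeff a (fst i) * orbcoeff a' (snd i) * b, op (orbsum (fst i) * orbsum (snd i)) \<phi>))"
  unfolding e by (rule pact_presentation) (auto intro!: orbsum_cent lm h cent_mult)
 also have "\<dots> = (\<Sum>Y\<in>?O. \<Sum>X\<in>?O. frag_of (orbcoeff a X * (orbcoeff a' Y * b), op (orbsum X) (op (orbsum Y) \<phi>)))"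
  by (subst sum.swap) (simp only: sum.cartesian_product case_prod_unfold op_mult mult.assoc)
 also have "eqv \<dots> (\<Sum>Y\<in>?O. pact a (orbcoeff a' Y * b, op (orbsum Y) \<phi>))"
  by (intro eqv_sum eqv_sym[OF pact_orbits] a hm_op h orbsum_cent lm)
 finally show ?thesis .
qed

lemma acts_add:
 assumes "a \<in> cent l m" "a' \<in> cent l m" "acts a s" "acts a' s'" shows "acts (a + a') (s + s')"
 unfolding acts_def
proof (intro allI impI)
 fix b :: 'a and \<phi> assume h: "hm \<phi>"
 have "eqv (pact (a + a') (b, \<phi>)) (pact a (b, \<phi>) + pact a' (b, \<phi>))" by (rule pact_add[OF assms(1,2) h])
 also have "eqv \<dots> (frag_of (s * b, \<phi>) + frag_of (s' * b, \<phi>))" using assms h by (intro eqv_add) (simp_all add: acts_def)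
 also have "eqv \<dots> (frag_of ((s + s') * b, \<phi>))" unfolding distrib_right by (rule eqv_sym[OF eqv_add_left[OF h]])
 finally show "eqv (pact (a + a') (b, \<phi>)) (frag_of ((s + s') * b, \<phi>))" .
qed

lemma acts_mult:
 assumes "a \<in> cent l m" "a' \<in> cent l m" "acts a s" "acts a' s'" shows "acts (a * a') (s * s')"
 unfolding acts_def
proof (intro allI impI)
 fix b :: 'a and \<phi> assume h: "hm \<phi>"
 have "eqv (pact (a * a') (b, \<phi>)) (\<Sum>Y\<in>orbits l m. pact a (orbcoeff a' Y * b, op (orbsum Y) \<phi>))"
  by (rule pact_mult[OF assms(1,2) h])
 also have "eqv \<dots> (\<Sum>Y\<in>orbits l m. frag_of (orbcoeff a' Y * (s * b), op (orbsum Y) \<phi>))"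
  using assms(3) hm_op[OF h orbsum_cent] lm by (intro eqv_sum) (auto simp: acts_def mult.left_commute)
 also have "eqv \<dots> (pact a' (s * b, \<phi>))" by (intro eqv_sym[OF pact_orbits] assms h)
 also have "eqv \<dots> (frag_of (s' * (s * b), \<phi>))" using assms(4) h by (simp add: acts_def)
 finally show "eqv (pact (a * a') (b, \<phi>)) (frag_of (s * s' * b, \<phi>))" by (simp add: ac_simps)
qed

lemma acts_uminus: assumes "a \<in> cent l m" "acts a s" shows "acts (- a) (- s)"
 using acts_mult[OF cent_scalar assms(1) acts_scal assms(2), of "- 1"] by (simp add: scal_simps)

lemma acts_diff:
 assumes "a \<in> cent l m" "a' \<in> cent l m" "acts a s" "acts a' s'" shows "acts (a - a') (s - s')"
 using acts_add[OF assms(1) cent_uminus[OF assms(2)] assms(3) acts_uminus[OF assms(2,4)]] by simp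

lemma acts_power: "a \<in> cent l m ==> acts a s ==> acts (a ^ N) (s ^ N)"
proof (induction N)
 case 0 thus ?case using acts_scal[of 1] by (simp add: scal_simps)
qed (simp add: acts_mult)

end

section \<open>Nonvanishing of the tensor product, and idempotents modulo powers of p\<close>

definition weighted_sum :: "('a \<Rightarrow> 'k::comm_ring_1) \<Rightarrow> ('a \<Rightarrow>\<^sub>0 int) \<Rightarrow> 'k" where
 "weighted_sum w x = (\<Sum>u\<in>keys x. of_int (lookup x u) * w u)"

lemma weighted_sum_superset: assumes "finite A" "keys x \<subseteq> A"
 shows "weighted_sum w x = (\<Sum>u\<in>A. of_int (lookup x u) * w u)"
 unfolding weighted_sum_def by (rule sum.mono_neutral_left) (use assms in \<open>auto simp: in_keys_iff\<close>)

lemma weighted_sum_diff: "weighted_sum w (x - y) = weighted_sum w x - weighted_sum w y"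
 using weighted_sum_superset[of "keys x \<union> keys y" "x - y" w]
  weighted_sum_superset[of "keys x \<union> keys y" x w]
  weighted_sum_superset[of "keys x \<union> keys y" y w] keys_diff[of x y]
 by (simp add: lookup_minus left_diff_distrib sum_subtractf)

lemma weighted_sum_simps [simp]: "weighted_sum w 0 = 0" "weighted_sum w (frag_of u) = w u"
 by (simp_all add: weighted_sum_def)

context skew begin

lemma mult_hom: "v \<in> L.S ==> (\<phi> \<otimes>\<^bsub>specht_hom l mu lam\<^esub> \<psi>) v = \<phi> v + \<psi> v" by (simp add: specht_hom_def)

text \<open>Scaling a nonzero matrix coefficient makes it a surjection onto the integers, hence the tensor
 product with a field does not vanish.\<close>

lemma tensor_nontrivial: assumes \<phi>0: "hm \<phi>0" and v: "v \<in> L.S" "\<phi>0 v \<noteq> 0"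
 obtains \<phi> where "hm \<phi>" "\<And>s :: 'k::field. eqv (frag_of (s, \<phi>)) 0 ==> s = 0"
proof -
 obtain T where T: "lookup (\<phi>0 v) T \<noteq> 0" using v(2) poly_mapping_eqI[of "\<phi>0 v" 0] by auto
 define f where "f \<phi> = lookup (\<phi> v) T" for \<phi> :: specht_map
 have fadd: "f (\<phi> \<otimes>\<^bsub>specht_hom l mu lam\<^esub> \<psi>) = f \<phi> + f \<psi>" for \<phi> \<psi>
  by (simp add: f_def mult_hom v lookup_add)
 have fop: "f (op (sc c) \<phi>) = c * f \<phi>" for \<phi> c by (simp add: f_def op_def v(1) act_single)
 define pos where "pos n \<longleftrightarrow> 0 < n \<and> (\<exists>\<phi>. hm \<phi> \<and> f \<phi> = int n)" for n
 have "\<exists>n. pos n"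
 proof (cases "f \<phi>0 > 0")
  case True
  thus ?thesis using \<phi>0 by (intro exI[of _ "nat (f \<phi>0)"]) (auto simp: pos_def)
 next
  case False
  hence "f (op (sc (-1)) \<phi>0) > 0" using T by (simp add: fop) (simp add: f_def)
  thus ?thesis using hm_op[OF \<phi>0 cent_scalar, of "-1"]
   by (intro exI[of _ "nat (f (op (sc (-1)) \<phi>0))"]) (auto simp: pos_def)
 qed
 hence posL: "pos (LEAST n. pos n)" by (rule LeastI_ex)
 define d where "d = (LEAST n. pos n)"
 have "pos d" unfolding d_def by (rule posL)
 then obtain \<phi> where \<phi>: "hm \<phi>" "f \<phi> = int d" and d: "0 < d" unfolding pos_def by blast
 have dvd: "int d dvd f \<psi>" if \<psi>: "hm \<psi>" for \<psi>
 proof (rule ccontr)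
  assume "\<not> int d dvd f \<psi>"
  hence r: "0 < f \<psi> mod int d" "f \<psi> mod int d < int d"
   using pos_mod_sign[of "int d" "f \<psi>"] pos_mod_bound[of "int d" "f \<psi>"] d unfolding dvd_eq_mod_eq_0 by linarith+
  let ?\<chi> = "\<psi> \<otimes>\<^bsub>specht_hom l mu lam\<^esub> op (sc (- (f \<psi> div int d))) \<phi>"
  have "f ?\<chi> = f \<psi> mod int d" unfolding fadd fop \<phi>(2) by (simp add: minus_div_mult_eq_mod[symmetric])
  hence "pos (nat (f \<psi> mod int d))" using r hm_mult[OF \<psi> hm_op[OF \<phi>(1) cent_scalar]] unfolding pos_def by auto
  hence "d \<le> nat (f \<psi> mod int d)" unfolding d_def by (rule Least_le)
  thus False using r by simp
 qed
 define w :: "'k \<times> specht_map \<Rightarrow> 'k" where "w = (\<lambda>(a, h). a * of_int (f h div int d))"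
 have ker: "weighted_sum w x = 0" if "x \<in> tensor_rels (specht_hom l mu lam)" for x
  using that unfolding tensor_rels_eq
 proof (rule generate_induct_free[OF _ rels_keys])
  fix x :: "('k \<times> specht_map) \<Rightarrow>\<^sub>0 int" assume "x \<in> rels"
  then consider (left) a b h where "x = frag_of (a + b, h) - frag_of (a, h) - frag_of (b, h)"
   | (right) a h h' where "hm h" "x = frag_of (a, h \<otimes>\<^bsub>specht_hom l mu lam\<^esub> h') - frag_of (a, h) - frag_of (a, h')"
   by blast
  thus "weighted_sum w x = 0"
  proof cases
   case left
   thus ?thesis by (simp add: weighted_sum_diff w_def distrib_right)
  next
   case right
   have "f (h \<otimes>\<^bsub>specht_hom l mu lam\<^esub> h') div int d = f h div int d + f h' div int d"
    unfolding fadd by (rule div_plus_div_distrib_dvd_left[OF dvd[OF right(1)]])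
   thus ?thesis unfolding right(2) by (simp add: weighted_sum_diff w_def distrib_left)
  qed
 qed (simp_all add: weighted_sum_diff)
 show ?thesis
 proof (rule that[OF \<phi>(1)])
  fix s :: 'k assume "eqv (frag_of (s, \<phi>)) 0"
  hence "weighted_sum w (frag_of (s, \<phi>)) = 0" unfolding eqv_def using ker by fastforce
  thus "s = 0" using \<phi>(2) d by (simp add: w_def)
 qed
qed

text \<open>u maps the submodule generated by \<phi> under the centraliser algebra into p^N times
  itself. The factor c to the right of u is what makes the condition concern the whole submodule and
  not only \<phi>.\<close>

definition divides :: "int \<Rightarrow> specht_map \<Rightarrow> nat \<Rightarrow> int gring \<Rightarrow> bool" where
 "divides p \<phi> N u \<longleftrightarrow> u \<in> cent l m \<and>
   (\<forall>c\<in>cent l m. \<exists>d\<in>cent l m. \<forall>v\<in>L.S. act (u * c) (\<phi> v) = frag_cmul (p ^ N) (act d (\<phi> v)))"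

lemma divides_cent: "divides p \<phi> N u ==> u \<in> cent l m" by (simp add: divides_def)

lemma divides_0: "u \<in> cent l m ==> divides p \<phi> 0 u" by (auto simp: divides_def intro: cent_mult)

lemma divides_mult: assumes u: "divides p \<phi> M u" "divides p \<phi> N u'" shows "divides p \<phi> (M + N) (u * u')"
 unfolding divides_def
proof (intro conjI ballI)
 show "u * u' \<in> cent l m" using u by (intro cent_mult divides_cent)
 fix c :: "int gring" assume "c \<in> cent l m"
 then obtain d where d: "d \<in> cent l m" "\<And>v. v \<in> L.S ==> act (u' * c) (\<phi> v) = frag_cmul (p ^ N) (act d (\<phi> v))"
  using u(2) unfolding divides_def by blast
 obtain d' where d': "d' \<in> cent l m" "\<And>v. v \<in> L.S ==> act (u * d) (\<phi> v) = frag_cmul (p ^ M) (act d' (\<phi> v))"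
  using u(1) d(1) unfolding divides_def by blast
 have "act (u * u' * c) (\<phi> v) = frag_cmul (p ^ (M + N)) (act d' (\<phi> v))" if "v \<in> L.S" for v
 proof -
  have "act (u * u' * c) (\<phi> v) = act u (act (u' * c) (\<phi> v))" by (simp only: act_mult mult.assoc)
  also have "\<dots> = act u (frag_cmul (p ^ N) (act d (\<phi> v)))" by (simp only: d(2)[OF that])
  also have "\<dots> = frag_cmul (p ^ N) (act (u * d) (\<phi> v))" by (simp only: act_cmul act_mult)
  finally show ?thesis unfolding d'(2)[OF that] by (simp add: power_add mult.commute)
 qed
 thus "\<exists>d\<in>cent l m. \<forall>v\<in>L.S. act (u * u' * c) (\<phi> v) = frag_cmul (p ^ (M + N)) (act d (\<phi> v))"
  using d'(1) by blast
qed

inductive_set divspan :: "int \<Rightarrow> specht_map \<Rightarrow> nat \<Rightarrow> 'k::field gring set" for p \<phi> N where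
 zero: "0 \<in> divspan p \<phi> N"
| step: "divides p \<phi> N u ==> a \<in> divspan p \<phi> N ==> scal b * iota u + a \<in> divspan p \<phi> N"

lemma divspan_single: "divides p \<phi> N u ==> scal b * iota u \<in> divspan p \<phi> N"
 using divspan.step[OF _ divspan.zero, of p \<phi> N u b] by simp

lemma divspan_add: "a \<in> divspan p \<phi> N ==> a' \<in> divspan p \<phi> N ==> a + a' \<in> divspan p \<phi> N"
proof (induction rule: divspan.induct)
 case (step u a b)
 thus ?case using divspan.step[of p \<phi> N u "a + a'" b] by (simp add: add.assoc)
qed simp

lemma divspan_sum: "(\<And>i. i \<in> I ==> f i \<in> divspan p \<phi> N) ==> sum f I \<in> divspan p \<phi> N"
 by (induction I rule: infinite_finite_induct) (auto intro: divspan.zero divspan_add)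

lemma divspan_mult: "a \<in> divspan p \<phi> M ==> a' \<in> divspan p \<phi> N ==> a * a' \<in> divspan p \<phi> (M + N)"
proof (induction rule: divspan.induct)
 case zero
 thus ?case by (simp add: divspan.zero)
next
 case (step u a b)
 have "scal b * iota u * a' \<in> divspan p \<phi> (M + N)" using step.prems
 proof (induction rule: divspan.induct)
  case zero thus ?case by (simp add: divspan.zero)
 next
  case (step u' a' b')
  have "scal b * iota u * (scal b' * iota u') = scal (b * b') * iota (u * u')"
   by (simp only: iota_mult scal_simps(3) mult.assoc scal_left[of "iota u"])
  thus ?case using divspan.step[OF divides_mult[OF \<open>divides p \<phi> M u\<close> step(1)] step(3), of "b * b'"]
   by (simp add: distrib_left)
 qed
 thus ?case using divspan_add step.IH[OF step.prems] by (simp add: distrib_right)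
qed

lemma divspan_0: assumes "a \<in> cent l m" shows "a \<in> divspan p \<phi> 0"
proof -
 have "(\<Sum>X\<in>orbits l m. scal (orbcoeff a X) * iota (orbsum X)) \<in> divspan p \<phi> 0"
  by (intro divspan_sum divspan_single divides_0 orbsum_cent lm)
 thus ?thesis unfolding iota_orbsum cent_decomp[OF assms lm, symmetric] .
qed

lemma divspan_cent: "a \<in> divspan p \<phi> N ==> a \<in> cent l m"
 by (induction rule: divspan.induct) (auto intro!: cent_add cent_mult cent_scalar iota_cent divides_cent)

text \<open>A nonzero multiple k \<psi> lies in the submodule generated by \<phi>. If p^s is the
  p-part of k, then u \<psi> is divisible by p^(N - s) up to a factor prime to p; for N > s a factor
  p is left, and it vanishes in the field.\<close>

lemma divides_kills:
 assumes p: "Factorial_Ring.prime p" "CHAR('k::field) = p" and \<phi>: "hm \<phi>" and v: "v \<in> L.S" "\<phi> v \<noteq> 0" and \<psi>: "hm \<psi>"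
 shows "\<exists>s. \<forall>N u (b :: 'k). s < N \<longrightarrow> divides (int p) \<phi> N u \<longrightarrow> eqv (frag_of (b, op u \<psi>)) 0"
proof -
 have "\<exists>c k. c \<in> cent l m \<and> k \<noteq> 0 \<and> (\<forall>x\<in>L.S. act c (\<phi> x) = frag_cmul k (\<psi> x))"
  by (rule shom_irreducible[OF lam mu lm hm_shom[OF \<phi>] hm_shom[OF \<psi>] v]) (intro exI conjI ballI)
 then obtain c k where c: "c \<in> cent l m" "k \<noteq> 0" "\<And>x. x \<in> L.S ==> act c (\<phi> x) = frag_cmul k (\<psi> x)"
  by blast
 define s where "s = multiplicity (int p) k"
 have pp: "Factorial_Ring.prime (int p)" using p(1) by simp
 have nu: "\<not> is_unit (int p)" using pp not_prime_unit by blast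
 obtain k' where k': "k = int p ^ s * k'" "\<not> int p dvd k'"
  unfolding s_def by (rule multiplicity_decompose'[OF c(2) nu])
 have k0: "of_int k' \<noteq> (0::'k)" using k'(2) p(2) of_int_eq_0_iff_char_dvd by metis
 have p0: "of_int (int p) = (0::'k)" using p(2) of_nat_CHAR[where 'a = 'k] by simp
 have pz: "int p ^ s \<noteq> 0" using p(1) by (auto simp: not_prime_0)
 show ?thesis
 proof (intro exI[of _ s] allI impI)
  fix N u and b :: 'k assume N: "s < N" and u: "divides (int p) \<phi> N u"
  obtain d where d: "d \<in> cent l m" "\<And>x. x \<in> L.S ==> act (u * c) (\<phi> x) = frag_cmul (int p ^ N) (act d (\<phi> x))"
   using u c(1) unfolding divides_def by blast
  \<comment> \<open>One factor p is kept outside, to be moved over to the field coefficient, where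
    it becomes zero; the remaining powers are absorbed in the centraliser algebra.\<close>
  let ?d = "sc (int p ^ (N - Suc s)) * d"
  have Ns: "int p ^ N = int p ^ s * (int p * int p ^ (N - Suc s))"
  proof -
   have NN: "N = s + Suc (N - Suc s)" using N by simp
   have "int p ^ N = int p ^ (s + Suc (N - Suc s))" by (rule arg_cong[OF NN])
   thus ?thesis by (simp only: power_add power_Suc)
  qed
  have "op (sc k' * u) \<psi> = op (sc (int p) * ?d) \<phi>"
  proof (rule op_eqI)
   fix x assume x: "x \<in> L.S"
   have "frag_cmul (int p ^ s) (act (sc k' * u) (\<psi> x)) = act u (frag_cmul k (\<psi> x))"
    unfolding act_sc act_cmul k'(1) by simp
   also have "\<dots> = frag_cmul (int p ^ N) (act d (\<phi> x))" using d(2)[OF x] c(3)[OF x] by (simp add: act_mult)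
   also have "\<dots> = frag_cmul (int p ^ s) (act (sc (int p) * ?d) (\<phi> x))" unfolding act_sc Ns by simp
   finally show "act (sc k' * u) (\<psi> x) = act (sc (int p) * ?d) (\<phi> x)"
    unfolding L.frag_cmul_cancel using pz by blast
  qed
  note e = this
  have "eqv (frag_of (of_int k' * (b / of_int k'), op u \<psi>)) (frag_of (b / of_int k', op (sc k' * u) \<psi>))"
   by (rule eqv_sym[OF eqv_op_sc[OF \<psi> divides_cent[OF u]]])
  also have "\<dots> = frag_of (b / of_int k', op (sc (int p) * ?d) \<phi>)" by (simp only: e)
  also have "eqv \<dots> (frag_of (of_int (int p) * (b / of_int k'), op ?d \<phi>))"
   by (rule eqv_op_sc[OF \<phi> cent_mult[OF cent_scalar d(1)]])
  also have "eqv \<dots> 0"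
   unfolding p0 mult_zero_left by (rule eqv_0_left[OF hm_op[OF \<phi> cent_mult[OF cent_scalar d(1)]]])
  finally show "eqv (frag_of (b, op u \<psi>)) 0" using k0 by simp
 qed
qed

lemma divspan_acts_0: fixes a :: "'k::field gring"
 assumes p: "Factorial_Ring.prime p" "CHAR('k) = p" and \<phi>: "hm \<phi>" and v: "v \<in> L.S" "\<phi> v \<noteq> 0"
  and a: "\<And>N. a \<in> divspan (int p) \<phi> N" shows "acts a 0" unfolding acts_def
proof (intro allI impI)
 fix b :: 'k and \<psi> assume \<psi>: "hm \<psi>"
 obtain s where s: "\<And>N u (b :: 'k). s < N ==> divides (int p) \<phi> N u ==> eqv (frag_of (b, op u \<psi>)) 0"
  using divides_kills[OF p \<phi> v \<psi>] by auto
 have "eqv (pact a (b, \<psi>)) 0" using a[of "Suc s"]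
 proof (induction rule: divspan.induct)
  case zero
  show ?case by (simp add: pact_def)
 next
  case (step u a c)
  have u: "u \<in> cent l m" by (rule divides_cent[OF step(1)])
  have "eqv (pact (scal c * iota u + a) (b, \<psi>)) (pact (scal c * iota u) (b, \<psi>) + pact a (b, \<psi>))"
   by (rule pact_add[OF cent_mult[OF cent_scalar iota_cent[OF u]] divspan_cent[OF step(2)] \<psi>])
  also have "eqv \<dots> (frag_of (c * b, op u \<psi>) + 0)" by (rule eqv_add[OF pact_single[OF u \<psi>] step.IH])
  also have "eqv \<dots> (0 + 0)" by (rule eqv_add[OF s[OF _ step(1)] eqv_refl]) simp
  finally show ?case by simp
 qed
 thus "eqv (pact a (b, \<psi>)) (frag_of (0 * b, \<psi>))"
  unfolding mult_zero_left by (rule eqv_trans[OF _ eqv_sym[OF eqv_0_left[OF \<psi>]]])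
qed

text \<open>From e e = e follows e (e - \<beta>) = (1 - \<beta>) e, so each multiplication by e -
  \<beta> gains one power of p at the cost of an invertible scalar.\<close>

lemma idempotent_divspan:
 assumes e: "e * e = e" "e \<in> cent l m" and \<beta>: "e - scal \<beta> \<in> divspan p \<phi> 1" "\<beta> \<noteq> (1 :: 'k::field)"
 shows "e \<in> divspan p \<phi> N"
proof (induction N)
 case 0 show ?case by (rule divspan_0[OF e(2)])
next
 case (Suc N)
 have "e * (e - scal \<beta>) = scal (1 - \<beta>) * e"
  by (simp only: right_diff_distrib left_diff_distrib e(1) scalar_commute[symmetric] scal_simps(2,4) mult_1_left)
 hence "scal (1 - \<beta>) * e \<in> divspan p \<phi> (Suc N)" using divspan_mult[OF Suc \<beta>(1)] by simp
 moreover have "scal (inverse (1 - \<beta>)) \<in> divspan p \<phi> 0" by (rule divspan_0[OF cent_scalar])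
 ultimately have "scal (inverse (1 - \<beta>)) * (scal (1 - \<beta>) * e) \<in> divspan p \<phi> (0 + Suc N)" by (rule divspan_mult[rotated])
 moreover have "scal (inverse (1 - \<beta>)) * (scal (1 - \<beta>) * e) = e"
  using \<beta>(2) by (simp add: mult.assoc[symmetric] scal_simps(3)[symmetric])
 ultimately show ?case by simp
qed

text \<open>For \<beta> other than 1 the idempotent lies in every level and acts as zero. For
  nonzero \<beta> the same applies to the complementary idempotent 1 - e with the scalar 1 -
  \<beta>.\<close>

theorem idempotent_acts: fixes e :: "'k::field gring"
 assumes p: "Factorial_Ring.prime p" "CHAR('k) = p" and \<phi>: "hm \<phi>" and v: "v \<in> L.S" "\<phi> v \<noteq> 0"
  and e: "e * e = e" "e \<in> cent l m" and \<beta>: "e - scal \<beta> \<in> divspan (int p) \<phi> 1"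
 shows "\<beta> \<noteq> 1 ==> acts e 0" "\<beta> \<noteq> 0 ==> acts e 1"
proof -
 show "acts e 0" if "\<beta> \<noteq> 1" by (rule divspan_acts_0[OF p \<phi> v idempotent_divspan[OF e \<beta> that]])
 assume b: "\<beta> \<noteq> 0"
 have "scal (- 1) \<in> divspan (int p) \<phi> 0" by (rule divspan_0[OF cent_scalar])
 hence "scal (- 1) * (e - scal \<beta>) \<in> divspan (int p) \<phi> (0 + 1)" by (rule divspan_mult[OF _ \<beta>])
 moreover have "scal (- 1) * (e - scal \<beta>) = (1 - e) - scal (1 - \<beta>)" by (simp only: scal_simps(2,4,6)) simp
 ultimately have "(1 - e) - scal (1 - \<beta>) \<in> divspan (int p) \<phi> 1" by simp
 moreover have "(1 - e) * (1 - e) = 1 - e" using e(1) by (simp add: algebra_simps)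
 ultimately have "acts (1 - e) 0"
  using b e(2) by (intro divspan_acts_0[OF p \<phi> v] idempotent_divspan[of "1 - e" "1 - \<beta>"]) auto
 hence "acts (1 - (1 - e)) (1 - 0)" using acts_diff[OF cent_1 cent_diff[OF cent_1 e(2)] acts_scal[of 1, unfolded scal_simps]] by blast
 thus "acts e 1" by simp
qed

end

context skew begin

text \<open>The annihilator of the class of \<phi> modulo p in the submodule it generates. It is a
  left ideal, since a factor on the right would change \<phi>.\<close>

definition pideal :: "int \<Rightarrow> specht_map \<Rightarrow> int gring set" where
 "pideal p \<phi> = {a \<in> cent l m. \<exists>d\<in>cent l m. \<forall>v\<in>L.S. act a (\<phi> v) = frag_cmul p (act d (\<phi> v))}"

lemma pidealI: "a \<in> cent l m ==> d \<in> cent l m ==> (\<And>v. v \<in> L.S ==> act a (\<phi> v) = frag_cmul p (act d (\<phi> v))) ==> a \<in> pideal p \<phi>"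
 by (auto simp: pideal_def)

lemma pidealE: assumes "a \<in> pideal p \<phi>"
 obtains d where "a \<in> cent l m" "d \<in> cent l m" "\<forall>v\<in>L.S. act a (\<phi> v) = frag_cmul p (act d (\<phi> v))"
 using assms by (auto simp: pideal_def)

lemma pideal_0: "0 \<in> pideal p \<phi>" by (rule pidealI[of _ 0]) auto

lemma pideal_add: assumes "a \<in> pideal p \<phi>" "b \<in> pideal p \<phi>" shows "a + b \<in> pideal p \<phi>"
proof -
 obtain d where d: "a \<in> cent l m" "d \<in> cent l m" "\<forall>v\<in>L.S. act a (\<phi> v) = frag_cmul p (act d (\<phi> v))" by (rule pidealE[OF assms(1)])
 obtain f where f: "b \<in> cent l m" "f \<in> cent l m" "\<forall>v\<in>L.S. act b (\<phi> v) = frag_cmul p (act f (\<phi> v))" by (rule pidealE[OF assms(2)])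
 show ?thesis by (rule pidealI[of _ "d + f"]) (use d f in \<open>auto simp: act_add_left frag_cmul_distrib2\<close>)
qed

lemma pideal_mult: assumes "c \<in> cent l m" "a \<in> pideal p \<phi>" shows "c * a \<in> pideal p \<phi>"
proof -
 obtain d where d: "a \<in> cent l m" "d \<in> cent l m" "\<forall>v\<in>L.S. act a (\<phi> v) = frag_cmul p (act d (\<phi> v))" by (rule pidealE[OF assms(2)])
 show ?thesis by (rule pidealI[of _ "c * d"]) (use d assms in \<open>auto simp: act_mult act_cmul\<close>)
qed

lemma pideal_p: "c \<in> cent l m ==> sc p * c \<in> pideal p \<phi>" by (rule pidealI[of _ c]) (auto simp: act_sc)

lemma pideal_scalar:
 assumes "a \<in> cent l m" "\<And>v. v \<in> L.S ==> act a (\<phi> v) = frag_cmul c (\<phi> v)" "c mod p = s mod p"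
 shows "a - sc s \<in> pideal p \<phi>"
proof -
 obtain k where k: "c - s = p * k" using assms(3) by (metis mod_eq_dvd_iff dvdE)
 show ?thesis
 proof (rule pidealI[of _ "sc k"])
  fix v assume v: "v \<in> L.S"
  have "act (a - sc s) (\<phi> v) = frag_cmul (c - s) (\<phi> v)"
   using assms(2)[OF v] frag_cmul_distrib[of "c - s" s "\<phi> v"] by (simp add: act_diff_left act_single)
  thus "act (a - sc s) (\<phi> v) = frag_cmul p (act (sc k) (\<phi> v))" unfolding k by (simp add: act_single)
 qed (use assms in auto)
qed

text \<open>Centrality modulo p allows a to be moved past any c up to p times an element of the
  centraliser algebra. So being small on \<phi> implies being small on the whole submodule generated
  by \<phi>.\<close>

lemma pideal_divides:
 assumes a: "a \<in> pideal p \<phi>" and com: "\<And>d. d \<in> cent l m ==> \<exists>y\<in>cent l m. a * d - d * a = sc p * y"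
 shows "divides p \<phi> 1 a"
proof -
 obtain d where d: "a \<in> cent l m" "d \<in> cent l m" "\<forall>v\<in>L.S. act a (\<phi> v) = frag_cmul p (act d (\<phi> v))" by (rule pidealE[OF a])
 show ?thesis unfolding divides_def
 proof (intro conjI ballI d(1))
  fix c :: "int gring" assume c: "c \<in> cent l m"
  obtain y where y: "y \<in> cent l m" "a * c - c * a = sc p * y" using com[OF c] by blast
  have e: "a * c = c * a + sc p * y" using y(2) by (simp add: algebra_simps)
  show "\<exists>d\<in>cent l m. \<forall>v\<in>L.S. act (a * c) (\<phi> v) = frag_cmul (p ^ 1) (act d (\<phi> v))"
  proof (intro bexI[of _ "c * d + y"] ballI)
   fix v assume v: "v \<in> L.S"
   have "act (a * c) (\<phi> v) = act c (act a (\<phi> v)) + frag_cmul p (act y (\<phi> v))"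
    unfolding e act_add_left act_sc by (simp only: act_mult)
   also have "act a (\<phi> v) = frag_cmul p (act d (\<phi> v))" using d(3) v by blast
   finally show "act (a * c) (\<phi> v) = frag_cmul (p ^ 1) (act (c * d + y) (\<phi> v))"
    by (simp add: act_cmul act_mult act_add_left frag_cmul_distrib2)
  qed (use c d y in auto)
 qed
qed

lemma path_shom: assumes "box_path lam cs mu" shows "\<exists>\<phi> v. hm \<phi> \<and> v \<in> L.S \<and> \<phi> v \<noteq> 0 \<and>
  (\<forall>j x. l < j \<longrightarrow> j \<le> m \<longrightarrow> x \<in> L.S \<longrightarrow> act (jm j) (\<phi> x) = frag_cmul (cs ! (j - Suc l)) (\<phi> x)) \<and>
  (\<forall>z x. z \<in> cent l l \<longrightarrow> x \<in> L.S \<longrightarrow> act z (\<phi> x) = frag_cmul (L.omega z) (\<phi> x))"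
proof -
 have len: "l + length cs = m" using box_path_res(2)[OF assms] lam(2) mu(2) by simp
 show ?thesis
 proof (rule path_hom[OF assms lam(2)])
  fix \<phi> assume \<phi>: "shom l lam mu \<phi>" "\<And>x. x \<in> L.S ==> \<phi> x = 0 ==> x = 0"
   "\<And>j x. j < length cs ==> x \<in> L.S ==> act (jm (Suc (l + j))) (\<phi> x) = frag_cmul (cs ! j) (\<phi> x)"
  obtain t where t: "t \<in> tableaux lam" using L.tableau_exists by blast
  show ?thesis
  proof (intro exI[of _ "restrict \<phi> L.S"] exI[of _ "L.e t"] conjI allI impI)
   show "hm (restrict \<phi> L.S)" by (rule hm_restrict[OF \<phi>(1)])
   show "L.e t \<in> L.S" by (rule L.S_poly[OF t])
   thus "restrict \<phi> L.S (L.e t) \<noteq> 0" using \<phi>(2) L.poly_nonzero[OF t] by auto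
   fix x assume x: "x \<in> L.S"
   show "act (jm j) (restrict \<phi> L.S x) = frag_cmul (cs ! (j - Suc l)) (restrict \<phi> L.S x)" if "l < j" "j \<le> m" for j
    using \<phi>(3)[of "j - Suc l", OF _ x] that len x by simp
   show "act z (restrict \<phi> L.S x) = frag_cmul (L.omega z) (restrict \<phi> L.S x)" if "z \<in> cent l l" for z
    using shom_omega[OF \<phi>(1) lam that x] x by simp
  qed
 qed
qed

end

text \<open>The integral components of e commute with the Jucys-Murphy elements modulo p, so
  \<open>commuting_scalar\<close> makes each a scalar modulo the ideal. The two paths have weights
  congruent modulo p, and the inner shapes have congruent central characters, so one ideal can serve
  both paths.\<close>

theorem central_scalar: fixes e :: "'k::field gring"
 assumes p: "Factorial_Ring.prime p" "CHAR('k) = p" and s: "skew l m lam1 mu1" "skew l m lam2 mu2"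
  and bp: "box_path lam1 cs1 mu1" "box_path lam2 cs2 mu2"
  and word: "residues p cs1 = residues p cs2" "distinct (residues p cs1)"
  and rc: "res_count p lam1 = res_count p lam2"
  and e: "e \<in> cent l m" "\<And>a. a \<in> cent l m ==> e * a = a * e" obtains \<beta> \<phi>1 \<phi>2 v1 v2 where
  "\<phi>1 \<in> carrier (specht_hom l mu1 lam1)" "v1 \<in> specht_lattice lam1" "\<phi>1 v1 \<noteq> 0"
  "\<phi>2 \<in> carrier (specht_hom l mu2 lam2)" "v2 \<in> specht_lattice lam2" "\<phi>2 v2 \<noteq> 0"
  "e - scal \<beta> \<in> skew.divspan l m lam1 (int p) \<phi>1 1"
  "e - scal \<beta> \<in> skew.divspan l m lam2 (int p) \<phi>2 1"
proof -
 interpret S1: skew l m lam1 mu1 by (rule s(1))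
 interpret S2: skew l m lam2 mu2 by (rule s(2))
 have lm: "l \<le> m" by (rule S1.lm)
 have p2: "p \<ge> 2" using p(1) by (rule prime_ge_2_nat)
 have len: "length cs1 = m - l" "length cs2 = m - l"
  using box_path_res(2)[OF bp(1)] box_path_res(2)[OF bp(2)] S1.lam(2) S1.mu(2) S2.lam(2) S2.mu(2) by simp_all
 obtain \<phi>1 v1 where \<phi>1: "S1.hm \<phi>1" "v1 \<in> S1.L.S" "\<phi>1 v1 \<noteq> 0"
  and jm1: "\<And>j x. l < j ==> j \<le> m ==> x \<in> S1.L.S ==> act (jm j) (\<phi>1 x) = frag_cmul (cs1 ! (j - Suc l)) (\<phi>1 x)"
  and om1: "\<And>z x. z \<in> cent l l ==> x \<in> S1.L.S ==> act z (\<phi>1 x) = frag_cmul (S1.L.omega z) (\<phi>1 x)"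
  using S1.path_shom[OF bp(1)] by blast
 obtain \<phi>2 v2 where \<phi>2: "S2.hm \<phi>2" "v2 \<in> S2.L.S" "\<phi>2 v2 \<noteq> 0"
  and jm2: "\<And>j x. l < j ==> j \<le> m ==> x \<in> S2.L.S ==> act (jm j) (\<phi>2 x) = frag_cmul (cs2 ! (j - Suc l)) (\<phi>2 x)"
  and om2: "\<And>z x. z \<in> cent l l ==> x \<in> S2.L.S ==> act z (\<phi>2 x) = frag_cmul (S2.L.omega z) (\<phi>2 x)"
  using S2.path_shom[OF bp(2)] by blast
 \<comment> \<open>Taking the intersection forces the scalar of each integral component to be the
   same for both paths.\<close>
 define I where "I = S1.pideal (int p) \<phi>1 \<inter> S2.pideal (int p) \<phi>2"
 define w where "w j = cs1 ! (j - Suc l)" for j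
 have wmod: "cs2 ! (j - Suc l) mod int p = w j mod int p" if "l < j" "j \<le> m" for j
 proof -
  have "j - Suc l < length cs1" "j - Suc l < length cs2" using that len by simp_all
  thus ?thesis using arg_cong[OF word(1), of "\<lambda>xs. xs ! (j - Suc l)"] by (simp add: w_def)
 qed
 interpret W: weight_ideal l m I "int p" w
 proof
  show "l \<le> m" by (rule lm)
  show "0 \<in> I" by (simp add: I_def S1.pideal_0 S2.pideal_0)
  show "a + b \<in> I" if "a \<in> I" "b \<in> I" for a b using that by (simp add: I_def S1.pideal_add S2.pideal_add)
  show "c * a \<in> I" if "c \<in> cent l m" "a \<in> I" for a c using that by (simp add: I_def S1.pideal_mult S2.pideal_mult)
  show "sc (int p) * c \<in> I" if "c \<in> cent l m" for c
   unfolding I_def by (intro IntI S1.pideal_p S2.pideal_p that)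
  show "jm j - sc (w j) \<in> I" if "l < j" "j \<le> m" for j
   unfolding I_def using S1.pideal_scalar[OF jm_cent_le[OF that] jm1[OF that], where p = "int p" and s = "w j"]
    S2.pideal_scalar[OF jm_cent_le[OF that] jm2[OF that] wmod[OF that]] by (simp add: w_def)
  show "\<exists>s. z - sc s \<in> I" if z: "z \<in> cent l l" for z
  proof -
   have zm: "z \<in> cent l m" using z cent_mono2[OF lm] by blast
   have "S1.L.omega z mod int p = S2.L.omega z mod int p"
    by (rule omega_cong[OF p2 S1.lam(1) S2.lam(1) S1.lam(2) rc z])
   hence "z - sc (S1.L.omega z) \<in> S2.pideal (int p) \<phi>2" by (intro S2.pideal_scalar[OF zm om2[OF z] sym])
   moreover have "z - sc (S1.L.omega z) \<in> S1.pideal (int p) \<phi>1" by (rule S1.pideal_scalar[OF zm om1[OF z] refl])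
   ultimately have "z - sc (S1.L.omega z) \<in> I" unfolding I_def by (rule IntI[rotated])
   thus ?thesis by (rule exI)
  qed
  show "Factorial_Ring.prime (int p)" using p(1) by simp
  fix i j assume ij: "l < i" "i \<le> m" "l < j" "j \<le> m" "i \<noteq> j"
  hence "i - Suc l < length cs1" "j - Suc l < length cs1" "i - Suc l \<noteq> j - Suc l" using len by simp_all
  hence "residues p cs1 ! (i - Suc l) \<noteq> residues p cs1 ! (j - Suc l)"
   using word(2) by (simp add: nth_eq_iff_index_eq del: nth_map)
  hence "w i mod int p \<noteq> w j mod int p"
   using \<open>i - Suc l < length cs1\<close> \<open>j - Suc l < length cs1\<close> by (simp add: w_def)
  thus "\<not> int p dvd w i - w j" by (simp add: mod_eq_dvd_iff)
 qed
 obtain B c where B: "finite B" "fp_indep B" and c0: "\<forall>b\<in>B. c b \<in> cent l m" and ec: "e = (\<Sum>b\<in>B. scal b * iota (c b))"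
 proof (rule cent_integral_form[OF p e(1) lm])
  fix B c assume h: "finite B" "fp_indep B" "\<And>b. b \<in> B ==> c b \<in> cent l m" "e = (\<Sum>b\<in>B. scal b * iota (c b))"
  show thesis by (rule that[OF h(1,2) _ h(4)]) (simp add: h(3))
 qed
 note c = bspec[OF c0]
 have com: "\<exists>y\<in>cent l m. c b * d - d * c b = sc (int p) * y" if b: "b \<in> B" and d: "d \<in> cent l m" for b d
  by (rule integral_commutes[OF p B c ec e(2) b d]) (assumption | rule bexI)+
 have "\<exists>s. c b - sc s \<in> I" if b: "b \<in> B" for b
 proof (rule W.commuting_scalar[OF c[OF b]])
  fix j assume j: "l < j" "j \<le> m"
  obtain y where "y \<in> cent l m" "c b * jm j - jm j * c b = sc (int p) * y" using com[OF b jm_cent_le[OF j]] by blast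
  hence "c b * jm j - jm j * c b \<in> I" using W.pI by simp
  hence "- (c b * jm j - jm j * c b) \<in> I" by (rule W.Iuminus)
  thus "jm j * c b - c b * jm j \<in> I" by simp
 qed
 then obtain s where s: "\<forall>b\<in>B. c b - sc (s b) \<in> I" using bchoice[of B "\<lambda>b s. c b - sc s \<in> I"] by blast
 hence s1: "c b - sc (s b) \<in> S1.pideal (int p) \<phi>1" and s2: "c b - sc (s b) \<in> S2.pideal (int p) \<phi>2"
  if "b \<in> B" for b using that unfolding I_def by blast+
 \<comment> \<open>The scalars of the integral components are recombined with the basis elements
   over the prime field.\<close>
 define \<beta> where "\<beta> = (\<Sum>b\<in>B. b * of_int (s b))"
 have com': "\<exists>y\<in>cent l m. (c b - sc (s b)) * d - d * (c b - sc (s b)) = sc (int p) * y"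
  if b: "b \<in> B" and d: "d \<in> cent l m" for b d
  using com[OF b d] sc_comm[of d "s b"] by (simp add: left_diff_distrib right_diff_distrib)
 have e\<beta>: "e - scal \<beta> = (\<Sum>b\<in>B. scal b * iota (c b - sc (s b)))"
  unfolding ec \<beta>_def scal_sum scal_simps(3) by (simp only: sum_subtractf[symmetric] right_diff_distrib[symmetric] iota_diff iota_single)
 have "e - scal \<beta> \<in> S1.divspan (int p) \<phi>1 1"
  unfolding e\<beta> by (intro S1.divspan_sum S1.divspan_single S1.pideal_divides[OF s1 com'])
 moreover have "e - scal \<beta> \<in> S2.divspan (int p) \<phi>2 1"
  unfolding e\<beta> by (intro S2.divspan_sum S2.divspan_single S2.pideal_divides[OF s2 com'])
 ultimately show ?thesis by (rule that[OF \<phi>1 \<phi>2])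
qed

context skew begin

lemma acts_unique: fixes s s' :: "'k::field"
 assumes \<phi>0: "hm \<phi>0" "v \<in> L.S" "\<phi>0 v \<noteq> 0" and a: "acts a s" "acts a s'" shows "s = s'"
proof -
 have "\<exists>\<phi>. hm \<phi> \<and> (\<forall>s :: 'k. eqv (frag_of (s, \<phi>)) 0 \<longrightarrow> s = 0)"
  by (rule tensor_nontrivial[OF \<phi>0]) blast
 then obtain \<phi> where \<phi>: "hm \<phi>" "\<forall>s :: 'k. eqv (frag_of (s, \<phi>)) 0 \<longrightarrow> s = 0" by blast
 have 1: "eqv (frag_of (s, \<phi>)) (frag_of (s', \<phi>))"
  using eqv_trans[OF eqv_sym[of "pact a (1, \<phi>)" "frag_of (s, \<phi>)"], of "frag_of (s', \<phi>)"] a \<phi>(1) unfolding acts_def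
  by (metis mult.right_neutral)
 have "eqv (frag_of (s - s' + s', \<phi>)) (frag_of (s - s', \<phi>) + frag_of (s', \<phi>))" by (rule eqv_add_left[OF \<phi>(1)])
 hence 2: "eqv (frag_of (s, \<phi>)) (frag_of (s - s', \<phi>) + frag_of (s', \<phi>))" by simp
 have "eqv (frag_of (s - s', \<phi>) + frag_of (s', \<phi>)) (frag_of (s', \<phi>))" by (rule eqv_trans[OF eqv_sym[OF 2] 1])
 hence "eqv (frag_of (s - s', \<phi>)) 0" by (simp add: eqv_def)
 thus ?thesis using \<phi>(2) by auto
qed

text \<open>The right factor only moves one equivariant map to a sum of others, and a kills all of
  them. No scalar action of the right factor is assumed, and this matters for the cofactor in
  Fitting's lemma.\<close>

lemma acts_0_mult: assumes "a \<in> cent l m" "a' \<in> cent l m" "acts a 0" shows "acts (a * a') 0"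
 unfolding acts_def
proof (intro allI impI)
 fix b :: 'a and \<phi> assume h: "hm \<phi>"
 have "eqv (pact (a * a') (b, \<phi>)) (\<Sum>Y\<in>orbits l m. pact a (orbcoeff a' Y * b, op (orbsum Y) \<phi>))"
  by (rule pact_mult[OF assms(1,2) h])
 also have "eqv \<dots> (\<Sum>Y\<in>orbits l m. 0)"
 proof (rule eqv_sum)
  fix Y assume Y: "Y \<in> orbits l m"
  have hY: "hm (op (orbsum Y) \<phi>)" by (rule hm_op[OF h orbsum_cent[OF Y lm]])
  have "eqv (pact a (orbcoeff a' Y * b, op (orbsum Y) \<phi>)) (frag_of (0 * (orbcoeff a' Y * b), op (orbsum Y) \<phi>))"
   using assms(3) hY unfolding acts_def by blast
  also have "eqv \<dots> 0" unfolding mult_zero_left by (rule eqv_0_left[OF hY])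
  finally show "eqv (pact a (orbcoeff a' Y * b, op (orbsum Y) \<phi>)) 0" .
 qed
 also have "\<dots> = 0" by simp
 also have "eqv 0 (frag_of (0 * b, \<phi>))" unfolding mult_zero_left by (rule eqv_sym[OF eqv_0_left[OF h]])
 finally show "eqv (pact (a * a') (b, \<phi>)) (frag_of (0 * b, \<phi>))" .
qed

lemma acts_iota:
 assumes z: "z \<in> cent l m" and s: "\<And>\<phi> v. hm \<phi> ==> v \<in> L.S ==> act z (\<phi> v) = frag_cmul s (\<phi> v)"
 shows "acts (iota z) (of_int s :: 'k::field)" unfolding acts_def
proof (intro allI impI)
 fix b :: 'k and \<phi> assume h: "hm \<phi>"
 have "op z \<phi> = op (sc s * 1) \<phi>" by (rule op_eqI) (simp add: act_single s[OF h])
 thus "eqv (pact (iota z) (b, \<phi>)) (frag_of (of_int s * b, \<phi>))"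
  using eqv_trans[OF pact_iota[OF z h] , of b "frag_of (of_int s * b, \<phi>)"] eqv_op_sc[OF h cent_1, of b s] unfolding op_1[OF h] by simp
qed

lemma acts_sum: assumes "finite F" "\<And>f. f \<in> F ==> f \<in> cent l m \<and> acts f 0" shows "acts (\<Sum>F) 0"
 using assms
proof (induction F rule: finite_induct)
 case empty
 thus ?case using acts_scal[of 0] by (simp add: scal_simps)
next
 case (insert f F)
 have "acts (f + \<Sum>F) (0 + 0)" by (rule acts_add) (use insert in \<open>auto intro: cent_sum\<close>)
 thus ?case using insert by simp
qed

end

section \<open>Primitive central idempotents and Fitting's lemma\<close>

definition cidem :: "nat \<Rightarrow> nat \<Rightarrow> 'k::field gring \<Rightarrow> bool" where
 "cidem l m e \<longleftrightarrow> e \<in> cent l m \<and> e * e = e \<and> (\<forall>a\<in>cent l m. e * a = a * e)"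

definition prim :: "nat \<Rightarrow> nat \<Rightarrow> 'k::field gring \<Rightarrow> bool" where
 "prim l m e \<longleftrightarrow> cidem l m e \<and> e \<noteq> 0 \<and> (\<forall>f g. cidem l m f \<and> cidem l m g \<and> f * g = 0 \<and> e = f + g \<longrightarrow> f = 0 \<or> g = 0)"

interpretation kv: vector_space "\<lambda>(c :: 'k::field) (a :: 'k gring). scal c * a"
 by unfold_locales (simp_all add: scal_simps distrib_left distrib_right mult.assoc)

lemma independent_galg: assumes S: "kv.independent S" "S \<subseteq> (galg m :: 'k::field gring set)"
 shows "finite S \<and> card S \<le> card (syms m)"
proof -
 have "a \<in> kv.span (gs ` syms m)" if "a \<in> galg m" for a :: "'k gring" using that
 proof (rule galg_induct)
  fix g and c :: 'k assume "g \<in> syms m"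
  thus "single g c \<in> kv.span (gs ` syms m)"
   unfolding single_times[of g c] by (intro kv.span_scale kv.span_base) blast
 qed (auto intro: kv.span_zero kv.span_add)
 hence "S \<subseteq> kv.span (gs ` syms m)" using S(2) by blast
 hence "finite S \<and> card S \<le> card (gs ` syms m :: 'k gring set)"
  by (rule kv.independent_span_bound[OF finite_imageI[OF finite_syms] S(1)])
 thus ?thesis using card_image_le[of "syms m" "gs :: nperm \<Rightarrow> 'k gring"] by (meson finite_syms order_trans)
qed

definition decomposition :: "nat \<Rightarrow> nat \<Rightarrow> 'k::field gring set \<Rightarrow> bool" where
 "decomposition l m F \<longleftrightarrow> finite F \<and> (\<forall>f\<in>F. cidem l m f \<and> f \<noteq> 0) \<and>
   (\<forall>f\<in>F. \<forall>g\<in>F. f \<noteq> g \<longrightarrow> f * g = 0) \<and> \<Sum>F = 1"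

lemma decomposition_bound: fixes F :: "'k::field gring set"
 assumes F: "decomposition l m F" shows "card F \<le> card (syms m)"
proof -
 have "kv.independent F"
 proof
  assume "kv.dependent F"
  moreover have "finite F" using F by (simp add: decomposition_def)
  ultimately have "\<exists>u. (\<exists>v\<in>F. u v \<noteq> 0) \<and> (\<Sum>v\<in>F. scal (u v) * v) = 0"
   by (simp only: kv.dependent_finite)
  then obtain u f where u: "f \<in> F" "u f \<noteq> 0" "(\<Sum>v\<in>F. scal (u v) * v) = 0" by blast
  have "0 = f * (\<Sum>v\<in>F. scal (u v) * v)" unfolding u(3) by simp
  also have "\<dots> = (\<Sum>v\<in>F. if v = f then scal (u f) * f else 0)" unfolding sum_distrib_left
  proof (rule sum.cong[OF refl])
   fix v assume v: "v \<in> F"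
   show "f * (scal (u v) * v) = (if v = f then scal (u f) * f else 0)"
    using F u(1) v unfolding decomposition_def cidem_def scal_left[of f] by auto
  qed
  also have "\<dots> = scal (u f) * f" using u(1) F by (simp add: decomposition_def)
  finally have "scal (inverse (u f)) * (scal (u f) * f) = 0" by simp
  hence "f = 0" using u(2) by (simp add: mult.assoc[symmetric] scal_simps(3)[symmetric])
  thus False using F u(1) unfolding decomposition_def by blast
 qed
 moreover have "F \<subseteq> galg m" using F cent_galg unfolding decomposition_def cidem_def by blast
 ultimately show ?thesis using independent_galg by blast
qed

text \<open>A decomposition of 1 with the largest number of summands is taken: orthogonal nonzero
  idempotents are linearly independent, so the number is bounded, and splitting a summand that is
  not primitive would increase it.\<close>

lemma primitive_decomposition:
 obtains F :: "'k::field gring set" where "finite F" "\<And>f. f \<in> F ==> prim l m f" "\<Sum>F = 1"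
proof -
 have 1: "decomposition l m {1 :: 'k gring}" by (simp add: decomposition_def cidem_def)
 have 2: "\<forall>G :: 'k gring set. decomposition l m G \<longrightarrow> card G < Suc (card (syms m))"
  by (simp add: less_Suc_eq_le decomposition_bound)
 have "\<exists>F :: 'k gring set. decomposition l m F \<and> (\<forall>G :: 'k gring set. decomposition l m G \<longrightarrow> card G \<le> card F)"
  by (rule ex_has_greatest_nat[of "decomposition l m" "{1}" card "Suc (card (syms m))", OF 1 2])
 then obtain F :: "'k gring set" where F: "decomposition l m F"
  and max: "\<And>G :: 'k gring set. decomposition l m G ==> card G \<le> card F" by blast
 have fin: "finite F" and Fc: "\<And>f. f \<in> F ==> cidem l m f" and F0: "\<And>f. f \<in> F ==> f \<noteq> 0"
  and orth: "\<And>f g. f \<in> F ==> g \<in> F ==> f \<noteq> g ==> f * g = 0" and F1: "\<Sum>F = 1"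
  using F by (auto simp: decomposition_def)
 have "prim l m f" if f: "f \<in> F" for f
 proof (rule ccontr)
  assume "\<not> prim l m f"
  then obtain g h where gh: "cidem l m g" "cidem l m h" "g * h = 0" "f = g + h" "g \<noteq> 0" "h \<noteq> 0"
   using Fc[OF f] F0[OF f] unfolding prim_def by blast
  have "g * h = h * g" using gh(1,2) unfolding cidem_def by blast
  hence hg: "h * g = 0" using gh(3) by simp
  have idem: "g * g = g" "h * h = h" using gh(1,2) unfolding cidem_def by blast+
  have gf: "g * f = g" "f * g = g" "h * f = h" "f * h = h"
   using idem gh(3) hg by (simp_all add: gh(4) distrib_left distrib_right)
  have o: "x * y = 0" "y * x = 0" if "x = g \<or> x = h" "y \<in> F - {f}" for x y
  proof -
   have "f * y = 0" "y * f = 0" using orth f that(2) by auto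
   moreover have x: "x * f = x" "f * x = x" using that(1) gf by blast+
   have "x * y = x * (f * y)" "y * x = y * f * x" by (simp only: mult.assoc[symmetric] x) (simp only: mult.assoc x)
   ultimately show "x * y = 0" "y * x = 0" by simp_all
  qed
  have nin: "g \<notin> F - {f}" "h \<notin> F - {f}" using o[of g g] o[of h h] idem gh(5,6) by auto
  have ne: "g \<noteq> h" using gh(3,5) idem by auto
  have fin': "finite (F - {f})" using fin by simp
  have "\<Sum>(insert g (insert h (F - {f}))) = g + (h + \<Sum>(F - {f}))" using nin ne fin' by simp
  also have "\<dots> = 1" using sum.remove[OF fin f, of "\<lambda>x. x"] F1 gh(4) by (simp add: add.assoc)
  finally have s: "\<Sum>(insert g (insert h (F - {f}))) = 1" .
  have "decomposition l m (insert g (insert h (F - {f})))" unfolding decomposition_def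
  proof (intro conjI ballI impI s)
   fix x y assume "x \<in> insert g (insert h (F - {f}))" "y \<in> insert g (insert h (F - {f}))" "x \<noteq> y"
   then consider "x = g" "y = h" | "x = h" "y = g" | "x = g \<or> x = h" "y \<in> F - {f}" | "y = g \<or> y = h" "x \<in> F - {f}"
    | "x \<in> F" "y \<in> F" by blast
   thus "x * y = 0" by cases (use gh(3) hg o orth \<open>x \<noteq> y\<close> in auto)
  qed (use fin gh(1,2,5,6) Fc F0 in auto)
  hence "card (insert g (insert h (F - {f}))) \<le> card F" by (rule max)
  moreover have "card (insert g (insert h (F - {f}))) = Suc (Suc (card (F - {f})))" using nin ne fin' by simp
  ultimately show False using card_Suc_Diff1[OF fin f] by linarith
 qed
 thus ?thesis by (rule that[OF fin _ F1])
qed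

text \<open>The algebra is finite-dimensional, so the powers of w are linearly dependent. Solving a
  relation for its lowest power expresses this power through higher ones, with a cofactor r that is
  a polynomial in w and hence central.\<close>

lemma fitting_power: fixes w :: "'k::field gring"
 assumes w: "w \<in> cent l m" "\<And>a. a \<in> cent l m ==> w * a = a * w"
 obtains n r where "r \<in> cent l m" "\<And>a. a \<in> cent l m ==> r * a = a * r" "w ^ n = w ^ n * w * r"
proof -
 let ?Z = "{r \<in> cent l m. \<forall>a\<in>cent l m. r * a = a * r}"
 have Zw: "w ^ i \<in> ?Z" for i using w(1) power_commuting_commutes[OF w(2)] by simp
 have Zs: "scal c * r \<in> ?Z" if "r \<in> ?Z" for c r
 proof -
  have "scal c * r * a = a * (scal c * r)" if "a \<in> cent l m" for a
   using \<open>r \<in> ?Z\<close> that by (simp add: mult.assoc scal_left)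
  thus ?thesis using that by simp
 qed
 have Zsum: "sum f I \<in> ?Z" if "\<And>i. i \<in> I ==> f i \<in> ?Z" for f and I :: "nat set"
  using that by (simp add: cent_sum sum_distrib_left sum_distrib_right)
 let ?N = "card (syms m)"
 have "\<exists>n. \<exists>r\<in>?Z. w ^ n = w ^ n * w * r"
 proof (cases "inj_on (\<lambda>i. w ^ i) {..?N}")
  case False
  then obtain i j where ij: "i < j" "w ^ i = w ^ j" unfolding inj_on_def by (metis linorder_neqE_nat)
  have "j = Suc i + (j - Suc i)" using ij(1) by simp
  hence "w ^ j = w ^ Suc i * w ^ (j - Suc i)" by (metis power_add)
  hence "w ^ i = w ^ i * w * w ^ (j - Suc i)" using ij(2) by (simp add: power_commutes)
  thus ?thesis by (intro exI[of _ i] bexI[OF _ Zw[of "j - Suc i"]])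
 next
  case True
  let ?S = "(\<lambda>i. w ^ i) ` {..?N}"
  have "?S \<subseteq> galg m" using w(1) cent_galg cent_power by blast
  moreover have "card ?S = Suc ?N" by (simp add: card_image[OF True])
  ultimately have "kv.dependent ?S" using independent_galg[of ?S m] by auto
  hence "\<exists>u. (\<exists>v\<in>?S. u v \<noteq> 0) \<and> (\<Sum>v\<in>?S. scal (u v) * v) = 0"
   by (simp only: kv.dependent_finite[OF finite_imageI[OF finite_atMost]])
  then obtain u v where u: "v \<in> ?S" "u v \<noteq> 0" "(\<Sum>v\<in>?S. scal (u v) * v) = 0" by blast
  define c where "c i = u (w ^ i)" for i
  have s: "(\<Sum>i\<le>?N. scal (c i) * w ^ i) = 0" using u(3) by (simp add: sum.reindex[OF True] c_def)
  have ex: "\<exists>i. i \<le> ?N \<and> c i \<noteq> 0" using u(1,2) by (auto simp: c_def)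
  \<comment> \<open>The lowest power with a nonzero coefficient; all other terms of the relation are
    divisible by the next power of w.\<close>
  define n where "n = (LEAST i. i \<le> ?N \<and> c i \<noteq> 0)"
  have n: "n \<le> ?N" "c n \<noteq> 0" using LeastI_ex[OF ex] unfolding n_def by blast+
  have small: "c i = 0" if "i < n" for i using not_less_Least[of i "\<lambda>i. i \<le> ?N \<and> c i \<noteq> 0"] that n(1) unfolding n_def by auto
  define q where "q = (\<Sum>i\<in>{n<..?N}. scal (c i) * w ^ (i - Suc n))"
  have "(\<Sum>i\<le>?N. scal (c i) * w ^ i) = (\<Sum>i\<in>{n..?N}. scal (c i) * w ^ i)"
   by (rule sum.mono_neutral_right) (use small in \<open>auto simp: not_le\<close>)
  also have "{n..?N} = insert n {n<..?N}" using n(1) by auto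
  also have "(\<Sum>i\<in>insert n {n<..?N}. scal (c i) * w ^ i) = scal (c n) * w ^ n + (\<Sum>i\<in>{n<..?N}. scal (c i) * w ^ i)" by simp
  also have "(\<Sum>i\<in>{n<..?N}. scal (c i) * w ^ i) = w ^ n * w * q" unfolding q_def sum_distrib_left
  proof (rule sum.cong[OF refl])
   fix i assume "i \<in> {n<..?N}"
   hence "i = n + Suc (i - Suc n)" by simp
   hence "w ^ i = w ^ n * w * w ^ (i - Suc n)" by (metis power_add power_Suc mult.assoc)
   thus "scal (c i) * w ^ i = w ^ n * w * (scal (c i) * w ^ (i - Suc n))" by (simp only: scal_left)
  qed
  finally have "scal (c n) * w ^ n + w ^ n * w * q = 0" using s by simp
  hence h: "scal (c n) * w ^ n = w ^ n * w * (- q)" by (simp add: eq_neg_iff_add_eq_0)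
  have "w ^ n = scal (inverse (c n)) * (scal (c n) * w ^ n)"
   using n(2) by (simp add: mult.assoc[symmetric] scal_simps(3)[symmetric])
  also have "\<dots> = w ^ n * w * (scal (inverse (c n)) * (- q))" unfolding h by (simp only: scal_left)
  finally have "w ^ n = w ^ n * w * (scal (- inverse (c n)) * q)" by (simp add: scal_simps(6))
  moreover have "scal (- inverse (c n)) * q \<in> ?Z" unfolding q_def by (intro Zs Zsum Zw)
  ultimately show ?thesis by (intro exI[of _ n] bexI[of _ "scal (- inverse (c n)) * q"])
 qed
 then obtain n r where "r \<in> ?Z" "w ^ n = w ^ n * w * r" by blast
 thus ?thesis by (intro that[of r n]) simp_all
qed

text \<open>Fitting's lemma for w = (z - s1) e, which acts as 0 on the first module and as s2 - s1
  on the second. It splits e into a part on which w is invertible and one on which w is nilpotent;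
  as e is primitive, one of them is zero. Invertibility is excluded by the first module, and
  nilpotency gives s1 = s2 on the second.\<close>

theorem primitive_scalars: fixes e z :: "'k::field gring"
 assumes e: "prim l m e" and z: "z \<in> cent l m" "\<And>a. a \<in> cent l m ==> z * a = a * z"
  and S1: "skew l m lam1 mu1" "\<phi>1 \<in> carrier (specht_hom l mu1 lam1)" "v1 \<in> specht_lattice lam1" "\<phi>1 v1 \<noteq> 0"
  and S2: "skew l m lam2 mu2" "\<phi>2 \<in> carrier (specht_hom l mu2 lam2)" "v2 \<in> specht_lattice lam2" "\<phi>2 v2 \<noteq> 0"
  and a1: "skew.acts l lam1 mu1 e 1" "skew.acts l lam1 mu1 z s1"
  and a2: "skew.acts l lam2 mu2 e 1" "skew.acts l lam2 mu2 z s2" shows "s1 = s2"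
proof -
 interpret S1: skew l m lam1 mu1 by (rule S1)
 interpret S2: skew l m lam2 mu2 by (rule S2)
 have ec: "e \<in> cent l m" "e * e = e" "\<And>a. a \<in> cent l m ==> e * a = a * e" using e by (auto simp: prim_def cidem_def)
 define w where "w = (z - scal s1) * e"
 have wc: "w \<in> cent l m" unfolding w_def by (intro cent_mult cent_diff cent_scalar z(1) ec(1))
 have ww: "w * a = a * w" if a: "a \<in> cent l m" for a
 proof -
  have "(z - scal s1) * a = a * (z - scal s1)"
   by (simp only: left_diff_distrib right_diff_distrib z(2)[OF a] scalar_commute)
  hence "(z - scal s1) * (a * e) = a * ((z - scal s1) * e)" by (simp only: mult.assoc[symmetric])
  thus ?thesis by (simp only: w_def mult.assoc ec(3)[OF a])
 qed
 have we: "w * e = w" by (simp add: w_def mult.assoc ec(2))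
 obtain n r where r: "r \<in> cent l m" "\<And>a. a \<in> cent l m ==> r * a = a * r" "w ^ n = w ^ n * w * r"
 proof (rule fitting_power[OF wc ww])
  fix r n assume h: "r \<in> cent l m" "\<And>a. a \<in> cent l m ==> r * a = a * r" "w ^ n = w ^ n * w * r"
  show thesis by (rule that[OF h(1) _ h(3)]) (rule h(2))
 qed
 define k where "k = Suc n"
 define x where "x = w * r"
 have xc: "x \<in> cent l m" unfolding x_def by (rule cent_mult[OF wc r(1)])
 have xx: "x * a = a * x" if "a \<in> cent l m" for a
 proof -
  have "w * (a * r) = a * (w * r)" using ww[OF that] by (simp only: mult.assoc[symmetric])
  thus ?thesis by (simp only: x_def mult.assoc r(2)[OF that])
 qed
 have k1: "w ^ k = w ^ k * x" unfolding k_def x_def using r(3) by (simp add: mult.assoc)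
 have kj: "w ^ k = w ^ k * x ^ j" for j
 proof (induction j)
  case (Suc j)
  have "w ^ k * x ^ Suc j = w ^ k * x * x ^ j" by (simp add: mult.assoc)
  thus ?case using k1 Suc by simp
 qed simp
 \<comment> \<open>The idempotent projecting to the part on which w is invertible: there x = w r is
   the identity, while its power x^k vanishes on the nilpotent part.\<close>
 define f where "f = x ^ k"
 have fc: "f \<in> cent l m" unfolding f_def using xc by simp
 have ff: "f * a = a * f" if "a \<in> cent l m" for a
  unfolding f_def by (rule power_commuting_commutes[OF xx[OF that]])
 have rr: "r ^ j * a = a * r ^ j" if "a \<in> cent l m" for a j
  by (rule power_commuting_commutes[OF r(2)[OF that]])
 have "x ^ j = w ^ j * r ^ j" for j
 proof (induction j)
  case (Suc j)
  have "x ^ Suc j = w * (r * (w ^ j * r ^ j))" unfolding power_Suc Suc by (simp only: x_def mult.assoc)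
  also have "r * (w ^ j * r ^ j) = w ^ j * (r * r ^ j)"
   using r(2)[OF cent_power[OF wc], of j] by (simp only: mult.assoc[symmetric])
  finally show ?case by (simp add: mult.assoc)
 qed simp
 hence fw: "f = w ^ k * r ^ k" by (simp add: f_def)
 have f2: "f * f = f"
 proof -
  have "w ^ k = w ^ k * f" unfolding f_def by (rule kj)
  hence "f = w ^ k * f * r ^ k" using fw by simp
  also have "\<dots> = w ^ k * (r ^ k * f)" unfolding rr[OF fc] by (rule mult.assoc)
  also have "\<dots> = f * f" unfolding mult.assoc[symmetric] fw[symmetric] ..
  finally show ?thesis ..
 qed
 have fe: "f * e = f" "e * f = f"
 proof -
  have "x * e = w * e * r" unfolding x_def mult.assoc r(2)[OF ec(1)] ..
  hence "x * e = x" unfolding we x_def .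
  thus "f * e = f" unfolding f_def k_def power_Suc2 mult.assoc by simp
  thus "e * f = f" using ff[OF ec(1)] by simp
 qed
 have "cidem l m f" unfolding cidem_def using fc f2 ff by blast
 moreover have "cidem l m (e - f)" unfolding cidem_def
 proof (intro conjI ballI cent_diff ec(1) fc)
  show "(e - f) * (e - f) = e - f" by (simp add: left_diff_distrib right_diff_distrib ec(2) fe f2)
  show "(e - f) * a = a * (e - f)" if "a \<in> cent l m" for a
   by (simp only: left_diff_distrib right_diff_distrib ec(3)[OF that] ff[OF that])
 qed
 moreover have "f * (e - f) = 0" by (simp add: right_diff_distrib fe f2)
 moreover have "e = f + (e - f)" by simp
 ultimately have "f = 0 \<or> e - f = 0" using e unfolding prim_def by blast
 thus ?thesis
 proof
  assume "f = 0"
  hence w0: "w ^ k = 0" using kj[of k] by (simp add: f_def)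
  have "S2.acts w ((s2 - s1) * 1)"
   unfolding w_def by (intro S2.acts_mult S2.acts_diff S2.acts_scal cent_diff cent_scalar z(1) ec(1) a2)
  hence "S2.acts (w ^ k) ((s2 - s1) ^ k)" using S2.acts_power[OF wc] by simp
  moreover have "S2.acts (w ^ k) 0" unfolding w0 using S2.acts_scal[of 0] by (simp add: scal_simps)
  ultimately have "(s2 - s1) ^ k = 0" using S2.acts_unique[OF S2(2-4)] by blast
  thus ?thesis by (auto simp: k_def)
 next
  \<comment> \<open>Here e is a multiple of w, so e would act as zero on the first module.\<close>
  assume "e - f = 0"
  have "S1.acts w ((s1 - s1) * 1)"
   unfolding w_def by (intro S1.acts_mult S1.acts_diff S1.acts_scal cent_diff cent_scalar z(1) ec(1) a1)
  hence "S1.acts w 0" by simp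
  hence "S1.acts (w * (r * x ^ n)) 0" by (intro S1.acts_0_mult cent_mult cent_power wc r(1) xc)
  moreover have "w * (r * x ^ n) = e" using \<open>e - f = 0\<close> by (simp add: f_def k_def x_def mult.assoc)
  ultimately show ?thesis using a1(1) S1.acts_unique[OF S1(2-4)] by (metis zero_neq_one)
 qed
qed

section \<open>Recovering residue counts from central characters\<close>

lemma esym_large: "n < j ==> esym x n j = 0" by (induction x n j rule: esym.induct) auto

lemma coeff_prod_linear: fixes x :: "nat \<Rightarrow> 'k::comm_ring_1"
 shows "coeff (\<Prod>i\<in>{1..n}. [:x i, 1:]) k = (if k \<le> n then esym x n (n - k) else 0)"
proof (induction n arbitrary: k)
 case 0
 thus ?case by (cases k) auto
next
 case (Suc n)
 let ?P = "\<Prod>i\<in>{1..n}. [:x i, 1:]"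
 have c: "coeff (\<Prod>i\<in>{1..Suc n}. [:x i, 1:]) k = x (Suc n) * coeff ?P k + (case k of 0 \<Rightarrow> 0 | Suc k \<Rightarrow> coeff ?P k)"
  by (simp add: coeff_pCons split: nat.split)
 show ?case
 proof (cases k)
  case 0
  thus ?thesis unfolding c Suc by (simp add: esym_large mult.commute)
 next
  case (Suc k')
  show ?thesis
  proof (cases "k' < n")
   case True
   hence "n - k' = Suc (n - Suc k')" by simp
   thus ?thesis unfolding c Suc.IH using True by (simp add: Suc mult.commute)
  next
   case False
   thus ?thesis unfolding c Suc.IH by (auto simp: Suc)
  qed
 qed
qed

text \<open>Elementary symmetric polynomials are the coefficients of the product of the linear
  factors X + x i, and over a domain this product determines the multiset of its roots.\<close>

lemma esym_determines_mset: fixes x y :: "nat \<Rightarrow> 'k::idom" assumes "\<And>j. esym x n j = esym y n j"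
 shows "image_mset x (mset_set {1..n}) = image_mset y (mset_set {1..n})"
proof -
 have r: "proots (\<Prod>i\<in>{1..n}. [:z i, 1:]) = image_mset (\<lambda>i. - z i) (mset_set {1..n})" for z :: "nat \<Rightarrow> 'k"
 proof -
  have "proots (\<Prod>i\<in>{1..n}. [:z i, 1:]) = (\<Sum>i\<in>{1..n}. {#- z i#})" by (subst proots_prod) auto
  also have "\<dots> = image_mset (\<lambda>i. - z i) (mset_set {1..n})"
   by (induction n) (simp_all add: atLeastAtMostSuc_conv)
  finally show ?thesis .
 qed
 have "(\<Prod>i\<in>{1..n}. [:x i, 1:]) = (\<Prod>i\<in>{1..n}. [:y i, 1:])"
  by (rule poly_eqI) (simp only: coeff_prod_linear assms)
 hence "image_mset (\<lambda>i. - x i) (mset_set {1..n}) = image_mset (\<lambda>i. - y i) (mset_set {1..n})" using r by metis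
 hence "image_mset uminus (image_mset (\<lambda>i. - x i) (mset_set {1..n})) = image_mset uminus (image_mset (\<lambda>i. - y i) (mset_set {1..n}))"
  by (simp only:)
 thus ?thesis by (simp add: image_mset.compositionality comp_def)
qed

text \<open>The given values determine the multiset of contents as elements of k. The residues 0,
  ..., p - 1 embed into k, so this multiset is the residue count.\<close>

lemma res_count_from_esym:
 assumes p: "p \<ge> 2" "CHAR('k::field) = p" and cs: "box_path (\<lambda>_. 0) cs mu" "box_path (\<lambda>_. 0) cs' mu'"
  and m: "partition_size mu = m" "partition_size mu' = m"
  and e: "\<And>j. of_int (esym (\<lambda>i. cs ! (i - 1)) m j) = (of_int (esym (\<lambda>i. cs' ! (i - 1)) m j) :: 'k)"
 shows "res_count p mu = res_count p mu'"
proof -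
 have len: "length cs = m" "length cs' = m"
  using box_path_res(2)[OF cs(1)] box_path_res(2)[OF cs(2)] m empty_partition(3) by simp_all
 have p0: "of_int (c mod int p) = (of_int c :: 'k)" for c
 proof -
  have "of_int (int p) = (0::'k)" using p(2) of_nat_CHAR[where 'a = 'k] by simp
  hence "of_int (c div int p * int p + c mod int p) = (of_int (c mod int p) :: 'k)" by (simp only: of_int_add of_int_mult mult_zero_right add_0)
  thus ?thesis by simp
 qed
 let ?g = "of_int :: int \<Rightarrow> 'k" and ?A = "{0..<int p}"
 have inj: "inj_on ?g ?A"
 proof (rule inj_onI)
  fix a b assume h: "a \<in> ?A" "b \<in> ?A" "?g a = ?g b"
  hence "of_int (a - b) = (0::'k)" by simp
  hence "int p dvd a - b" using p(2) of_int_eq_0_iff_char_dvd by metis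
  hence "a mod int p = b mod int p" by (simp add: mod_eq_dvd_iff)
  thus "a = b" using h by simp
 qed
 have ms: "mset xs = image_mset (\<lambda>i. xs ! (i - 1)) (mset_set {1..length xs})" for xs :: "int list"
 proof -
  have "map (\<lambda>i. xs ! (i - 1)) [1..<Suc (length xs)] = xs"
   by (rule nth_equalityI) (simp_all del: upt_Suc)
  hence "mset xs = image_mset (\<lambda>i. xs ! (i - 1)) (mset [1..<Suc (length xs)])" by (metis mset_map)
  moreover have "{1..<Suc (length xs)} = {1..length xs}" by auto
  ultimately show ?thesis by (simp only: mset_upt)
 qed
 let ?r = "\<lambda>xs. mset (residues p xs)"
 have g: "image_mset ?g (?r xs) = image_mset (\<lambda>i. ?g (xs ! (i - 1))) (mset_set {1..length xs})" for xs
 proof -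
  have "image_mset ?g (?r xs) = image_mset ?g (mset xs)" by (simp add: image_mset.compositionality comp_def p0)
  also have "\<dots> = image_mset ?g (image_mset (\<lambda>i. xs ! (i - 1)) (mset_set {1..length xs}))" by (subst ms) (rule refl)
  finally show ?thesis by (simp add: image_mset.compositionality comp_def)
 qed
 have "image_mset (\<lambda>i. ?g (cs ! (i - 1))) (mset_set {1..m}) = image_mset (\<lambda>i. ?g (cs' ! (i - 1))) (mset_set {1..m})"
  by (rule esym_determines_mset) (use e in \<open>simp add: esym_of_int\<close>)
 hence eq: "image_mset ?g (?r cs) = image_mset ?g (?r cs')" unfolding g len .
 have bk: "image_mset (inv_into ?A ?g) (image_mset ?g (?r xs)) = ?r xs" for xs
 proof -
  have "image_mset (inv_into ?A ?g) (image_mset ?g (?r xs)) = image_mset (\<lambda>x. x) (?r xs)"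
   unfolding image_mset.compositionality
   by (rule image_mset_cong) (use p(1) inj in \<open>auto simp: inv_into_f_f\<close>)
  thus ?thesis by simp
 qed
 have "?r cs = ?r cs'" using bk[of cs] bk[of cs'] unfolding eq by simp
 thus ?thesis using box_path_res(1)[OF cs(1), of p] box_path_res(1)[OF cs(2), of p] by (simp only:)
qed

context skew begin

lemma nonzero_hom: assumes "diagram lam \<subseteq> diagram mu" obtains \<phi> v where "hm \<phi>" "v \<in> L.S" "\<phi> v \<noteq> 0"
proof -
 obtain cs where "box_path lam cs mu" using box_path_exists[OF lam(1) mu(1) assms] by blast
 from path_shom[OF this] show ?thesis using that by blast
qed

lemma acts_centre_outer: "z \<in> cent m m ==> acts (iota z) (of_int (M.omega z) :: 'k::field)"
proof (rule acts_iota)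
 assume z: "z \<in> cent m m"
 thus "z \<in> cent l m" using cent_mono[OF lm] by blast
 show "act z (\<phi> v) = frag_cmul (M.omega z) (\<phi> v)" if "hm \<phi>" "v \<in> L.S" for \<phi> v
  by (rule M.omega[OF z shom_in[OF hm_shom[OF that(1)] that(2)]])
qed

lemma acts_centre_inner: "z \<in> cent l l ==> acts (iota z) (of_int (L.omega z) :: 'k::field)"
proof (rule acts_iota)
 assume z: "z \<in> cent l l"
 thus "z \<in> cent l m" using cent_mono2[OF lm] by blast
 show "act z (\<phi> v) = frag_cmul (L.omega z) (\<phi> v)" if "hm \<phi>" "v \<in> L.S" for \<phi> v
  by (rule shom_omega[OF hm_shom[OF that(1)] lam z that(2)])
qed

end

lemma skew_intro: "(mu, lam) \<in> skew_partitions l m ==> skew l m lam mu"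
proof
 assume h: "(mu, lam) \<in> skew_partitions l m"
 thus "is_partition lam" "partition_size lam = l" "is_partition mu" "partition_size mu = m"
  by (auto simp: skew_partitions_def)
 have "finite (diagram mu)" using finite_diagram h by (auto simp: skew_partitions_def)
 thus "l \<le> m" using h card_mono[of "diagram mu" "diagram lam"] by (auto simp: skew_partitions_def partition_size_def)
qed

text \<open>Two families of central elements are used: symmetric polynomials in the Jucys-Murphy
  elements of S_m are central in the whole group ring, and those of S_l lie in the group ring of
  S_l, with which the centraliser algebra commutes. Their scalars determine the residue counts of
  the outer and of the inner shape.\<close>

theorem primitive_cores: fixes e :: "'k::field gring"
 assumes p: "p \<ge> 2" "CHAR('k) = p" and s: "(mu1, lam1) \<in> skew_partitions l m" "(mu2, lam2) \<in> skew_partitions l m"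
  and e: "prim l m e" "skew.acts l lam1 mu1 e 1" "skew.acts l lam2 mu2 e 1"
 shows "res_count p mu1 = res_count p mu2" "res_count p lam1 = res_count p lam2"
proof -
 interpret S1: skew l m lam1 mu1 by (rule skew_intro[OF s(1)])
 interpret S2: skew l m lam2 mu2 by (rule skew_intro[OF s(2)])
 obtain \<phi>1 v1 where f1: "S1.hm \<phi>1" "v1 \<in> S1.L.S" "\<phi>1 v1 \<noteq> 0"
  by (rule S1.nonzero_hom) (use s(1) in \<open>auto simp: skew_partitions_def\<close>)
 obtain \<phi>2 v2 where f2: "S2.hm \<phi>2" "v2 \<in> S2.L.S" "\<phi>2 v2 \<noteq> 0"
  by (rule S2.nonzero_hom) (use s(2) in \<open>auto simp: skew_partitions_def\<close>)
 note scal = primitive_scalars[OF e(1) _ _ S1.skew_axioms f1 S2.skew_axioms f2 e(2) _ e(3)]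
 have outer: "of_int (S1.M.omega (esym jm m j)) = (of_int (S2.M.omega (esym jm m j)) :: 'k)" for j
 proof (rule scal[OF _ _ S1.acts_centre_outer[OF esym_cent] S2.acts_centre_outer[OF esym_cent]])
  have z: "iota (esym jm m j) \<in> (cent m m :: 'k gring set)" by (rule iota_cent[OF esym_cent])
  thus "iota (esym jm m j) \<in> (cent l m :: 'k gring set)" using cent_mono[OF S1.lm] by blast
  show "iota (esym jm m j) * a = a * iota (esym jm m j)" if "a \<in> cent l m" for a :: "'k gring"
   by (rule cent_commute[OF z cent_galg[OF that], symmetric])
 qed
 have inner: "of_int (S1.L.omega (esym jm l j)) = (of_int (S2.L.omega (esym jm l j)) :: 'k)" for j
 proof (rule scal[OF _ _ S1.acts_centre_inner[OF esym_cent] S2.acts_centre_inner[OF esym_cent]])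
  have z: "iota (esym jm l j) \<in> (cent l l :: 'k gring set)" by (rule iota_cent[OF esym_cent])
  thus "iota (esym jm l j) \<in> (cent l m :: 'k gring set)" using cent_mono2[OF S1.lm] by blast
  show "iota (esym jm l j) * a = a * iota (esym jm l j)" if "a \<in> cent l m" for a :: "'k gring"
   by (rule cent_commute[OF that cent_galg[OF z]])
 qed
 obtain c1 where c1: "box_path (\<lambda>_. 0) c1 mu1" by (rule box_path_from_empty[OF S1.mu(1)])
 obtain c2 where c2: "box_path (\<lambda>_. 0) c2 mu2" by (rule box_path_from_empty[OF S2.mu(1)])
 show "res_count p mu1 = res_count p mu2"
  by (rule res_count_from_esym[OF p c1 c2 S1.mu(2) S2.mu(2)])
   (use outer in \<open>simp only: omega_esym[OF c1 S1.mu(2)] omega_esym[OF c2 S2.mu(2)]\<close>)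
 obtain d1 where d1: "box_path (\<lambda>_. 0) d1 lam1" by (rule box_path_from_empty[OF S1.lam(1)])
 obtain d2 where d2: "box_path (\<lambda>_. 0) d2 lam2" by (rule box_path_from_empty[OF S2.lam(1)])
 show "res_count p lam1 = res_count p lam2"
  by (rule res_count_from_esym[OF p d1 d2 S1.lam(2) S2.lam(2)])
   (use inner in \<open>simp only: omega_esym[OF d1 S1.lam(2)] omega_esym[OF d2 S2.lam(2)]\<close>)
qed

lemma distinct_residues: assumes "mset xs = mset_set {0..<int p}" shows "distinct xs"
proof -
 have "set xs = {0..<int p}" using assms by (metis finite_atLeastLessThan_int finite_set_mset_mset_set set_mset_mset)
 moreover have "length xs = p" using arg_cong[OF assms, of size] by simp
 ultimately show ?thesis by (intro card_distinct) simp
qed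

text \<open>The common scalar \<beta> of \<open>central_scalar\<close> decides for both shapes at
  once: if it is 1 the idempotent acts as the identity on both, otherwise as zero on both. With the
  two shapes taken equal, this says that every central idempotent acts as 0 or 1.\<close>

lemma central_dichotomy: fixes e :: "'k::field gring"
 assumes p: "Factorial_Ring.prime p" "CHAR('k) = p" and s: "skew l m lam1 mu1" "skew l m lam2 mu2"
  and bp: "box_path lam1 cs1 mu1" "box_path lam2 cs2 mu2"
  and word: "residues p cs1 = residues p cs2" "mset (residues p cs1) = mset_set {0..<int p}"
  and rc: "res_count p lam1 = res_count p lam2" and e: "cidem l m e"
 shows "skew.acts l lam1 mu1 e 0 \<and> skew.acts l lam2 mu2 e 0 \<and> \<not> skew.acts l lam1 mu1 e 1 \<or> skew.acts l lam1 mu1 e 1 \<and> skew.acts l lam2 mu2 e 1"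
proof -
 interpret S1: skew l m lam1 mu1 by (rule s(1))
 interpret S2: skew l m lam2 mu2 by (rule s(2))
 have ec: "e \<in> cent l m" "e * e = e" "\<And>a. a \<in> cent l m ==> e * a = a * e" using e unfolding cidem_def by blast+
 obtain \<beta> \<phi>1 \<phi>2 v1 v2 where h: "S1.hm \<phi>1" "v1 \<in> S1.L.S" "\<phi>1 v1 \<noteq> 0" "S2.hm \<phi>2" "v2 \<in> S2.L.S" "\<phi>2 v2 \<noteq> 0"
  "e - scal \<beta> \<in> S1.divspan (int p) \<phi>1 1" "e - scal \<beta> \<in> S2.divspan (int p) \<phi>2 1"
  by (rule central_scalar[OF p s bp word(1) distinct_residues[OF word(2)] rc ec(1,3)])
 note d1 = S1.idempotent_acts[OF p h(1-3) ec(2,1) h(7)] and d2 = S2.idempotent_acts[OF p h(4-6) ec(2,1) h(8)]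
 show ?thesis
 proof (cases "\<beta> = 1")
  case True
  thus ?thesis using d1(2) d2(2) by simp
 next
  case False
  have "\<not> S1.acts e 1" using S1.acts_unique[OF h(1-3) d1(1)[OF False]] by (metis zero_neq_one)
  thus ?thesis using d1(1)[OF False] d2(1)[OF False] by blast
 qed
qed

text \<open>Some primitive idempotent acts as the identity on the first module.
  \<open>central_dichotomy\<close> carries this property over to any pair with the same residue word
  and the same residue count of the inner shape, and \<open>belt_link\<close> joins the two given
  pairs by such steps.\<close>

theorem belt_same_block: fixes e :: "'k::field gring"
 assumes p: "Factorial_Ring.prime p" "CHAR('k) = p" and s: "(mu1, lam1) \<in> skew_partitions l m" "(mu2, lam2) \<in> skew_partitions l m"
  and c: "content p (mu1, lam1) = mset_set {0..<int p}" "content p (mu2, lam2) = mset_set {0..<int p}"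
  and rc: "res_count p lam1 = res_count p lam2"
 shows "\<exists>e :: 'k gring. prim l m e \<and> skew.acts l lam1 mu1 e 1 \<and> skew.acts l lam2 mu2 e 1"
proof -
 have p2: "p \<ge> 2" using p(1) by (rule prime_ge_2_nat)
 interpret S1: skew l m lam1 mu1 by (rule skew_intro[OF s(1)])
 interpret S2: skew l m lam2 mu2 by (rule skew_intro[OF s(2)])
 obtain cs1 where cs1: "box_path lam1 cs1 mu1" using box_path_exists[OF S1.lam(1) S1.mu(1)] s(1) by (auto simp: skew_partitions_def)
 obtain cs2 where cs2: "box_path lam2 cs2 mu2" using box_path_exists[OF S2.lam(1) S2.mu(1)] s(2) by (auto simp: skew_partitions_def)
 have w1: "mset (residues p cs1) = mset_set {0..<int p}" using box_path_content[OF cs1] c(1) by simp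
 have w2: "mset (residues p cs2) = mset_set {0..<int p}" using box_path_content[OF cs2] c(2) by simp
 obtain F :: "'k gring set" where F: "finite F" "\<forall>f\<in>F. prim l m f" "\<Sum>F = 1"
 proof (rule primitive_decomposition)
  fix F :: "'k gring set"
  assume "finite F" "\<And>f. f \<in> F ==> prim l m f" "\<Sum>F = 1"
  thus thesis by (intro that) auto
 qed
 have Fc: "f \<in> cent l m" "cidem l m f" if "f \<in> F" for f using F(2) that unfolding prim_def cidem_def by blast+
 \<comment> \<open>If all summands acted as zero, so would their sum 1, contrary to the uniqueness
   of scalars on a nonzero module.\<close>
 have "\<exists>e\<in>F. S1.acts e 1"
 proof (rule ccontr)
  assume n: "\<not> (\<exists>e\<in>F. S1.acts e 1)"
  have "f \<in> cent l m \<and> S1.acts f 0" if "f \<in> F" for f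
   using central_dichotomy[OF p S1.skew_axioms S1.skew_axioms cs1 cs1 refl w1 refl Fc(2)[OF that]] n that Fc(1) by blast
  hence "S1.acts (1 :: 'k gring) 0" using S1.acts_sum[OF F(1)] F(3) by metis
  moreover have "S1.acts (1 :: 'k gring) 1" using S1.acts_scal[of 1] by (simp add: scal_simps)
  moreover obtain \<phi> v where "S1.hm \<phi>" "v \<in> S1.L.S" "\<phi> v \<noteq> 0"
   by (rule S1.nonzero_hom) (use s(1) in \<open>auto simp: skew_partitions_def\<close>)
  ultimately show False using S1.acts_unique by (metis zero_neq_one)
 qed
 then obtain e where e: "e \<in> F" "S1.acts e 1" by blast
 let ?A = "\<lambda>lam mu. partition_size lam = l \<and> skew.acts l lam mu e 1"
 have "?A lam2 mu2"
 proof (rule belt_link[OF p2 _ cs1 w1 cs2 w2 rc, where A = ?A])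
  fix lam cs mu lam' cs' mu'
  assume bp: "box_path lam cs mu" "box_path lam' cs' mu'"
   and w: "residues p cs = residues p cs'" "mset (residues p cs) = mset_set {0..<int p}"
   and r: "res_count p lam = res_count p lam'" and A: "?A lam mu"
  have "size (res_count p lam) = size (res_count p lam')" by (simp add: r)
  hence l': "partition_size lam' = l" using A by (simp add: res_count_def partition_size_def)
  have len: "length cs' = length cs" using w(1) map_eq_imp_length_eq by metis
  \<comment> \<open>All words in the chain have length p, so every pair met on the way has inner
    size l and outer size m and defines a module of the same algebra.\<close>
  have "length cs = p" using arg_cong[OF w(2), of size] by simp
  moreover have "length cs1 = p" using arg_cong[OF w1, of size] by simp
  ultimately have m: "l + length cs = m" using box_path_res(2)[OF cs1] S1.lam(2) S1.mu(2) by simp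
  have "skew l m lam mu" "skew l m lam' mu'"
   using box_path_partition[OF bp(1)] box_path_partition[OF bp(2)] box_path_res(2)[OF bp(1)] box_path_res(2)[OF bp(2)] A l' m len S1.lm
   by (auto intro!: skew.intro)
  thus "?A lam' mu'" using central_dichotomy[OF p _ _ bp w r Fc(2)[OF e(1)]] A l' by blast
 qed (use e(2) S1.lam in auto)
 thus ?thesis using e F(2) by blast
qed

section \<open>Transfer to the ring structures of the definitions\<close>

text \<open>Coefficients are transported along the injection of \<open>nperm\<close> into functions.
  Only elements supported on permutations are determined by their image, hence the support
  conditions below.\<close>

definition pull :: "'r::zero fun_alg \<Rightarrow> 'r gring" where
 "pull = Poly_Mapping.map_key nfun"

lemma inj_nfun: "inj nfun" by (simp add: inj_on_def nfun_inject)

lemma lookup_pull [simp]: "lookup (pull a) g = lookup a (nfun g)"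
 by (simp add: pull_def Poly_Mapping.map_key.rep_eq[OF inj_nfun])

lemma sym_carrier: "carrier (sym_group m) = nfun ` syms m"
proof
 show "carrier (sym_group m) \<subseteq> nfun ` syms m"
 proof
  fix \<pi> assume "\<pi> \<in> carrier (sym_group m)"
  hence p: "\<pi> permutes {1..m}" by (simp add: sym_group_def)
  hence n: "nfun (Nperm \<pi>) = \<pi>" by (intro nfun_Nperm permutes_bij)
  thus "\<pi> \<in> nfun ` syms m" using p by (intro image_eqI[of _ _ "Nperm \<pi>"]) (simp_all add: syms_def)
 qed
qed (auto simp: sym_group_def syms_def)

lemma keys_pull: "keys (pull a) = {g. nfun g \<in> keys a}" by (auto simp: in_keys_iff)

lemma pull_galg: assumes "keys a \<subseteq> carrier (sym_group m)" shows "pull a \<in> galg m"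
proof -
 have "g \<in> syms m" if "nfun g \<in> keys a" for g
  using subsetD[OF assms that] unfolding sym_carrier inj_image_mem_iff[OF inj_nfun] .
 thus ?thesis unfolding galg_def mem_Collect_eq keys_pull by blast
qed

lemma keys_image: "keys a \<subseteq> carrier (sym_group m) ==> keys a = nfun ` keys (pull a)"
 unfolding sym_carrier keys_pull by blast

lemma pull_add: "pull (a + b) = pull a + pull b" and pull_0 [simp]: "pull 0 = 0"
 by (rule poly_mapping_eqI; simp add: lookup_add)+

lemma pull_sum: "pull (sum f I) = (\<Sum>i\<in>I. pull (f i))"
 by (induction I rule: infinite_finite_induct) (simp_all add: pull_add)

lemma pull_single: "pull (single (nfun g) c) = single g c"
 by (rule poly_mapping_eqI) (simp add: lookup_single when_def nfun_inject)

lemma pull_inject: assumes "keys a \<subseteq> carrier (sym_group m)" "keys b \<subseteq> carrier (sym_group m)"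
 shows "pull a = pull b \<longleftrightarrow> a = b"
proof
 assume e: "pull a = pull b"
 show "a = b"
 proof (rule poly_mapping_eqI)
  fix \<pi>
  show "lookup a \<pi> = lookup b \<pi>"
  proof (cases "\<pi> \<in> carrier (sym_group m)")
   case True
   then obtain g where "\<pi> = nfun g" unfolding sym_carrier by blast
   thus ?thesis using arg_cong[OF e, of "\<lambda>x. lookup x g"] by simp
  next
   case False
   hence "\<pi> \<notin> keys a" "\<pi> \<notin> keys b" using assms by blast+
   thus ?thesis by (simp add: in_keys_iff)
  qed
 qed
qed simp

lemma pull_surj: assumes "a \<in> galg m" obtains b where "keys b \<subseteq> carrier (sym_group m)" "pull b = a"
proof
 let ?b = "\<Sum>g\<in>keys a. single (nfun g) (lookup a g)"
 have "keys ?b \<subseteq> (\<Union>g\<in>keys a. {nfun g})" by (rule subset_trans[OF keys_sum]) (auto split: if_splits)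
 thus "keys ?b \<subseteq> carrier (sym_group m)" using assms unfolding sym_carrier galg_def by blast
 show "pull ?b = a" unfolding pull_sum pull_single by (rule poly_mapping_sum[symmetric])
qed

lemma pull_mult: fixes a b :: "'r::comm_ring_1 fun_alg"
 assumes a: "keys a \<subseteq> carrier (sym_group m)" and b: "keys b \<subseteq> carrier (sym_group m)"
 shows "pull (a \<otimes>\<^bsub>group_algebra (sym_group m)\<^esub> b) = pull a * pull b"
proof -
 have "a \<otimes>\<^bsub>group_algebra (sym_group m)\<^esub> b = (\<Sum>g\<in>keys (pull a). \<Sum>h\<in>keys (pull b).
   single (nfun (g + h)) (lookup (pull a) g * lookup (pull b) h))"
  unfolding group_algebra_def monoid.simps sym_group_mult keys_image[OF a] keys_image[OF b]
  by (simp add: sum.reindex inj_on_subset[OF inj_nfun])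
 hence "pull (a \<otimes>\<^bsub>group_algebra (sym_group m)\<^esub> b) =
  (\<Sum>g\<in>keys (pull a). single g (lookup (pull a) g)) *
  (\<Sum>h\<in>keys (pull b). single h (lookup (pull b) h))"
  by (simp only: pull_sum pull_single sum_product mult_single)
 thus ?thesis by (simp only: poly_mapping_sum[symmetric])
qed

lemma keys_group_mult: fixes a b :: "'r::comm_ring_1 fun_alg"
 assumes a: "keys a \<subseteq> carrier (sym_group m)" and b: "keys b \<subseteq> carrier (sym_group m)"
 shows "keys (a \<otimes>\<^bsub>group_algebra (sym_group m)\<^esub> b) \<subseteq> carrier (sym_group m)"
proof -
 have "g \<circ> h \<in> carrier (sym_group m)" if "g \<in> keys a" "h \<in> keys b" for g h
 proof -
  have "g permutes {1..m}" "h permutes {1..m}" using that a b sym_group_carrier by blast+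
  thus ?thesis unfolding sym_group_carrier by (intro permutes_compose)
 qed
 thus ?thesis unfolding group_algebra_def monoid.simps sym_group_mult
  by (intro subset_trans[OF keys_sum] UN_least) (auto split: if_splits)
qed

abbreviation CA :: "nat \<Rightarrow> nat \<Rightarrow> 'r::comm_ring_1 fun_alg ring" where
 "CA \<equiv> centraliser_algebra"

lemma CA_simps: "a \<otimes>\<^bsub>CA l m\<^esub> b = a \<otimes>\<^bsub>group_algebra (sym_group m)\<^esub> b" "a \<oplus>\<^bsub>CA l m\<^esub> b = a + b" "\<zero>\<^bsub>CA l m\<^esub> = 0"
 by (simp_all add: centraliser_algebra_def group_algebra_def)

lemma CA_carrier: fixes a :: "'r::comm_ring_1 fun_alg" assumes lm: "l \<le> m"
 shows "a \<in> carrier (CA l m) \<longleftrightarrow> keys a \<subseteq> carrier (sym_group m) \<and> pull a \<in> cent l m"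
proof -
 have c: "a \<in> carrier (CA l m) \<longleftrightarrow> keys a \<subseteq> carrier (sym_group m) \<and>
  (\<forall>b. keys b \<subseteq> carrier (sym_group l) \<longrightarrow>
   a \<otimes>\<^bsub>group_algebra (sym_group m)\<^esub> b = b \<otimes>\<^bsub>group_algebra (sym_group m)\<^esub> a)"
  by (auto simp: centraliser_algebra_def group_algebra_def)
 have sub: "carrier (sym_group l) \<subseteq> carrier (sym_group m)" unfolding sym_carrier using syms_mono[OF lm] by blast
 show ?thesis
 proof
  assume h: "a \<in> carrier (CA l m)"
  hence a: "keys a \<subseteq> carrier (sym_group m)" using c by blast
  have "gs g * pull a = pull a * gs g" if g: "g \<in> syms l" for g
  proof -
   let ?b = "single (nfun g) (1::'r)"
   have b: "keys ?b \<subseteq> carrier (sym_group l)" unfolding sym_carrier using g by simp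
   have "pull (a \<otimes>\<^bsub>group_algebra (sym_group m)\<^esub> ?b) = pull (?b \<otimes>\<^bsub>group_algebra (sym_group m)\<^esub> a)" using h b c by simp
   thus ?thesis using pull_mult[OF a subset_trans[OF b sub]] pull_mult[OF subset_trans[OF b sub] a] by (simp add: pull_single)
  qed
  thus "keys a \<subseteq> carrier (sym_group m) \<and> pull a \<in> cent l m" using a pull_galg by (simp add: cent_def)
 next
  assume h: "keys a \<subseteq> carrier (sym_group m) \<and> pull a \<in> cent l m"
  show "a \<in> carrier (CA l m)" unfolding c
  proof (intro conjI allI impI)
   fix b :: "'r fun_alg" assume b: "keys b \<subseteq> carrier (sym_group l)"
   note b' = subset_trans[OF b sub]
   have "pull b * pull a = pull a * pull b" using cent_commute pull_galg[OF b] h by blast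
   hence "pull (a \<otimes>\<^bsub>group_algebra (sym_group m)\<^esub> b) = pull (b \<otimes>\<^bsub>group_algebra (sym_group m)\<^esub> a)"
    using pull_mult b' h by metis
   thus "a \<otimes>\<^bsub>group_algebra (sym_group m)\<^esub> b = b \<otimes>\<^bsub>group_algebra (sym_group m)\<^esub> a"
    using pull_inject keys_group_mult b' h by metis
  qed (use h in blast)
 qed
qed

lemma CA_surj:
 assumes lm: "l \<le> m" and a: "a \<in> cent l m" obtains b where "b \<in> carrier (CA l m)" "pull b = a"
proof -
 obtain b where "keys b \<subseteq> carrier (sym_group m)" "pull b = a" by (rule pull_surj[OF cent_galg[OF a]])
 thus ?thesis using that a CA_carrier[OF lm] by blast
qed

lemma CA_mult: "l \<le> m ==> a \<in> carrier (CA l m) ==> b \<in> carrier (CA l m) ==> pull (a \<otimes>\<^bsub>CA l m\<^esub> b) = pull a * pull b"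
 unfolding CA_simps by (rule pull_mult[of _ m]) (simp_all add: CA_carrier)

lemma CA_mult_closed: "l \<le> m ==> a \<in> carrier (CA l m) ==> b \<in> carrier (CA l m) ==> a \<otimes>\<^bsub>CA l m\<^esub> b \<in> carrier (CA l m)"
 using CA_mult[of l m a b] keys_group_mult[of a m b] by (simp add: CA_carrier CA_simps)

lemma CA_eq: "l \<le> m ==> a \<in> carrier (CA l m) ==> b \<in> carrier (CA l m) ==> pull a = pull b \<longleftrightarrow> a = b"
 by (rule pull_inject[of _ m]) (simp_all add: CA_carrier)

lemma central_idempotent_pull: fixes e :: "'k::field fun_alg" assumes lm: "l \<le> m"
 shows "central_idempotent (CA l m) e \<longleftrightarrow> e \<in> carrier (CA l m) \<and> cidem l m (pull e)"
proof (cases "e \<in> carrier (CA l m)")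
 case True
 have i: "e \<otimes>\<^bsub>CA l m\<^esub> e = e \<longleftrightarrow> pull e * pull e = pull e"
  using CA_eq[OF lm CA_mult_closed[OF lm True True] True] CA_mult[OF lm True True] by simp
 have c: "e \<otimes>\<^bsub>CA l m\<^esub> a = a \<otimes>\<^bsub>CA l m\<^esub> e \<longleftrightarrow> pull e * pull a = pull a * pull e" if a: "a \<in> carrier (CA l m)" for a
  using CA_eq[OF lm CA_mult_closed[OF lm True a] CA_mult_closed[OF lm a True]] CA_mult[OF lm True a] CA_mult[OF lm a True] by simp
 have "(\<forall>a\<in>carrier (CA l m). pull e * pull a = pull a * pull e) \<longleftrightarrow> (\<forall>a\<in>cent l m. pull e * a = a * pull e)"
 proof
  assume h: "\<forall>a\<in>carrier (CA l m). pull e * pull a = pull a * pull e"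
  show "\<forall>a\<in>cent l m. pull e * a = a * pull e"
  proof
   fix a :: "'k gring" assume "a \<in> cent l m"
   then obtain b where "b \<in> carrier (CA l m)" "pull b = a" by (rule CA_surj[OF lm])
   thus "pull e * a = a * pull e" using h by blast
  qed
 qed (use CA_carrier[OF lm] in blast)
 thus ?thesis using True c i CA_carrier[OF lm, of e] unfolding central_idempotent_def cidem_def by auto
qed (simp add: central_idempotent_def)

lemma primitive_pull: fixes e :: "'k::field fun_alg" assumes lm: "l \<le> m"
 shows "primitive_central_idempotent (CA l m) e \<longleftrightarrow> e \<in> carrier (CA l m) \<and> prim l m (pull e)"
proof -
 have 0: "(0 :: 'k fun_alg) \<in> carrier (CA l m)" using CA_carrier[OF lm, of 0] by simp
 have z: "a = 0 \<longleftrightarrow> pull a = 0" if "a \<in> carrier (CA l m)" for a :: "'k fun_alg"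
  using CA_eq[OF lm that 0] by simp
 have add: "a + b \<in> carrier (CA l m)" if "a \<in> carrier (CA l m)" "b \<in> carrier (CA l m)" for a b :: "'k fun_alg"
  using that keys_add[of a b] unfolding CA_carrier[OF lm] pull_add by (auto intro: cent_add)
 show ?thesis
 proof
  assume h: "primitive_central_idempotent (CA l m) e"
  hence e: "e \<in> carrier (CA l m)" "cidem l m (pull e)" "e \<noteq> 0"
   unfolding primitive_central_idempotent_def central_idempotent_pull[OF lm] CA_simps by blast+
  have "f = 0 \<or> g = 0" if fg: "cidem l m f" "cidem l m g" "f * g = 0" "pull e = f + g" for f g
  proof -
   have "f \<in> cent l m" "g \<in> cent l m" using fg unfolding cidem_def by blast+
   then obtain f' g' where f': "f' \<in> carrier (CA l m)" "pull f' = f" and g': "g' \<in> carrier (CA l m)" "pull g' = g"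
    by (meson CA_surj[OF lm])
   have "f' \<otimes>\<^bsub>CA l m\<^esub> g' = 0"
    using z[OF CA_mult_closed[OF lm f'(1) g'(1)]] CA_mult[OF lm f'(1) g'(1)] f' g' fg(3) by simp
   moreover have "e = f' + g'" using CA_eq[OF lm e(1) add[OF f'(1) g'(1)]] fg(4) f' g' by (simp add: pull_add)
   ultimately have "f' = 0 \<or> g' = 0"
    using h f' g' fg(1,2) unfolding primitive_central_idempotent_def central_idempotent_pull[OF lm] CA_simps by blast
   thus ?thesis using f' g' by auto
  qed
  thus "e \<in> carrier (CA l m) \<and> prim l m (pull e)" using e z[OF e(1)] unfolding prim_def by blast
 next
  assume h: "e \<in> carrier (CA l m) \<and> prim l m (pull e)"
  hence e: "e \<in> carrier (CA l m)" "cidem l m (pull e)" "pull e \<noteq> 0" unfolding prim_def by blast+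
  have "f = 0 \<or> g = 0" if f: "f \<in> carrier (CA l m)" "cidem l m (pull f)" and g: "g \<in> carrier (CA l m)" "cidem l m (pull g)"
   and fg: "f \<otimes>\<^bsub>CA l m\<^esub> g = 0" "e = f + g" for f g
  proof -
   have "pull f * pull g = 0" using CA_mult[OF lm f(1) g(1)] fg(1) by simp
   moreover have "pull e = pull f + pull g" unfolding fg(2) by (rule pull_add)
   ultimately have "pull f = 0 \<or> pull g = 0" using h f(2) g(2) unfolding prim_def by blast
   thus ?thesis using z f(1) g(1) by blast
  qed
  thus "primitive_central_idempotent (CA l m) e"
   unfolding primitive_central_idempotent_def central_idempotent_pull[OF lm] CA_simps using e z[OF e(1)] by blast
 qed
qed

text \<open>Each of two central idempotents generating the same ideal is an identity for the other.
  Membership in a block chooses an idempotent for every module separately, and this lemma identifies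
  the two choices.\<close>

lemma primitive_ideal_inject: fixes e f :: "'k::field fun_alg"
 assumes lm: "l \<le> m" and e: "central_idempotent (CA l m) e" and f: "central_idempotent (CA l m) f"
  and eq: "e <#\<^bsub>CA l m\<^esub> carrier (CA l m) = f <#\<^bsub>CA l m\<^esub> carrier (CA l m)" shows "e = f"
proof -
 have absorb: "pull f * pull e = pull e"
  if e: "central_idempotent (CA l m) e" and f: "central_idempotent (CA l m) f"
   and sub: "e <#\<^bsub>CA l m\<^esub> carrier (CA l m) \<subseteq> f <#\<^bsub>CA l m\<^esub> carrier (CA l m)" for e f :: "'k fun_alg"
 proof -
  have ec: "e \<in> carrier (CA l m)" "e \<otimes>\<^bsub>CA l m\<^esub> e = e" and fc: "f \<in> carrier (CA l m)" "pull f * pull f = pull f"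
   using e f unfolding central_idempotent_def central_idempotent_pull[OF lm, of f] cidem_def
   by (blast, blast, blast) (use f in \<open>simp add: central_idempotent_pull[OF lm] cidem_def\<close>)
  have "e \<in> e <#\<^bsub>CA l m\<^esub> carrier (CA l m)" unfolding l_coset_def using ec by force
  then obtain x where x: "x \<in> carrier (CA l m)" "e = f \<otimes>\<^bsub>CA l m\<^esub> x" using sub unfolding l_coset_def by blast
  hence "pull e = pull f * pull x" using CA_mult[OF lm fc(1) x(1)] by simp
  thus ?thesis using fc(2) by (simp add: mult.assoc[symmetric])
 qed
 have ec: "e \<in> carrier (CA l m)" "cidem l m (pull e)" and fc: "f \<in> carrier (CA l m)" "cidem l m (pull f)"
  using e f central_idempotent_pull[OF lm] by blast+
 have "pull f * pull e = pull e * pull f" using ec(2) fc(2) unfolding cidem_def by blast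
 hence "pull e = pull f" using absorb[OF e f] absorb[OF f e] eq by simp
 thus ?thesis using CA_eq[OF lm ec(1) fc(1)] by blast
qed

lemma conj_orbit_nfun: "conj_orbit l (nfun g) = nfun ` orb l g"
proof -
 interpret group "sym_group l" by (rule sym_group_is_group)
 have inv: "inv\<^bsub>sym_group l\<^esub> (nfun t) = nfun (- t)" if "t \<in> syms l" for t
 proof (rule inv_equality)
  show "nfun (- t) \<otimes>\<^bsub>sym_group l\<^esub> nfun t = \<one>\<^bsub>sym_group l\<^esub>"
   unfolding sym_group_mult sym_group_one nfun_add[symmetric] by simp
 qed (use that sym_carrier in auto)
 have "conj_orbit l (nfun g) = (\<lambda>\<tau>. \<tau> \<circ> nfun g \<circ> inv\<^bsub>sym_group l\<^esub> \<tau>) ` (nfun ` syms l)"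
  unfolding conj_orbit_def sym_carrier[symmetric] by blast
 also have "\<dots> = (\<lambda>t. nfun (t + g - t)) ` syms l"
  unfolding image_image by (rule image_cong) (simp_all add: inv diff_conv_add_uminus del: add_uminus_conv_diff)
 finally show ?thesis by (simp add: orb_def image_image)
qed

context skew begin

lemma pure_act_pull: assumes c: "keys c \<subseteq> carrier (sym_group m)"
 shows "pure_act l lam c = pact (pull c)"
proof
 fix x :: "'a \<times> specht_map"
 obtain b \<phi> where x: "x = (b, \<phi>)" by (cases x)
 have k: "conj_orbit l ` keys c = (\<lambda>X. nfun ` X) ` (orb l ` keys (pull c))"
  unfolding keys_image[OF c] image_image conj_orbit_nfun ..
 have inj: "inj_on (\<lambda>X. nfun ` X) A" for A using inj_image_eq_iff[OF inj_nfun] by (auto simp: inj_on_def)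
 have o: "orbit_sum_act lam (nfun ` X) \<phi> = op (orbsum X) \<phi>" for X
  unfolding orbit_sum_act_def op_def orbsum_def
  by (rule restrict_ext) (simp add: act_sum_left sum.reindex inj_on_subset[OF inj_nfun])
 have l: "the_elem (lookup c ` nfun ` X) = orbcoeff (pull c) X" for X
  by (simp add: orbcoeff_def image_image)
 show "pure_act l lam c x = pact (pull c) x"
  unfolding pure_act_def pact_def x prod.case k by (simp add: sum.reindex[OF inj] o l)
qed

lemma in_coset: "y \<in> tensor_rels (specht_hom l mu lam) #>\<^bsub>tensor_gens (specht_hom l mu lam)\<^esub> x \<longleftrightarrow> eqv y x"
proof
 assume "eqv y x"
 hence "y - x \<in> tensor_rels (specht_hom l mu lam)" by (simp add: eqv_def)
 thus "y \<in> tensor_rels (specht_hom l mu lam) #>\<^bsub>tensor_gens (specht_hom l mu lam)\<^esub> x"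
  unfolding r_coset_def tensor_gens_def by (intro UN_I[of "y - x"]) simp_all
qed (auto simp: r_coset_def tensor_gens_def eqv_def)

text \<open>The action on cosets is additive and compatible with the tensor relations, so being the
  identity on all cosets can be tested on the generators. Since it is defined as a union over all
  representatives, the argument runs over every representative of a coset.\<close>

lemma specht_act_identity: fixes c :: "'k::field fun_alg"
 assumes c: "keys c \<subseteq> carrier (sym_group m)"
 shows "(\<forall>\<xi>\<in>carrier (specht_module l (mu, lam)). specht_act l (mu, lam) c \<xi> = \<xi>) \<longleftrightarrow> acts (pull c) 1"
proof -
 let ?R = "tensor_rels (specht_hom l mu lam) :: (('k \<times> specht_map) \<Rightarrow>\<^sub>0 int) set"
 let ?T = "tensor_gens (specht_hom l mu lam) :: (('k \<times> specht_map) \<Rightarrow>\<^sub>0 int) monoid"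
 let ?F = "frag_extend (pact (pull c))"
 have car: "\<xi> \<in> carrier (specht_module l (mu, lam)) \<longleftrightarrow> (\<exists>x. keys x \<subseteq> UNIV \<times> {\<phi>. hm \<phi>} \<and> \<xi> = ?R #>\<^bsub>?T\<^esub> x)" for \<xi>
  unfolding specht_module_def field_tensor_def FactGroup_def RCOSETS_def tensor_gens_def by (simp add: Bex_def)
 have sa: "specht_act l (mu, lam) c \<xi> = (\<Union>x\<in>\<xi>. ?R #>\<^bsub>?T\<^esub> ?F x)" for \<xi>
  unfolding specht_act_def by (simp add: pure_act_pull[OF c])
 show ?thesis
 proof
  assume h: "\<forall>\<xi>\<in>carrier (specht_module l (mu, lam)). specht_act l (mu, lam) c \<xi> = \<xi>"
  show "acts (pull c) 1" unfolding acts_def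
  proof (intro allI impI)
   fix b :: 'k and \<phi> assume \<phi>: "hm \<phi>"
   let ?x = "frag_of (b, \<phi>)" let ?\<xi> = "?R #>\<^bsub>?T\<^esub> ?x"
   have "?\<xi> \<in> carrier (specht_module l (mu, lam))" unfolding car using \<phi> by (intro exI[of _ ?x]) simp
   hence e: "(\<Union>x\<in>?\<xi>. ?R #>\<^bsub>?T\<^esub> ?F x) = ?\<xi>" using h sa by blast
   have "?x \<in> ?\<xi>" "?F ?x \<in> ?R #>\<^bsub>?T\<^esub> ?F ?x" unfolding in_coset by (rule eqv_refl)+
   hence "?F ?x \<in> ?\<xi>" using e by blast
   thus "eqv (pact (pull c) (b, \<phi>)) (frag_of (1 * b, \<phi>))" unfolding in_coset by simp
  qed
 next
  assume h: "acts (pull c) 1"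
  have F: "eqv (?F x) x" if "keys x \<subseteq> UNIV \<times> {\<phi>. hm \<phi>}" for x using that
  proof (induction x rule: frag_induction)
   case (one u)
   then obtain b \<phi> where "u = (b, \<phi>)" "hm \<phi>" by auto
   thus ?case using h unfolding acts_def by simp
  next
   case (diff a b)
   thus ?case by (simp add: frag_extend_diff eqv_diff)
  qed simp
  show "\<forall>\<xi>\<in>carrier (specht_module l (mu, lam)). specht_act l (mu, lam) c \<xi> = \<xi>"
  proof
   fix \<xi> :: "(('k \<times> specht_map) \<Rightarrow>\<^sub>0 int) set" assume "\<xi> \<in> carrier (specht_module l (mu, lam))"
   then obtain a where a: "keys a \<subseteq> UNIV \<times> {\<phi>. hm \<phi>}" "\<xi> = ?R #>\<^bsub>?T\<^esub> a" unfolding car by blast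
   have Rk: "keys x \<subseteq> UNIV \<times> {\<phi>. hm \<phi>}" if "x \<in> ?R" for x using that unfolding tensor_rels_eq
   proof (rule generate_induct_free[OF _ rels_keys])
    fix x y :: "('k \<times> specht_map) \<Rightarrow>\<^sub>0 int"
    assume "keys x \<subseteq> UNIV \<times> {\<phi>. hm \<phi>}" "keys y \<subseteq> UNIV \<times> {\<phi>. hm \<phi>}"
    thus "keys (x - y) \<subseteq> UNIV \<times> {\<phi>. hm \<phi>}" using keys_diff[of x y] by blast
   qed (erule rels_keys | simp)+
   have Fa: "eqv (?F x) a" if x: "eqv x a" for x
   proof -
    have "keys (x - a) \<subseteq> UNIV \<times> {\<phi>. hm \<phi>}" using Rk x unfolding eqv_def by blast
    hence "keys (x - a + a) \<subseteq> UNIV \<times> {\<phi>. hm \<phi>}" using keys_add[of "x - a" a] a(1) by blast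
    hence "eqv (?F x) x" using F by simp
    thus ?thesis using x by (rule eqv_trans)
   qed
   have "y \<in> (\<Union>x\<in>\<xi>. ?R #>\<^bsub>?T\<^esub> ?F x) \<longleftrightarrow> eqv y a" for y
   proof
    assume "y \<in> (\<Union>x\<in>\<xi>. ?R #>\<^bsub>?T\<^esub> ?F x)"
    then obtain x where "x \<in> ?R #>\<^bsub>?T\<^esub> a" "y \<in> ?R #>\<^bsub>?T\<^esub> ?F x" unfolding a(2) by blast
    hence x: "eqv x a" "eqv y (?F x)" unfolding in_coset by blast+
    show "eqv y a" by (rule eqv_trans[OF x(2) Fa[OF x(1)]])
   next
    assume y: "eqv y a"
    have "eqv y (?F a)" using y eqv_sym[OF Fa[OF eqv_refl]] by (rule eqv_trans)
    thus "y \<in> (\<Union>x\<in>\<xi>. ?R #>\<^bsub>?T\<^esub> ?F x)" unfolding a(2) UN_iff in_coset by (intro bexI[of _ a]) (simp_all add: in_coset)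
   qed
   thus "specht_act l (mu, lam) c \<xi> = \<xi>" unfolding sa by (intro Set.set_eqI) (simp add: a(2) in_coset)
  qed
 qed
qed

end

theorem same_block_iff:
 assumes s: "(mu1, lam1) \<in> skew_partitions l m" "(mu2, lam2) \<in> skew_partitions l m"
 shows "(\<exists>b \<in> block_ideals (centraliser_algebra l m :: 'k::field fun_alg ring).
   specht_in_block l m (mu1, lam1) b \<and> specht_in_block l m (mu2, lam2) b) \<longleftrightarrow>
  (\<exists>e :: 'k gring. prim l m e \<and> skew.acts l lam1 mu1 e 1 \<and> skew.acts l lam2 mu2 e 1)"
proof -
 interpret S1: skew l m lam1 mu1 by (rule skew_intro[OF s(1)])
 interpret S2: skew l m lam2 mu2 by (rule skew_intro[OF s(2)])
 note lm = S1.lm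
 have keys: "keys e \<subseteq> carrier (sym_group m)" if "e \<in> carrier (CA l m)" for e :: "'k fun_alg"
  using that CA_carrier[OF lm] by blast
 show ?thesis
 proof
  assume "\<exists>b \<in> block_ideals (CA l m :: 'k fun_alg ring).
   specht_in_block l m (mu1, lam1) b \<and> specht_in_block l m (mu2, lam2) b"
  then obtain b :: "'k fun_alg set" where b: "specht_in_block l m (mu1, lam1) b" "specht_in_block l m (mu2, lam2) b" by blast
  obtain e where e: "primitive_central_idempotent (CA l m) e" "b = e <#\<^bsub>CA l m\<^esub> carrier (CA l m)"
   "\<forall>\<xi>\<in>carrier (specht_module l (mu1, lam1)). specht_act l (mu1, lam1) e \<xi> = \<xi>"
   using b(1) unfolding specht_in_block_def by blast
  obtain f where f: "primitive_central_idempotent (CA l m) f" "b = f <#\<^bsub>CA l m\<^esub> carrier (CA l m)"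
   "\<forall>\<xi>\<in>carrier (specht_module l (mu2, lam2)). specht_act l (mu2, lam2) f \<xi> = \<xi>"
   using b(2) unfolding specht_in_block_def by blast
  have fe: "f = e"
   by (rule primitive_ideal_inject[OF lm]) (use e f in \<open>auto simp: primitive_central_idempotent_def\<close>)
  have ec: "e \<in> carrier (CA l m)" "prim l m (pull e)" using e(1) primitive_pull[OF lm] by blast+
  have "S1.acts (pull e) 1" using e(3) S1.specht_act_identity[OF keys[OF ec(1)]] by blast
  moreover have "S2.acts (pull e) 1" using f(3) S2.specht_act_identity[OF keys[OF ec(1)]] unfolding fe by blast
  ultimately show "\<exists>e :: 'k gring. prim l m e \<and> S1.acts e 1 \<and> S2.acts e 1" using ec(2) by blast
 next
  assume "\<exists>e :: 'k gring. prim l m e \<and> S1.acts e 1 \<and> S2.acts e 1"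
  then obtain e' :: "'k gring" where e': "prim l m e'" "S1.acts e' 1" "S2.acts e' 1" by blast
  hence "e' \<in> cent l m" unfolding prim_def cidem_def by blast
  then obtain e where e: "e \<in> carrier (CA l m)" "pull e = e'" by (rule CA_surj[OF lm])
  have pe: "primitive_central_idempotent (CA l m) e" using primitive_pull[OF lm] e e'(1) by blast
  have "\<forall>\<xi>\<in>carrier (specht_module l (mu1, lam1)). specht_act l (mu1, lam1) e \<xi> = \<xi>"
   "\<forall>\<xi>\<in>carrier (specht_module l (mu2, lam2)). specht_act l (mu2, lam2) e \<xi> = \<xi>"
   using S1.specht_act_identity[OF keys[OF e(1)]] S2.specht_act_identity[OF keys[OF e(1)]] e(2) e'(2,3) by blast+
  thus "\<exists>b \<in> block_ideals (CA l m :: 'k fun_alg ring).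
   specht_in_block l m (mu1, lam1) b \<and> specht_in_block l m (mu2, lam2) b"
   unfolding block_ideals_def specht_in_block_def
   by (intro bexI[of _ "e <#\<^bsub>CA l m\<^esub> carrier (CA l m)"] conjI) (use pe in blast)+
 qed
qed

theorem corollary3p24:
  fixes p l m :: nat
    and B :: "((nat \<Rightarrow> nat) \<times> (nat \<Rightarrow> nat)) set"
    and mu1 lam1 mu2 lam2 :: "nat \<Rightarrow> nat"
  assumes "Factorial_Ring.prime p"
    and "CHAR('k::alg_closed_field) = p"
    and "l \<le> m" and "m - l = p"
    and "belt_block p l m B"
    and "(mu1, lam1) \<in> B"
    and "(mu2, lam2) \<in> skew_partitions l m"
  shows "(\<exists>b \<in> block_ideals (centraliser_algebra l m :: ((nat \<Rightarrow> nat) \<Rightarrow>\<^sub>0 'k) ring).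
            specht_in_block l m (mu1, lam1) b \<and> specht_in_block l m (mu2, lam2) b)
         \<longleftrightarrow> core p mu1 = core p mu2 \<and> core p lam1 = core p lam2"
proof -
 have p2: "p \<ge> 2" using assms(1) by (rule prime_ge_2_nat)
 obtain \<gamma> \<delta> where B: "B = {(mu, lam) \<in> skew_partitions l m. core p mu = \<gamma> \<and> core p lam = \<delta>}"
  and con: "\<forall>s\<in>B. content p s = mset_set {0..<int p}"
  using assms(5) unfolding belt_block_def combinatorial_block_def by blast
 have s: "(mu1, lam1) \<in> skew_partitions l m" using assms(6) B by blast
 have pt: "is_partition mu1" "is_partition lam1" "is_partition mu2" "is_partition lam2"
  "partition_size mu1 = partition_size mu2" "partition_size lam1 = partition_size lam2"
  using s assms(7) by (auto simp: skew_partitions_def)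
 have cores: "core p mu1 = core p mu2 \<longleftrightarrow> res_count p mu1 = res_count p mu2"
  "core p lam1 = core p lam2 \<longleftrightarrow> res_count p lam1 = res_count p lam2"
  using core_eq_iff_res[OF p2] pt by blast+
 have "(\<exists>e :: 'k gring. prim l m e \<and> skew.acts l lam1 mu1 e 1 \<and> skew.acts l lam2 mu2 e 1) \<longleftrightarrow>
   core p mu1 = core p mu2 \<and> core p lam1 = core p lam2"
 proof
  assume "\<exists>e :: 'k gring. prim l m e \<and> skew.acts l lam1 mu1 e 1 \<and> skew.acts l lam2 mu2 e 1"
  thus "core p mu1 = core p mu2 \<and> core p lam1 = core p lam2"
   using primitive_cores[OF p2 assms(2) s assms(7)] cores by blast
 next
  assume c: "core p mu1 = core p mu2 \<and> core p lam1 = core p lam2"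
  \<comment> \<open>Equal cores place the second pair in the belt block as well, and membership
    yields its content, which \<open>belt_same_block\<close> asks for.\<close>
  hence "(mu2, lam2) \<in> B" using assms(6,7) unfolding B by auto
  thus "\<exists>e :: 'k gring. prim l m e \<and> skew.acts l lam1 mu1 e 1 \<and> skew.acts l lam2 mu2 e 1"
   using belt_same_block[OF assms(1,2) s assms(7)] con assms(6) c cores by blast
 qed
 thus ?thesis unfolding same_block_iff[OF s assms(7)] .
qed

end
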